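(* Let $n\in\mathbb N$, let $\Omega\subset\mathbb R^n$ be a bounded domain with boundary of class $C^2$, let $0<\alpha\le 1$ and $T>0$. Let $\mathcal A=(a_{ij})_{1\le i,j\le n}$ with $a_{ij}=a_{ji}\in C^1(\overline\Omega)$ be uniformly elliptic, i.e. there is a constant $\kappa_0>0$ with $\sum_{i,j=1}^n a_{ij}(x)\xi_i\xi_j\ge\kappa_0\sum_{j=1}^n\xi_j^2$ for all $x\in\overline\Omega$ and $\xi\in\mathbb R^n$; let $\mathcal B=(b_1,\dots,b_n)$ with $b_j\in W^{1,\infty}(\Omega)$, and let $p\in L^\infty(\Omega)$ (all coefficients real-valued). Assume that there exists a function $b\in W^{2,\infty}(\Omega)$ such that $\mathcal B=\mathcal A\nabla b$. Let $L$ be the operator on $L^2(\Omega)$ with domain $D(L)=H^2(\Omega)\cap H^1_0(\Omega)$ given by $$Lu=\mathrm{div}(\mathcal A\nabla u)+\mathcal B\cdot\nabla u+pu .$$ Then there exists a constant $\kappa=\kappa(\mathcal A,b,p,\alpha,T)\ge 1$ such that for every $u_T\in L^2(\Omega)$ and every solution $u\in C([0,T];L^2(\Omega))$ of the backward problem $$\partial_t^\alpha u=Lu \ \text{ in }(0,T)\times\Omega,\qquad u|_{\partial\Omega}=0\ \text{ on }(0,T)\times\partial\Omega,\qquad u(T,\cdot)=u_T\ \text{ in }\Omega,$$ one has $$\|u(t,\cdot)\|_{L^2(\Omega)}\le \kappa\, e^{\|b\|_\infty}\,\|u(0,\cdot)\|_{L^2(\Omega)}^{1-\frac tT}\,\|u(T,\cdot)\|_{L^2(\Omega)}^{\frac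 tT},\qquad 0\le t\le T .$$
   Context: $\|b\|_\infty$ denotes the norm of $b$ in $L^\infty(\Omega)$. The domain $\Omega$ is fixed; $\kappa$ does not depend on $u$ or $u_T$. The convention $0^0=1$ is used. $\partial_t^\alpha$ is the Caputo derivative in time: $\partial_t^\alpha u(t)=\frac{1}{\Gamma(1-\alpha)}\int_0^t(t-s)^{-\alpha}\frac{d}{ds}u(s)\,ds$ for $0<\alpha<1$, and $\partial_t^1u=\frac{d}{dt}u$, whenever the right-hand side is defined; $\Gamma$ is the Euler gamma function. Notion of solution: $L$ with domain $H^2(\Omega)\cap H^1_0(\Omega)$ generates a $C_0$-semigroup $(S(t))_{t\ge0}$ on $L^2(\Omega)$. The solution of $\partial_t^\alpha u=Lu$ with Dirichlet boundary condition and initial value $u(0,\cdot)=u_0\in L^2(\Omega)$ is $u(t)=S_\alpha(t)u_0$, where $S_1(t)=S(t)$ and, for $0<\alpha<1$, $$S_\alpha(t)v=\int_0^\infty\Phi_\alpha(s)\,S(st^\alpha)v\,ds,\qquad v\in L^2(\Omega),\qquad \Phi_\alpha(z)=\sum_{m=0}^\infty\frac{(-z)^m}{m!\,\Gamma(-\alpha m+1-\alpha)},$$ where $1/\Gamma$ is taken to be $0$ at the poles of $\Gamma$ ($\Phi_\alpha$ is the Wright function, a probability density on $(0,\infty)$). A solution of the backward problem with final datum $u_T$ is such a function $u$, with $u_0=u(0,\cdot)\in L^2(\Omega)$, satisfying $u(T)=u_T$. *)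

theory Defs
  imports "HOL-Analysis.Analysis" "HOL-Probability.Essential_Supremum"
begin

section \<open>The space of square integrable functions\<close>

definition square_integrable :: "('a::euclidean_space \<Rightarrow> complex) \<Rightarrow> bool" where
  "square_integrable f \<longleftrightarrow>
     f \<in> borel_measurable lebesgue \<and> integrable lebesgue (\<lambda>x. (norm (f x))\<^sup>2)"

lemma square_integrable_inner:
  assumes "square_integrable f" "square_integrable g"
  shows "integrable lebesgue (\<lambda>x. f x \<bullet> g x)"
proof (rule Bochner_Integration.integrable_bound)
  show "integrable lebesgue (\<lambda>x. (norm (f x))\<^sup>2 + (norm (g x))\<^sup>2)"
    using assms by (simp add: square_integrable_def)
  show "(\<lambda>x. f x \<bullet> g x) \<in> borel_measurable lebesgue"
    using assms by (auto simp: square_integrable_def)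
  have "\<bar>f x \<bullet> g x\<bar> \<le> (norm (f x))\<^sup>2 + (norm (g x))\<^sup>2" for x
  proof -
    have "2 * (norm (f x) * norm (g x)) \<le> (norm (f x))\<^sup>2 + (norm (g x))\<^sup>2"
      using sum_squares_bound[of "norm (f x)" "norm (g x)"] by (simp add: mult.assoc)
    moreover have "\<bar>f x \<bullet> g x\<bar> \<le> norm (f x) * norm (g x)"
      by (rule Cauchy_Schwarz_ineq2)
    moreover have "0 \<le> norm (f x) * norm (g x)" by simp
    ultimately show ?thesis by linarith
  qed
  then show "AE x in lebesgue. norm (f x \<bullet> g x) \<le> norm ((norm (f x))\<^sup>2 + (norm (g x))\<^sup>2)"
    by (simp add: abs_of_nonneg)
qed

lemma square_integrable_zero: "square_integrable (\<lambda>_. 0)"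
  by (simp add: square_integrable_def)

lemma square_integrable_add:
  assumes "square_integrable f" "square_integrable g"
  shows "square_integrable (\<lambda>x. f x + g x)"
proof -
  have "(norm (f x + g x))\<^sup>2 = (norm (f x))\<^sup>2 + 2 * (f x \<bullet> g x) + (norm (g x))\<^sup>2" for x
    by (simp add: power2_norm_eq_inner inner_add_left inner_add_right inner_commute)
  then show ?thesis
    using assms square_integrable_inner[OF assms] by (auto simp: square_integrable_def)
qed

lemma square_integrable_scaleR:
  "square_integrable f \<Longrightarrow> square_integrable (\<lambda>x. r *\<^sub>R f x)"
  by (auto simp: square_integrable_def power_mult_distrib)

lemma square_integrable_uminus:
  "square_integrable f \<Longrightarrow> square_integrable (\<lambda>x. - f x)"
  using square_integrable_scaleR[of f "-1"] by simp

lemma square_integrable_diff: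
  "square_integrable f \<Longrightarrow> square_integrable g \<Longrightarrow> square_integrable (\<lambda>x. f x - g x)"
  using square_integrable_add[OF _ square_integrable_uminus, of f g] by simp

definition L2_rel :: "('a::euclidean_space \<Rightarrow> complex) \<Rightarrow> ('a \<Rightarrow> complex) \<Rightarrow> bool" where
  "L2_rel f g \<longleftrightarrow> square_integrable f \<and> square_integrable g \<and> (AE x in lebesgue. f x = g x)"

quotient_type (overloaded) 'a L2 = "'a::euclidean_space \<Rightarrow> complex" / partial: L2_rel
  morphisms rep_L2 abs_L2
proof (rule part_equivpI)
  show "\<exists>f. L2_rel f f"
    by (rule exI[of _ "\<lambda>_. 0"]) (simp add: L2_rel_def square_integrable_zero)
  show "symp L2_rel"
    by (auto simp: symp_def L2_rel_def)
  show "transp L2_rel"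
    unfolding transp_def L2_rel_def by (auto elim: eventually_elim2)
qed

lemma L2_rel_integral_inner:
  assumes "L2_rel f f'" "L2_rel g g'"
  shows "(\<integral>x. f x \<bullet> g x \<partial>lebesgue) = (\<integral>x. f' x \<bullet> g' x \<partial>lebesgue)"
proof (rule integral_cong_AE)
  show "(\<lambda>x. f x \<bullet> g x) \<in> borel_measurable lebesgue"
    "(\<lambda>x. f' x \<bullet> g' x) \<in> borel_measurable lebesgue"
    using assms by (auto simp: L2_rel_def square_integrable_def)
  show "AE x in lebesgue. f x \<bullet> g x = f' x \<bullet> g' x"
    using assms unfolding L2_rel_def by (auto elim: eventually_elim2)
qed

text \<open>The inner product is the real part of the usual Hermitian inner product of
  \<open>L\<^sup>2(\<real>\<^sup>n; \<complex>)\<close>, so that the norm is the usual one.\<close>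

instantiation L2 :: (euclidean_space) real_inner
begin

lift_definition zero_L2 :: "'a L2" is "\<lambda>_. 0"
  by (simp add: L2_rel_def square_integrable_zero)

lift_definition plus_L2 :: "'a L2 \<Rightarrow> 'a L2 \<Rightarrow> 'a L2" is "\<lambda>f g x. f x + g x"
  unfolding L2_rel_def by (auto intro: square_integrable_add elim: eventually_elim2)

lift_definition uminus_L2 :: "'a L2 \<Rightarrow> 'a L2" is "\<lambda>f x. - f x"
  unfolding L2_rel_def by (auto intro: square_integrable_uminus elim: eventually_mono)

lift_definition minus_L2 :: "'a L2 \<Rightarrow> 'a L2 \<Rightarrow> 'a L2" is "\<lambda>f g x. f x - g x"
  unfolding L2_rel_def by (auto intro: square_integrable_diff elim: eventually_elim2)

lift_definition scaleR_L2 :: "real \<Rightarrow> 'a L2 \<Rightarrow> 'a L2" is "\<lambda>r f x. r *\<^sub>R f x"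
  unfolding L2_rel_def by (auto intro: square_integrable_scaleR elim: eventually_mono)

lift_definition inner_L2 :: "'a L2 \<Rightarrow> 'a L2 \<Rightarrow> real" is "\<lambda>f g. \<integral>x. f x \<bullet> g x \<partial>lebesgue"
  by (rule L2_rel_integral_inner)

definition norm_L2 :: "'a L2 \<Rightarrow> real" where "norm_L2 f = sqrt (f \<bullet> f)"
definition sgn_L2 :: "'a L2 \<Rightarrow> 'a L2" where "sgn_L2 f = inverse (norm f) *\<^sub>R f"
definition dist_L2 :: "'a L2 \<Rightarrow> 'a L2 \<Rightarrow> real" where "dist_L2 f g = norm (f - g)"
definition uniformity_L2 :: "('a L2 \<times> 'a L2) filter" where
  "uniformity_L2 = (INF e\<in>{0<..}. principal {(x, y). dist x y < e})"
definition open_L2 :: "'a L2 set \<Rightarrow> bool" where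
  "open_L2 U = (\<forall>x\<in>U. eventually (\<lambda>(x', y). x' = x \<longrightarrow> y \<in> U) uniformity)"

instance
proof
  fix x y z :: "'a L2" and r s :: real
  show "x + y + z = x + (y + z)"
    by transfer (auto simp: L2_rel_def add.assoc intro!: square_integrable_add)
  show "x + y = y + x"
    by transfer (auto simp: L2_rel_def add.commute intro!: square_integrable_add)
  show "0 + x = x"
    by transfer (auto simp: L2_rel_def)
  show "- x + x = 0"
    by transfer (auto simp: L2_rel_def square_integrable_zero)
  show "x - y = x + - y"
    by transfer (auto simp: L2_rel_def intro: square_integrable_diff)
  show "r *\<^sub>R (x + y) = r *\<^sub>R x + r *\<^sub>R y"
    by transfer (auto simp: L2_rel_def scaleR_right_distrib
        intro!: square_integrable_add square_integrable_scaleR)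
  show "(r + s) *\<^sub>R x = r *\<^sub>R x + s *\<^sub>R x"
    by transfer (auto simp: L2_rel_def scaleR_left_distrib
        intro!: square_integrable_add square_integrable_scaleR)
  show "r *\<^sub>R s *\<^sub>R x = (r * s) *\<^sub>R x"
    by transfer (auto simp: L2_rel_def simp del: scaleR_conv_of_real
        intro!: square_integrable_scaleR)
  show "1 *\<^sub>R x = x"
    by transfer (auto simp: L2_rel_def)
  show "x \<bullet> y = y \<bullet> x"
    by transfer (simp add: inner_commute)
  show "(x + y) \<bullet> z = x \<bullet> z + y \<bullet> z"
    by transfer (auto simp: L2_rel_def inner_add_left
        intro!: Bochner_Integration.integral_add square_integrable_inner)
  show "r *\<^sub>R x \<bullet> y = r * (x \<bullet> y)"
    by transfer simp
  show "0 \<le> x \<bullet> x"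
    by transfer (auto intro!: integral_nonneg_AE)
  show "(x \<bullet> x = 0) = (x = 0)"
  proof transfer
    fix f :: "'a \<Rightarrow> complex" assume f: "L2_rel f f"
    then have "((\<integral>x. f x \<bullet> f x \<partial>lebesgue) = 0) \<longleftrightarrow> (AE x in lebesgue. f x \<bullet> f x = 0)"
      by (intro integral_nonneg_eq_0_iff_AE square_integrable_inner) (auto simp: L2_rel_def)
    then show "((\<integral>x. f x \<bullet> f x \<partial>lebesgue) = 0) = L2_rel f (\<lambda>_. 0)"
      using f by (simp add: L2_rel_def square_integrable_zero)
  qed
qed (simp_all add: norm_L2_def sgn_L2_def dist_L2_def uniformity_L2_def open_L2_def)

end

text \<open>\<open>L\<^sup>2(\<Omega>)\<close> is identified with the closed subspace of \<open>L\<^sup>2(\<real>\<^sup>n)\<close> of the functions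
  vanishing almost everywhere outside \<open>\<Omega>\<close>; on it, the norm above is the norm of \<open>L\<^sup>2(\<Omega>)\<close>.\<close>

definition L2_space :: "'a::euclidean_space set \<Rightarrow> 'a L2 set" where
  "L2_space \<Omega> = {v. AE x in lebesgue. x \<notin> \<Omega> \<longrightarrow> rep_L2 v x = 0}"


section \<open>Classical differentiability\<close>

definition partial_deriv ::
    "'n::finite \<Rightarrow> (real^'n \<Rightarrow> 'b::real_normed_vector) \<Rightarrow> real^'n \<Rightarrow> 'b" where
  "partial_deriv i f x = frechet_derivative f (at x) (axis i 1)"

text \<open>\<open>C\<^sup>k(U)\<close>, for open \<open>U\<close>.\<close>

primrec Ck_on ::
    "nat \<Rightarrow> (real^'n) set \<Rightarrow> (real^'n::finite \<Rightarrow> 'b::real_normed_vector) \<Rightarrow> bool" where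
  "Ck_on 0 U f \<longleftrightarrow> continuous_on U f"
| "Ck_on (Suc k) U f \<longleftrightarrow>
     (\<forall>x\<in>U. f differentiable (at x)) \<and> (\<forall>i. Ck_on k U (partial_deriv i f))"

definition C1_closure :: "(real^'n::finite) set \<Rightarrow> (real^'n \<Rightarrow> real) \<Rightarrow> bool" where
  "C1_closure \<Omega> f \<longleftrightarrow> Ck_on 1 \<Omega> f \<and> continuous_on (closure \<Omega>) f \<and>
     (\<forall>i. \<exists>g. continuous_on (closure \<Omega>) g \<and> (\<forall>x\<in>\<Omega>. g x = partial_deriv i f x))"

definition test_function ::
    "(real^'n::finite) set \<Rightarrow> (real^'n \<Rightarrow> 'b::real_normed_vector) \<Rightarrow> bool" where
  "test_function \<Omega> \<phi> \<longleftrightarrow> (\<forall>k. Ck_on k UNIV \<phi>) \<and>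
     compact (closure {x. \<phi> x \<noteq> 0}) \<and> closure {x. \<phi> x \<noteq> 0} \<subseteq> \<Omega>"

text \<open>Near each boundary point, \<open>\<Omega>\<close> is the region on one side of the graph of a \<open>C\<^sup>2\<close> function
  defined on the hyperplane orthogonal to a unit vector \<open>e\<close>. A function on that hyperplane is
  encoded as a function on the whole space that is constant in the direction \<open>e\<close>.\<close>

definition C2_boundary :: "(real^'n::finite) set \<Rightarrow> bool" where
  "C2_boundary \<Omega> \<longleftrightarrow>
     (\<forall>x0\<in>frontier \<Omega>. \<exists>r>0. \<exists>e. \<exists>\<gamma>::real^'n \<Rightarrow> real.
        norm e = 1 \<and> Ck_on 2 UNIV \<gamma> \<and> (\<forall>x s. \<gamma> (x + s *\<^sub>R e) = \<gamma> x) \<and>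
        \<Omega> \<inter> ball x0 r = {x \<in> ball x0 r. \<gamma> x < x \<bullet> e})"


section \<open>Weak derivatives and Sobolev spaces\<close>

definition locally_integrable_on ::
    "(real^'n::finite) set \<Rightarrow> (real^'n \<Rightarrow> 'b::euclidean_space) \<Rightarrow> bool" where
  "locally_integrable_on \<Omega> f \<longleftrightarrow> (\<forall>K. compact K \<and> K \<subseteq> \<Omega> \<longrightarrow> set_integrable lebesgue K f)"

text \<open>\<open>g\<close> is the weak derivative of \<open>f\<close> in \<open>\<Omega>\<close> in the \<open>i\<close>-th coordinate direction. Real test
  functions suffice, also for complex-valued \<open>f\<close> and \<open>g\<close>.\<close>

definition weak_partial ::
    "(real^'n::finite) set \<Rightarrow> 'n \<Rightarrow> (real^'n \<Rightarrow> 'b::euclidean_space) \<Rightarrow> (real^'n \<Rightarrow> 'b) \<Rightarrow> bool" where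
  "weak_partial \<Omega> i f g \<longleftrightarrow> locally_integrable_on \<Omega> f \<and> locally_integrable_on \<Omega> g \<and>
     (\<forall>\<phi>::real^'n \<Rightarrow> real. test_function \<Omega> \<phi> \<longrightarrow>
        (LINT x:\<Omega>|lebesgue. partial_deriv i \<phi> x *\<^sub>R f x) = - (LINT x:\<Omega>|lebesgue. \<phi> x *\<^sub>R g x))"

definition Linf :: "(real^'n::finite) set \<Rightarrow> (real^'n \<Rightarrow> real) \<Rightarrow> bool" where
  "Linf \<Omega> f \<longleftrightarrow> f \<in> borel_measurable (lebesgue_on \<Omega>) \<and>
     (\<exists>C. AE x in lebesgue_on \<Omega>. \<bar>f x\<bar> \<le> C)"

definition Linf_norm :: "(real^'n::finite) set \<Rightarrow> (real^'n \<Rightarrow> real) \<Rightarrow> real" where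
  "Linf_norm \<Omega> f = real_of_ereal (esssup (lebesgue_on \<Omega>) (\<lambda>x. ereal \<bar>f x\<bar>))"

text \<open>\<open>W\<^sup>k\<^sup>,\<^sup>\<infinity>(\<Omega>)\<close>\<close>

primrec W_inf :: "nat \<Rightarrow> (real^'n::finite) set \<Rightarrow> (real^'n \<Rightarrow> real) \<Rightarrow> bool" where
  "W_inf 0 \<Omega> f \<longleftrightarrow> Linf \<Omega> f"
| "W_inf (Suc k) \<Omega> f \<longleftrightarrow> Linf \<Omega> f \<and> (\<forall>i. \<exists>g. weak_partial \<Omega> i f g \<and> W_inf k \<Omega> g)"

text \<open>\<open>H\<^sup>k(\<Omega>)\<close>\<close>

primrec H_space :: "nat \<Rightarrow> (real^'n::finite) set \<Rightarrow> (real^'n) L2 set" where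
  "H_space 0 \<Omega> = L2_space \<Omega>"
| "H_space (Suc k) \<Omega> = {u \<in> L2_space \<Omega>.
     \<forall>i. \<exists>g\<in>H_space k \<Omega>. weak_partial \<Omega> i (rep_L2 u) (rep_L2 g)}"

text \<open>\<open>H\<^sub>0\<^sup>1(\<Omega>)\<close>, the closure of \<open>C\<^sub>c\<^sup>\<infinity>(\<Omega>; \<complex>)\<close> in \<open>H\<^sup>1(\<Omega>)\<close>\<close>

definition H10_space :: "(real^'n::finite) set \<Rightarrow> (real^'n) L2 set" where
  "H10_space \<Omega> = {u \<in> H_space 1 \<Omega>.
     \<exists>\<phi>::nat \<Rightarrow> real^'n \<Rightarrow> complex. (\<forall>k. test_function \<Omega> (\<phi> k)) \<and>
       (\<lambda>k. abs_L2 (\<phi> k)) \<longlonglongrightarrow> u \<and>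
       (\<forall>i. \<exists>g\<in>L2_space \<Omega>. weak_partial \<Omega> i (rep_L2 u) (rep_L2 g) \<and>
              (\<lambda>k. abs_L2 (partial_deriv i (\<phi> k))) \<longlonglongrightarrow> g)}"


section \<open>The elliptic operator\<close>

definition uniformly_elliptic :: "(real^'n::finite) set \<Rightarrow> (real^'n \<Rightarrow> real^'n^'n) \<Rightarrow> bool" where
  "uniformly_elliptic \<Omega> A \<longleftrightarrow> (\<exists>\<kappa>\<^sub>0>0. \<forall>x\<in>closure \<Omega>. \<forall>\<xi>::real^'n.
     (\<Sum>i\<in>UNIV. \<Sum>j\<in>UNIV. A x $ i $ j * \<xi> $ i * \<xi> $ j) \<ge> \<kappa>\<^sub>0 * (\<Sum>j\<in>UNIV. (\<xi> $ j)\<^sup>2))"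

text \<open>\<open>B = A \<nabla>b\<close> almost everywhere in \<open>\<Omega>\<close>, for the weak gradient of \<open>b\<close>\<close>

definition is_A_gradient ::
    "(real^'n::finite) set \<Rightarrow> (real^'n \<Rightarrow> real^'n^'n) \<Rightarrow> (real^'n \<Rightarrow> real) \<Rightarrow> (real^'n \<Rightarrow> real^'n) \<Rightarrow> bool"
  where
  "is_A_gradient \<Omega> A b B \<longleftrightarrow> (\<exists>Db. (\<forall>j. weak_partial \<Omega> j b (\<lambda>x. Db x $ j)) \<and>
     (AE x in lebesgue_on \<Omega>. B x = A x *v Db x))"

text \<open>The graph of \<open>L\<close>, i.e. the pairs \<open>(u, w)\<close> with \<open>u \<in> H\<^sup>2(\<Omega>) \<inter> H\<^sub>0\<^sup>1(\<Omega>)\<close> and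
  \<open>w = div (A \<nabla>u) + B \<cdot> \<nabla>u + p u\<close>. Here \<open>g j\<close> is the weak derivative of \<open>u\<close> in direction \<open>j\<close>, and
  \<open>h i\<close> is that of the \<open>i\<close>-th component of \<open>A \<nabla>u\<close> in direction \<open>i\<close>.\<close>

definition elliptic_op_graph ::
    "(real^'n::finite) set \<Rightarrow> (real^'n \<Rightarrow> real^'n^'n) \<Rightarrow> (real^'n \<Rightarrow> real^'n) \<Rightarrow> (real^'n \<Rightarrow> real)
      \<Rightarrow> ((real^'n) L2 \<times> (real^'n) L2) set" where
  "elliptic_op_graph \<Omega> A B p = {(u, w).
     u \<in> H_space 2 \<Omega> \<inter> H10_space \<Omega> \<and> w \<in> L2_space \<Omega> \<and>
     (\<exists>g h :: 'n \<Rightarrow> (real^'n) L2.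
        (\<forall>j. g j \<in> L2_space \<Omega> \<and> weak_partial \<Omega> j (rep_L2 u) (rep_L2 (g j))) \<and>
        (\<forall>i. h i \<in> L2_space \<Omega> \<and>
             weak_partial \<Omega> i (\<lambda>x. \<Sum>j\<in>UNIV. A x $ i $ j *\<^sub>R rep_L2 (g j) x) (rep_L2 (h i))) \<and>
        (AE x in lebesgue_on \<Omega>. rep_L2 w x =
           (\<Sum>i\<in>UNIV. rep_L2 (h i) x) + (\<Sum>j\<in>UNIV. B x $ j *\<^sub>R rep_L2 (g j) x)
             + p x *\<^sub>R rep_L2 u x))}"


section \<open>Semigroups and the solution operators\<close>

text \<open>\<open>C\<^sub>0\<close>-semigroups of bounded linear operators on a subspace \<open>X\<close>; the values \<open>S t v\<close> for
  \<open>t < 0\<close> or \<open>v \<notin> X\<close> are irrelevant.\<close>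

definition C0_semigroup_on ::
    "'v::real_normed_vector set \<Rightarrow> (real \<Rightarrow> 'v \<Rightarrow> 'v) \<Rightarrow> bool" where
  "C0_semigroup_on X S \<longleftrightarrow>
     (\<forall>t\<ge>0. (\<forall>v\<in>X. S t v \<in> X) \<and>
        (\<forall>v\<in>X. \<forall>w\<in>X. S t (v + w) = S t v + S t w) \<and>
        (\<forall>c. \<forall>v\<in>X. S t (c *\<^sub>R v) = c *\<^sub>R S t v) \<and>
        (\<exists>C. \<forall>v\<in>X. norm (S t v) \<le> C * norm v)) \<and>
     (\<forall>v\<in>X. S 0 v = v) \<and>
     (\<forall>s\<ge>0. \<forall>t\<ge>0. \<forall>v\<in>X. S (s + t) v = S s (S t v)) \<and>
     (\<forall>v\<in>X. ((\<lambda>t. S t v) \<longlongrightarrow> v) (at_right 0))"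

definition generator_graph ::
    "'v::real_normed_vector set \<Rightarrow> (real \<Rightarrow> 'v \<Rightarrow> 'v) \<Rightarrow> ('v \<times> 'v) set" where
  "generator_graph X S = {(v, w). v \<in> X \<and> w \<in> X \<and>
     ((\<lambda>h. (S h v - v) /\<^sub>R h) \<longlongrightarrow> w) (at_right 0)}"

definition Wright :: "real \<Rightarrow> real \<Rightarrow> real" where
  "Wright \<alpha> z = (\<Sum>m. (- z) ^ m * rGamma (- \<alpha> * real m + 1 - \<alpha>) / fact m)"

text \<open>\<open>w = S\<^sub>\<alpha>(t) v\<close>. The integrand is continuous and decays fast, so that the gauge integral used
  here agrees with the Bochner integral.\<close>

definition solution_op ::
    "real \<Rightarrow> (real \<Rightarrow> 'v::real_normed_vector \<Rightarrow> 'v) \<Rightarrow> real \<Rightarrow> 'v \<Rightarrow> 'v \<Rightarrow> bool" where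
  "solution_op \<alpha> S t v w \<longleftrightarrow>
     (if \<alpha> = 1 then w = S t v
      else ((\<lambda>s. Wright \<alpha> s *\<^sub>R S (s * t powr \<alpha>) v) has_integral w) {0<..})"

definition backward_solution ::
    "(real^'n::finite) set \<Rightarrow> (real^'n \<Rightarrow> real^'n^'n) \<Rightarrow> (real^'n \<Rightarrow> real^'n) \<Rightarrow> (real^'n \<Rightarrow> real)
      \<Rightarrow> real \<Rightarrow> real \<Rightarrow> (real^'n) L2 \<Rightarrow> (real \<Rightarrow> (real^'n) L2) \<Rightarrow> bool" where
  "backward_solution \<Omega> A B p \<alpha> T uT u \<longleftrightarrow>
     (\<exists>S. C0_semigroup_on (L2_space \<Omega>) S \<and>
          generator_graph (L2_space \<Omega>) S = elliptic_op_graph \<Omega> A B p \<and>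
          u 0 \<in> L2_space \<Omega> \<and> (\<forall>t\<in>{0..T}. solution_op \<alpha> S t (u 0) (u t))) \<and>
     u T = uT"

text \<open>Powers of nonnegative numbers with the convention \<open>0\<^sup>0 = 1\<close> (whereas \<open>0 powr 0 = 0\<close>).\<close>

definition rpow :: "real \<Rightarrow> real \<Rightarrow> real" where
  "rpow x a = (if a = 0 then 1 else x powr a)"

end

theory Submission
  imports Defs "HOL-Probability.Probability" "HOL-Real_Asymp.Real_Asymp"
begin

text \<open>Put \<open>w = exp (b / 2)\<close> on \<open>\<Omega>\<close>. Since \<open>B = A \<nabla>b\<close>, the operator is
  \<open>L u = e\<^sup>-\<^sup>b div (e\<^sup>b A \<nabla>u) + p u\<close>. It is therefore symmetric for the inner product with weight
  \<open>e\<^sup>b = w\<^sup>2\<close> and bounded above in it by \<open>M\<close>, a bound for \<open>\<bar>p\<bar>\<close>. Multiplication by \<open>w\<close>, called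
  \<open>E\<close>, turns the weighted norm into the norm of \<open>L\<^sup>2\<close>; passing from one norm to the other and
  back costs the factor \<open>exp \<parallel>b\<parallel>\<^sub>\<infinity>\<close> of the estimate. The semigroup \<open>S\<close> generated by \<open>L\<close>
  inherits the symmetry (\<open>Q_symmetric\<close>), and \<open>e\<^sup>-\<^sup>M\<^sup>t S(t)\<close> is a contraction for the weighted
  norm (\<open>Q_contractive\<close>).

  The spectral theorem for \<open>L\<close> is replaced by a spectral measure of a single orbit. For fixed
  \<open>u\<close> the function \<open>r \<mapsto> e\<^sup>-\<^sup>M\<^sup>r \<langle>E S(r) u, E u\<rangle>\<close> has nonnegative alternating differences of all
  orders: by symmetry those of even order are squares of norms, and those of odd order are
  differences of two such squares, one of them shrunk by the contraction. By the
  Hausdorff-Bernstein-Widder theorem (\<open>bernstein_widder_representation\<close>) the function equals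
  \<open>\<parallel>E u\<parallel>\<^sup>2 \<integral>x\<^sup>r d\<mu>(x)\<close> for a probability measure \<open>\<mu>\<close> on \<open>[0, 1]\<close>; the point \<open>x\<close> stands for the
  eigenvalue \<open>M + ln x\<close> of \<open>L\<close> (\<open>spectral_representation\<close>). Integrating this twice against the
  Wright function gives \<open>\<parallel>E u(t)\<parallel>\<^sup>2 = \<parallel>E u(0)\<parallel>\<^sup>2 \<integral>g\<^sub>t(x)\<^sup>2 d\<mu>(x)\<close>, where \<open>g\<^sub>t\<close>, called \<open>profile\<close>,
  solves the scalar equation for this eigenvalue (\<open>solution_energy\<close>).

  The theorem is thereby reduced to the pointwise inequality \<open>g\<^sub>t \<le> \<kappa> g\<^sub>T\<^sup>\<tau>\<close> with \<open>\<tau> = t / T\<close>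
  (\<open>profile_ratio\<close>), because Hoelder's inequality for \<open>\<mu>\<close> turns it into the estimate for the
  norms (\<open>solution_interpolation\<close>). For \<open>\<alpha> = 1\<close> it is an equality with \<open>\<kappa> = 1\<close>. For \<open>\<alpha> < 1\<close>
  the value \<open>g\<^sub>t\<close> is the Laplace transform of the Wright function at \<open>t\<^sup>\<alpha> \<lambda>\<close>, where \<open>-\<lambda>\<close> is the
  eigenvalue. That transform is bounded above and below by multiples of \<open>1 / (1 + max l 0)\<close>
  for \<open>l \<ge> - M T\<^sup>\<alpha>\<close> (\<open>Wright_laplace_bounds\<close>), and with \<open>a = max (T\<^sup>\<alpha> \<lambda>) 0\<close> what remains is
  \<open>(1 + a)\<^sup>\<tau> \<le> 1 + \<tau> a \<le> 1 + \<tau>\<^sup>\<alpha> a\<close>.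

  The two bounds for the Laplace transform need the Wright function to be continuous,
  nonnegative, positive at \<open>0\<close> and to have exponential moments. The sign is invisible in the
  alternating series. It comes from a probabilistic limit: \<open>j\<^sup>\<alpha>\<close> times the probability of
  exactly \<open>\<lfloor>z j\<^sup>\<alpha>\<rfloor>\<close> renewals up to time \<open>j\<close>, for waiting times with generating function
  \<open>1 - (1 - x)\<^sup>\<alpha>\<close>, tends to the Wright function at \<open>z\<close> (\<open>Wright_limit\<close>). The moments of these
  probabilities are explicit and pass to the limit (\<open>Wright_moment_le\<close>).

  On the side of the differential operator, the weighted integration by parts
  (\<open>weighted_parts\<close>) is the delicate point, because \<open>e\<^sup>b \<phi>\<close> is not a test function when \<open>\<phi>\<close> is
  one. It is derived from a product rule for weak derivatives (\<open>weak_partial_mult\<close>), proved by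
  mollification, and from the exponential series of \<open>b\<close> (\<open>weak_partial_exp\<close>).\<close>


section \<open>The Hilbert space of square integrable functions\<close>

lemma L2_rel_rep: "L2_rel (rep_L2 u) (rep_L2 u)"
  by (rule Quotient_rep_reflp[OF Quotient_L2])

lemma square_integrable_rep: "square_integrable (rep_L2 u)"
  using L2_rel_rep by (simp add: L2_rel_def)

lemma measurable_rep_L2 [measurable]: "rep_L2 u \<in> borel_measurable lebesgue"
  using square_integrable_rep[of u] by (simp add: square_integrable_def)

lemma abs_rep_L2: "abs_L2 (rep_L2 u) = u"
  by (rule Quotient_abs_rep[OF Quotient_L2])

lemma rep_abs_L2: "square_integrable f \<Longrightarrow> AE x in lebesgue. rep_L2 (abs_L2 f) x = f x"
proof -
  assume "square_integrable f"
  then have "L2_rel f f" by (simp add: L2_rel_def)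
  then have "L2_rel (rep_L2 (abs_L2 f)) f"
    by (rule Quotient_rep_abs[OF Quotient_L2])
  then show ?thesis by (simp add: L2_rel_def)
qed

lemma abs_L2_eq: "square_integrable f \<Longrightarrow> square_integrable g \<Longrightarrow> AE x in lebesgue. f x = g x \<Longrightarrow> abs_L2 f = abs_L2 g"
  by (rule Quotient_rel_abs[OF Quotient_L2]) (simp add: L2_rel_def)

lemma L2_eqI: "AE x in lebesgue. rep_L2 u x = rep_L2 v x \<Longrightarrow> u = v"
  using abs_L2_eq[OF square_integrable_rep square_integrable_rep, of u v] by (simp add: abs_rep_L2)

lemma rep_L2_plus: "AE x in lebesgue. rep_L2 (u + v) x = rep_L2 u x + rep_L2 v x"
proof -
  have "u + v = abs_L2 (\<lambda>x. rep_L2 u x + rep_L2 v x)"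
    using plus_L2.abs_eq[OF L2_rel_rep L2_rel_rep, of u v] by (simp add: abs_rep_L2)
  then show ?thesis
    using rep_abs_L2[OF square_integrable_add[OF square_integrable_rep square_integrable_rep]] by simp
qed

lemma rep_L2_diff: "AE x in lebesgue. rep_L2 (u - v) x = rep_L2 u x - rep_L2 v x"
proof -
  have "u - v = abs_L2 (\<lambda>x. rep_L2 u x - rep_L2 v x)"
    using minus_L2.abs_eq[OF L2_rel_rep L2_rel_rep, of u v] by (simp add: abs_rep_L2)
  then show ?thesis
    using rep_abs_L2[OF square_integrable_diff[OF square_integrable_rep square_integrable_rep]] by simp
qed

lemma rep_L2_scaleR: "AE x in lebesgue. rep_L2 (r *\<^sub>R u) x = r *\<^sub>R rep_L2 u x"
proof -
  have "r *\<^sub>R u = abs_L2 (\<lambda>x. r *\<^sub>R rep_L2 u x)"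
    using scaleR_L2.abs_eq[OF L2_rel_rep, of r u] by (simp add: abs_rep_L2)
  then show ?thesis
    using rep_abs_L2[OF square_integrable_scaleR[OF square_integrable_rep]] by simp
qed

lemma inner_L2_eq: "inner u v = (\<integral>x. inner (rep_L2 u x) (rep_L2 v x) \<partial>lebesgue)"
  using inner_L2.abs_eq[OF L2_rel_rep L2_rel_rep, of u v] by (simp add: abs_rep_L2)

lemma norm_L2_square: "(norm u)\<^sup>2 = (\<integral>x. (norm (rep_L2 u x))\<^sup>2 \<partial>lebesgue)"
  by (simp add: power2_norm_eq_inner inner_L2_eq)

lemma nn_integral_norm_L2:
  "(\<integral>\<^sup>+x. ennreal ((norm (rep_L2 u x))\<^sup>2) \<partial>lebesgue) = ennreal ((norm u)\<^sup>2)"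
  unfolding norm_L2_square using square_integrable_rep[of u]
  by (intro nn_integral_eq_integral) (auto simp: square_integrable_def)

lemma nn_integral_norm_L2_diff:
  "(\<integral>\<^sup>+x. ennreal ((norm (rep_L2 u x - rep_L2 v x))\<^sup>2) \<partial>lebesgue) = ennreal ((norm (u - v))\<^sup>2)"
proof -
  have "(\<integral>\<^sup>+x. ennreal ((norm (rep_L2 u x - rep_L2 v x))\<^sup>2) \<partial>lebesgue) =
      (\<integral>\<^sup>+x. ennreal ((norm (rep_L2 (u - v) x))\<^sup>2) \<partial>lebesgue)"
    using rep_L2_diff[of u v] by (intro nn_integral_cong_AE) (auto elim: eventually_mono)
  then show ?thesis by (simp add: nn_integral_norm_L2)
qed

lemma square_integrable_iff_nn_integral:
  "square_integrable f \<longleftrightarrow> f \<in> borel_measurable lebesgue \<and> (\<integral>\<^sup>+x. ennreal ((norm (f x))\<^sup>2) \<partial>lebesgue) < \<infinity>"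
  unfolding square_integrable_def integrable_iff_bounded by auto

lemma Cauchy_fast_subseq:
  fixes X :: "nat \<Rightarrow> 'a::real_normed_vector"
  assumes "Cauchy X"
  obtains r :: "nat \<Rightarrow> nat" where "strict_mono r" "\<And>k. norm (X (r (Suc k)) - X (r k)) \<le> (1 / 2) ^ k"
proof -
  have "\<forall>k. \<exists>N. \<forall>m\<ge>N. \<forall>n\<ge>N. norm (X m - X n) < (1 / 2) ^ k"
    using assms unfolding Cauchy_iff by simp
  then obtain N where N: "\<And>k m n. N k \<le> m \<Longrightarrow> N k \<le> n \<Longrightarrow> norm (X m - X n) < (1 / 2) ^ k"
    by metis
  define r where "r k = (\<Sum>i\<le>k. N i) + k" for k
  have "N k \<le> r k" for k
    unfolding r_def by (simp add: member_le_sum trans_le_add1)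
  moreover have r: "strict_mono r"
    unfolding strict_mono_Suc_iff r_def by simp
  moreover have "r k \<le> r (Suc k)" for k
    using strict_monoD[OF r, of k "Suc k"] by simp
  ultimately have "norm (X (r (Suc k)) - X (r k)) \<le> (1 / 2) ^ k" for k
    by (meson less_imp_le N order_trans)
  then show ?thesis by (rule that[OF r])
qed

text \<open>With \<open>g\<^sub>k\<close> the increments, \<open>\<Sum>2\<^sup>k \<bar>g\<^sub>k\<bar>\<^sup>2\<close> has a finite integral and is thus finite almost
  everywhere; since \<open>2 \<bar>g\<^sub>k\<bar> \<le> 2\<^sup>k \<bar>g\<^sub>k\<bar>\<^sup>2 + 2\<^sup>-\<^sup>k\<close>, the increments are summable there.\<close>

lemma fast_L2_sequence_converges_AE:
  fixes Y :: "nat \<Rightarrow> 'a::euclidean_space L2"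
  assumes Y: "\<And>k. norm (Y (Suc k) - Y k) \<le> (1 / 2) ^ k"
  shows "AE x in lebesgue. convergent (\<lambda>k. rep_L2 (Y k) x)"
proof -
  define g where "g k x = rep_L2 (Y (Suc k)) x - rep_L2 (Y k) x" for k x
  have [measurable]: "g k \<in> borel_measurable lebesgue" for k
    unfolding g_def by measurable
  have "(\<integral>\<^sup>+x. (\<Sum>k. ennreal (2 ^ k * (norm (g k x))\<^sup>2)) \<partial>lebesgue) =
      (\<Sum>k. \<integral>\<^sup>+x. ennreal (2 ^ k * (norm (g k x))\<^sup>2) \<partial>lebesgue)"
    by (rule nn_integral_suminf) measurable
  also have "\<dots> \<le> (\<Sum>k. ennreal ((1 / 2) ^ k))"
  proof (intro suminf_le allI summableI)
    fix k
    have "(\<integral>\<^sup>+x. ennreal (2 ^ k * (norm (g k x))\<^sup>2) \<partial>lebesgue) =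
        ennreal (2 ^ k) * (\<integral>\<^sup>+x. ennreal ((norm (g k x))\<^sup>2) \<partial>lebesgue)"
      by (subst nn_integral_cmult[symmetric]) (auto simp: ennreal_mult')
    also have "\<dots> = ennreal (2 ^ k * (norm (Y (Suc k) - Y k))\<^sup>2)"
      unfolding g_def nn_integral_norm_L2_diff by (simp add: ennreal_mult')
    also have "\<dots> \<le> ennreal (2 ^ k * ((1 / 2) ^ k)\<^sup>2)"
      using Y by (intro ennreal_leI mult_left_mono power_mono) auto
    also have "2 ^ k * ((1 / 2) ^ k)\<^sup>2 = (1 / 2 :: real) ^ k"
      by (simp add: power2_eq_square power_one_over field_simps)
    finally show "(\<integral>\<^sup>+x. ennreal (2 ^ k * (norm (g k x))\<^sup>2) \<partial>lebesgue) \<le> ennreal ((1 / 2) ^ k)" .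
  qed
  also have "\<dots> = ennreal 2"
    using geometric_sums[of "1 / 2 :: real"] by (intro suminf_ennreal_eq) auto
  finally have "(\<integral>\<^sup>+x. (\<Sum>k. ennreal (2 ^ k * (norm (g k x))\<^sup>2)) \<partial>lebesgue) \<noteq> \<infinity>"
    by (auto simp: top_unique)
  then have "AE x in lebesgue. (\<Sum>k. ennreal (2 ^ k * (norm (g k x))\<^sup>2)) \<noteq> \<infinity>"
    by (intro nn_integral_PInf_AE) measurable
  then show ?thesis
  proof eventually_elim
    case (elim x)
    have 1: "summable (\<lambda>k. 2 ^ k * (norm (g k x))\<^sup>2)"
      using elim by (intro summable_suminf_not_top) auto
    have 2: "summable (\<lambda>k. (1 / 2 :: real) ^ k)"
      by (intro summable_geometric) simp
    have "summable (\<lambda>k. g k x)"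
    proof (rule summable_comparison_test'[OF summable_add[OF 1 2], of 0])
      fix k
      have "2 * norm (g k x) \<le> 2 ^ k * (norm (g k x))\<^sup>2 + (1 / 2) ^ k"
      proof -
        \<comment> \<open>the inequality between arithmetic and geometric mean\<close>
        have "0 \<le> (2 ^ k * norm (g k x) - 1)\<^sup>2 / 2 ^ k" by simp
        also have "\<dots> = 2 ^ k * (norm (g k x))\<^sup>2 + (1 / 2) ^ k - 2 * norm (g k x)"
          by (simp add: power2_eq_square field_simps power_one_over)
        finally show ?thesis by simp
      qed
      then show "norm (g k x) \<le> 2 ^ k * (norm (g k x))\<^sup>2 + (1 / 2) ^ k"
        using norm_ge_zero[of "g k x"] by linarith
    qed
    then have "convergent (\<lambda>n. \<Sum>k<n. g k x)"
      by (simp add: summable_iff_convergent)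
    moreover have "(\<Sum>k<n. g k x) = rep_L2 (Y n) x - rep_L2 (Y 0) x" for n
      unfolding g_def by (rule sum_lessThan_telescope)
    ultimately have "convergent (\<lambda>n. rep_L2 (Y n) x - rep_L2 (Y 0) x + rep_L2 (Y 0) x)"
      by (intro convergent_add convergent_const) simp
    then show ?case by simp
  qed
qed

text \<open>The almost everywhere limit of a fast subsequence of a Cauchy sequence is its limit in
  the norm, by Fatou's lemma.\<close>

instance L2 :: (euclidean_space) banach
proof
  fix X :: "nat \<Rightarrow> 'a L2" assume X: "Cauchy X"
  obtain r where r: "strict_mono r" "\<And>k. norm (X (r (Suc k)) - X (r k)) \<le> (1 / 2) ^ k"
    using Cauchy_fast_subseq[OF X] by blast
  define f where "f x = lim (\<lambda>k. rep_L2 (X (r k)) x)" for x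
  have [measurable]: "f \<in> borel_measurable lebesgue"
    unfolding f_def by (rule borel_measurable_lim_metric) measurable
  have lim: "AE x in lebesgue. (\<lambda>k. rep_L2 (X (r k)) x) \<longlonglongrightarrow> f x"
    using fast_L2_sequence_converges_AE[of "\<lambda>k. X (r k)", OF r(2)]
    by eventually_elim (simp add: f_def convergent_LIMSEQ_iff)
  have bound: "(\<integral>\<^sup>+x. ennreal ((norm (f x - rep_L2 (X n) x))\<^sup>2) \<partial>lebesgue) \<le> ennreal (e\<^sup>2)"
    if e: "0 < e" "\<And>m. m \<ge> N \<Longrightarrow> norm (X m - X n) < e" for e n N
  proof -
    have "(\<integral>\<^sup>+x. ennreal ((norm (f x - rep_L2 (X n) x))\<^sup>2) \<partial>lebesgue) =
        (\<integral>\<^sup>+x. liminf (\<lambda>k. ennreal ((norm (rep_L2 (X (r k)) x - rep_L2 (X n) x))\<^sup>2)) \<partial>lebesgue)"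
    proof (rule nn_integral_cong_AE)
      show "AE x in lebesgue. ennreal ((norm (f x - rep_L2 (X n) x))\<^sup>2) =
          liminf (\<lambda>k. ennreal ((norm (rep_L2 (X (r k)) x - rep_L2 (X n) x))\<^sup>2))"
        using lim
      proof eventually_elim
        case (elim x)
        have "(\<lambda>k. ennreal ((norm (rep_L2 (X (r k)) x - rep_L2 (X n) x))\<^sup>2)) \<longlonglongrightarrow>
            ennreal ((norm (f x - rep_L2 (X n) x))\<^sup>2)"
          by (intro tendsto_ennrealI tendsto_power tendsto_norm tendsto_diff elim tendsto_const)
        from lim_imp_Liminf[OF sequentially_bot this] show ?case by simp
      qed
    qed
    also have "\<dots> \<le> liminf (\<lambda>k. \<integral>\<^sup>+x. ennreal ((norm (rep_L2 (X (r k)) x - rep_L2 (X n) x))\<^sup>2) \<partial>lebesgue)"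
      by (rule nn_integral_liminf) measurable
    also have "\<dots> \<le> liminf (\<lambda>k. ennreal (e\<^sup>2))"
    proof (rule Liminf_mono)
      show "\<forall>\<^sub>F k in sequentially. (\<integral>\<^sup>+x. ennreal ((norm (rep_L2 (X (r k)) x - rep_L2 (X n) x))\<^sup>2) \<partial>lebesgue) \<le> ennreal (e\<^sup>2)"
        using eventually_ge_at_top[of N]
      proof eventually_elim
        case (elim k)
        have "N \<le> r k" using elim seq_suble[OF r(1), of k] by simp
        then have "norm (X (r k) - X n) \<le> e" using e(2) less_imp_le by blast
        then show ?case
          unfolding nn_integral_norm_L2_diff using e(1) by (intro ennreal_leI power_mono) auto
      qed
    qed
    also have "\<dots> = ennreal (e\<^sup>2)" by (simp add: Liminf_const)
    finally show ?thesis .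
  qed
  have ex: "\<exists>N. \<forall>m\<ge>N. \<forall>n\<ge>N. norm (X m - X n) < e" if "0 < e" for e
    using X that unfolding Cauchy_iff by blast
  have sf: "square_integrable f"
  proof -
    obtain N where N: "\<And>m. m \<ge> N \<Longrightarrow> norm (X m - X N) < 1"
      using ex[of 1] by auto
    have "square_integrable (\<lambda>x. f x - rep_L2 (X N) x)"
    proof -
      have "(\<integral>\<^sup>+x. ennreal ((norm (f x - rep_L2 (X N) x))\<^sup>2) \<partial>lebesgue) \<le> ennreal (1\<^sup>2)"
        by (rule bound[OF zero_less_one N])
      then show ?thesis
        unfolding square_integrable_iff_nn_integral by (simp add: order.strict_trans1)
    qed
    from square_integrable_add[OF this square_integrable_rep[of "X N"]] show ?thesis by simp
  qed
  have "X \<longlonglongrightarrow> abs_L2 f"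
  proof (rule LIMSEQ_I)
    fix e :: real assume e: "0 < e"
    obtain N where N: "\<And>m n. m \<ge> N \<Longrightarrow> n \<ge> N \<Longrightarrow> norm (X m - X n) < e / 2"
      using ex[of "e / 2"] e by auto
    have "norm (X n - abs_L2 f) < e" if n: "n \<ge> N" for n
    proof -
      have "ennreal ((norm (abs_L2 f - X n))\<^sup>2) = (\<integral>\<^sup>+x. ennreal ((norm (f x - rep_L2 (X n) x))\<^sup>2) \<partial>lebesgue)"
        unfolding nn_integral_norm_L2_diff[symmetric]
        using rep_abs_L2[OF sf] by (intro nn_integral_cong_AE) (auto elim: eventually_mono)
      also have "\<dots> \<le> ennreal ((e / 2)\<^sup>2)"
        using N n e by (intro bound[of _ N]) auto
      finally have "(norm (abs_L2 f - X n))\<^sup>2 \<le> (e / 2)\<^sup>2"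
        by (simp add: ennreal_le_iff)
      then have "norm (abs_L2 f - X n) \<le> e / 2"
        by (rule power2_le_imp_le) (use e in simp)
      then show ?thesis using e by (simp add: norm_minus_commute)
    qed
    then show "\<exists>N. \<forall>n\<ge>N. norm (X n - abs_L2 f) < e" by blast
  qed
  then show "convergent X" by (auto simp: convergent_def)
qed

text \<open>A pointwise multiplier, used only for bounded measurable \<open>a\<close>; this makes it a bounded
  operator. The weight, the coefficients of the operator and the projection onto \<open>L\<^sup>2(\<Omega>)\<close> all
  take this form.\<close>

definition mult_L2 :: "('a::euclidean_space \<Rightarrow> real) \<Rightarrow> 'a L2 \<Rightarrow> 'a L2" where
  "mult_L2 a u = abs_L2 (\<lambda>x. a x *\<^sub>R rep_L2 u x)"

lemma square_integrable_mult:
  assumes [measurable]: "a \<in> borel_measurable lebesgue" and a: "\<And>x. \<bar>a x\<bar> \<le> C" and f: "square_integrable f"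
  shows "square_integrable (\<lambda>x. a x *\<^sub>R f x)"
proof -
  have "f \<in> borel_measurable lebesgue" using f by (simp add: square_integrable_def)
  then have m: "(\<lambda>x. a x *\<^sub>R f x) \<in> borel_measurable lebesgue"
    by (intro borel_measurable_scaleR assms)
  have "integrable lebesgue (\<lambda>x. (norm (a x *\<^sub>R f x))\<^sup>2)"
  proof (rule Bochner_Integration.integrable_bound)
    show "integrable lebesgue (\<lambda>x. C\<^sup>2 * (norm (f x))\<^sup>2)"
      using f by (simp add: square_integrable_def)
    have "(norm (a x *\<^sub>R f x))\<^sup>2 \<le> C\<^sup>2 * (norm (f x))\<^sup>2" for x
      using power_mono[OF a[of x], of 2] by (simp add: power_mult_distrib mult_right_mono)
    then show "AE x in lebesgue. norm ((norm (a x *\<^sub>R f x))\<^sup>2) \<le> norm (C\<^sup>2 * (norm (f x))\<^sup>2)"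
      by (intro AE_I2) (simp only: real_norm_def abs_mult abs_power2 abs_norm_cancel power2_abs)
    show "(\<lambda>x. (norm (a x *\<^sub>R f x))\<^sup>2) \<in> borel_measurable lebesgue"
      using m by (rule measurable_compose) measurable
  qed
  then show ?thesis using m by (simp add: square_integrable_def)
qed

lemma rep_mult_L2:
  assumes "a \<in> borel_measurable lebesgue" "\<And>x. \<bar>a x\<bar> \<le> C"
  shows "AE x in lebesgue. rep_L2 (mult_L2 a u) x = a x *\<^sub>R rep_L2 u x"
  unfolding mult_L2_def by (rule rep_abs_L2[OF square_integrable_mult[OF assms square_integrable_rep]])

lemma bounded_linear_mult_L2:
  assumes a: "a \<in> borel_measurable lebesgue" "\<And>x. \<bar>a x\<bar> \<le> C"
  shows "bounded_linear (mult_L2 a)"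
proof (rule bounded_linear_intro)
  note rep = rep_mult_L2[OF a]
  fix u v :: "'a L2" and r :: real
  have "AE x in lebesgue. rep_L2 (mult_L2 a (u + v)) x = rep_L2 (mult_L2 a u + mult_L2 a v) x"
    using rep[of "u + v"] rep[of u] rep[of v] rep_L2_plus[of u v] rep_L2_plus[of "mult_L2 a u" "mult_L2 a v"]
    by eventually_elim (simp add: scaleR_add_right del: scaleR_conv_of_real)
  then show "mult_L2 a (u + v) = mult_L2 a u + mult_L2 a v" by (rule L2_eqI)
  have "AE x in lebesgue. rep_L2 (mult_L2 a (r *\<^sub>R u)) x = rep_L2 (r *\<^sub>R mult_L2 a u) x"
    using rep[of "r *\<^sub>R u"] rep[of u] rep_L2_scaleR[of r u] rep_L2_scaleR[of r "mult_L2 a u"]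
    by eventually_elim (simp del: scaleR_conv_of_real add: mult.commute)
  then show "mult_L2 a (r *\<^sub>R u) = r *\<^sub>R mult_L2 a u" by (rule L2_eqI)
  have "(norm (mult_L2 a u))\<^sup>2 \<le> (norm u * \<bar>C\<bar>)\<^sup>2"
  proof -
    have "ennreal ((norm (mult_L2 a u))\<^sup>2) = (\<integral>\<^sup>+x. ennreal ((norm (a x *\<^sub>R rep_L2 u x))\<^sup>2) \<partial>lebesgue)"
      unfolding nn_integral_norm_L2[symmetric] using rep[of u]
      by (intro nn_integral_cong_AE) (auto elim: eventually_mono)
    also have "\<dots> \<le> (\<integral>\<^sup>+x. ennreal (C\<^sup>2) * ennreal ((norm (rep_L2 u x))\<^sup>2) \<partial>lebesgue)"
    proof (rule nn_integral_mono)
      fix x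
      have "(norm (a x *\<^sub>R rep_L2 u x))\<^sup>2 \<le> C\<^sup>2 * (norm (rep_L2 u x))\<^sup>2"
        using power_mono[OF a(2)[of x], of 2] by (simp add: power_mult_distrib mult_right_mono)
      then have "ennreal ((norm (a x *\<^sub>R rep_L2 u x))\<^sup>2) \<le> ennreal (C\<^sup>2 * (norm (rep_L2 u x))\<^sup>2)"
        by (rule ennreal_leI)
      then show "ennreal ((norm (a x *\<^sub>R rep_L2 u x))\<^sup>2) \<le> ennreal (C\<^sup>2) * ennreal ((norm (rep_L2 u x))\<^sup>2)"
        by (simp only: ennreal_mult zero_le_power2)
    qed
    also have "\<dots> = ennreal ((norm u * \<bar>C\<bar>)\<^sup>2)"
    proof -
      have "(\<integral>\<^sup>+x. ennreal (C\<^sup>2) * ennreal ((norm (rep_L2 u x))\<^sup>2) \<partial>lebesgue) = ennreal (C\<^sup>2) * ennreal ((norm u)\<^sup>2)"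
        by (subst nn_integral_cmult) (simp_all add: nn_integral_norm_L2)
      also have "\<dots> = ennreal (C\<^sup>2 * (norm u)\<^sup>2)" by (simp only: ennreal_mult zero_le_power2)
      also have "C\<^sup>2 * (norm u)\<^sup>2 = (norm u * \<bar>C\<bar>)\<^sup>2" by (simp add: power_mult_distrib)
      finally show ?thesis .
    qed
    finally show ?thesis by (simp add: ennreal_le_iff)
  qed
  then show "norm (mult_L2 a u) \<le> norm u * \<bar>C\<bar>"
    by (rule power2_le_imp_le) simp
qed

lemma inner_mult_L2:
  assumes a: "a \<in> borel_measurable lebesgue" "\<And>x. \<bar>a x\<bar> \<le> C"
  shows "inner (mult_L2 a u) (mult_L2 a v) = (\<integral>x. (a x)\<^sup>2 * inner (rep_L2 u x) (rep_L2 v x) \<partial>lebesgue)"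
  unfolding inner_L2_eq
proof (rule integral_cong_AE)
  show "AE x in lebesgue. inner (rep_L2 (mult_L2 a u) x) (rep_L2 (mult_L2 a v) x) = (a x)\<^sup>2 * inner (rep_L2 u x) (rep_L2 v x)"
    using rep_mult_L2[OF a, of u] rep_mult_L2[OF a, of v]
    by eventually_elim (simp add: power2_eq_square del: scaleR_conv_of_real)
  show "(\<lambda>x. (a x)\<^sup>2 * inner (rep_L2 u x) (rep_L2 v x)) \<in> borel_measurable lebesgue"
    using a(1) by measurable
qed measurable

lemma indicator_projection:
  assumes \<Omega>: "\<Omega> \<in> sets lebesgue"
  shows "bounded_linear (mult_L2 (indicator \<Omega>))"
    and "range (mult_L2 (indicator \<Omega>)) = L2_space \<Omega>"
    and "v \<in> L2_space \<Omega> \<Longrightarrow> mult_L2 (indicator \<Omega>) v = v"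
proof -
  let ?a = "indicator \<Omega> :: 'a \<Rightarrow> real"
  have a: "?a \<in> borel_measurable lebesgue" "\<And>x. \<bar>?a x\<bar> \<le> 1"
    using \<Omega> by (auto simp: indicator_def)
  show "bounded_linear (mult_L2 ?a)" by (rule bounded_linear_mult_L2[OF a])
  have id: "mult_L2 ?a v = v" if "v \<in> L2_space \<Omega>" for v
  proof (rule L2_eqI)
    show "AE x in lebesgue. rep_L2 (mult_L2 ?a v) x = rep_L2 v x"
      using rep_mult_L2[OF a, of v] that[unfolded L2_space_def, simplified]
    proof eventually_elim
      case (elim x)
      then show ?case by (cases "x \<in> \<Omega>") auto
    qed
  qed
  then show "v \<in> L2_space \<Omega> \<Longrightarrow> mult_L2 ?a v = v" .
  have "mult_L2 ?a u \<in> L2_space \<Omega>" for u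
    using rep_mult_L2[OF a, of u] unfolding L2_space_def by (auto elim: eventually_mono)
  then show "range (mult_L2 ?a) = L2_space \<Omega>"
  proof (intro subset_antisym subsetI)
    fix v assume "v \<in> L2_space \<Omega>"
    then have "v = mult_L2 ?a v" by (simp only: id)
    then show "v \<in> range (mult_L2 ?a)" by (rule range_eqI)
  qed auto
qed


section \<open>Smooth functions with compact support\<close>

lemma partial_deriv_eq: "(f has_derivative f') (at x) \<Longrightarrow> partial_deriv i f x = f' (axis i 1)"
  unfolding partial_deriv_def by (metis frechet_derivative_at)

lemma Ck_differentiable: "Ck_on (Suc k) UNIV f \<Longrightarrow> f differentiable (at x)"
  by simp

lemma Ck_Suc_imp: "Ck_on (Suc k) UNIV f \<Longrightarrow> Ck_on k UNIV f"
proof (induction k arbitrary: f)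
  case 0
  then have "\<And>x. isCont f x" by (simp add: differentiable_imp_continuous_within)
  then show ?case by (simp add: continuous_on_eq_continuous_at)
next
  case (Suc k)
  then show ?case by (metis Ck_on.simps(2))
qed

lemma Ck_continuous: "Ck_on k UNIV f \<Longrightarrow> continuous_on UNIV f"
  by (induction k) (use Ck_Suc_imp in auto)

lemma Ck_const: "Ck_on k UNIV (\<lambda>x::real^'n. c::'b::real_normed_vector)"
proof (induction k arbitrary: c)
  case (Suc k)
  have "partial_deriv i (\<lambda>x::real^'n. c) = (\<lambda>x. 0)" for i
    by (simp add: fun_eq_iff partial_deriv_def)
  then show ?case using Suc by simp
qed simp

lemma Ck_add:
  fixes f g :: "real^'n \<Rightarrow> 'b::real_normed_vector"
  shows "Ck_on k UNIV f \<Longrightarrow> Ck_on k UNIV g \<Longrightarrow> Ck_on k UNIV (\<lambda>x. f x + g x)"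
proof (induction k arbitrary: f g)
  case (Suc k)
  then have d: "\<And>x. f differentiable (at x)" "\<And>x. g differentiable (at x)" by auto
  have "partial_deriv i (\<lambda>x. f x + g x) = (\<lambda>x. partial_deriv i f x + partial_deriv i g x)" for i
  proof
    fix x
    have "((\<lambda>x. f x + g x) has_derivative (\<lambda>h. frechet_derivative f (at x) h + frechet_derivative g (at x) h)) (at x)"
      using d by (intro has_derivative_add) (simp_all add: frechet_derivative_works)
    then show "partial_deriv i (\<lambda>x. f x + g x) x = partial_deriv i f x + partial_deriv i g x"
      by (simp add: partial_deriv_eq) (simp add: partial_deriv_def)
  qed
  then show ?case using Suc d by (auto intro: differentiable_add)
qed (auto intro: continuous_intros)

lemma partial_deriv_mult:
  fixes f g :: "real^'n \<Rightarrow> real"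
  assumes "f differentiable (at x)" "g differentiable (at x)"
  shows "partial_deriv i (\<lambda>x. f x * g x) x = f x * partial_deriv i g x + partial_deriv i f x * g x"
proof -
  have "((\<lambda>x. f x * g x) has_derivative (\<lambda>h. f x * frechet_derivative g (at x) h + frechet_derivative f (at x) h * g x)) (at x)"
    using assms by (intro has_derivative_mult) (simp_all add: frechet_derivative_works)
  then show ?thesis
    by (simp add: partial_deriv_eq) (simp add: partial_deriv_def)
qed

lemma Ck_mult:
  fixes f g :: "real^'n \<Rightarrow> real"
  shows "Ck_on k UNIV f \<Longrightarrow> Ck_on k UNIV g \<Longrightarrow> Ck_on k UNIV (\<lambda>x. f x * g x)"
proof (induction k arbitrary: f g)
  case (Suc k)
  then have d: "\<And>x. f differentiable (at x)" "\<And>x. g differentiable (at x)" by auto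
  have "partial_deriv i (\<lambda>x. f x * g x) = (\<lambda>x. f x * partial_deriv i g x + partial_deriv i f x * g x)" for i
    by (rule ext, rule partial_deriv_mult[OF d])
  moreover have "Ck_on k UNIV (\<lambda>x. f x * partial_deriv i g x + partial_deriv i f x * g x)" for i
    using Suc.prems by (intro Ck_add Suc.IH Ck_Suc_imp[OF Suc.prems(1)] Ck_Suc_imp[OF Suc.prems(2)]) auto
  ultimately show ?case using d by (auto intro: differentiable_mult)
qed (auto intro: continuous_intros)

lemma partial_deriv_linear:
  assumes L: "bounded_linear L" and f: "f differentiable (at x)"
  shows "partial_deriv i (\<lambda>x. L (f x)) x = L (partial_deriv i f x)"
proof -
  have "((\<lambda>x. L (f x)) has_derivative (\<lambda>h. L (frechet_derivative f (at x) h))) (at x)"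
    using f by (intro bounded_linear.has_derivative[OF L]) (simp add: frechet_derivative_works)
  then show ?thesis by (simp add: partial_deriv_eq) (simp add: partial_deriv_def)
qed

lemma Ck_linear:
  assumes L: "bounded_linear L"
  shows "Ck_on k UNIV f \<Longrightarrow> Ck_on k UNIV (\<lambda>x. L (f x))"
proof (induction k arbitrary: f)
  case 0
  then show ?case using bounded_linear.continuous_on[OF L] by simp
next
  case (Suc k)
  then have d: "\<And>x. f differentiable (at x)" by auto
  have "(\<lambda>x. L (f x)) differentiable (at x)" for x
    using bounded_linear.has_derivative[OF L] d[of x] unfolding differentiable_def by blast
  moreover have "partial_deriv i (\<lambda>x. L (f x)) = (\<lambda>x. L (partial_deriv i f x))" for i
    by (rule ext, rule partial_deriv_linear[OF L d])
  ultimately show ?case using Suc by auto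
qed

lemma Ck_affine: "Ck_on k UNIV (\<lambda>x::real^'n. a * (x $ i - c))"
proof (cases k)
  case 0
  have "continuous_on UNIV (\<lambda>x::real^'n. x $ i)"
    by (intro linear_continuous_on bounded_linear_vec_nth)
  then show ?thesis using 0 by (auto intro!: continuous_intros)
next
  case (Suc m)
  have d: "((\<lambda>x::real^'n. a * (x $ i - c)) has_derivative (\<lambda>h. a * (h $ i))) (at x)" for x
  proof -
    have "((\<lambda>x::real^'n. x $ i) has_derivative (\<lambda>h. h $ i)) (at x)"
      by (rule bounded_linear_imp_has_derivative[OF bounded_linear_vec_nth])
    from has_derivative_mult_right[OF has_derivative_diff[OF this has_derivative_const[of c]], of a]
    show ?thesis by simp
  qed
  have "partial_deriv j (\<lambda>x::real^'n. a * (x $ i - c)) = (\<lambda>x. a * (axis j 1 $ i))" for j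
    by (rule ext, rule partial_deriv_eq[OF d])
  then show ?thesis using d Suc by (auto simp: differentiable_def intro: Ck_const)
qed

lemma Ck_square_dist: "Ck_on k UNIV (\<lambda>x::real^'n. e - (norm (x - c))\<^sup>2)"
proof (cases k)
  case 0
  then show ?thesis by (auto intro!: continuous_intros)
next
  case (Suc m)
  have d: "((\<lambda>x::real^'n. e - (norm (x - c))\<^sup>2) has_derivative (\<lambda>h. - (2 * inner (x - c) h))) (at x)" for x
    unfolding power2_norm_eq_inner
    by (auto intro!: derivative_eq_intros simp: inner_commute)
  have "partial_deriv j (\<lambda>x::real^'n. e - (norm (x - c))\<^sup>2) = (\<lambda>x. - 2 * (x $ j - c $ j))" for j
    by (rule ext, rule partial_deriv_eq[OF d, THEN trans]) (simp add: inner_axis)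
  then show ?thesis using d Suc by (auto simp: differentiable_def intro: Ck_affine[of _ "-2", simplified])
qed

text \<open>The functions \<open>e\<^sup>-\<^sup>1\<^sup>/\<^sup>t / t\<^sup>m\<close>, extended by \<open>0\<close>, form a family whose span is closed under
  differentiation, so that smoothness of all of them follows by one induction.\<close>

definition flat_exp :: "nat \<Rightarrow> real \<Rightarrow> real" where
  "flat_exp m t = (if t \<le> 0 then 0 else exp (- 1 / t) / t ^ m)"

lemma flat_exp_tendsto_0: "(flat_exp m \<longlongrightarrow> 0) (at 0)"
proof -
  have "((\<lambda>y. y ^ m / exp y) \<longlongrightarrow> (0::real)) at_top" by (rule tendsto_power_div_exp_0)
  then have "((\<lambda>t::real. inverse t ^ m / exp (inverse t)) \<longlongrightarrow> 0) (at_right 0)"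
    by (rule filterlim_compose[OF _ filterlim_inverse_at_top_right])
  moreover have "\<forall>\<^sub>F t in at_right 0. inverse t ^ m / exp (inverse t) = flat_exp m t"
    using eventually_at_right_less[of 0]
    by eventually_elim (simp add: flat_exp_def exp_minus field_simps)
  ultimately have "(flat_exp m \<longlongrightarrow> 0) (at_right 0)"
    by (rule Lim_transform_eventually)
  moreover have "(flat_exp m \<longlongrightarrow> 0) (at_left 0)"
    by (rule Lim_transform_eventually[OF tendsto_const])
      (auto simp: flat_exp_def eventually_at_filter)
  ultimately show ?thesis by (simp add: filterlim_split_at)
qed

lemma flat_exp_derivative:
  "(flat_exp m has_real_derivative (- real m * flat_exp (m + 1) t + flat_exp (m + 2) t)) (at t)"
proof -
  consider "t < 0" | "t = 0" | "0 < t" by linarith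
  then show ?thesis
  proof cases
    case 1
    have "((\<lambda>_. 0) has_real_derivative 0) (at t)" by simp
    moreover have "- real m * flat_exp (m + 1) t + flat_exp (m + 2) t = 0"
      using 1 by (simp add: flat_exp_def)
    ultimately have "((\<lambda>_. 0) has_real_derivative (- real m * flat_exp (m + 1) t + flat_exp (m + 2) t)) (at t)"
      by (simp only:)
    then show ?thesis
      by (rule has_field_derivative_transform_within_open[of _ _ t "{..<0}"]) (use 1 in \<open>simp_all add: flat_exp_def\<close>)
  next
    case 2
    have "((\<lambda>h. (flat_exp m (0 + h) - flat_exp m 0) / h) \<longlongrightarrow> 0) (at 0)"
      by (rule Lim_transform_eventually[OF flat_exp_tendsto_0[of "Suc m"]])
        (auto simp: flat_exp_def eventually_at_filter field_simps)
    then show ?thesis using 2 by (simp add: DERIV_def flat_exp_def)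
  next
    case 3
    have "((\<lambda>t. exp (- 1 / t) / t ^ m) has_real_derivative - real m * flat_exp (m + 1) t + flat_exp (m + 2) t) (at t)"
    proof -
      have "((\<lambda>t. exp (- 1 / t) / t ^ m) has_real_derivative
          (exp (- 1 / t) * (1 / t\<^sup>2) * t ^ m - exp (- 1 / t) * (real m * t ^ (m - 1))) / (t ^ m * t ^ m)) (at t)"
        using 3 by (auto intro!: derivative_eq_intros simp: power2_eq_square)
      moreover have "(exp (- 1 / t) * (1 / t\<^sup>2) * t ^ m - exp (- 1 / t) * (real m * t ^ (m - 1))) / (t ^ m * t ^ m) =
          - real m * flat_exp (m + 1) t + flat_exp (m + 2) t"
        using 3 by (cases m) (simp_all add: flat_exp_def field_simps power2_eq_square)
      ultimately show ?thesis by simp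
    qed
    then show ?thesis
      by (rule has_field_derivative_transform_within_open[of _ _ t "{0<..}"]) (use 3 in \<open>simp_all add: flat_exp_def\<close>)
  qed
qed

lemma Ck_flat_exp:
  fixes f :: "real^'n \<Rightarrow> real"
  assumes f: "\<And>k. Ck_on k UNIV f"
  shows "Ck_on k UNIV (\<lambda>x. flat_exp m (f x))"
proof (induction k arbitrary: m)
  case 0
  have "isCont (flat_exp m) t" for t
    using flat_exp_derivative by (rule DERIV_isCont)
  then have "continuous_on UNIV (flat_exp m)" by (simp add: continuous_on_eq_continuous_at)
  then show ?case
    using f[of 0] by (auto intro: continuous_on_compose2)
next
  case (Suc k)
  have d: "((\<lambda>x. flat_exp m (f x)) has_derivative
      (\<lambda>h. frechet_derivative f (at x) h * (- real m * flat_exp (m + 1) (f x) + flat_exp (m + 2) (f x)))) (at x)" for x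
    by (rule DERIV_compose_FDERIV[OF flat_exp_derivative])
      (use f[of "Suc 0"] in \<open>simp add: frechet_derivative_works\<close>)
  have "partial_deriv i (\<lambda>x. flat_exp m (f x)) =
      (\<lambda>x. partial_deriv i f x * ((- real m) * flat_exp (m + 1) (f x) + flat_exp (m + 2) (f x)))" for i
    by (rule ext, rule partial_deriv_eq[OF d, THEN trans]) (simp add: partial_deriv_def)
  moreover have "Ck_on k UNIV (\<lambda>x. partial_deriv i f x * ((- real m) * flat_exp (m + 1) (f x) + flat_exp (m + 2) (f x)))" for i
    using f[of "Suc k"] by (intro Ck_mult Ck_add Ck_const Suc) auto
  ultimately show ?case using d by (auto simp: differentiable_def)
qed

text \<open>The standard mollifier kernel without normalisation; \<open>bump_concentration\<close> below works
  with any positive mass.\<close>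

definition bump :: "real \<Rightarrow> real^'n \<Rightarrow> real" where
  "bump e z = flat_exp 0 (e\<^sup>2 - (norm z)\<^sup>2)"

lemma Ck_bump: "Ck_on k UNIV (\<lambda>x::real^'n. bump e (x - c))"
  unfolding bump_def by (intro Ck_flat_exp Ck_square_dist)

lemma bump_range: "0 \<le> bump e z" "bump e z \<le> 1"
  by (auto simp: bump_def flat_exp_def)

lemma bump_pos_iff: "0 < e \<Longrightarrow> 0 < bump e z \<longleftrightarrow> norm z < e"
  using power2_less_imp_less[of "norm z" e] power_strict_mono[of "norm z" e 2]
  by (auto simp: bump_def flat_exp_def not_le)

lemma bump_minus: "bump e (- z) = bump e z"
  by (simp add: bump_def)

lemma bump_commute: "bump e (x - y) = bump e (y - x)"
  by (simp add: bump_def norm_minus_commute)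

text \<open>Differentiating a kernel in \<open>x\<close> or in \<open>y\<close> differs by a sign. This is what moves a
  derivative from one factor of a mollified product to the other.\<close>

lemma partial_deriv_bump_reflect:
  "partial_deriv i (\<lambda>y. bump e (x - y)) y = - partial_deriv i (\<lambda>x. bump e (x - y)) x"
proof -
  have d: "(\<lambda>z::real^'n. bump e (z - 0)) differentiable (at z)" for z
    by (rule Ck_differentiable[OF Ck_bump])
  have D: "(bump e has_derivative frechet_derivative (bump e) (at z)) (at z)" for z :: "real^'n"
    using d[of z] by (simp add: frechet_derivative_works)
  have 1: "((\<lambda>y. bump e (x - y)) has_derivative (\<lambda>h. frechet_derivative (bump e) (at (x - y)) (- h))) (at y)"
    by (rule has_derivative_compose[OF _ D, of "\<lambda>y. x - y"]) (auto intro!: derivative_eq_intros)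
  have 2: "((\<lambda>x. bump e (x - y)) has_derivative (\<lambda>h. frechet_derivative (bump e) (at (x - y)) h)) (at x)"
    by (rule has_derivative_compose[OF _ D, of "\<lambda>x. x - y"]) (auto intro!: derivative_eq_intros)
  have "linear (frechet_derivative (bump e) (at (x - y)))"
    using D[of "x - y"] by (rule has_derivative_linear)
  then show ?thesis
    unfolding partial_deriv_eq[OF 1] partial_deriv_eq[OF 2] by (rule linear_neg)
qed

lemma test_function_bump:
  assumes "0 < e" "cball c e \<subseteq> \<Omega>"
  shows "test_function \<Omega> (\<lambda>x::real^'n. bump e (x - c))"
proof -
  have sub: "closure {x. bump e (x - c) \<noteq> 0} \<subseteq> cball c e"
  proof (rule closure_minimal)
    show "{x. bump e (x - c) \<noteq> 0} \<subseteq> cball c e"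
      using bump_pos_iff[OF assms(1)] bump_range(1)
      by (force simp: dist_norm norm_minus_commute less_le)
  qed simp
  then have "compact (closure {x. bump e (x - c) \<noteq> 0})"
    by (meson bounded_cball bounded_subset closed_closure compact_eq_bounded_closed)
  then show ?thesis
    using sub assms Ck_bump by (auto simp: test_function_def)
qed

lemma compact_closed_subset: "compact K \<Longrightarrow> closed A \<Longrightarrow> A \<subseteq> K \<Longrightarrow> compact A"
  using compact_Int_closed[of K A] by (simp add: inf.absorb2)

lemma test_function_bump_mult:
  assumes "test_function \<Omega> \<phi>"
  shows "test_function \<Omega> (\<lambda>x::real^'n. \<phi> x * bump e (x - c))"
proof -
  have sub: "closure {x. \<phi> x * bump e (x - c) \<noteq> 0} \<subseteq> closure {x. \<phi> x \<noteq> 0}"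
    by (rule closure_mono) auto
  then have "compact (closure {x. \<phi> x * bump e (x - c) \<noteq> 0})"
    using assms unfolding test_function_def by (intro compact_closed_subset[OF _ closed_closure]) auto
  then show ?thesis
    using sub assms unfolding test_function_def by (auto intro!: Ck_mult Ck_bump)
qed

lemma test_function_linear:
  assumes "test_function \<Omega> \<phi>" and L: "bounded_linear L"
  shows "test_function \<Omega> (\<lambda>x. L (\<phi> x))"
proof -
  have sub: "closure {x. L (\<phi> x) \<noteq> 0} \<subseteq> closure {x. \<phi> x \<noteq> 0}"
    using bounded_linear.linear[OF L] by (intro closure_mono) (auto simp: linear_0)
  then have "compact (closure {x. L (\<phi> x) \<noteq> 0})"
    using assms unfolding test_function_def by (intro compact_closed_subset[OF _ closed_closure]) auto
  then show ?thesis
    using sub assms unfolding test_function_def by (auto intro!: Ck_linear[OF L])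
qed

lemma test_function_differentiable: "test_function \<Omega> \<phi> \<Longrightarrow> \<phi> differentiable (at x)"
  unfolding test_function_def using Ck_differentiable by blast

lemma test_function_continuous: "test_function \<Omega> \<phi> \<Longrightarrow> continuous_on UNIV \<phi>"
  unfolding test_function_def using Ck_continuous by blast

lemma partial_deriv_test_continuous: "test_function \<Omega> \<phi> \<Longrightarrow> continuous_on UNIV (partial_deriv i \<phi>)"
  unfolding test_function_def by (metis Ck_on.simps(2) Ck_continuous)

lemma partial_deriv_outside_support:
  assumes "x \<notin> closure {x. \<phi> x \<noteq> 0}"
  shows "partial_deriv i \<phi> x = 0"
proof -
  have "(\<phi> has_derivative (\<lambda>_. 0)) (at x)"
    by (rule has_derivative_transform_within_open[of "\<lambda>_. 0" _ x _ "- closure {x. \<phi> x \<noteq> 0}"])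
      (use assms closure_subset[of "{x. \<phi> x \<noteq> 0}"] in auto)
  then show ?thesis by (simp add: partial_deriv_eq)
qed

lemma compact_support_bounded:
  fixes f :: "'a::euclidean_space \<Rightarrow> 'b::real_normed_vector"
  assumes "continuous_on UNIV f" "compact K" "\<And>x. x \<notin> K \<Longrightarrow> f x = 0"
  obtains C where "0 \<le> C" "\<And>x. norm (f x) \<le> C"
proof -
  have "compact (f ` K)"
    using assms by (intro compact_continuous_image continuous_on_subset[OF assms(1)]) auto
  then have "bounded (f ` K)" by (rule compact_imp_bounded)
  then obtain C where C: "\<And>x. x \<in> K \<Longrightarrow> norm (f x) \<le> C"
    unfolding bounded_iff by auto
  show ?thesis
  proof (rule that[of "max C 0"])
    show "norm (f x) \<le> max C 0" for x
      using C[of x] assms(3)[of x] by (cases "x \<in> K") auto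
  qed simp
qed

lemma test_function_bounds:
  assumes "test_function \<Omega> \<phi>"
  obtains C where "0 \<le> C" "\<And>x. norm (\<phi> x) \<le> C" "\<And>x. norm (partial_deriv i \<phi> x) \<le> C"
proof -
  let ?K = "closure {x. \<phi> x \<noteq> 0}"
  have K: "compact ?K" using assms by (simp add: test_function_def)
  have out: "\<phi> x = 0" if "x \<notin> ?K" for x
    using that closure_subset[of "{x. \<phi> x \<noteq> 0}"] by auto
  obtain C1 where C1: "0 \<le> C1" "\<And>x. norm (\<phi> x) \<le> C1"
    using compact_support_bounded[OF test_function_continuous[OF assms] K out] by metis
  obtain C2 where C2: "0 \<le> C2" "\<And>x. norm (partial_deriv i \<phi> x) \<le> C2"
    using compact_support_bounded[OF partial_deriv_test_continuous[OF assms, of i] K partial_deriv_outside_support]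
    by metis
  show ?thesis
  proof (rule that[of "max C1 C2"])
    show "norm (\<phi> x) \<le> max C1 C2" for x
      using C1(2)[of x] by linarith
    show "norm (partial_deriv i \<phi> x) \<le> max C1 C2" for x
      using C2(2)[of x] by linarith
    show "0 \<le> max C1 C2" using C1 by simp
  qed
qed


section \<open>Continuity of translations in the mean and mollified pairings\<close>

text \<open>Square integrability of real functions, for Borel functions and \<open>lborel\<close> instead of the
  completed measure, since Fubini's theorem is to be applied to products of them.\<close>

definition sqi :: "('a::euclidean_space \<Rightarrow> real) \<Rightarrow> bool" where
  "sqi f \<longleftrightarrow> f \<in> borel_measurable borel \<and> integrable lborel (\<lambda>x. (f x)\<^sup>2)"

lemma sqi_measurable [measurable_dest]: "sqi f \<Longrightarrow> f \<in> borel_measurable borel"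
  by (simp add: sqi_def)

lemma sqi_integrable: "sqi f \<Longrightarrow> integrable lborel (\<lambda>x. (f x)\<^sup>2)"
  by (simp add: sqi_def)

lemma two_abs_mult_le: "2 * \<bar>a * b\<bar> \<le> a\<^sup>2 + (b::real)\<^sup>2"
  using sum_squares_bound[of "\<bar>a\<bar>" "\<bar>b\<bar>"] by (simp add: abs_mult)

lemma sqi_mult_integrable:
  assumes f: "sqi f" and g: "sqi g"
  shows "integrable lborel (\<lambda>x. f x * g x)"
proof (rule Bochner_Integration.integrable_bound)
  show "integrable lborel (\<lambda>x. (f x)\<^sup>2 + (g x)\<^sup>2)"
    using f g by (auto simp: sqi_def)
  have "norm (f x * g x) \<le> norm ((f x)\<^sup>2 + (g x)\<^sup>2)" for x
    using two_abs_mult_le[of "f x" "g x"] by simp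
  then show "AE x in lborel. norm (f x * g x) \<le> norm ((f x)\<^sup>2 + (g x)\<^sup>2)" by simp
qed (use f g in measurable)

lemma sqi_diff: 
  assumes f: "sqi f" and g: "sqi g" 
  shows "sqi (\<lambda>x. f x - g x)"
proof -
  have "integrable lborel (\<lambda>x. (f x)\<^sup>2 + (g x)\<^sup>2 - 2 * (f x * g x))"
    by (intro Bochner_Integration.integrable_diff Bochner_Integration.integrable_add integrable_mult_right
        sqi_mult_integrable sqi_integrable f g)
  moreover have "(\<lambda>x. (f x)\<^sup>2 + (g x)\<^sup>2 - 2 * (f x * g x)) = (\<lambda>x. (f x - g x)\<^sup>2)"
    by (simp add: power2_diff fun_eq_iff)
  moreover have "(\<lambda>x. f x - g x) \<in> borel_measurable borel"
    using f g by measurable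
  ultimately show ?thesis by (simp add: sqi_def)
qed

lemma bounded_support_sqi:
  fixes f :: "'a::euclidean_space \<Rightarrow> real"
  assumes f: "f \<in> borel_measurable borel" "\<And>x. \<bar>f x\<bar> \<le> B" "\<And>x. R < norm x \<Longrightarrow> f x = 0"
  shows "sqi f"
proof -
  have "integrable lborel (\<lambda>x. (f x)\<^sup>2)"
  proof (rule Bochner_Integration.integrable_bound)
    show "integrable lborel (\<lambda>x. B\<^sup>2 * indicator (cball 0 R) x :: real)"
      by (intro integrable_mult_right integrable_real_indicator) (use emeasure_lborel_cball_finite in \<open>simp_all add: less_top[symmetric]\<close>)
    have "(f x)\<^sup>2 \<le> B\<^sup>2 * indicator (cball 0 R) x" for x
      using power_mono[OF f(2)[of x], of 2] f(3)[of x] by (cases "norm x \<le> R") auto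
    then show "AE x in lborel. norm ((f x)\<^sup>2) \<le> norm (B\<^sup>2 * indicator (cball 0 R) x :: real)"
      by (intro AE_I2) (simp add: abs_mult)
  qed (use f in measurable)
  then show ?thesis using f by (simp add: sqi_def)
qed

lemma lborel_translate:
  fixes f :: "'a::euclidean_space \<Rightarrow> 'b::{banach,second_countable_topology}"
  assumes [measurable]: "f \<in> borel_measurable borel"
  shows "(\<integral>x. f (x - z) \<partial>lborel) = (\<integral>x. f x \<partial>lborel)"
    and "integrable lborel (\<lambda>x. f (x - z)) \<longleftrightarrow> integrable lborel f"
proof -
  have L: "(lborel :: 'a measure) = distr lborel borel ((+) (- z))"
    by (rule lborel_distr_plus[symmetric])
  have "(\<integral>x. f x \<partial>lborel) = (\<integral>x. f x \<partial>distr lborel borel ((+) (- z)))"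
    by (simp only: L[symmetric])
  also have "\<dots> = (\<integral>x. f (- z + x) \<partial>lborel)"
    by (rule integral_distr) measurable
  finally show "(\<integral>x. f (x - z) \<partial>lborel) = (\<integral>x. f x \<partial>lborel)" by simp
  have "integrable lborel f \<longleftrightarrow> integrable (distr lborel borel ((+) (- z))) f"
    by (simp only: L[symmetric])
  also have "\<dots> \<longleftrightarrow> integrable lborel (\<lambda>x. f (- z + x))"
    by (rule integrable_distr_eq) measurable
  finally show "integrable lborel (\<lambda>x. f (x - z)) \<longleftrightarrow> integrable lborel f" by simp
qed

lemma sqi_translate:
  assumes "sqi f" shows "sqi (\<lambda>x. f (x - z))"
  using assms lborel_translate(2)[of "\<lambda>x. (f x)\<^sup>2" z] unfolding sqi_def by auto

text \<open>Almost everywhere approximation by continuous functions, cut off in range and in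
  support, becomes approximation in the mean by dominated convergence.\<close>

lemma bounded_support_approx:
  fixes f :: "'a::euclidean_space \<Rightarrow> real"
  assumes f: "f \<in> borel_measurable borel" "\<And>x. \<bar>f x\<bar> \<le> B" "\<And>x. R < norm x \<Longrightarrow> f x = 0" and d: "0 < d"
  obtains g where "continuous_on UNIV g" "\<And>x. \<bar>g x\<bar> \<le> B" "\<And>x. R + 1 < norm x \<Longrightarrow> g x = 0"
    "(\<integral>x. (f x - g x)\<^sup>2 \<partial>lborel) < d"
proof -
  have "f measurable_on UNIV"
    using f(1) by (intro lebesgue_measurable_imp_measurable_on_real measurable_completion) simp_all
  then obtain N h where N: "negligible N" and h: "\<And>n. continuous_on UNIV (h n :: 'a \<Rightarrow> real)"
    and lim: "\<And>x. x \<notin> N \<Longrightarrow> (\<lambda>n. h n x) \<longlonglongrightarrow> f x"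
    unfolding measurable_on_def by auto
  have B: "0 \<le> B" using f(2)[of 0] by linarith
  define ct where "ct x = min 1 (max 0 (R + 1 - norm x))" for x :: 'a
  define g where "g n x = ct x * min B (max (- B) (h n x))" for n x
  have ct: "0 \<le> ct x" "ct x \<le> 1" for x by (auto simp: ct_def)
  have gc: "continuous_on UNIV (g n)" for n
    unfolding g_def ct_def by (intro continuous_intros h)
  have gB: "\<bar>g n x\<bar> \<le> B" for n x
  proof -
    have "\<bar>g n x\<bar> \<le> 1 * B"
      unfolding g_def abs_mult using ct[of x] B by (intro mult_mono) auto
    then show ?thesis by simp
  qed
  have g0: "g n x = 0" if "R + 1 < norm x" for n x
    using that by (simp add: g_def ct_def)
  have "(\<lambda>n. \<integral>x. (f x - g n x)\<^sup>2 \<partial>lborel) \<longlonglongrightarrow> (\<integral>x. 0 \<partial>(lborel :: 'a measure))"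
  proof (rule integral_dominated_convergence[where w = "\<lambda>x. (2 * B)\<^sup>2 * indicator (cball 0 (R + 1)) x"])
    have [measurable]: "g n \<in> borel_measurable borel" for n
      using gc by (rule borel_measurable_continuous_onI)
    show "(\<lambda>x. (f x - g n x)\<^sup>2) \<in> borel_measurable lborel" for n
      using f(1) by measurable
    show "integrable lborel (\<lambda>x::'a. (2 * B)\<^sup>2 * indicator (cball 0 (R + 1)) x :: real)"
      by (intro integrable_mult_right integrable_real_indicator) (use emeasure_lborel_cball_finite in \<open>simp_all add: less_top[symmetric]\<close>)
    show "AE x in lborel. norm ((f x - g n x)\<^sup>2) \<le> (2 * B)\<^sup>2 * indicator (cball 0 (R + 1)) x" for n
    proof (rule AE_I2)
      fix x
      have "\<bar>f x - g n x\<bar> \<le> 2 * B" using f(2)[of x] gB[of n x] by linarith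
      then have "\<bar>f x - g n x\<bar>\<^sup>2 \<le> (2 * B)\<^sup>2" by (intro power_mono) auto
      then show "norm ((f x - g n x)\<^sup>2) \<le> (2 * B)\<^sup>2 * indicator (cball 0 (R + 1)) x"
        using f(3)[of x] g0[of x n] by (cases "norm x \<le> R + 1") auto
    qed
    have "AE x in lborel. x \<notin> N"
    proof -
      have "AE x in lebesgue. x \<notin> N"
        using N by (intro AE_not_in) (simp add: negligible_iff_null_sets)
      then show ?thesis by (simp only: AE_completion_iff)
    qed
    then show "AE x in lborel. (\<lambda>n. (f x - g n x)\<^sup>2) \<longlonglongrightarrow> 0"
    proof eventually_elim
      case (elim x)
      have "(\<lambda>n. (f x - g n x)\<^sup>2) \<longlonglongrightarrow> (f x - ct x * min B (max (- B) (f x)))\<^sup>2"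
        unfolding g_def by (intro tendsto_intros lim elim)
      moreover have "f x - ct x * min B (max (- B) (f x)) = 0"
      proof (cases "R < norm x")
        case True
        then show ?thesis using f(3)[of x] B by simp
      next
        case False
        then have "ct x = 1" by (simp add: ct_def)
        moreover have "min B (max (- B) (f x)) = f x" using f(2)[of x] by auto
        ultimately show ?thesis by simp
      qed
      ultimately show ?case by simp
    qed
  qed simp
  then have "\<forall>\<^sub>F n in sequentially. (\<integral>x. (f x - g n x)\<^sup>2 \<partial>lborel) < d"
    using d by (intro order_tendstoD(2)) auto
  then obtain n where "(\<integral>x. (f x - g n x)\<^sup>2 \<partial>lborel) < d"
    by (auto simp: eventually_sequentially)
  then show ?thesis using that[of "g n"] gc gB g0 by blast
qed

lemma sqi_truncation:
  fixes f :: "'a::euclidean_space \<Rightarrow> real"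
  assumes f: "sqi f" and d: "0 < d"
  obtains n :: nat where "(\<integral>x. (f x - (if norm x \<le> real n then min (real n) (max (- real n) (f x)) else 0))\<^sup>2 \<partial>lborel) < d"
proof -
  define g where "g n x = (if norm x \<le> real n then min (real n) (max (- real n) (f x)) else 0)" for n x
  have [measurable]: "f \<in> borel_measurable borel" using f by (simp add: sqi_def)
  have gm [measurable]: "g n \<in> borel_measurable borel" for n
    unfolding g_def by measurable
  have "(\<lambda>n. \<integral>x. (f x - g n x)\<^sup>2 \<partial>lborel) \<longlonglongrightarrow> (\<integral>x. 0 \<partial>(lborel :: 'a measure))"
  proof (rule integral_dominated_convergence[where w = "\<lambda>x. (f x)\<^sup>2"])
    show "integrable lborel (\<lambda>x. (f x)\<^sup>2)" using f by (simp add: sqi_def)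
    show "AE x in lborel. norm ((f x - g n x)\<^sup>2) \<le> (f x)\<^sup>2" for n
    proof (rule AE_I2)
      fix x
      have "\<bar>f x - g n x\<bar> \<le> \<bar>f x\<bar>" by (auto simp: g_def min_def max_def)
      then have "\<bar>f x - g n x\<bar>\<^sup>2 \<le> \<bar>f x\<bar>\<^sup>2" by (intro power_mono) auto
      then show "norm ((f x - g n x)\<^sup>2) \<le> (f x)\<^sup>2" by simp
    qed
    show "AE x in lborel. (\<lambda>n. (f x - g n x)\<^sup>2) \<longlonglongrightarrow> 0"
    proof (rule AE_I2)
      fix x
      obtain m where m: "max (norm x) \<bar>f x\<bar> \<le> real m" using real_arch_simple by blast
      have "\<forall>\<^sub>F n in sequentially. 0 = (f x - g n x)\<^sup>2"
        using eventually_ge_at_top[of m]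
      proof eventually_elim
        case (elim n)
        then have "real m \<le> real n" by simp
        then have "norm x \<le> real n" "\<bar>f x\<bar> \<le> real n" using m by linarith+
        then show ?case by (auto simp: g_def min_def max_def)
      qed
      then show "(\<lambda>n. (f x - g n x)\<^sup>2) \<longlonglongrightarrow> 0"
        by (rule Lim_transform_eventually[OF tendsto_const])
    qed
  qed measurable
  then have "\<forall>\<^sub>F n in sequentially. (\<integral>x. (f x - g n x)\<^sup>2 \<partial>lborel) < d"
    using d by (intro order_tendstoD(2)) auto
  then obtain n where "(\<integral>x. (f x - g n x)\<^sup>2 \<partial>lborel) < d"
    by (auto simp: eventually_sequentially)
  then show ?thesis using that unfolding g_def by blast
qed

lemma sqi_approx:
  fixes f :: "'a::euclidean_space \<Rightarrow> real"
  assumes f: "sqi f" and d: "0 < d"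
  obtains g B R where "continuous_on UNIV g" "\<And>x. \<bar>g x\<bar> \<le> B" "\<And>x. R < norm x \<Longrightarrow> g x = 0"
    "sqi g" "(\<integral>x. (f x - g x)\<^sup>2 \<partial>lborel) < d"
proof -
  obtain n where n: "(\<integral>x. (f x - (if norm x \<le> real n then min (real n) (max (- real n) (f x)) else 0))\<^sup>2 \<partial>lborel) < d / 4"
    using sqi_truncation[OF f, of "d / 4"] d by auto
  define h where "h x = (if norm x \<le> real n then min (real n) (max (- real n) (f x)) else 0)" for x
  have [measurable]: "f \<in> borel_measurable borel" using f by (simp add: sqi_def)
  have hm: "h \<in> borel_measurable borel" unfolding h_def by measurable
  have hB: "\<bar>h x\<bar> \<le> real n" "real n < norm x \<Longrightarrow> h x = 0" for x by (auto simp: h_def min_def max_def)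
  obtain g where g: "continuous_on UNIV g" "\<And>x. \<bar>g x\<bar> \<le> real n" "\<And>x. real n + 1 < norm x \<Longrightarrow> g x = 0"
    "(\<integral>x. (h x - g x)\<^sup>2 \<partial>lborel) < d / 4"
    using bounded_support_approx[where R = "real n" and d = "d / 4", OF hm hB(1) hB(2)] d by auto
  have sh: "sqi h" by (rule bounded_support_sqi[OF hm hB(1) hB(2)])
  have sg: "sqi g"
    by (rule bounded_support_sqi[OF borel_measurable_continuous_onI[OF g(1)] g(2,3)])
  have "(\<integral>x. (f x - g x)\<^sup>2 \<partial>lborel) \<le> (\<integral>x. 2 * (f x - h x)\<^sup>2 + 2 * (h x - g x)\<^sup>2 \<partial>lborel)"
  proof (rule integral_mono)
    show "integrable lborel (\<lambda>x. (f x - g x)\<^sup>2)" by (intro sqi_integrable sqi_diff f sg)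
    show "integrable lborel (\<lambda>x. 2 * (f x - h x)\<^sup>2 + 2 * (h x - g x)\<^sup>2)"
      by (intro Bochner_Integration.integrable_add integrable_mult_right sqi_integrable sqi_diff f sh sg)
    fix x
    have "0 \<le> ((f x - h x) - (h x - g x))\<^sup>2" by simp
    then show "(f x - g x)\<^sup>2 \<le> 2 * (f x - h x)\<^sup>2 + 2 * (h x - g x)\<^sup>2"
      by (simp add: power2_eq_square algebra_simps)
  qed
  also have "\<dots> = 2 * (\<integral>x. (f x - h x)\<^sup>2 \<partial>lborel) + 2 * (\<integral>x. (h x - g x)\<^sup>2 \<partial>lborel)"
    by (subst Bochner_Integration.integral_add) (auto intro!: sqi_integrable sqi_diff f sh sg)
  also have "\<dots> < d"
    using n g(4) d unfolding h_def[symmetric] by linarith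
  finally show ?thesis using that[of g "real n" "real n + 1"] g sg by blast
qed

text \<open>The inequality of Cauchy and Schwarz, in the form \<open>p e \<le> k p\<^sup>2 + e\<^sup>2 / k\<close> whose free
  parameter \<open>k\<close> avoids square roots.\<close>

lemma sqi_mult_small:
  assumes p: "sqi p" and e: "sqi e" and k: "0 < k"
  shows "\<bar>\<integral>x. p x * e x \<partial>lborel\<bar> \<le> k * (\<integral>x. (p x)\<^sup>2 \<partial>lborel) + (\<integral>x. (e x)\<^sup>2 \<partial>lborel) / k"
proof -
  have "\<bar>\<integral>x. p x * e x \<partial>lborel\<bar> \<le> (\<integral>x. \<bar>p x * e x\<bar> \<partial>lborel)"
    using integral_norm_bound[of lborel "\<lambda>x. p x * e x"] by simp
  also have "\<dots> \<le> (\<integral>x. k * (p x)\<^sup>2 + (e x)\<^sup>2 / k \<partial>lborel)"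
  proof (rule integral_mono)
    show "integrable lborel (\<lambda>x. \<bar>p x * e x\<bar>)"
      by (intro integrable_abs sqi_mult_integrable p e)
    show "integrable lborel (\<lambda>x. k * (p x)\<^sup>2 + (e x)\<^sup>2 / k)"
      by (intro Bochner_Integration.integrable_add integrable_mult_right integrable_divide sqi_integrable p e)
    fix x
    have "2 * \<bar>(k * p x) * e x\<bar> \<le> (k * p x)\<^sup>2 + (e x)\<^sup>2" by (rule two_abs_mult_le)
    then have "k * (2 * \<bar>p x * e x\<bar>) \<le> k * (k * (p x)\<^sup>2 + (e x)\<^sup>2 / k)"
      using k by (simp add: abs_mult power2_eq_square algebra_simps)
    then have "2 * \<bar>p x * e x\<bar> \<le> k * (p x)\<^sup>2 + (e x)\<^sup>2 / k" using k by simp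
    then show "\<bar>p x * e x\<bar> \<le> k * (p x)\<^sup>2 + (e x)\<^sup>2 / k" by linarith
  qed
  also have "\<dots> = k * (\<integral>x. (p x)\<^sup>2 \<partial>lborel) + (\<integral>x. (e x)\<^sup>2 \<partial>lborel) / k"
    by (subst Bochner_Integration.integral_add) (auto intro!: sqi_integrable p e)
  finally show ?thesis .
qed

definition correl :: "('a::euclidean_space \<Rightarrow> real) \<Rightarrow> ('a \<Rightarrow> real) \<Rightarrow> 'a \<Rightarrow> real" where
  "correl p f z = (\<integral>x. p x * f (x - z) \<partial>lborel)"

lemma correl_continuous_support:
  fixes g :: "'a::euclidean_space \<Rightarrow> real"
  assumes p: "sqi p" and g: "continuous_on UNIV g" "\<And>x. \<bar>g x\<bar> \<le> B" "\<And>x. R < norm x \<Longrightarrow> g x = 0"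
    and z: "z \<longlonglongrightarrow> 0"
  shows "(\<lambda>n. correl p g (z n)) \<longlonglongrightarrow> correl p g 0"
proof -
  obtain Z where Z: "\<And>n. norm (z n) \<le> Z"
    using convergent_imp_Bseq[of z] z by (auto simp: convergent_def Bseq_def)
  have [measurable]: "p \<in> borel_measurable borel" using p by (simp add: sqi_def)
  have [measurable]: "g \<in> borel_measurable borel" by (rule borel_measurable_continuous_onI[OF g(1)])
  have B: "0 \<le> B" using g(2)[of 0] by linarith
  have "(\<lambda>n. \<integral>x. p x * g (x - z n) \<partial>lborel) \<longlonglongrightarrow> (\<integral>x. p x * g (x - 0) \<partial>lborel)"
  proof (rule integral_dominated_convergence[where w = "\<lambda>x. \<bar>p x * (B * indicator (cball 0 (R + Z)) x)\<bar>"])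
    have "sqi (\<lambda>x. B * indicator (cball 0 (R + Z)) x)"
      using B by (intro bounded_support_sqi[of _ B "R + Z"]) (auto simp: indicator_def)
    then show "integrable lborel (\<lambda>x. \<bar>p x * (B * indicator (cball 0 (R + Z)) x)\<bar>)"
      by (intro integrable_abs sqi_mult_integrable p)
    show "AE x in lborel. norm (p x * g (x - z n)) \<le> \<bar>p x * (B * indicator (cball 0 (R + Z)) x)\<bar>" for n
    proof (rule AE_I2)
      fix x
      have "\<bar>g (x - z n)\<bar> \<le> B * indicator (cball 0 (R + Z)) x"
      proof (cases "norm x \<le> R + Z")
        case True
        then show ?thesis using g(2)[of "x - z n"] by simp
      next
        case False
        then have "R < norm (x - z n)"
          using norm_triangle_ineq2[of x "z n"] Z[of n] by linarith
        then show ?thesis using False g(3) by simp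
      qed
      then show "norm (p x * g (x - z n)) \<le> \<bar>p x * (B * indicator (cball 0 (R + Z)) x)\<bar>"
        using B by (simp add: abs_mult mult_left_mono)
    qed
    have "isCont g x" for x using g(1) by (simp add: continuous_on_eq_continuous_at)
    then show "AE x in lborel. (\<lambda>n. p x * g (x - z n)) \<longlonglongrightarrow> p x * g (x - 0)"
      by (intro AE_I2 tendsto_mult tendsto_const isCont_tendsto_compose[of _ g] tendsto_diff z)
  qed measurable
  then show ?thesis by (simp add: correl_def)
qed

text \<open>This is continuity of translations in \<open>L\<^sup>2\<close>, tested against \<open>p\<close>: replacing \<open>f\<close> by a
  continuous function with bounded support changes all the correlations uniformly little,
  because the integral is invariant under translations.\<close>

lemma correl_isCont_0:
  fixes f :: "'a::euclidean_space \<Rightarrow> real"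
  assumes p: "sqi p" and f: "sqi f"
  shows "isCont (correl p f) 0"
  unfolding continuous_at_sequentially
proof (intro allI impI, unfold o_def, rule LIMSEQ_I)
  fix z :: "nat \<Rightarrow> 'a" and e :: real
  assume z: "z \<longlonglongrightarrow> 0" and e: "0 < e"
  define P where "P = (\<integral>x. (p x)\<^sup>2 \<partial>lborel)"
  have P: "0 \<le> P" by (simp add: P_def)
  \<comment> \<open>\<open>k\<close> makes the first term of \<open>sqi_mult_small\<close> at most \<open>e / 6\<close>; the approximation \<open>g\<close> does
    the same for the second.\<close>
  define k where "k = e / (6 * (P + 1))"
  have k: "0 < k" "k * P \<le> e / 6"
    using e P by (auto simp: k_def field_simps)
  have "0 < k * (e / 6)" using k e by simp
  then obtain g B R where g: "continuous_on UNIV g" "\<And>x. \<bar>g x\<bar> \<le> B" "\<And>x. R < norm x \<Longrightarrow> g x = 0"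
    "sqi g" "(\<integral>x. (f x - g x)\<^sup>2 \<partial>lborel) < k * (e / 6)"
    by (rule sqi_approx[OF f]) blast
  have close: "\<bar>correl p f w - correl p g w\<bar> \<le> e / 3" for w
  proof -
    have s: "sqi (\<lambda>x. f (x - w))" "sqi (\<lambda>x. g (x - w))" by (intro sqi_translate f g)+
    have "correl p f w - correl p g w = (\<integral>x. p x * (f (x - w) - g (x - w)) \<partial>lborel)"
      unfolding correl_def right_diff_distrib
      by (rule Bochner_Integration.integral_diff[symmetric]) (intro sqi_mult_integrable p s)+
    also have "\<bar>\<dots>\<bar> \<le> k * P + (\<integral>x. (f (x - w) - g (x - w))\<^sup>2 \<partial>lborel) / k"
      unfolding P_def by (intro sqi_mult_small p sqi_diff s k)
    also have "(\<integral>x. (f (x - w) - g (x - w))\<^sup>2 \<partial>lborel) = (\<integral>x. (f x - g x)\<^sup>2 \<partial>lborel)"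
      using f g(4) by (intro lborel_translate(1)[of "\<lambda>x. (f x - g x)\<^sup>2"]) (auto simp: sqi_def)
    also have "k * P + \<dots> / k \<le> e / 6 + e / 6"
      using k g(5) by (intro add_mono) (auto simp: divide_le_eq mult.commute)
    finally show ?thesis by simp
  qed
  have "(\<lambda>n. correl p g (z n)) \<longlonglongrightarrow> correl p g 0"
    by (rule correl_continuous_support[OF p g(1-3) z])
  then obtain N where N: "\<And>n. N \<le> n \<Longrightarrow> norm (correl p g (z n) - correl p g 0) < e / 3"
    using LIMSEQ_D[of "\<lambda>n. correl p g (z n)" _ "e / 3"] e by auto
  have "norm (correl p f (z n) - correl p f 0) < e" if "N \<le> n" for n
    using N[OF that] close[of "z n"] close[of 0] unfolding real_norm_def by linarith
  then show "\<exists>N. \<forall>n\<ge>N. norm (correl p f (z n) - correl p f 0) < e" by blast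
qed

lemma bump_measurable [measurable]: "bump e \<in> borel_measurable borel"
  using Ck_continuous[OF Ck_bump[of 0 e 0]] by (intro borel_measurable_continuous_onI) simp

lemma sqi_bump: "sqi (bump e)"
proof (rule bounded_support_sqi[of _ 1 "\<bar>e\<bar>"])
  show "\<bar>bump e x\<bar> \<le> 1" for x :: "real^'n" using bump_range[of e x] by simp
  show "bump e x = 0" if "\<bar>e\<bar> < norm x" for x :: "real^'n"
    using power_strict_mono[OF that, of 2] by (simp add: bump_def flat_exp_def)
qed measurable

lemma integrable_bump: "integrable lborel (bump e)"
proof -
  have "sqi (indicator (cball 0 \<bar>e\<bar>) :: real^'n \<Rightarrow> real)"
  proof (rule bounded_support_sqi[of _ 1 "\<bar>e\<bar>"])
    show "indicator (cball 0 \<bar>e\<bar>) \<in> borel_measurable (borel :: (real^'n) measure)"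
      by (rule borel_measurable_indicator) simp
  qed (auto simp: indicator_def)
  from sqi_mult_integrable[OF sqi_bump[of e] this]
  have "integrable lborel (\<lambda>x::real^'n. bump e x * indicator (cball 0 \<bar>e\<bar>) x)" .
  moreover have "(\<lambda>x::real^'n. bump e x * indicator (cball 0 \<bar>e\<bar>) x) = bump e"
  proof
    fix x :: "real^'n"
    show "bump e x * indicator (cball 0 \<bar>e\<bar>) x = bump e x"
    proof (cases "norm x \<le> \<bar>e\<bar>")
      case False
      then have "\<bar>e\<bar> < norm x" by simp
      from power_strict_mono[OF this, of 2] show ?thesis by (simp add: bump_def flat_exp_def)
    qed simp
  qed
  ultimately show ?thesis by (rule back_subst[of "integrable lborel"])
qed

lemma integral_bump_pos: "0 < e \<Longrightarrow> 0 < (\<integral>x. bump e (x::real^'n) \<partial>lborel)"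
proof (rule ccontr)
  assume e: "0 < e" and "\<not> 0 < (\<integral>x. bump e (x::real^'n) \<partial>lborel)"
  moreover have "0 \<le> (\<integral>x. bump e (x::real^'n) \<partial>lborel)"
    by (intro integral_nonneg_AE) (simp add: bump_range)
  ultimately have "(\<integral>x. bump e (x::real^'n) \<partial>lborel) = 0" by linarith
  then have "AE x in lborel. bump e (x :: real^'n) = 0"
    using integrable_bump[of e] by (subst (asm) integral_nonneg_eq_0_iff_AE) (auto simp: bump_range)
  then have "AE x in lebesgue. x \<notin> ball (0 :: real^'n) e"
    unfolding AE_completion_iff by eventually_elim (use bump_pos_iff[OF e] in force)
  then have "ball (0 :: real^'n) e \<in> null_sets lebesgue"
    by (subst (asm) AE_iff_null_sets[symmetric]) auto
  then show False
    using open_not_negligible[of "ball (0 :: real^'n) e"] e by (simp add: negligible_iff_null_sets)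
qed

text \<open>The bumps concentrate at \<open>0\<close> when \<open>e\<close> tends to \<open>0\<close>. If \<open>C 0\<close> were not zero, \<open>C\<close> would
  have one sign on a small ball, where the bump is positive. Identities that hold for all
  mollified pairings thus hold for the pairings themselves.\<close>

lemma bump_concentration:
  fixes C :: "real^'n \<Rightarrow> real"
  assumes cont: "isCont C 0" and int: "\<And>e. integrable lborel (\<lambda>z. bump e z * C z)"
    and e0: "0 < e0" and zero: "\<And>e. 0 < e \<Longrightarrow> e < e0 \<Longrightarrow> (\<integral>z. bump e z * C z \<partial>lborel) = 0"
  shows "C 0 = 0"
proof (rule ccontr)
  assume "C 0 \<noteq> 0"
  define c where "c = C 0"
  have c: "0 < c\<^sup>2" using \<open>C 0 \<noteq> 0\<close> by (simp add: c_def)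
  have "((\<lambda>z. c * C z) \<longlongrightarrow> c * c) (at 0)"
    using cont unfolding isCont_def c_def by (intro tendsto_intros)
  then have "\<forall>\<^sub>F z in at 0. c\<^sup>2 / 2 < c * C z"
    using c by (intro order_tendstoD) (auto simp: power2_eq_square)
  then obtain d where d: "0 < d" "\<And>z. z \<noteq> 0 \<Longrightarrow> dist z 0 < d \<Longrightarrow> c\<^sup>2 / 2 < c * C z"
    by (auto simp: eventually_at)
  have near: "c\<^sup>2 / 2 \<le> c * C z" if "norm z < d" for z
    using d(2)[of z] that c by (cases "z = 0") (auto simp: c_def power2_eq_square)
  \<comment> \<open>so small that the support of the bump lies where \<open>C\<close> has the sign of \<open>C 0\<close>\<close>
  define e where "e = min d e0 / 2"
  have e: "0 < e" "e < e0" "e < d" using d e0 by (auto simp: e_def)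
  have "(\<integral>z. bump e (z::real^'n) * (c\<^sup>2 / 2) \<partial>lborel) \<le> (\<integral>z. c * (bump e z * C z) \<partial>lborel)"
  proof (rule integral_mono)
    show "integrable lborel (\<lambda>z::real^'n. bump e z * (c\<^sup>2 / 2))"
      by (intro integrable_mult_left integrable_bump)
    show "integrable lborel (\<lambda>z. c * (bump e z * C z))" by (intro integrable_mult_right int)
    fix z :: "real^'n"
    show "bump e z * (c\<^sup>2 / 2) \<le> c * (bump e z * C z)"
    proof (cases "norm z < e")
      case True
      then have "bump e z * (c\<^sup>2 / 2) \<le> bump e z * (c * C z)"
        using near[of z] e bump_range by (intro mult_left_mono) auto
      then show ?thesis by (simp add: mult_ac)
    next
      case False
      then have "bump e z = 0" using bump_pos_iff[OF e(1), of z] bump_range(1)[of e z] by linarith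
      then show ?thesis by simp
    qed
  qed
  also have "\<dots> = 0" using zero[OF e(1,2)] by simp
  finally have "(\<integral>z. bump e (z::real^'n) \<partial>lborel) * (c\<^sup>2 / 2) \<le> 0" by simp
  then show False
    using mult_pos_pos[OF integral_bump_pos[OF e(1), where 'n = 'n] c] by simp
qed

lemma correl_pair_integrable:
  fixes p f :: "real^'n \<Rightarrow> real"
  assumes p: "sqi p" and f: "sqi f"
  shows "integrable (lborel \<Otimes>\<^sub>M lborel) (\<lambda>(z, x). bump e z * (p x * f (x + z)))"
proof (rule lborel_pair.Fubini_integrable)
  have [measurable]: "p \<in> borel_measurable borel" "f \<in> borel_measurable borel"
    using p f by (simp_all add: sqi_def)
  show "(\<lambda>(z, x). bump e z * (p x * f (x + z))) \<in> borel_measurable (lborel \<Otimes>\<^sub>M lborel)"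
    by measurable
  have s: "sqi (\<lambda>x. f (x + z))" for z using sqi_translate[OF f, of "- z"] by simp
  have i: "integrable lborel (\<lambda>x. p x * f (x + z))" for z by (intro sqi_mult_integrable p s)
  then show "AE z in lborel. integrable lborel (\<lambda>x. case (z, x) of (z, x) \<Rightarrow> bump e z * (p x * f (x + z)))"
    by simp
  define K where "K = (\<integral>x. (p x)\<^sup>2 \<partial>lborel) + (\<integral>x. (f x)\<^sup>2 \<partial>lborel)"
  show "integrable lborel (\<lambda>z. \<integral>x. norm (case (z, x) of (z, x) \<Rightarrow> bump e z * (p x * f (x + z))) \<partial>lborel)"
  proof (rule Bochner_Integration.integrable_bound)
    show "integrable lborel (\<lambda>z::real^'n. bump e z * K)" by (intro integrable_mult_left integrable_bump)
    show "(\<lambda>z. \<integral>x. norm (case (z, x) of (z, x) \<Rightarrow> bump e z * (p x * f (x + z))) \<partial>lborel) \<in> borel_measurable lborel"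
      by measurable
    have "(\<integral>x. \<bar>p x * f (x + z)\<bar> \<partial>lborel) \<le> K" for z
    proof -
      have "(\<integral>x. \<bar>p x * f (x + z)\<bar> \<partial>lborel) \<le> (\<integral>x. (p x)\<^sup>2 + (f (x + z))\<^sup>2 \<partial>lborel)"
      proof (rule integral_mono)
        show "integrable lborel (\<lambda>x. \<bar>p x * f (x + z)\<bar>)" using i by (rule integrable_abs)
        show "integrable lborel (\<lambda>x. (p x)\<^sup>2 + (f (x + z))\<^sup>2)"
          by (intro Bochner_Integration.integrable_add sqi_integrable p s)
        show "\<bar>p x * f (x + z)\<bar> \<le> (p x)\<^sup>2 + (f (x + z))\<^sup>2" for x
          using two_abs_mult_le[of "p x" "f (x + z)"] by linarith
      qed
      also have "\<dots> = (\<integral>x. (p x)\<^sup>2 \<partial>lborel) + (\<integral>x. (f (x + z))\<^sup>2 \<partial>lborel)"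
        by (rule Bochner_Integration.integral_add) (intro sqi_integrable p s)+
      also have "(\<integral>x. (f (x + z))\<^sup>2 \<partial>lborel) = (\<integral>x. (f x)\<^sup>2 \<partial>lborel)"
        using lborel_translate(1)[of "\<lambda>x. (f x)\<^sup>2" "- z"] by simp
      finally show ?thesis by (simp add: K_def)
    qed
    note K = this
    have K0: "0 \<le> K" by (simp add: K_def)
    show "AE z in lborel. norm (\<integral>x. norm (case (z, x) of (z, x) \<Rightarrow> bump e z * (p x * f (x + z))) \<partial>lborel) \<le> norm (bump e z * K)"
    proof (rule AE_I2)
      fix z
      have "(\<integral>x. norm (bump e z * (p x * f (x + z))) \<partial>lborel) = bump e z * (\<integral>x. \<bar>p x * f (x + z)\<bar> \<partial>lborel)"
        using bump_range(1)[of e z] by (simp add: abs_mult)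
      also have "\<dots> \<le> bump e z * K" by (intro mult_left_mono K bump_range)
      finally show "norm (\<integral>x. norm (case (z, x) of (z, x) \<Rightarrow> bump e z * (p x * f (x + z))) \<partial>lborel) \<le> norm (bump e z * K)"
        using bump_range(1)[of e z] K0 by (simp add: integral_nonneg_AE abs_of_nonneg)
    qed
  qed
qed

text \<open>Substituting \<open>y = x + z\<close> makes the mollified pairing an average of correlations over the
  shift \<open>z\<close>, to which \<open>bump_concentration\<close> applies.\<close>

lemma mollified_pairing:
  fixes p f :: "real^'n \<Rightarrow> real"
  assumes p: "sqi p" and f: "sqi f"
  shows "(\<integral>x. (\<integral>y. bump e (x - y) * (p x * f y) \<partial>lborel) \<partial>lborel) = (\<integral>z. bump e z * correl p f (- z) \<partial>lborel)"
    and "integrable lborel (\<lambda>z. bump e z * correl p f (- z))"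
proof -
  have [measurable]: "p \<in> borel_measurable borel" "f \<in> borel_measurable borel"
    using p f by (simp_all add: sqi_def)
  have c: "bump e z * correl p f (- z) = (\<integral>x. bump e z * (p x * f (x + z)) \<partial>lborel)" for z
    by (simp add: correl_def)
  have "(\<integral>y. bump e (x - y) * (p x * f y) \<partial>lborel) = (\<integral>z. bump e z * (p x * f (x + z)) \<partial>lborel)" for x
  proof -
    have "(\<integral>y. bump e (y - x) * (p x * f (x + (y - x))) \<partial>lborel) = (\<integral>z. bump e z * (p x * f (x + z)) \<partial>lborel)"
      by (rule lborel_translate(1)) measurable
    then show ?thesis by (simp add: bump_commute[of e x])
  qed
  then have "(\<integral>x. (\<integral>y. bump e (x - y) * (p x * f y) \<partial>lborel) \<partial>lborel) =
      (\<integral>x. (\<integral>z. bump e z * (p x * f (x + z)) \<partial>lborel) \<partial>lborel)" by simp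
  also have "\<dots> = (\<integral>z. (\<integral>x. bump e z * (p x * f (x + z)) \<partial>lborel) \<partial>lborel)"
    by (rule lborel_pair.Fubini_integral[OF correl_pair_integrable[OF p f]])
  finally show "(\<integral>x. (\<integral>y. bump e (x - y) * (p x * f y) \<partial>lborel) \<partial>lborel) = (\<integral>z. bump e z * correl p f (- z) \<partial>lborel)"
    by (simp only: c)
  show "integrable lborel (\<lambda>z. bump e z * correl p f (- z))"
    using lborel_pair.integrable_fst[OF correl_pair_integrable[OF p f, of e]] by (simp only: c)
qed

lemma correl_reflect_isCont: "sqi p \<Longrightarrow> sqi f \<Longrightarrow> isCont (\<lambda>z. correl p f (- z)) 0"
  using isCont_o2[of 0 uminus "correl p f"] correl_isCont_0[of p f] by (simp add: continuous_intros)

text \<open>The integrability that Fubini's theorem requires in the product rule below\<close>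

lemma kernel_pair_integrable:
  fixes k :: "real^'n \<Rightarrow> real"
  assumes k: "continuous_on UNIV k" "\<And>z. \<bar>k z\<bar> \<le> C" and p: "integrable lborel p" and f: "integrable lborel f"
  shows "integrable (lborel \<Otimes>\<^sub>M lborel) (\<lambda>(x, y). k (x - y) * (p x * f y))"
proof (rule lborel_pair.Fubini_integrable)
  have [measurable]: "p \<in> borel_measurable borel" "f \<in> borel_measurable borel" "k \<in> borel_measurable borel"
    using p f borel_measurable_continuous_onI[OF k(1)] by auto
  have C: "0 \<le> C" using k(2)[of 0] by linarith
  show "(\<lambda>(x, y). k (x - y) * (p x * f y)) \<in> borel_measurable (lborel \<Otimes>\<^sub>M lborel)"
    by measurable
  have i: "integrable lborel (\<lambda>y. k (x - y) * (p x * f y))" for x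
  proof (rule Bochner_Integration.integrable_bound)
    show "integrable lborel (\<lambda>y. C * (\<bar>p x\<bar> * f y))" by (intro integrable_mult_right f)
    show "AE y in lborel. norm (k (x - y) * (p x * f y)) \<le> norm (C * (\<bar>p x\<bar> * f y))"
      using k(2) C by (intro AE_I2) (simp add: abs_mult mult_right_mono)
  qed measurable
  then show "AE x in lborel. integrable lborel (\<lambda>y. case (x, y) of (x, y) \<Rightarrow> k (x - y) * (p x * f y))"
    by simp
  define K where "K = (\<integral>y. \<bar>f y\<bar> \<partial>lborel)"
  have K0: "0 \<le> K" by (simp add: K_def)
  show "integrable lborel (\<lambda>x. \<integral>y. norm (case (x, y) of (x, y) \<Rightarrow> k (x - y) * (p x * f y)) \<partial>lborel)"
  proof (rule Bochner_Integration.integrable_bound)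
    show "integrable lborel (\<lambda>x. C * K * p x)" by (intro integrable_mult_right p)
    show "(\<lambda>x. \<integral>y. norm (case (x, y) of (x, y) \<Rightarrow> k (x - y) * (p x * f y)) \<partial>lborel) \<in> borel_measurable lborel"
      by measurable
    show "AE x in lborel. norm (\<integral>y. norm (case (x, y) of (x, y) \<Rightarrow> k (x - y) * (p x * f y)) \<partial>lborel) \<le> norm (C * K * p x)"
    proof (rule AE_I2)
      fix x
      have "(\<integral>y. norm (k (x - y) * (p x * f y)) \<partial>lborel) \<le> (\<integral>y. C * \<bar>p x\<bar> * \<bar>f y\<bar> \<partial>lborel)"
      proof (rule integral_mono)
        show "integrable lborel (\<lambda>y. norm (k (x - y) * (p x * f y)))" using i by (rule integrable_norm)
        show "integrable lborel (\<lambda>y. C * \<bar>p x\<bar> * \<bar>f y\<bar>)" by (intro integrable_mult_right integrable_abs f)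
        show "norm (k (x - y) * (p x * f y)) \<le> C * \<bar>p x\<bar> * \<bar>f y\<bar>" for y
          using mult_right_mono[OF k(2)[of "x - y"], of "\<bar>p x * f y\<bar>"] by (simp add: abs_mult mult_ac)
      qed
      also have "\<dots> = norm (C * K * p x)" using C K0 by (simp add: K_def abs_mult)
      finally show "norm (\<integral>y. norm (case (x, y) of (x, y) \<Rightarrow> k (x - y) * (p x * f y)) \<partial>lborel) \<le> norm (C * K * p x)"
        by (simp add: integral_nonneg_AE abs_of_nonneg)
    qed
  qed
qed


section \<open>Uniqueness of weak derivatives\<close>

definition sqi_on :: "'a::euclidean_space set \<Rightarrow> ('a \<Rightarrow> real) \<Rightarrow> bool" where
  "sqi_on \<Omega> f \<longleftrightarrow> f \<in> borel_measurable (lebesgue_on \<Omega>) \<and> integrable (lebesgue_on \<Omega>) (\<lambda>x. (f x)\<^sup>2)"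

text \<open>A Borel function on the whole space that represents \<open>f\<close> on \<open>\<Omega>\<close> and vanishes outside. It
  translates set integrals for the Lebesgue measure into integrals for \<open>lborel\<close>.\<close>

definition borel_version :: "'a::euclidean_space set \<Rightarrow> ('a \<Rightarrow> real) \<Rightarrow> ('a \<Rightarrow> real) \<Rightarrow> bool" where
  "borel_version \<Omega> f g \<longleftrightarrow> sqi g \<and> (\<forall>x. x \<notin> \<Omega> \<longrightarrow> g x = 0) \<and>
     (AE x in lebesgue. g x = (if x \<in> \<Omega> then f x else 0))"

lemma sqi_mult_bounded:
  assumes a: "a \<in> borel_measurable borel" "\<And>x. \<bar>a x\<bar> \<le> C" and f: "sqi f"
  shows "sqi (\<lambda>x. a x * f x)"
proof -
  have [measurable]: "f \<in> borel_measurable borel" "a \<in> borel_measurable borel" using f a by (simp_all add: sqi_def)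
  have "integrable lborel (\<lambda>x. (a x * f x)\<^sup>2)"
  proof (rule Bochner_Integration.integrable_bound)
    show "integrable lborel (\<lambda>x. C\<^sup>2 * (f x)\<^sup>2)" by (intro integrable_mult_right sqi_integrable f)
    have "(a x * f x)\<^sup>2 \<le> C\<^sup>2 * (f x)\<^sup>2" for x
      using power_mono[OF a(2)[of x], of 2] by (simp add: power_mult_distrib mult_right_mono)
    then show "AE x in lborel. norm ((a x * f x)\<^sup>2) \<le> norm (C\<^sup>2 * (f x)\<^sup>2)"
      by (intro AE_I2) simp
  qed measurable
  then show ?thesis by (simp add: sqi_def)
qed

lemma borel_version_exists:
  assumes \<Omega>: "open \<Omega>" and f: "sqi_on \<Omega> f"
  obtains g where "borel_version \<Omega> f g"
proof -
  define h where "h x = (if x \<in> \<Omega> then f x else 0)" for x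
  have L: "\<Omega> \<in> sets lebesgue" using \<Omega> by auto
  have h: "h \<in> borel_measurable lebesgue"
    unfolding h_def using f L by (intro borel_measurable_if_I) (auto simp: sqi_on_def)
  obtain g0 where g0: "g0 \<in> borel_measurable lborel" "AE x in lborel. h x = g0 x"
    using completion_ex_borel_measurable_real[OF h] by auto
  define g where "g x = indicator \<Omega> x * g0 x" for x
  have gm: "g \<in> borel_measurable borel"
    unfolding g_def using \<Omega> g0(1) by (intro borel_measurable_times borel_measurable_indicator) auto
  have ae: "AE x in lebesgue. g x = h x"
    using g0(2) unfolding AE_completion_iff by eventually_elim (auto simp: g_def h_def indicator_def)
  have "integrable lebesgue (\<lambda>x. indicator \<Omega> x *\<^sub>R (f x)\<^sup>2)"
    using f L by (subst integrable_restrict_space[symmetric]) (auto simp: sqi_on_def)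
  then have "integrable lebesgue (\<lambda>x. (h x)\<^sup>2)"
    by (rule back_subst[of "integrable lebesgue"]) (simp add: h_def fun_eq_iff indicator_def)
  then have "integrable lebesgue (\<lambda>x. (g x)\<^sup>2)"
  proof (rule integrable_cong_AE_imp)
    show "(\<lambda>x. (g x)\<^sup>2) \<in> borel_measurable lebesgue"
      using gm by (intro measurable_completion) simp
    show "AE x in lebesgue. (h x)\<^sup>2 = (g x)\<^sup>2" using ae by eventually_elim simp
  qed
  then have "integrable lborel (\<lambda>x. (g x)\<^sup>2)"
    using gm by (subst (asm) integrable_completion) simp_all
  then have "borel_version \<Omega> f g"
    using gm ae by (simp add: borel_version_def sqi_def h_def g_def)
  then show ?thesis by (rule that)
qed

lemma set_integral_lborel:
  fixes p h k :: "'a::euclidean_space \<Rightarrow> real"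
  assumes \<Omega>: "open \<Omega>" and p: "p \<in> borel_measurable borel" and h: "h \<in> borel_measurable (lebesgue_on \<Omega>)"
    and k: "k \<in> borel_measurable borel" and hk: "AE x in lebesgue. k x = (if x \<in> \<Omega> then h x else 0)"
  shows "(LINT x:\<Omega>|lebesgue. p x * h x) = (\<integral>x. p x * k x \<partial>lborel)"
proof -
  have L: "\<Omega> \<in> sets lebesgue" using \<Omega> by auto
  have hm: "(\<lambda>x. if x \<in> \<Omega> then h x else 0) \<in> borel_measurable lebesgue"
    using h L by (intro borel_measurable_if_I) auto
  have pl: "p \<in> borel_measurable lebesgue" "k \<in> borel_measurable lebesgue"
    using p k by (auto intro!: measurable_completion)
  have "(LINT x:\<Omega>|lebesgue. p x * h x) = (\<integral>x. p x * (if x \<in> \<Omega> then h x else 0) \<partial>lebesgue)"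
    unfolding set_lebesgue_integral_def
    by (intro Bochner_Integration.integral_cong) (auto simp: indicator_def)
  also have "\<dots> = (\<integral>x. p x * k x \<partial>lebesgue)"
  proof (rule integral_cong_AE)
    show "AE x in lebesgue. p x * (if x \<in> \<Omega> then h x else 0) = p x * k x"
      using hk by eventually_elim simp
    show "(\<lambda>x. p x * (if x \<in> \<Omega> then h x else 0)) \<in> borel_measurable lebesgue"
      by (intro borel_measurable_times pl hm)
    show "(\<lambda>x. p x * k x) \<in> borel_measurable lebesgue"
      by (intro borel_measurable_times pl)
  qed
  also have "\<dots> = (\<integral>x. p x * k x \<partial>lborel)"
  proof (rule integral_completion)
    show "(\<lambda>x. p x * k x) \<in> borel_measurable lborel" using p k by simp
  qed
  finally show ?thesis .
qed

lemma set_integral_borel_version: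
  assumes \<Omega>: "open \<Omega>" and f: "f \<in> borel_measurable (lebesgue_on \<Omega>)" and g: "borel_version \<Omega> f g"
    and p: "p \<in> borel_measurable borel"
  shows "(LINT x:\<Omega>|lebesgue. p x * f x) = (\<integral>x. p x * g x \<partial>lborel)"
  using g by (intro set_integral_lborel[OF \<Omega> p f]) (simp_all add: borel_version_def sqi_def)

lemma test_function_borel: 
  assumes "test_function \<Omega> \<phi>"
  shows "\<phi> \<in> borel_measurable borel" "partial_deriv i \<phi> \<in> borel_measurable borel"
  using test_function_continuous[OF assms] partial_deriv_test_continuous[OF assms]
  by (auto intro: borel_measurable_continuous_onI)

lemma weak_partial_borel_version:
  fixes f f' :: "real^'n \<Rightarrow> real"
  assumes \<Omega>: "open \<Omega>" and w: "weak_partial \<Omega> i f f'" and sq: "sqi_on \<Omega> f" "sqi_on \<Omega> f'"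
    and g: "borel_version \<Omega> f g" "borel_version \<Omega> f' g'" and \<phi>: "test_function \<Omega> \<phi>"
  shows "(\<integral>x. partial_deriv i \<phi> x * g x \<partial>lborel) = - (\<integral>x. \<phi> x * g' x \<partial>lborel)"
proof -
  have m: "f \<in> borel_measurable (lebesgue_on \<Omega>)" "f' \<in> borel_measurable (lebesgue_on \<Omega>)"
    using sq by (simp_all add: sqi_on_def)
  show ?thesis
    using w \<phi> set_integral_borel_version[OF \<Omega> m(1) g(1) test_function_borel(2)[OF \<phi>, of i]]
      set_integral_borel_version[OF \<Omega> m(2) g(2) test_function_borel(1)[OF \<phi>]]
    unfolding weak_partial_def by simp
qed

lemma sqi_integrable_bounded:
  assumes f: "sqi f" "\<And>x. x \<notin> \<Omega> \<Longrightarrow> f x = 0" and \<Omega>: "bounded \<Omega>"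
  shows "integrable lborel f"
proof -
  obtain R where R: "\<And>x. x \<in> \<Omega> \<Longrightarrow> norm x \<le> R" using \<Omega> by (auto simp: bounded_iff)
  have "sqi (\<lambda>x. indicator (cball 0 R) x)"
    by (rule bounded_support_sqi[of _ 1 R]) (auto simp: indicator_def)
  from sqi_mult_integrable[OF f(1) this]
  have "integrable lborel (\<lambda>x. f x * indicator (cball 0 R) x)" .
  moreover have "(\<lambda>x. f x * indicator (cball 0 R) x) = f"
    using R f(2) by (auto simp: fun_eq_iff indicator_def)
  ultimately show ?thesis by (rule back_subst[of "integrable lborel"])
qed

lemma partial_deriv_shift: "partial_deriv i (\<lambda>x. bump e (x - y)) x = partial_deriv i (bump e) (x - y)"
proof -
  have "(\<lambda>z::real^'n. bump e (z - 0)) differentiable (at z)" for z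
    by (rule Ck_differentiable[OF Ck_bump])
  then have D: "(bump e has_derivative frechet_derivative (bump e) (at z)) (at z)" for z :: "real^'n"
    by (simp add: frechet_derivative_works)
  have "((\<lambda>x. bump e (x - y)) has_derivative (\<lambda>h. frechet_derivative (bump e) (at (x - y)) h)) (at x)"
    by (rule has_derivative_compose[OF _ D, of "\<lambda>x. x - y"]) (auto intro!: derivative_eq_intros)
  from partial_deriv_eq[OF this] show ?thesis by (simp add: partial_deriv_def)
qed

lemma partial_deriv_bump_odd: "partial_deriv i (bump e) (- z) = - partial_deriv i (bump e) (z::real^'n)"
proof -
  have "(\<lambda>y::real^'n. bump e (0 - y)) = bump e" by (simp add: bump_minus fun_eq_iff)
  then have "partial_deriv i (bump e) z = - partial_deriv i (\<lambda>x. bump e (x - z)) 0"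
    using partial_deriv_bump_reflect[of i e 0 z] by (simp only:)
  then show ?thesis by (simp only: partial_deriv_shift) simp
qed

lemma partial_deriv_bump_bounded:
  assumes "0 < e"
  obtains C where "\<And>z. \<bar>partial_deriv i (bump e) (z::real^'n)\<bar> \<le> C"
    and "continuous_on UNIV (partial_deriv i (bump e :: real^'n \<Rightarrow> real))"
proof -
  have "test_function UNIV (\<lambda>x::real^'n. bump e (x - 0))"
    using assms by (intro test_function_bump) auto
  then have t: "test_function UNIV (bump e :: real^'n \<Rightarrow> real)" by simp
  obtain C where "\<And>z. norm (partial_deriv i (bump e) (z::real^'n)) \<le> C"
    using test_function_bounds[OF t, of i] by metis
  then show ?thesis
    using partial_deriv_test_continuous[OF t, of i] by (intro that[of C]) auto
qed

text \<open>On a ball inside \<open>\<Omega>\<close>, multiply \<open>d\<close> by a bump \<open>\<phi>\<close> that is positive there and let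
  \<open>p = \<phi> d\<close>. For each \<open>x\<close> the function \<open>\<phi>(y) bump e (y - x)\<close> is a test function, so all
  mollified pairings of \<open>p\<close> with itself vanish. Hence \<open>\<integral>p\<^sup>2 = 0\<close> by concentration. Countably
  many such balls cover \<open>\<Omega>\<close>.\<close>

lemma fundamental_lemma_variations:
  fixes d :: "real^'n \<Rightarrow> real"
  assumes \<Omega>: "open \<Omega>" and d: "sqi d" "\<And>x. x \<notin> \<Omega> \<Longrightarrow> d x = 0"
    and zero: "\<And>\<phi>. test_function \<Omega> \<phi> \<Longrightarrow> (\<integral>x. \<phi> x * d x \<partial>lborel) = 0"
  shows "AE x in lborel. d x = 0"
proof -
  have local: "AE x in lborel. x \<in> ball c r \<longrightarrow> d x = 0" if r: "0 < r" "cball c r \<subseteq> \<Omega>" for c r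
  proof -
    let ?\<phi> = "\<lambda>x. bump r (x - c)"
    have t: "test_function \<Omega> ?\<phi>" by (rule test_function_bump[OF r])
    define p where "p x = ?\<phi> x * d x" for x
    have p: "sqi p" unfolding p_def
    proof (rule sqi_mult_bounded[OF test_function_borel(1)[OF t] _ d(1)])
      show "\<bar>?\<phi> x\<bar> \<le> 1" for x using bump_range[of r "x - c"] by simp
    qed
    \<comment> \<open>The hypothesis on \<open>d\<close>, applied to \<open>y \<mapsto> \<phi>(y) bump e (y - x)\<close>\<close>
    have in0: "(\<integral>y. bump e (x - y) * (p x * p y) \<partial>lborel) = 0" for e x
    proof -
      have "(\<integral>y. (?\<phi> y * bump e (y - x)) * d y \<partial>lborel) = 0"
        by (rule zero[OF test_function_bump_mult[OF t]])
      then have "(\<integral>y. p x * ((?\<phi> y * bump e (y - x)) * d y) \<partial>lborel) = 0" by simp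
      then show ?thesis by (simp add: p_def bump_commute[of e x] mult_ac)
    qed
    have "correl p p (- 0) = 0"
    proof (rule bump_concentration[of "\<lambda>z. correl p p (- z)" 1])
      show "isCont (\<lambda>z. correl p p (- z)) 0" by (rule correl_reflect_isCont[OF p p])
      show "integrable lborel (\<lambda>z. bump e z * correl p p (- z))" for e by (rule mollified_pairing(2)[OF p p])
      show "(\<integral>z. bump e z * correl p p (- z) \<partial>lborel) = 0" for e
        using mollified_pairing(1)[OF p p, of e] in0 by simp
    qed simp
    then have "(\<integral>x. (p x)\<^sup>2 \<partial>lborel) = 0" by (simp add: correl_def power2_eq_square)
    then have "AE x in lborel. (p x)\<^sup>2 = 0"
      using sqi_integrable[OF p] by (subst (asm) integral_nonneg_eq_0_iff_AE) auto
    then show ?thesis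
    proof eventually_elim
      case (elim x)
      show ?case
      proof
        assume "x \<in> ball c r"
        then have "0 < ?\<phi> x" using bump_pos_iff[OF r(1), of "x - c"] by (simp add: dist_norm norm_minus_commute)
        then show "d x = 0" using elim by (simp add: p_def)
      qed
    qed
  qed
  define \<F> where "\<F> = {ball c r | c r. 0 < r \<and> cball c r \<subseteq> \<Omega>}"
  obtain \<F>' where F': "\<F>' \<subseteq> \<F>" "countable \<F>'" "\<Union>\<F>' = \<Union>\<F>"
    by (rule Lindelof[of \<F>]) (auto simp: \<F>_def)
  have U: "\<Omega> \<subseteq> \<Union>\<F>"
  proof
    fix x assume "x \<in> \<Omega>"
    then obtain r where "0 < r" "cball x r \<subseteq> \<Omega>" using \<Omega> open_contains_cball by blast
    then show "x \<in> \<Union>\<F>" unfolding \<F>_def by (intro UnionI[of "ball x r"]) auto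
  qed
  have "AE x in lborel. \<forall>U\<in>\<F>'. x \<in> U \<longrightarrow> d x = 0"
    unfolding AE_ball_countable[OF F'(2)] using F'(1) local by (auto simp: \<F>_def)
  then show ?thesis
  proof eventually_elim
    case (elim x)
    show ?case
    proof (cases "x \<in> \<Omega>")
      case True
      then show ?thesis using U F'(3) elim by blast
    qed (rule d(2))
  qed
qed

lemma weak_partial_unique:
  fixes f g g' :: "real^'n \<Rightarrow> real"
  assumes \<Omega>: "open \<Omega>" and w: "weak_partial \<Omega> i f g" "weak_partial \<Omega> i f g'" and sq: "sqi_on \<Omega> g" "sqi_on \<Omega> g'"
  shows "AE x in lebesgue_on \<Omega>. g x = g' x"
proof -
  obtain v v' where v: "borel_version \<Omega> g v" "borel_version \<Omega> g' v'"
    using borel_version_exists[OF \<Omega>] sq by metis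
  have s: "sqi v" "sqi v'" using v by (simp_all add: borel_version_def)
  have "AE x in lborel. v x - v' x = 0"
  proof (rule fundamental_lemma_variations[OF \<Omega>])
    show "sqi (\<lambda>x. v x - v' x)" by (rule sqi_diff[OF s])
    show "v x - v' x = 0" if "x \<notin> \<Omega>" for x using v that by (simp add: borel_version_def)
    fix \<phi> :: "real^'n \<Rightarrow> real" assume \<phi>: "test_function \<Omega> \<phi>"
    obtain C where C: "\<And>x. norm (\<phi> x) \<le> C" using test_function_bounds[OF \<phi>] by metis
    have "bounded (closure {x. \<phi> x \<noteq> 0})"
      using \<phi> by (intro compact_imp_bounded) (simp add: test_function_def)
    then obtain R where R: "\<And>x. x \<in> closure {x. \<phi> x \<noteq> 0} \<Longrightarrow> norm x \<le> R"
      unfolding bounded_iff by blast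
    have sp: "sqi \<phi>"
    proof (rule bounded_support_sqi[OF test_function_borel(1)[OF \<phi>]])
      show "\<bar>\<phi> x\<bar> \<le> C" for x using C[of x] by simp
      show "\<phi> x = 0" if "R < norm x" for x
        using that R[of x] closure_subset[of "{x. \<phi> x \<noteq> 0}"] by (meson linorder_not_less mem_Collect_eq subsetD)
    qed
    have i: "integrable lborel (\<lambda>x. \<phi> x * v x)" "integrable lborel (\<lambda>x. \<phi> x * v' x)"
      by (intro sqi_mult_integrable sp s)+
    have m: "g \<in> borel_measurable (lebesgue_on \<Omega>)" "g' \<in> borel_measurable (lebesgue_on \<Omega>)"
      using sq by (simp_all add: sqi_on_def)
    have "(LINT x:\<Omega>|lebesgue. \<phi> x * g x) = (LINT x:\<Omega>|lebesgue. \<phi> x * g' x)"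
      using w \<phi> unfolding weak_partial_def by simp
    then have "(\<integral>x. \<phi> x * v x \<partial>lborel) = (\<integral>x. \<phi> x * v' x \<partial>lborel)"
      using set_integral_borel_version[OF \<Omega> m(1) v(1) test_function_borel(1)[OF \<phi>]]
        set_integral_borel_version[OF \<Omega> m(2) v(2) test_function_borel(1)[OF \<phi>]] by simp
    then show "(\<integral>x. \<phi> x * (v x - v' x) \<partial>lborel) = 0"
      using i by (simp add: right_diff_distrib)
  qed
  then have "AE x in lebesgue. v x - v' x = 0" by (simp only: AE_completion_iff)
  then have "AE x in lebesgue. x \<in> \<Omega> \<longrightarrow> g x = g' x"
    using v[unfolded borel_version_def] by (auto elim!: eventually_elim2)
  then show ?thesis using \<Omega> by (subst AE_restrict_space_iff) auto
qed


section \<open>The product rule for weak derivatives\<close>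

text \<open>Testing \<open>g\<close> with \<open>\<phi>(x) bump e (x - y)\<close> as a function of \<open>x\<close> produces a term in which the
  derivative falls on the bump. Testing \<open>f\<close> with the same bump as a function of \<open>y\<close> moves it
  over to \<open>f\<close>. The product rule is this identity without the mollifier.\<close>

lemma mollified_product_identity:
  fixes f f' g g' \<phi> :: "real^'n \<Rightarrow> real"
  assumes int: "integrable lborel f" "integrable lborel f'" "integrable lborel g" "integrable lborel g'"
    and \<phi>: "test_function \<Omega> \<phi>" and e: "0 < e" and near: "\<And>x. \<phi> x \<noteq> 0 \<Longrightarrow> cball x e \<subseteq> \<Omega>"
    and wf: "\<And>\<psi>. test_function \<Omega> \<psi> \<Longrightarrow> (\<integral>x. partial_deriv i \<psi> x * f x \<partial>lborel) = - (\<integral>x. \<psi> x * f' x \<partial>lborel)"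
    and wg: "\<And>\<psi>. test_function \<Omega> \<psi> \<Longrightarrow> (\<integral>x. partial_deriv i \<psi> x * g x \<partial>lborel) = - (\<integral>x. \<psi> x * g' x \<partial>lborel)"
  shows "(\<integral>x. (\<integral>y. bump e (x - y) * (partial_deriv i \<phi> x * g x * f y) \<partial>lborel) \<partial>lborel) +
      (\<integral>x. (\<integral>y. bump e (x - y) * (\<phi> x * g x * f' y) \<partial>lborel) \<partial>lborel) +
      (\<integral>x. (\<integral>y. bump e (x - y) * (\<phi> x * g' x * f y) \<partial>lborel) \<partial>lborel) = 0"
proof -
  let ?k = "partial_deriv i (bump e :: real^'n \<Rightarrow> real)"
  let ?d = "partial_deriv i \<phi>"
  have bc: "continuous_on UNIV (bump e :: real^'n \<Rightarrow> real)"
    using Ck_continuous[OF Ck_bump[of 0 e 0]] by simp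
  have bb: "\<bar>bump e z\<bar> \<le> 1" for z :: "real^'n" using bump_range[of e z] by simp
  obtain K where K: "\<And>z. \<bar>?k z\<bar> \<le> K" and kc: "continuous_on UNIV ?k"
    using partial_deriv_bump_bounded[OF e, of i] by metis
  obtain C where C: "\<And>x. norm (\<phi> x) \<le> C" "\<And>x. norm (?d x) \<le> C"
    using test_function_bounds[OF \<phi>, of i] by metis
  have [measurable]: "\<phi> \<in> borel_measurable borel" "?d \<in> borel_measurable borel"
    using test_function_borel[OF \<phi>] by auto
  have mi: "integrable lborel (\<lambda>x. a x * h x)"
    if "a \<in> borel_measurable borel" "\<And>x. norm (a x) \<le> C" "integrable lborel h" for a h :: "real^'n \<Rightarrow> real"
  proof (rule Bochner_Integration.integrable_bound)
    show "integrable lborel (\<lambda>x. C * h x)" using that by simp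
    show "(\<lambda>x. a x * h x) \<in> borel_measurable lborel" using that by measurable
    show "AE x in lborel. norm (a x * h x) \<le> norm (C * h x)"
    proof (rule AE_I2)
      fix x
      have "0 \<le> C" using that(2)[of x] norm_ge_zero order_trans by blast
      then show "norm (a x * h x) \<le> norm (C * h x)"
        using that(2)[of x] by (simp add: abs_mult mult_right_mono)
    qed
  qed
  have i1: "integrable lborel (\<lambda>x. ?d x * g x)" and i2: "integrable lborel (\<lambda>x. \<phi> x * g x)"
    and i3: "integrable lborel (\<lambda>x. \<phi> x * g' x)"
    by (intro mi C int; measurable)+
  note P1 = kernel_pair_integrable[OF bc bb i1 int(1)]
  note P2 = kernel_pair_integrable[OF kc K i2 int(1)]
  note P3 = kernel_pair_integrable[OF bc bb i3 int(1)]
  \<comment> \<open>\<open>g\<close> tested with \<open>\<phi>(x) bump e (x - y)\<close> for fixed \<open>y\<close>\<close>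
  have A: "(\<integral>x. bump e (x - y) * (?d x * g x * f y) \<partial>lborel) + (\<integral>x. ?k (x - y) * (\<phi> x * g x * f y) \<partial>lborel)
      = - (\<integral>x. bump e (x - y) * (\<phi> x * g' x * f y) \<partial>lborel)" for y
  proof -
    have t: "test_function \<Omega> (\<lambda>x. \<phi> x * bump e (x - y))" by (rule test_function_bump_mult[OF \<phi>])
    have pd: "partial_deriv i (\<lambda>x. \<phi> x * bump e (x - y)) x = \<phi> x * ?k (x - y) + ?d x * bump e (x - y)" for x
      by (subst partial_deriv_mult[OF test_function_differentiable[OF \<phi>] Ck_differentiable[OF Ck_bump]])
        (simp only: partial_deriv_shift)
    have j1: "integrable lborel (\<lambda>x. bump e (x - y) * (?d x * g x))"
      and j2: "integrable lborel (\<lambda>x. ?k (x - y) * (\<phi> x * g x))"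
    proof -
      have m: "(\<lambda>x. bump e (x - y)) \<in> borel_measurable borel" "(\<lambda>x. ?k (x - y)) \<in> borel_measurable borel"
        by (intro borel_measurable_continuous_onI continuous_on_compose2[OF bc] continuous_on_compose2[OF kc] continuous_intros; simp)+
      show "integrable lborel (\<lambda>x. bump e (x - y) * (?d x * g x))"
      proof (rule Bochner_Integration.integrable_bound[OF i1])
        show "AE x in lborel. norm (bump e (x - y) * (?d x * g x)) \<le> norm (?d x * g x)"
          using mult_right_mono[OF bb] by (intro AE_I2) (simp add: abs_mult)
      qed (use m i1 in measurable)
      show "integrable lborel (\<lambda>x. ?k (x - y) * (\<phi> x * g x))"
      proof (rule Bochner_Integration.integrable_bound)
        show "integrable lborel (\<lambda>x. K * (\<phi> x * g x))" using i2 by simp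
        show "AE x in lborel. norm (?k (x - y) * (\<phi> x * g x)) \<le> norm (K * (\<phi> x * g x))"
        proof (rule AE_I2)
          fix x
          have "\<bar>?k (x - y)\<bar> \<le> \<bar>K\<bar>" using K[of "x - y"] by linarith
          then show "norm (?k (x - y) * (\<phi> x * g x)) \<le> norm (K * (\<phi> x * g x))"
            by (simp only: real_norm_def abs_mult) (rule mult_right_mono, auto)
        qed
      qed (use m i2 in measurable)
    qed
    have "(\<integral>x. (bump e (x - y) * (?d x * g x) + ?k (x - y) * (\<phi> x * g x)) \<partial>lborel) =
        - (\<integral>x. bump e (x - y) * (\<phi> x * g' x) \<partial>lborel)"
      using wg[OF t] by (simp add: pd algebra_simps)
    then have "(\<integral>x. bump e (x - y) * (?d x * g x) \<partial>lborel) + (\<integral>x. ?k (x - y) * (\<phi> x * g x) \<partial>lborel) =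
        - (\<integral>x. bump e (x - y) * (\<phi> x * g' x) \<partial>lborel)"
      by (subst (asm) Bochner_Integration.integral_add[OF j1 j2])
    from arg_cong[OF this, of "\<lambda>s. s * f y"] show ?thesis
      by (simp add: distrib_right mult.assoc[symmetric] flip: integral_mult_left_zero)
  qed
  \<comment> \<open>\<open>f\<close> tested with \<open>bump e (y - x)\<close> for fixed \<open>x\<close>; this requires the support of the bump to
    lie in \<open>\<Omega>\<close>.\<close>
  have B: "(\<integral>y. ?k (x - y) * (\<phi> x * g x * f y) \<partial>lborel) = (\<integral>y. bump e (x - y) * (\<phi> x * g x * f' y) \<partial>lborel)" for x
  proof (cases "\<phi> x = 0")
    case False
    have t: "test_function \<Omega> (\<lambda>y. bump e (y - x))" by (rule test_function_bump[OF e near[OF False]])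
    have pd: "partial_deriv i (\<lambda>y. bump e (y - x)) y = - ?k (x - y)" for y
      using partial_deriv_bump_odd[of i e "x - y"] by (simp add: partial_deriv_shift)
    have "(\<integral>y. ?k (x - y) * f y \<partial>lborel) = (\<integral>y. bump e (x - y) * f' y \<partial>lborel)"
      using wf[OF t] by (simp add: pd bump_commute[of e x])
    from arg_cong[OF this, of "\<lambda>s. \<phi> x * g x * s"] show ?thesis
      by (simp add: mult_ac flip: integral_mult_right_zero)
  qed simp
  have F1: "(\<integral>y. (\<integral>x. bump e (x - y) * (?d x * g x * f y) \<partial>lborel) \<partial>lborel) =
      (\<integral>x. (\<integral>y. bump e (x - y) * (?d x * g x * f y) \<partial>lborel) \<partial>lborel)"
    by (rule lborel_pair.Fubini_integral[OF P1])
  have F2: "(\<integral>y. (\<integral>x. ?k (x - y) * (\<phi> x * g x * f y) \<partial>lborel) \<partial>lborel) =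
      (\<integral>x. (\<integral>y. ?k (x - y) * (\<phi> x * g x * f y) \<partial>lborel) \<partial>lborel)"
    by (rule lborel_pair.Fubini_integral[OF P2])
  have F3: "(\<integral>y. (\<integral>x. bump e (x - y) * (\<phi> x * g' x * f y) \<partial>lborel) \<partial>lborel) =
      (\<integral>x. (\<integral>y. bump e (x - y) * (\<phi> x * g' x * f y) \<partial>lborel) \<partial>lborel)"
    by (rule lborel_pair.Fubini_integral[OF P3])
  have "(\<integral>y. (\<integral>x. bump e (x - y) * (?d x * g x * f y) \<partial>lborel) + (\<integral>x. ?k (x - y) * (\<phi> x * g x * f y) \<partial>lborel) \<partial>lborel) =
      - (\<integral>y. (\<integral>x. bump e (x - y) * (\<phi> x * g' x * f y) \<partial>lborel) \<partial>lborel)"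
    by (simp only: A integral_minus)
  then have "(\<integral>y. (\<integral>x. bump e (x - y) * (?d x * g x * f y) \<partial>lborel) \<partial>lborel) +
      (\<integral>y. (\<integral>x. ?k (x - y) * (\<phi> x * g x * f y) \<partial>lborel) \<partial>lborel) =
      - (\<integral>y. (\<integral>x. bump e (x - y) * (\<phi> x * g' x * f y) \<partial>lborel) \<partial>lborel)"
    by (subst (asm) Bochner_Integration.integral_add[OF lborel_pair.integrable_snd[OF P1] lborel_pair.integrable_snd[OF P2]])
  then show ?thesis
    unfolding F1 F2 F3 B by simp
qed

text \<open>The three integrals of \<open>mollified_product_identity\<close> are averages of a function \<open>Q\<close> of
  the shift that is continuous at \<open>0\<close>, and \<open>Q 0 = 0\<close> is the claim.\<close>

lemma weak_product_rule_lborel: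
  fixes f f' g g' \<phi> :: "real^'n \<Rightarrow> real"
  assumes \<Omega>: "open \<Omega>"
    and sq: "sqi f" "sqi f'" "sqi g" "sqi g'"
    and int: "integrable lborel f" "integrable lborel f'" "integrable lborel g" "integrable lborel g'"
    and \<phi>: "test_function \<Omega> \<phi>"
    and wf: "\<And>\<psi>. test_function \<Omega> \<psi> \<Longrightarrow> (\<integral>x. partial_deriv i \<psi> x * f x \<partial>lborel) = - (\<integral>x. \<psi> x * f' x \<partial>lborel)"
    and wg: "\<And>\<psi>. test_function \<Omega> \<psi> \<Longrightarrow> (\<integral>x. partial_deriv i \<psi> x * g x \<partial>lborel) = - (\<integral>x. \<psi> x * g' x \<partial>lborel)"
  shows "(\<integral>x. partial_deriv i \<phi> x * (f x * g x) \<partial>lborel) = - (\<integral>x. \<phi> x * (f' x * g x + f x * g' x) \<partial>lborel)"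
proof -
  let ?d = "partial_deriv i \<phi>"
  let ?K = "closure {x. \<phi> x \<noteq> 0}"
  have "compact ?K" "?K \<subseteq> \<Omega>" using \<phi> by (simp_all add: test_function_def)
  then obtain e1 where e1: "0 < e1" "(\<Union>x\<in>?K. ball x e1) \<subseteq> \<Omega>"
    using compact_subset_open_imp_ball_epsilon_subset[OF _ \<Omega>] by metis
  obtain C where C: "\<And>x. norm (\<phi> x) \<le> C" "\<And>x. norm (?d x) \<le> C"
    using test_function_bounds[OF \<phi>, of i] by metis
  have m: "\<phi> \<in> borel_measurable borel" "?d \<in> borel_measurable borel"
    using test_function_borel[OF \<phi>] by auto
  have s1: "sqi (\<lambda>x. ?d x * g x)" and s2: "sqi (\<lambda>x. \<phi> x * g x)" and s3: "sqi (\<lambda>x. \<phi> x * g' x)"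
    using C by (auto intro!: sqi_mult_bounded m sq)
  define Q where "Q z = correl (\<lambda>x. ?d x * g x) f (- z) + correl (\<lambda>x. \<phi> x * g x) f' (- z) + correl (\<lambda>x. \<phi> x * g' x) f (- z)" for z
  have "Q 0 = 0"
  proof (rule bump_concentration[of Q e1])
    show "isCont Q 0"
      unfolding Q_def by (intro continuous_add correl_reflect_isCont s1 s2 s3 sq)
    show "integrable lborel (\<lambda>z. bump e z * Q z)" for e
      unfolding Q_def distrib_left
      by (intro Bochner_Integration.integrable_add mollified_pairing(2) s1 s2 s3 sq)
    show "0 < e1" by (rule e1)
    fix e :: real assume e: "0 < e" "e < e1"
    have near: "cball x e \<subseteq> \<Omega>" if "\<phi> x \<noteq> 0" for x
    proof -
      have "x \<in> ?K" using that closure_subset[of "{x. \<phi> x \<noteq> 0}"] by blast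
      then have "ball x e1 \<subseteq> \<Omega>" using e1(2) by blast
      then show ?thesis using e by (auto simp: subset_iff)
    qed
    have "(\<integral>z. bump e z * Q z \<partial>lborel) =
        (\<integral>z. bump e z * correl (\<lambda>x. ?d x * g x) f (- z) \<partial>lborel) +
        (\<integral>z. bump e z * correl (\<lambda>x. \<phi> x * g x) f' (- z) \<partial>lborel) +
        (\<integral>z. bump e z * correl (\<lambda>x. \<phi> x * g' x) f (- z) \<partial>lborel)"
      unfolding Q_def distrib_left
      by (subst Bochner_Integration.integral_add Bochner_Integration.integrable_add;
          intro Bochner_Integration.integrable_add mollified_pairing(2) s1 s2 s3 sq
           Bochner_Integration.integral_add arg_cong2[where f = "(+)"] refl)+
    also have "\<dots> = 0"
      using mollified_product_identity[OF int \<phi> e(1) near wf wg]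
      unfolding mollified_pairing(1)[OF s1 sq(1), symmetric] mollified_pairing(1)[OF s2 sq(2), symmetric]
        mollified_pairing(1)[OF s3 sq(1), symmetric] by simp
    finally show "(\<integral>z. bump e z * Q z \<partial>lborel) = 0" .
  qed
  then have 0: "(\<integral>x. ?d x * g x * f x \<partial>lborel) + (\<integral>x. \<phi> x * g x * f' x \<partial>lborel) + (\<integral>x. \<phi> x * g' x * f x \<partial>lborel) = 0"
    by (simp add: Q_def correl_def)
  have "(\<integral>x. \<phi> x * (f' x * g x + f x * g' x) \<partial>lborel) =
      (\<integral>x. \<phi> x * g x * f' x + \<phi> x * g' x * f x \<partial>lborel)"
    by (intro Bochner_Integration.integral_cong) (simp_all add: algebra_simps)
  also have "\<dots> = (\<integral>x. \<phi> x * g x * f' x \<partial>lborel) + (\<integral>x. \<phi> x * g' x * f x \<partial>lborel)"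
    by (rule Bochner_Integration.integral_add) (intro sqi_mult_integrable s2 s3 sq)+
  finally show ?thesis using 0 by (simp add: mult_ac)
qed

lemma sqi_on_mult_integrable:
  assumes "sqi_on \<Omega> f" "sqi_on \<Omega> g"
  shows "integrable (lebesgue_on \<Omega>) (\<lambda>x. f x * g x)"
proof (rule Bochner_Integration.integrable_bound)
  show "integrable (lebesgue_on \<Omega>) (\<lambda>x. (f x)\<^sup>2 + (g x)\<^sup>2)" using assms by (simp add: sqi_on_def)
  show "(\<lambda>x. f x * g x) \<in> borel_measurable (lebesgue_on \<Omega>)"
    using assms by (intro borel_measurable_times) (simp_all add: sqi_on_def)
  have "norm (f x * g x) \<le> norm ((f x)\<^sup>2 + (g x)\<^sup>2)" for x
    using two_abs_mult_le[of "f x" "g x"] by simp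
  then show "AE x in lebesgue_on \<Omega>. norm (f x * g x) \<le> norm ((f x)\<^sup>2 + (g x)\<^sup>2)" by simp
qed

lemma integrable_on_imp_locally_integrable:
  fixes f :: "real^'n \<Rightarrow> 'b::euclidean_space"
  assumes \<Omega>: "open \<Omega>" and f: "integrable (lebesgue_on \<Omega>) f"
  shows "locally_integrable_on \<Omega> f"
proof -
  have "set_integrable lebesgue \<Omega> f"
    unfolding set_integrable_def using f \<Omega> by (subst (asm) integrable_restrict_space) auto
  then show ?thesis
    unfolding locally_integrable_on_def
    by (auto intro!: set_integrable_subset[of lebesgue \<Omega>] compact_imp_closed borel_closed simp: sets_completionI_sets)
qed

text \<open>Square integrability of the functions and of their derivatives makes the products
  integrable, and boundedness of \<open>\<Omega>\<close> makes the functions themselves integrable, so that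
  Fubini's theorem applies to the mollified integrals.\<close>

theorem weak_partial_mult:
  fixes f f' g g' :: "real^'n \<Rightarrow> real"
  assumes \<Omega>: "open \<Omega>" "bounded \<Omega>"
    and sq: "sqi_on \<Omega> f" "sqi_on \<Omega> f'" "sqi_on \<Omega> g" "sqi_on \<Omega> g'"
    and w: "weak_partial \<Omega> i f f'" "weak_partial \<Omega> i g g'"
  shows "weak_partial \<Omega> i (\<lambda>x. f x * g x) (\<lambda>x. f' x * g x + f x * g' x)"
proof -
  note i = sqi_on_mult_integrable[OF sq(1,3)] sqi_on_mult_integrable[OF sq(2,3)] sqi_on_mult_integrable[OF sq(1,4)]
  obtain v v' where v: "borel_version \<Omega> f v" "borel_version \<Omega> f' v'"
    using borel_version_exists[OF \<Omega>(1)] sq by metis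
  obtain u u' where u: "borel_version \<Omega> g u" "borel_version \<Omega> g' u'"
    using borel_version_exists[OF \<Omega>(1)] sq by metis
  have s: "sqi v" "sqi v'" "sqi u" "sqi u'"
    and out: "\<And>x. x \<notin> \<Omega> \<Longrightarrow> v x = 0" "\<And>x. x \<notin> \<Omega> \<Longrightarrow> v' x = 0" "\<And>x. x \<notin> \<Omega> \<Longrightarrow> u x = 0" "\<And>x. x \<notin> \<Omega> \<Longrightarrow> u' x = 0"
    using u v by (simp_all add: borel_version_def)
  have int: "integrable lborel v" "integrable lborel v'" "integrable lborel u" "integrable lborel u'"
    using sqi_integrable_bounded[OF s(1) out(1) \<Omega>(2)] sqi_integrable_bounded[OF s(2) out(2) \<Omega>(2)]
      sqi_integrable_bounded[OF s(3) out(3) \<Omega>(2)] sqi_integrable_bounded[OF s(4) out(4) \<Omega>(2)] by auto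
  show ?thesis
    unfolding weak_partial_def
  proof (intro conjI allI impI)
    show "locally_integrable_on \<Omega> (\<lambda>x. f x * g x)"
      by (rule integrable_on_imp_locally_integrable[OF \<Omega>(1) i(1)])
    show "locally_integrable_on \<Omega> (\<lambda>x. f' x * g x + f x * g' x)"
      by (rule integrable_on_imp_locally_integrable[OF \<Omega>(1)]) (intro Bochner_Integration.integrable_add i)
    fix \<phi> :: "real^'n \<Rightarrow> real" assume \<phi>: "test_function \<Omega> \<phi>"
    have m [measurable]: "v \<in> borel_measurable borel" "v' \<in> borel_measurable borel" "u \<in> borel_measurable borel" "u' \<in> borel_measurable borel"
      using s by (simp_all add: sqi_def)
    have ml: "f \<in> borel_measurable (lebesgue_on \<Omega>)" "f' \<in> borel_measurable (lebesgue_on \<Omega>)"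
       "g \<in> borel_measurable (lebesgue_on \<Omega>)" "g' \<in> borel_measurable (lebesgue_on \<Omega>)"
      using sq by (simp_all add: sqi_on_def)
    have ae: "AE x in lebesgue. v x = (if x \<in> \<Omega> then f x else 0) \<and> v' x = (if x \<in> \<Omega> then f' x else 0) \<and>
        u x = (if x \<in> \<Omega> then g x else 0) \<and> u' x = (if x \<in> \<Omega> then g' x else 0)"
      using u v unfolding borel_version_def by auto
    have 1: "(LINT x:\<Omega>|lebesgue. partial_deriv i \<phi> x * (f x * g x)) = (\<integral>x. partial_deriv i \<phi> x * (v x * u x) \<partial>lborel)"
    proof (rule set_integral_lborel[OF \<Omega>(1) test_function_borel(2)[OF \<phi>]])
      show "AE x in lebesgue. v x * u x = (if x \<in> \<Omega> then f x * g x else 0)"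
        using ae by eventually_elim auto
    qed (use ml m in simp_all)
    have 2: "(LINT x:\<Omega>|lebesgue. \<phi> x * (f' x * g x + f x * g' x)) = (\<integral>x. \<phi> x * (v' x * u x + v x * u' x) \<partial>lborel)"
    proof (rule set_integral_lborel[OF \<Omega>(1) test_function_borel(1)[OF \<phi>]])
      show "AE x in lebesgue. v' x * u x + v x * u' x = (if x \<in> \<Omega> then f' x * g x + f x * g' x else 0)"
        using ae by eventually_elim auto
    qed (use ml m in simp_all)
    have "(\<integral>x. partial_deriv i \<phi> x * (v x * u x) \<partial>lborel) = - (\<integral>x. \<phi> x * (v' x * u x + v x * u' x) \<partial>lborel)"
      by (rule weak_product_rule_lborel[OF \<Omega>(1) s int \<phi>
           weak_partial_borel_version[OF \<Omega>(1) w(1) sq(1,2) v] weak_partial_borel_version[OF \<Omega>(1) w(2) sq(3,4) u]])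
    then show "(LINT x:\<Omega>|lebesgue. partial_deriv i \<phi> x *\<^sub>R (f x * g x)) =
        - (LINT x:\<Omega>|lebesgue. \<phi> x *\<^sub>R (f' x * g x + f x * g' x))"
      using 1 2 by simp
  qed
qed


section \<open>Weak derivatives of exponentials\<close>

lemma LinfI: "f \<in> borel_measurable (lebesgue_on \<Omega>) \<Longrightarrow> AE x in lebesgue_on \<Omega>. \<bar>f x\<bar> \<le> C \<Longrightarrow> Linf \<Omega> f"
  by (auto simp: Linf_def)

lemma LinfE:
  assumes "Linf \<Omega> f"
  obtains C where "0 \<le> C" "f \<in> borel_measurable (lebesgue_on \<Omega>)" "AE x in lebesgue_on \<Omega>. \<bar>f x\<bar> \<le> C"
proof -
  obtain C where C: "AE x in lebesgue_on \<Omega>. \<bar>f x\<bar> \<le> C" using assms by (auto simp: Linf_def)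
  show ?thesis
  proof (rule that[of "\<bar>C\<bar>"])
    show "AE x in lebesgue_on \<Omega>. \<bar>f x\<bar> \<le> \<bar>C\<bar>" using C by eventually_elim simp
  qed (use assms in \<open>simp_all add: Linf_def\<close>)
qed

lemma Linf_mult: "Linf \<Omega> f \<Longrightarrow> Linf \<Omega> g \<Longrightarrow> Linf \<Omega> (\<lambda>x. f x * g x)"
proof (elim LinfE)
  fix C D assume *: "0 \<le> C" "f \<in> borel_measurable (lebesgue_on \<Omega>)" "AE x in lebesgue_on \<Omega>. \<bar>f x\<bar> \<le> C"
    "0 \<le> D" "g \<in> borel_measurable (lebesgue_on \<Omega>)" "AE x in lebesgue_on \<Omega>. \<bar>g x\<bar> \<le> D"
  show ?thesis
  proof (rule LinfI)
    show "AE x in lebesgue_on \<Omega>. \<bar>f x * g x\<bar> \<le> C * D"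
      using *(3,6) by eventually_elim (use *(1) in \<open>auto simp: abs_mult intro!: mult_mono\<close>)
  qed (intro borel_measurable_times *)
qed

lemma Linf_add: "Linf \<Omega> f \<Longrightarrow> Linf \<Omega> g \<Longrightarrow> Linf \<Omega> (\<lambda>x. f x + g x)"
proof (elim LinfE)
  fix C D assume *: "0 \<le> C" "f \<in> borel_measurable (lebesgue_on \<Omega>)" "AE x in lebesgue_on \<Omega>. \<bar>f x\<bar> \<le> C"
    "0 \<le> D" "g \<in> borel_measurable (lebesgue_on \<Omega>)" "AE x in lebesgue_on \<Omega>. \<bar>g x\<bar> \<le> D"
  show ?thesis
  proof (rule LinfI)
    show "AE x in lebesgue_on \<Omega>. \<bar>f x + g x\<bar> \<le> C + D"
      using *(3,6) by eventually_elim linarith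
  qed (intro borel_measurable_add *)
qed

lemma Linf_const: "Linf \<Omega> (\<lambda>x. c)"
  by (rule LinfI[of _ _ "\<bar>c\<bar>"]) auto

lemma Linf_power: "Linf \<Omega> f \<Longrightarrow> Linf \<Omega> (\<lambda>x. f x ^ n)"
  by (induction n) (auto intro: Linf_const Linf_mult)

lemma Linf_exp: "Linf \<Omega> f \<Longrightarrow> Linf \<Omega> (\<lambda>x. exp (f x))"
proof (elim LinfE)
  fix C assume *: "0 \<le> C" "f \<in> borel_measurable (lebesgue_on \<Omega>)" "AE x in lebesgue_on \<Omega>. \<bar>f x\<bar> \<le> C"
  show ?thesis
  proof (rule LinfI)
    show "AE x in lebesgue_on \<Omega>. \<bar>exp (f x)\<bar> \<le> exp C"
      using *(3) by eventually_elim simp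
    show "(\<lambda>x. exp (f x)) \<in> borel_measurable (lebesgue_on \<Omega>)"
      by (rule measurable_compose[OF *(2)]) (auto intro!: borel_measurable_continuous_onI continuous_intros)
  qed
qed

lemma finite_measure_lebesgue_on:
  assumes "open \<Omega>" "bounded \<Omega>"
  shows "finite_measure (lebesgue_on \<Omega> :: 'a::euclidean_space measure)"
proof
  have "emeasure lebesgue \<Omega> < \<infinity>"
    using assms by (metis bounded_set_imp_lmeasurable fmeasurableD2 borel_open sets_completionI_sets sets_lborel top.not_eq_extremum infinity_ennreal_def)
  then show "emeasure (lebesgue_on \<Omega>) (space (lebesgue_on \<Omega>)) \<noteq> \<infinity>"
    using assms by (simp add: emeasure_restrict_space)
qed

lemma Linf_integrable:
  assumes "open \<Omega>" "bounded \<Omega>" "Linf \<Omega> f"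
  shows "integrable (lebesgue_on \<Omega>) f"
proof -
  interpret finite_measure "lebesgue_on \<Omega>" by (rule finite_measure_lebesgue_on[OF assms(1,2)])
  obtain C where C: "f \<in> borel_measurable (lebesgue_on \<Omega>)" "AE x in lebesgue_on \<Omega>. \<bar>f x\<bar> \<le> C"
    using assms(3) by (rule LinfE)
  show ?thesis
    by (rule integrable_const_bound[of _ C]) (use C in simp_all)
qed

lemma Linf_sqi_on:
  assumes "open \<Omega>" "bounded \<Omega>" "Linf \<Omega> f"
  shows "sqi_on \<Omega> f"
  using Linf_integrable[OF assms(1,2) Linf_power[OF assms(3), of 2]] assms(3)
  by (simp add: sqi_on_def Linf_def)

lemma weak_partial_locally: "weak_partial \<Omega> i f g \<Longrightarrow> locally_integrable_on \<Omega> f" "weak_partial \<Omega> i f g \<Longrightarrow> locally_integrable_on \<Omega> g"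
  by (simp_all add: weak_partial_def)

lemma test_mult_integrable:
  fixes f :: "real^'n \<Rightarrow> 'b::euclidean_space" and \<psi> :: "real^'n \<Rightarrow> real"
  assumes f: "locally_integrable_on \<Omega> f" and K: "compact K" "K \<subseteq> \<Omega>"
    and \<psi>: "continuous_on UNIV \<psi>" "\<And>x. x \<notin> K \<Longrightarrow> \<psi> x = 0"
  shows "integrable lebesgue (\<lambda>x. indicator \<Omega> x *\<^sub>R (\<psi> x *\<^sub>R f x))"
proof -
  obtain C where C: "0 \<le> C" "\<And>x. norm (\<psi> x) \<le> C"
    using compact_support_bounded[OF \<psi>(1) K(1) \<psi>(2)] by metis
  have i: "integrable lebesgue (\<lambda>x. indicator K x *\<^sub>R f x)"
    using f K unfolding locally_integrable_on_def set_integrable_def by blast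
  have m: "\<psi> \<in> borel_measurable lebesgue"
    using \<psi>(1) by (intro measurable_completion) (simp add: borel_measurable_continuous_onI)
  have eq: "indicator \<Omega> x *\<^sub>R (\<psi> x *\<^sub>R f x) = \<psi> x *\<^sub>R (indicator K x *\<^sub>R f x)" for x
    using K(2) \<psi>(2)[of x] by (auto simp: indicator_def)
  show ?thesis
    unfolding eq
  proof (rule Bochner_Integration.integrable_bound)
    show "integrable lebesgue (\<lambda>x. C *\<^sub>R (indicator K x *\<^sub>R f x))" using i by (rule integrable_scaleR_right)
    show "(\<lambda>x. \<psi> x *\<^sub>R (indicator K x *\<^sub>R f x)) \<in> borel_measurable lebesgue"
      by (rule borel_measurable_scaleR[OF m borel_measurable_integrable[OF i]])
    show "AE x in lebesgue. norm (\<psi> x *\<^sub>R (indicator K x *\<^sub>R f x)) \<le> norm (C *\<^sub>R (indicator K x *\<^sub>R f x))"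
    proof (rule AE_I2)
      fix x
      show "norm (\<psi> x *\<^sub>R (indicator K x *\<^sub>R f x)) \<le> norm (C *\<^sub>R (indicator K x *\<^sub>R f x))"
        unfolding norm_scaleR[of "\<psi> x"] norm_scaleR[of C] by (rule mult_right_mono) (use C in auto)
    qed
  qed
qed

lemma test_function_mult_integrable:
  fixes f :: "real^'n \<Rightarrow> 'b::euclidean_space" and \<phi> :: "real^'n \<Rightarrow> real"
  assumes f: "locally_integrable_on \<Omega> f" and \<phi>: "test_function \<Omega> \<phi>"
  shows "integrable lebesgue (\<lambda>x. indicator \<Omega> x *\<^sub>R (\<phi> x *\<^sub>R f x))"
    and "integrable lebesgue (\<lambda>x. indicator \<Omega> x *\<^sub>R (partial_deriv i \<phi> x *\<^sub>R f x))"
proof -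
  have K: "compact (closure {x. \<phi> x \<noteq> 0})" "closure {x. \<phi> x \<noteq> 0} \<subseteq> \<Omega>"
    using \<phi> by (simp_all add: test_function_def)
  have out: "\<phi> x = 0" if "x \<notin> closure {x. \<phi> x \<noteq> 0}" for x
    using that closure_subset[of "{x. \<phi> x \<noteq> 0}"] by blast
  show "integrable lebesgue (\<lambda>x. indicator \<Omega> x *\<^sub>R (\<phi> x *\<^sub>R f x))"
    by (rule test_mult_integrable[OF f K test_function_continuous[OF \<phi>] out])
  show "integrable lebesgue (\<lambda>x. indicator \<Omega> x *\<^sub>R (partial_deriv i \<phi> x *\<^sub>R f x))"
    by (rule test_mult_integrable[OF f K partial_deriv_test_continuous[OF \<phi>] partial_deriv_outside_support])
qed

lemma locally_integrable_linear:
  fixes f :: "real^'n \<Rightarrow> 'b::euclidean_space" and L :: "'b \<Rightarrow> 'c::euclidean_space"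
  assumes "locally_integrable_on \<Omega> f" and L: "bounded_linear L"
  shows "locally_integrable_on \<Omega> (\<lambda>x. L (f x))"
  unfolding locally_integrable_on_def
proof (intro allI impI)
  fix K assume "compact K \<and> K \<subseteq> \<Omega>"
  then have "integrable lebesgue (\<lambda>x. indicator K x *\<^sub>R f x)"
    using assms unfolding locally_integrable_on_def set_integrable_def by blast
  from integrable_bounded_linear[OF L this] show "set_integrable lebesgue K (\<lambda>x. L (f x))"
    unfolding set_integrable_def by (simp add: bounded_linear.linear[OF L] linear_scale)
qed

lemma locally_integrable_add:
  "locally_integrable_on \<Omega> f \<Longrightarrow> locally_integrable_on \<Omega> g \<Longrightarrow> locally_integrable_on \<Omega> (\<lambda>x. f x + g x)"
  unfolding locally_integrable_on_def by (auto intro: set_integral_add(1))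

lemma weak_partial_linear:
  fixes f g :: "real^'n \<Rightarrow> 'b::euclidean_space" and L :: "'b \<Rightarrow> 'c::euclidean_space"
  assumes w: "weak_partial \<Omega> i f g" and L: "bounded_linear L"
  shows "weak_partial \<Omega> i (\<lambda>x. L (f x)) (\<lambda>x. L (g x))"
  unfolding weak_partial_def
proof (intro conjI allI impI)
  note loc = weak_partial_locally[OF w]
  show "locally_integrable_on \<Omega> (\<lambda>x. L (f x))" "locally_integrable_on \<Omega> (\<lambda>x. L (g x))"
    by (rule locally_integrable_linear[OF loc(1) L], rule locally_integrable_linear[OF loc(2) L])
  fix \<phi> :: "real^'n \<Rightarrow> real" assume \<phi>: "test_function \<Omega> \<phi>"
  interpret L: bounded_linear L by (rule L)
  have "(LINT x:\<Omega>|lebesgue. partial_deriv i \<phi> x *\<^sub>R L (f x)) = L (LINT x:\<Omega>|lebesgue. partial_deriv i \<phi> x *\<^sub>R f x)"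
    unfolding set_lebesgue_integral_def
    using integral_bounded_linear[OF L test_function_mult_integrable(2)[OF loc(1) \<phi>]] by (simp add: L.scaleR)
  also have "\<dots> = L (- (LINT x:\<Omega>|lebesgue. \<phi> x *\<^sub>R g x))"
    using w \<phi> by (simp add: weak_partial_def)
  also have "\<dots> = - (LINT x:\<Omega>|lebesgue. \<phi> x *\<^sub>R L (g x))"
    unfolding set_lebesgue_integral_def
    using integral_bounded_linear[OF L test_function_mult_integrable(1)[OF loc(2) \<phi>]] by (simp add: L.scaleR linear_neg[OF bounded_linear.linear[OF L]])
  finally show "(LINT x:\<Omega>|lebesgue. partial_deriv i \<phi> x *\<^sub>R L (f x)) = - (LINT x:\<Omega>|lebesgue. \<phi> x *\<^sub>R L (g x))" .
qed

lemma weak_partial_add: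
  fixes f g :: "real^'n \<Rightarrow> 'b::euclidean_space"
  assumes w: "weak_partial \<Omega> i f f'" "weak_partial \<Omega> i g g'"
  shows "weak_partial \<Omega> i (\<lambda>x. f x + g x) (\<lambda>x. f' x + g' x)"
  unfolding weak_partial_def
proof (intro conjI allI impI)
  note loc = weak_partial_locally[OF w(1)] weak_partial_locally[OF w(2)]
  show "locally_integrable_on \<Omega> (\<lambda>x. f x + g x)" "locally_integrable_on \<Omega> (\<lambda>x. f' x + g' x)"
    by (rule locally_integrable_add[OF loc(1,3)], rule locally_integrable_add[OF loc(2,4)])
  fix \<phi> :: "real^'n \<Rightarrow> real" assume \<phi>: "test_function \<Omega> \<phi>"
  note t = test_function_mult_integrable[OF _ \<phi>]
  have "(LINT x:\<Omega>|lebesgue. partial_deriv i \<phi> x *\<^sub>R (f x + g x)) =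
      (LINT x:\<Omega>|lebesgue. partial_deriv i \<phi> x *\<^sub>R f x) + (LINT x:\<Omega>|lebesgue. partial_deriv i \<phi> x *\<^sub>R g x)"
    unfolding set_lebesgue_integral_def scaleR_add_right
    by (rule Bochner_Integration.integral_add[OF t(2)[OF loc(1)] t(2)[OF loc(3)]])
  moreover have "(LINT x:\<Omega>|lebesgue. \<phi> x *\<^sub>R (f' x + g' x)) =
      (LINT x:\<Omega>|lebesgue. \<phi> x *\<^sub>R f' x) + (LINT x:\<Omega>|lebesgue. \<phi> x *\<^sub>R g' x)"
    unfolding set_lebesgue_integral_def scaleR_add_right
    by (rule Bochner_Integration.integral_add[OF t(1)[OF loc(2)] t(1)[OF loc(4)]])
  ultimately show "(LINT x:\<Omega>|lebesgue. partial_deriv i \<phi> x *\<^sub>R (f x + g x)) = - (LINT x:\<Omega>|lebesgue. \<phi> x *\<^sub>R (f' x + g' x))"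
    using w \<phi> by (simp add: weak_partial_def)
qed

lemma weak_partial_power:
  fixes b b' :: "real^'n \<Rightarrow> real"
  assumes \<Omega>: "open \<Omega>" "bounded \<Omega>" and b: "Linf \<Omega> b" "Linf \<Omega> b'" and w: "weak_partial \<Omega> i b b'"
  shows "weak_partial \<Omega> i (\<lambda>x. b x ^ Suc n) (\<lambda>x. real (Suc n) * b x ^ n * b' x)"
proof (induction n)
  case 0
  then show ?case using w by simp
next
  case (Suc n)
  have "weak_partial \<Omega> i (\<lambda>x. b x * b x ^ Suc n) (\<lambda>x. b' x * b x ^ Suc n + b x * (real (Suc n) * b x ^ n * b' x))"
    by (intro weak_partial_mult[OF \<Omega> _ _ _ _ w Suc] Linf_sqi_on[OF \<Omega>] Linf_mult Linf_power Linf_const b)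
  moreover have "(\<lambda>x. b' x * b x ^ Suc n + b x * (real (Suc n) * b x ^ n * b' x)) = (\<lambda>x. real (Suc (Suc n)) * b x ^ Suc n * b' x)"
    by (simp add: fun_eq_iff algebra_simps)
  ultimately show ?case by simp
qed

text \<open>Both sides of the defining identity pass to the limit by dominated convergence.\<close>

lemma weak_partial_bounded_limit:
  fixes f g :: "real^'n \<Rightarrow> real"
  assumes \<Omega>: "open \<Omega>" "bounded \<Omega>"
    and w: "\<And>n. weak_partial \<Omega> i (F n) (G n)"
    and m: "\<And>n. F n \<in> borel_measurable (lebesgue_on \<Omega>)" "\<And>n. G n \<in> borel_measurable (lebesgue_on \<Omega>)"
    and lim: "\<And>x. (\<lambda>n. F n x) \<longlonglongrightarrow> f x" "\<And>x. (\<lambda>n. G n x) \<longlonglongrightarrow> g x"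
    and bound: "AE x in lebesgue_on \<Omega>. \<forall>n. \<bar>F n x\<bar> \<le> C" "AE x in lebesgue_on \<Omega>. \<forall>n. \<bar>G n x\<bar> \<le> C"
  shows "weak_partial \<Omega> i f g"
proof -
  have lims: "Linf \<Omega> h \<and> (\<forall>\<psi>. continuous_on UNIV \<psi> \<longrightarrow> (\<exists>D. \<forall>x. \<bar>\<psi> x\<bar> \<le> D) \<longrightarrow>
      (\<lambda>n. LINT x:\<Omega>|lebesgue. \<psi> x *\<^sub>R H n x) \<longlonglongrightarrow> (LINT x:\<Omega>|lebesgue. \<psi> x *\<^sub>R h x))"
    if m: "\<And>n. H n \<in> borel_measurable (lebesgue_on \<Omega>)" and lim: "\<And>x. (\<lambda>n. H n x) \<longlonglongrightarrow> h x"
      and bound: "AE x in lebesgue_on \<Omega>. \<forall>n. \<bar>H n x\<bar> \<le> C" for H and h :: "real^'n \<Rightarrow> real"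
  proof (intro conjI allI impI)
    have hm: "h \<in> borel_measurable (lebesgue_on \<Omega>)" by (rule borel_measurable_LIMSEQ_real[OF lim m])
    show "Linf \<Omega> h"
    proof (rule LinfI[OF hm])
      show "AE x in lebesgue_on \<Omega>. \<bar>h x\<bar> \<le> C"
        using bound by eventually_elim (rule LIMSEQ_le_const2[OF tendsto_rabs[OF lim]], auto)
    qed
    fix \<psi> :: "real^'n \<Rightarrow> real" assume \<psi>: "continuous_on UNIV \<psi>" "\<exists>D. \<forall>x. \<bar>\<psi> x\<bar> \<le> D"
    then obtain D where D: "\<And>x. \<bar>\<psi> x\<bar> \<le> D" by blast
    have \<psi>m: "\<psi> \<in> borel_measurable (lebesgue_on \<Omega>)"
      using \<psi>(1) by (intro measurable_restrict_space1 measurable_completion) (simp add: borel_measurable_continuous_onI)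
    interpret finite_measure "lebesgue_on \<Omega>" by (rule finite_measure_lebesgue_on[OF \<Omega>])
    have "(\<lambda>n. \<integral>x. \<psi> x * H n x \<partial>lebesgue_on \<Omega>) \<longlonglongrightarrow> (\<integral>x. \<psi> x * h x \<partial>lebesgue_on \<Omega>)"
    proof (rule integral_dominated_convergence[where w = "\<lambda>_. D * C"])
      show "(\<lambda>x. \<psi> x * h x) \<in> borel_measurable (lebesgue_on \<Omega>)" by (intro borel_measurable_times \<psi>m hm)
      show "(\<lambda>x. \<psi> x * H n x) \<in> borel_measurable (lebesgue_on \<Omega>)" for n by (intro borel_measurable_times \<psi>m m)
      show "AE x in lebesgue_on \<Omega>. (\<lambda>n. \<psi> x * H n x) \<longlonglongrightarrow> \<psi> x * h x"
        by (intro AE_I2 tendsto_intros lim)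
      show "AE x in lebesgue_on \<Omega>. norm (\<psi> x * H n x) \<le> D * C" for n
        using bound
      proof eventually_elim
        case (elim x)
        show ?case unfolding real_norm_def abs_mult
          using D[of x] elim by (intro mult_mono) auto
      qed
    qed simp
    then show "(\<lambda>n. LINT x:\<Omega>|lebesgue. \<psi> x *\<^sub>R H n x) \<longlonglongrightarrow> (LINT x:\<Omega>|lebesgue. \<psi> x *\<^sub>R h x)"
      using \<Omega> by (simp add: set_lebesgue_integral_def integral_restrict_space)
  qed
  note F = lims[OF m(1) lim(1) bound(1)] and G = lims[OF m(2) lim(2) bound(2)]
  show ?thesis
    unfolding weak_partial_def
  proof (intro conjI allI impI)
    show "locally_integrable_on \<Omega> f" "locally_integrable_on \<Omega> g"
      using F G by (auto intro: integrable_on_imp_locally_integrable[OF \<Omega>(1)] Linf_integrable[OF \<Omega>])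
    fix \<phi> :: "real^'n \<Rightarrow> real" assume \<phi>: "test_function \<Omega> \<phi>"
    obtain D where D: "\<And>x. norm (\<phi> x) \<le> D" "\<And>x. norm (partial_deriv i \<phi> x) \<le> D"
      using test_function_bounds[OF \<phi>, of i] by metis
    have 1: "(\<lambda>n. LINT x:\<Omega>|lebesgue. partial_deriv i \<phi> x *\<^sub>R F n x) \<longlonglongrightarrow> (LINT x:\<Omega>|lebesgue. partial_deriv i \<phi> x *\<^sub>R f x)"
      by (rule F[THEN conjunct2, rule_format, OF partial_deriv_test_continuous[OF \<phi>]])
        (use D(2) in \<open>auto intro: exI[of _ D]\<close>)
    have 2: "(\<lambda>n. LINT x:\<Omega>|lebesgue. \<phi> x *\<^sub>R G n x) \<longlonglongrightarrow> (LINT x:\<Omega>|lebesgue. \<phi> x *\<^sub>R g x)"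
      by (rule G[THEN conjunct2, rule_format, OF test_function_continuous[OF \<phi>]])
        (use D(1) in \<open>auto intro: exI[of _ D]\<close>)
    have "(\<lambda>n. LINT x:\<Omega>|lebesgue. partial_deriv i \<phi> x *\<^sub>R F n x) \<longlonglongrightarrow> - (LINT x:\<Omega>|lebesgue. \<phi> x *\<^sub>R g x)"
      using tendsto_minus[OF 2] w \<phi> by (simp add: weak_partial_def)
    with 1 show "(LINT x:\<Omega>|lebesgue. partial_deriv i \<phi> x *\<^sub>R f x) = - (LINT x:\<Omega>|lebesgue. \<phi> x *\<^sub>R g x)"
      by (rule LIMSEQ_unique)
  qed
qed

text \<open>The product rule gives the derivatives of powers, and the partial sums of the
  exponential series and of their derivatives converge boundedly. The constant term of the
  series is split off, so that every summand is a power with positive exponent.\<close>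

lemma weak_partial_exp:
  fixes b b' :: "real^'n \<Rightarrow> real"
  assumes \<Omega>: "open \<Omega>" "bounded \<Omega>" and b: "Linf \<Omega> b" "Linf \<Omega> b'" and w: "weak_partial \<Omega> i b b'"
  shows "weak_partial \<Omega> i (\<lambda>x. exp (b x) - 1) (\<lambda>x. exp (b x) * b' x)"
proof -
  obtain C where C: "0 \<le> C" "b \<in> borel_measurable (lebesgue_on \<Omega>)" "AE x in lebesgue_on \<Omega>. \<bar>b x\<bar> \<le> C"
    using b(1) by (rule LinfE)
  obtain D where D: "0 \<le> D" "b' \<in> borel_measurable (lebesgue_on \<Omega>)" "AE x in lebesgue_on \<Omega>. \<bar>b' x\<bar> \<le> D"
    using b(2) by (rule LinfE)
  define F where "F n x = (\<Sum>k\<le>n. b x ^ Suc k / fact (Suc k))" for n x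
  define G where "G n x = (\<Sum>k\<le>n. b x ^ k / fact k * b' x)" for n x
  have es: "(\<lambda>k. t ^ k / fact k) sums exp t" for t :: real
    using exp_converges[of t] by (simp add: divide_inverse mult.commute)
  have partial: "(\<Sum>k\<le>n. \<bar>t\<bar> ^ k / fact k) \<le> exp \<bar>t\<bar>" for t :: real and n
    using sum_le_suminf[OF sums_summable[OF es], of "{..n}" "\<bar>t\<bar>"] sums_unique[OF es, of "\<bar>t\<bar>"] by simp
  have summand: "weak_partial \<Omega> i (\<lambda>x. b x ^ Suc k / fact (Suc k)) (\<lambda>x. b x ^ k / fact k * b' x)" for k
  proof -
    have "weak_partial \<Omega> i (\<lambda>x. inverse (fact (Suc k)) * b x ^ Suc k) (\<lambda>x. inverse (fact (Suc k)) * (real (Suc k) * b x ^ k * b' x))"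
      by (rule weak_partial_linear[OF weak_partial_power[OF \<Omega> b w] bounded_linear_mult_right])
    moreover have "(\<lambda>x. inverse (fact (Suc k)) * b x ^ Suc k) = (\<lambda>x. b x ^ Suc k / fact (Suc k))"
      by (rule ext) (simp only: divide_inverse mult.commute)
    moreover have inv: "inverse (fact (Suc k)) * real (Suc k) = inverse (fact k)"
    proof -
      have "inverse (a * f) * a = inverse f" if "a \<noteq> 0" for a f :: real
        using that by simp
      from this[of "real (Suc k)" "fact k"] show ?thesis by simp
    qed
    from inv have "(\<lambda>x. inverse (fact (Suc k)) * (real (Suc k) * b x ^ k * b' x)) = (\<lambda>x. b x ^ k / fact k * b' x)"
      by (simp only: mult.assoc[symmetric] divide_inverse) (simp only: mult.commute[of "inverse (fact k)"])
    ultimately show ?thesis by (simp only:)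
  qed
  have 1: "weak_partial \<Omega> i (F n) (G n)" for n
  proof (induction n)
    case 0
    have "F 0 = (\<lambda>x. b x ^ Suc 0 / fact (Suc 0))" "G 0 = (\<lambda>x. b x ^ 0 / fact 0 * b' x)"
      by (simp_all add: F_def G_def fun_eq_iff)
    then show ?case using summand[of 0] by (simp only:)
  next
    case (Suc n)
    have "F (Suc n) = (\<lambda>x. F n x + b x ^ Suc (Suc n) / fact (Suc (Suc n)))"
      "G (Suc n) = (\<lambda>x. G n x + b x ^ Suc n / fact (Suc n) * b' x)"
      by (simp_all only: F_def G_def fun_eq_iff sum.atMost_Suc simp_thms)
    then show ?case using weak_partial_add[OF Suc summand[of "Suc n"]] by (simp only:)
  qed
  have 2: "F n \<in> borel_measurable (lebesgue_on \<Omega>)" "G n \<in> borel_measurable (lebesgue_on \<Omega>)" for n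
    unfolding F_def G_def
    using C(2) D(2) by measurable
  have 3: "(\<lambda>n. F n x) \<longlonglongrightarrow> exp (b x) - 1" for x
  proof -
    have "(\<lambda>k. b x ^ Suc k / fact (Suc k)) sums (exp (b x) - 1)"
      using es[of "b x"] by (subst sums_Suc_iff) simp
    then show ?thesis by (simp add: sums_def_le F_def)
  qed
  have 4: "(\<lambda>n. G n x) \<longlonglongrightarrow> exp (b x) * b' x" for x
    using sums_mult2[OF es[of "b x"], of "b' x"] by (simp add: sums_def_le G_def)
  define E where "E = max (exp C * C) (exp C * D)"
  have 5: "AE x in lebesgue_on \<Omega>. \<forall>n. \<bar>F n x\<bar> \<le> E"
    using C(3)
  proof eventually_elim
    case (elim x)
    show ?case
    proof
      fix n
      have "\<bar>F n x\<bar> \<le> (\<Sum>k\<le>n. \<bar>b x\<bar> ^ k / fact k * \<bar>b x\<bar>)"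
        unfolding F_def
      proof (rule order_trans[OF sum_abs sum_mono])
        fix k
        have "\<bar>b x ^ Suc k / fact (Suc k)\<bar> = \<bar>b x\<bar> ^ k * \<bar>b x\<bar> / fact (Suc k)"
          by (simp add: abs_mult power_abs mult.commute)
        also have "\<dots> \<le> \<bar>b x\<bar> ^ k * \<bar>b x\<bar> / fact k"
          by (intro divide_left_mono fact_mono) auto
        finally show "\<bar>b x ^ Suc k / fact (Suc k)\<bar> \<le> \<bar>b x\<bar> ^ k / fact k * \<bar>b x\<bar>" by simp
      qed
      also have "\<dots> = (\<Sum>k\<le>n. \<bar>b x\<bar> ^ k / fact k) * \<bar>b x\<bar>" by (simp only: sum_distrib_right)
      also have "\<dots> \<le> exp C * C"
        using elim by (intro mult_mono order_trans[OF partial]) auto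
      finally show "\<bar>F n x\<bar> \<le> E" by (simp add: E_def)
    qed
  qed
  have 6: "AE x in lebesgue_on \<Omega>. \<forall>n. \<bar>G n x\<bar> \<le> E"
    using C(3) D(3)
  proof eventually_elim
    case (elim x)
    show ?case
    proof
      fix n
      have "\<bar>G n x\<bar> \<le> (\<Sum>k\<le>n. \<bar>b x\<bar> ^ k / fact k * \<bar>b' x\<bar>)"
        unfolding G_def by (rule order_trans[OF sum_abs]) (simp add: abs_mult power_abs)
      also have "\<dots> = (\<Sum>k\<le>n. \<bar>b x\<bar> ^ k / fact k) * \<bar>b' x\<bar>" by (simp only: sum_distrib_right)
      also have "\<dots> \<le> exp C * D"
        using elim by (intro mult_mono order_trans[OF partial]) auto
      finally show "\<bar>G n x\<bar> \<le> E" by (simp add: E_def)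
    qed
  qed
  show ?thesis by (rule weak_partial_bounded_limit[OF \<Omega> 1 2 3 4 5 6])
qed

theorem weak_partial_exp_mult:
  fixes b b' f f' :: "real^'n \<Rightarrow> real"
  assumes \<Omega>: "open \<Omega>" "bounded \<Omega>" and b: "Linf \<Omega> b" "Linf \<Omega> b'" "weak_partial \<Omega> i b b'"
    and f: "sqi_on \<Omega> f" "sqi_on \<Omega> f'" "weak_partial \<Omega> i f f'"
  shows "weak_partial \<Omega> i (\<lambda>x. exp (b x) * f x) (\<lambda>x. exp (b x) * b' x * f x + exp (b x) * f' x)"
proof -
  have e1: "Linf \<Omega> (\<lambda>x. exp (b x) - 1)"
    using Linf_add[OF Linf_exp[OF b(1)] Linf_const[of \<Omega> "-1"]] by simp
  have "weak_partial \<Omega> i (\<lambda>x. (exp (b x) - 1) * f x) (\<lambda>x. exp (b x) * b' x * f x + (exp (b x) - 1) * f' x)"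
    by (intro weak_partial_mult[OF \<Omega> _ _ f(1,2) weak_partial_exp[OF \<Omega> b] f(3)] Linf_sqi_on[OF \<Omega>] e1 Linf_mult Linf_exp b)
  from weak_partial_add[OF this f(3)] show ?thesis
    by (simp add: algebra_simps)
qed


section \<open>Weighted integration by parts\<close>

lemma square_integrable_test:
  fixes \<phi> :: "real^'n \<Rightarrow> complex"
  assumes "continuous_on UNIV \<phi>" "compact K" "\<And>x. x \<notin> K \<Longrightarrow> \<phi> x = 0"
  shows "square_integrable \<phi>"
proof -
  obtain C where C: "\<And>x. norm (\<phi> x) \<le> C" using compact_support_bounded[OF assms] by metis
  obtain R where R: "\<And>x. x \<in> K \<Longrightarrow> norm x \<le> R"
    using compact_imp_bounded[OF assms(2)] unfolding bounded_iff by blast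
  have b: "\<phi> \<in> borel_measurable borel" by (rule borel_measurable_continuous_onI[OF assms(1)])
  have "sqi (\<lambda>x. norm (\<phi> x))"
  proof (rule bounded_support_sqi)
    show "(\<lambda>x. norm (\<phi> x)) \<in> borel_measurable borel" using b by measurable
    show "\<bar>norm (\<phi> x)\<bar> \<le> C" for x using C by simp
    show "norm (\<phi> x) = 0" if "R < norm x" for x using that R[of x] assms(3)[of x] by fastforce
  qed
  then have "integrable lebesgue (\<lambda>x. (norm (\<phi> x))\<^sup>2)"
    using b by (subst integrable_completion) (auto simp: sqi_def)
  then show ?thesis
    using b by (auto simp: square_integrable_def intro: measurable_completion)
qed

lemma test_function_square_integrable:
  fixes \<phi> :: "real^'n \<Rightarrow> complex"
  assumes \<phi>: "test_function \<Omega> \<phi>"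
  shows "square_integrable \<phi>" "square_integrable (partial_deriv i \<phi>)"
proof -
  have K: "compact (closure {x. \<phi> x \<noteq> 0})" using \<phi> by (simp add: test_function_def)
  have out: "\<phi> x = 0" if "x \<notin> closure {x. \<phi> x \<noteq> 0}" for x
    using that closure_subset[of "{x. \<phi> x \<noteq> 0}"] by blast
  show "square_integrable \<phi>" by (rule square_integrable_test[OF test_function_continuous[OF \<phi>] K out])
  show "square_integrable (partial_deriv i \<phi>)"
    by (rule square_integrable_test[OF partial_deriv_test_continuous[OF \<phi>] K partial_deriv_outside_support])
qed

text \<open>Weak derivatives of products have been computed for real functions only, so that complex
  functions are split into real and imaginary parts; \<open>L\<close> is either of the two projections.\<close>

lemma square_integrable_linear_mult:
  fixes u v :: "'a::euclidean_space \<Rightarrow> complex" and L :: "complex \<Rightarrow> real"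
  assumes u: "square_integrable u" and v: "square_integrable v" and L: "L = Re \<or> L = Im"
    and a: "a \<in> borel_measurable lebesgue" "\<And>x. \<bar>a x\<bar> \<le> C"
  shows "integrable lebesgue (\<lambda>x. a x * (L (u x) * L (v x)))"
proof (rule Bochner_Integration.integrable_bound)
  have Lm: "L \<in> borel_measurable borel" using L by (auto intro: borel_measurable_continuous_onI continuous_intros)
  have m: "u \<in> borel_measurable lebesgue" "v \<in> borel_measurable lebesgue"
    using u v by (simp_all add: square_integrable_def)
  show "integrable lebesgue (\<lambda>x. C * ((norm (u x))\<^sup>2 + (norm (v x))\<^sup>2))"
    using u v by (simp add: square_integrable_def)
  show "(\<lambda>x. a x * (L (u x) * L (v x))) \<in> borel_measurable lebesgue"
    by (intro borel_measurable_times a measurable_compose[OF m(1) Lm] measurable_compose[OF m(2) Lm])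
  show "AE x in lebesgue. norm (a x * (L (u x) * L (v x))) \<le> norm (C * ((norm (u x))\<^sup>2 + (norm (v x))\<^sup>2))"
  proof (rule AE_I2)
    fix x
    have "\<bar>L z\<bar> \<le> norm z" for z using L abs_Re_le_cmod abs_Im_le_cmod by auto
    then have "\<bar>L (u x)\<bar> * \<bar>L (v x)\<bar> \<le> norm (u x) * norm (v x)" by (intro mult_mono) auto
    also have "\<dots> \<le> (norm (u x))\<^sup>2 + (norm (v x))\<^sup>2"
    proof -
      have "0 \<le> norm (u x) * norm (v x)" by simp
      then show ?thesis using two_abs_mult_le[of "norm (u x)" "norm (v x)"] by linarith
    qed
    finally have "\<bar>a x\<bar> * (\<bar>L (u x)\<bar> * \<bar>L (v x)\<bar>) \<le> C * ((norm (u x))\<^sup>2 + (norm (v x))\<^sup>2)"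
      using a(2)[of x] by (intro mult_mono) auto
    then show "norm (a x * (L (u x) * L (v x))) \<le> norm (C * ((norm (u x))\<^sup>2 + (norm (v x))\<^sup>2))"
      unfolding real_norm_def abs_mult[of "a x"] abs_mult[of "L (u x)"] by linarith
  qed
qed

lemma inner_weighted_split:
  assumes w: "w \<in> borel_measurable lebesgue" "\<And>x. \<bar>w x\<bar> \<le> C" and \<psi>: "square_integrable \<psi>"
  shows "inner (mult_L2 w u) (mult_L2 w (abs_L2 \<psi>)) =
    (\<integral>x. (w x)\<^sup>2 * (Re (rep_L2 u x) * Re (\<psi> x)) \<partial>lebesgue) + (\<integral>x. (w x)\<^sup>2 * (Im (rep_L2 u x) * Im (\<psi> x)) \<partial>lebesgue)"
proof -
  have w2: "(\<lambda>x. (w x)\<^sup>2) \<in> borel_measurable lebesgue" "\<And>x. \<bar>(w x)\<^sup>2\<bar> \<le> C\<^sup>2"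
    using w power_mono[OF w(2), of _ 2] by (auto intro: borel_measurable_power)
  note i = square_integrable_linear_mult[OF square_integrable_rep[of u] \<psi> _ w2]
  have "inner (mult_L2 w u) (mult_L2 w (abs_L2 \<psi>)) = (\<integral>x. (w x)\<^sup>2 * inner (rep_L2 u x) (rep_L2 (abs_L2 \<psi>) x) \<partial>lebesgue)"
    by (rule inner_mult_L2[OF w])
  also have "\<dots> = (\<integral>x. (w x)\<^sup>2 * (Re (rep_L2 u x) * Re (\<psi> x)) + (w x)\<^sup>2 * (Im (rep_L2 u x) * Im (\<psi> x)) \<partial>lebesgue)"
  proof (rule integral_cong_AE)
    show "AE x in lebesgue. (w x)\<^sup>2 * inner (rep_L2 u x) (rep_L2 (abs_L2 \<psi>) x) =
        (w x)\<^sup>2 * (Re (rep_L2 u x) * Re (\<psi> x)) + (w x)\<^sup>2 * (Im (rep_L2 u x) * Im (\<psi> x))"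
      using rep_abs_L2[OF \<psi>] by eventually_elim (simp add: inner_complex_def distrib_left)
    show "(\<lambda>x. (w x)\<^sup>2 * inner (rep_L2 u x) (rep_L2 (abs_L2 \<psi>) x)) \<in> borel_measurable lebesgue"
      by (intro borel_measurable_times w2 borel_measurable_inner measurable_rep_L2)
    show "(\<lambda>x. (w x)\<^sup>2 * (Re (rep_L2 u x) * Re (\<psi> x)) + (w x)\<^sup>2 * (Im (rep_L2 u x) * Im (\<psi> x))) \<in> borel_measurable lebesgue"
      by (intro borel_measurable_add borel_measurable_integrable i) auto
  qed
  also have "\<dots> = (\<integral>x. (w x)\<^sup>2 * (Re (rep_L2 u x) * Re (\<psi> x)) \<partial>lebesgue) + (\<integral>x. (w x)\<^sup>2 * (Im (rep_L2 u x) * Im (\<psi> x)) \<partial>lebesgue)"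
    by (rule Bochner_Integration.integral_add) (rule i, simp)+
  finally show ?thesis .
qed

lemma sqi_on_rep:
  assumes \<Omega>: "open \<Omega>" and L: "L = Re \<or> L = Im"
  shows "sqi_on \<Omega> (\<lambda>x. L (rep_L2 u x))"
proof -
  have Lm: "L \<in> borel_measurable borel" using L by (auto intro: borel_measurable_continuous_onI continuous_intros)
  have m: "(\<lambda>x. L (rep_L2 u x)) \<in> borel_measurable lebesgue"
    by (rule measurable_compose[OF measurable_rep_L2 Lm])
  have "integrable lebesgue (\<lambda>x. 1 * (L (rep_L2 u x) * L (rep_L2 u x)))"
    by (rule square_integrable_linear_mult[OF square_integrable_rep square_integrable_rep L, of _ 1]) auto
  then have "integrable lebesgue (\<lambda>x. (L (rep_L2 u x))\<^sup>2)" by (simp add: power2_eq_square)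
  then have "integrable lebesgue (\<lambda>x. indicator \<Omega> x *\<^sub>R (L (rep_L2 u x))\<^sup>2)"
    using \<Omega> by (intro integrable_mult_indicator) auto
  then have "integrable (lebesgue_on \<Omega>) (\<lambda>x. (L (rep_L2 u x))\<^sup>2)"
    using \<Omega> by (subst integrable_restrict_space) auto
  then show ?thesis
    using m by (simp add: sqi_on_def measurable_restrict_space1)
qed

text \<open>The flux \<open>A \<nabla>u\<close> enters the definition of the operator as a function and the energy
  identity below as an element of \<open>L\<^sup>2\<close>; the two agree almost everywhere only.\<close>

lemma weak_partial_cong_AE:
  fixes f f' :: "real^'n \<Rightarrow> 'b::euclidean_space"
  assumes \<Omega>: "open \<Omega>" and w: "weak_partial \<Omega> i f g" and eq: "AE x in lebesgue_on \<Omega>. f x = f' x"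
    and m: "f' \<in> borel_measurable lebesgue"
  shows "weak_partial \<Omega> i f' g"
proof -
  have ae: "AE x in lebesgue. x \<in> \<Omega> \<longrightarrow> f x = f' x"
    using eq \<Omega> by (subst (asm) AE_restrict_space_iff) auto
  have loc: "locally_integrable_on \<Omega> f'"
    unfolding locally_integrable_on_def
  proof (intro allI impI)
    fix K assume K: "compact K \<and> K \<subseteq> \<Omega>"
    have "integrable lebesgue (\<lambda>x. indicator K x *\<^sub>R f x)"
      using weak_partial_locally(1)[OF w] K unfolding locally_integrable_on_def set_integrable_def by blast
    then have "integrable lebesgue (\<lambda>x. indicator K x *\<^sub>R f' x)"
    proof (rule integrable_cong_AE_imp)
      show "(\<lambda>x. indicator K x *\<^sub>R f' x) \<in> borel_measurable lebesgue"
        using K by (intro borel_measurable_scaleR borel_measurable_indicator m fmeasurableD lmeasurable_compact) auto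
      show "AE x in lebesgue. indicator K x *\<^sub>R f x = indicator K x *\<^sub>R f' x"
        using ae by eventually_elim (use K in \<open>auto simp: indicator_def\<close>)
    qed
    then show "set_integrable lebesgue K f'" by (simp add: set_integrable_def)
  qed
  have "(LINT x:\<Omega>|lebesgue. partial_deriv i \<phi> x *\<^sub>R f' x) = (LINT x:\<Omega>|lebesgue. partial_deriv i \<phi> x *\<^sub>R f x)"
    if \<phi>: "test_function \<Omega> \<phi>" for \<phi> :: "real^'n \<Rightarrow> real"
    unfolding set_lebesgue_integral_def
  proof (rule integral_cong_AE)
    show "AE x in lebesgue. indicator \<Omega> x *\<^sub>R (partial_deriv i \<phi> x *\<^sub>R f' x) = indicator \<Omega> x *\<^sub>R (partial_deriv i \<phi> x *\<^sub>R f x)"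
      using ae by eventually_elim (auto simp: indicator_def)
  qed (intro borel_measurable_integrable test_function_mult_integrable(2)[OF loc \<phi>]
        test_function_mult_integrable(2)[OF weak_partial_locally(1)[OF w] \<phi>])+
  then show ?thesis
    using w loc by (simp add: weak_partial_def)
qed

text \<open>The weak derivative of \<open>e\<^sup>b L(F)\<close> is \<open>e\<^sup>b (\<beta> L(F) + L(h))\<close> by \<open>weak_partial_exp_mult\<close>;
  this is its definition, tested with \<open>L(\<phi>)\<close>.\<close>

lemma weighted_parts_component:
  fixes \<phi> :: "real^'n \<Rightarrow> complex" and b bi :: "real^'n \<Rightarrow> real"
  assumes \<Omega>: "open \<Omega>" "bounded \<Omega>"
    and b: "Linf \<Omega> b" "Linf \<Omega> bi" "weak_partial \<Omega> i b bi"
    and w: "w \<in> borel_measurable lebesgue" "\<And>x. \<bar>w x\<bar> \<le> C" "\<And>x. x \<notin> \<Omega> \<Longrightarrow> w x = 0"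
      "AE x in lebesgue_on \<Omega>. (w x)\<^sup>2 = exp (b x)"
    and \<beta>: "\<beta> \<in> borel_measurable lebesgue" "\<And>x. \<bar>\<beta> x\<bar> \<le> D" "AE x in lebesgue_on \<Omega>. \<beta> x = bi x"
    and F: "weak_partial \<Omega> i (rep_L2 F) (rep_L2 h)"
    and \<phi>: "test_function \<Omega> \<phi>" and L: "L = Re \<or> L = Im"
  shows "(\<integral>x. (w x)\<^sup>2 * (L (rep_L2 F x) * L (partial_deriv i \<phi> x)) \<partial>lebesgue) =
     - (\<integral>x. (w x)\<^sup>2 * (L (rep_L2 (mult_L2 \<beta> F) x) * L (\<phi> x)) \<partial>lebesgue)
     - (\<integral>x. (w x)\<^sup>2 * (L (rep_L2 h x) * L (\<phi> x)) \<partial>lebesgue)"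
proof -
  have Lb: "bounded_linear L" using L bounded_linear_Re bounded_linear_Im by auto
  have Lm: "L \<in> borel_measurable borel" using L by (auto intro: borel_measurable_continuous_onI continuous_intros)
  have w2: "(\<lambda>x. (w x)\<^sup>2) \<in> borel_measurable lebesgue" "\<And>x. \<bar>(w x)\<^sup>2\<bar> \<le> C\<^sup>2"
    using w power_mono[OF w(2), of _ 2] by (auto intro: borel_measurable_power)
  have t: "test_function \<Omega> (\<lambda>x. L (\<phi> x))" by (rule test_function_linear[OF \<phi> Lb])
  have pd: "partial_deriv i (\<lambda>x. L (\<phi> x)) x = L (partial_deriv i \<phi> x)" for x
    by (rule partial_deriv_linear[OF Lb test_function_differentiable[OF \<phi>]])
  note ss = test_function_square_integrable[OF \<phi>]
  have W: "weak_partial \<Omega> i (\<lambda>x. exp (b x) * L (rep_L2 F x))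
      (\<lambda>x. exp (b x) * bi x * L (rep_L2 F x) + exp (b x) * L (rep_L2 h x))"
    by (rule weak_partial_exp_mult[OF \<Omega> b sqi_on_rep[OF \<Omega>(1) L] sqi_on_rep[OF \<Omega>(1) L] weak_partial_linear[OF F Lb]])
  have ae: "AE x in lebesgue. x \<in> \<Omega> \<longrightarrow> (w x)\<^sup>2 = exp (b x) \<and> \<beta> x = bi x"
    using w(4) \<beta>(3) \<Omega> by (subst (asm) (1 2) AE_restrict_space_iff) auto
  have i1: "integrable lebesgue (\<lambda>x. (w x)\<^sup>2 * (L (rep_L2 F x) * L (partial_deriv i \<phi> x)))"
    and i2: "integrable lebesgue (\<lambda>x. (w x)\<^sup>2 * (L (rep_L2 (mult_L2 \<beta> F) x) * L (\<phi> x)))"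
    and i3: "integrable lebesgue (\<lambda>x. (w x)\<^sup>2 * (L (rep_L2 h x) * L (\<phi> x)))"
    by (intro square_integrable_linear_mult[OF _ _ L w2] square_integrable_rep ss)+
  have "(LINT x:\<Omega>|lebesgue. partial_deriv i (\<lambda>x. L (\<phi> x)) x *\<^sub>R (exp (b x) * L (rep_L2 F x))) =
      (\<integral>x. (w x)\<^sup>2 * (L (rep_L2 F x) * L (partial_deriv i \<phi> x)) \<partial>lebesgue)"
    unfolding set_lebesgue_integral_def
  proof (rule integral_cong_AE)
    show "AE x in lebesgue. indicator \<Omega> x *\<^sub>R (partial_deriv i (\<lambda>x. L (\<phi> x)) x *\<^sub>R (exp (b x) * L (rep_L2 F x))) =
        (w x)\<^sup>2 * (L (rep_L2 F x) * L (partial_deriv i \<phi> x))"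
      using ae
    proof eventually_elim
      case (elim x)
      then show ?case using w(3)[of x] by (cases "x \<in> \<Omega>") (simp_all add: pd)
    qed
    show "(\<lambda>x. indicator \<Omega> x *\<^sub>R (partial_deriv i (\<lambda>x. L (\<phi> x)) x *\<^sub>R (exp (b x) * L (rep_L2 F x)))) \<in> borel_measurable lebesgue"
      by (rule borel_measurable_integrable[OF test_function_mult_integrable(2)[OF weak_partial_locally(1)[OF W] t]])
  qed (rule borel_measurable_integrable[OF i1])
  moreover have "(LINT x:\<Omega>|lebesgue. L (\<phi> x) *\<^sub>R (exp (b x) * bi x * L (rep_L2 F x) + exp (b x) * L (rep_L2 h x))) =
      (\<integral>x. (w x)\<^sup>2 * (L (rep_L2 (mult_L2 \<beta> F) x) * L (\<phi> x)) + (w x)\<^sup>2 * (L (rep_L2 h x) * L (\<phi> x)) \<partial>lebesgue)"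
    unfolding set_lebesgue_integral_def
  proof (rule integral_cong_AE)
    show "AE x in lebesgue. indicator \<Omega> x *\<^sub>R (L (\<phi> x) *\<^sub>R (exp (b x) * bi x * L (rep_L2 F x) + exp (b x) * L (rep_L2 h x))) =
        (w x)\<^sup>2 * (L (rep_L2 (mult_L2 \<beta> F) x) * L (\<phi> x)) + (w x)\<^sup>2 * (L (rep_L2 h x) * L (\<phi> x))"
      using ae rep_mult_L2[OF \<beta>(1,2), of F]
    proof eventually_elim
      case (elim x)
      have "L (\<beta> x *\<^sub>R rep_L2 F x) = \<beta> x * L (rep_L2 F x)"
        by (simp only: bounded_linear.linear[OF Lb, THEN linear_scale] real_scaleR_def)
      then show ?case using elim w(3)[of x] by (cases "x \<in> \<Omega>") (simp_all add: algebra_simps del: scaleR_conv_of_real)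
    qed
    show "(\<lambda>x. indicator \<Omega> x *\<^sub>R (L (\<phi> x) *\<^sub>R (exp (b x) * bi x * L (rep_L2 F x) + exp (b x) * L (rep_L2 h x)))) \<in> borel_measurable lebesgue"
      by (rule borel_measurable_integrable[OF test_function_mult_integrable(1)[OF weak_partial_locally(2)[OF W] t]])
  qed (rule borel_measurable_integrable[OF Bochner_Integration.integrable_add[OF i2 i3]])
  moreover have "(LINT x:\<Omega>|lebesgue. partial_deriv i (\<lambda>x. L (\<phi> x)) x *\<^sub>R (exp (b x) * L (rep_L2 F x))) =
      - (LINT x:\<Omega>|lebesgue. L (\<phi> x) *\<^sub>R (exp (b x) * bi x * L (rep_L2 F x) + exp (b x) * L (rep_L2 h x)))"
    using W t unfolding weak_partial_def by blast
  ultimately show ?thesis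
    using Bochner_Integration.integral_add[OF i2 i3] by simp
qed

text \<open>The adjoint of \<open>\<partial>\<^sub>i\<close> for the weight \<open>e\<^sup>b = w\<^sup>2\<close> is \<open>- \<partial>\<^sub>i - \<beta>\<close>, where \<open>\<beta> = \<partial>\<^sub>i b\<close>.\<close>

theorem weighted_parts:
  fixes \<phi> :: "real^'n \<Rightarrow> complex" and b bi :: "real^'n \<Rightarrow> real"
  assumes \<Omega>: "open \<Omega>" "bounded \<Omega>"
    and b: "Linf \<Omega> b" "Linf \<Omega> bi" "weak_partial \<Omega> i b bi"
    and w: "w \<in> borel_measurable lebesgue" "\<And>x. \<bar>w x\<bar> \<le> C" "\<And>x. x \<notin> \<Omega> \<Longrightarrow> w x = 0"
      "AE x in lebesgue_on \<Omega>. (w x)\<^sup>2 = exp (b x)"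
    and \<beta>: "\<beta> \<in> borel_measurable lebesgue" "\<And>x. \<bar>\<beta> x\<bar> \<le> D" "AE x in lebesgue_on \<Omega>. \<beta> x = bi x"
    and F: "weak_partial \<Omega> i (rep_L2 F) (rep_L2 h)"
    and \<phi>: "test_function \<Omega> \<phi>"
  shows "inner (mult_L2 w F) (mult_L2 w (abs_L2 (partial_deriv i \<phi>))) =
     - inner (mult_L2 w (mult_L2 \<beta> F)) (mult_L2 w (abs_L2 \<phi>)) - inner (mult_L2 w h) (mult_L2 w (abs_L2 \<phi>))"
  unfolding inner_weighted_split[OF w(1,2) test_function_square_integrable(1)[OF \<phi>]]
    inner_weighted_split[OF w(1,2) test_function_square_integrable(2)[OF \<phi>]]
  using weighted_parts_component[OF \<Omega> b w \<beta> F \<phi>, of Re] weighted_parts_component[OF \<Omega> b w \<beta> F \<phi>, of Im]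
  by simp

lemma weak_partial_unique_L2:
  assumes \<Omega>: "open \<Omega>" and w: "weak_partial \<Omega> i (rep_L2 u) (rep_L2 g)" "weak_partial \<Omega> i (rep_L2 u) (rep_L2 g')"
    and X: "g \<in> L2_space \<Omega>" "g' \<in> L2_space \<Omega>"
  shows "g = g'"
proof (rule L2_eqI)
  have *: "AE x in lebesgue. x \<in> \<Omega> \<longrightarrow> L (rep_L2 g x) = L (rep_L2 g' x)" if L: "L = Re \<or> L = Im" for L
  proof -
    have Lb: "bounded_linear L" using L bounded_linear_Re bounded_linear_Im by auto
    have "AE x in lebesgue_on \<Omega>. L (rep_L2 g x) = L (rep_L2 g' x)"
      by (rule weak_partial_unique[OF \<Omega> weak_partial_linear[OF w(1) Lb] weak_partial_linear[OF w(2) Lb]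
            sqi_on_rep[OF \<Omega> L] sqi_on_rep[OF \<Omega> L]])
    then show ?thesis using \<Omega> by (subst (asm) AE_restrict_space_iff) auto
  qed
  have r: "AE x in lebesgue. x \<in> \<Omega> \<longrightarrow> Re (rep_L2 g x) = Re (rep_L2 g' x)"
    and i: "AE x in lebesgue. x \<in> \<Omega> \<longrightarrow> Im (rep_L2 g x) = Im (rep_L2 g' x)"
    using *[of Re] *[of Im] by auto
  have o: "AE x in lebesgue. x \<notin> \<Omega> \<longrightarrow> rep_L2 g x = 0" "AE x in lebesgue. x \<notin> \<Omega> \<longrightarrow> rep_L2 g' x = 0"
    using X by (simp_all add: L2_space_def)
  show "AE x in lebesgue. rep_L2 g x = rep_L2 g' x"
    using r i o
  proof eventually_elim
    case (elim x)
    then show ?case by (cases "x \<in> \<Omega>") (simp_all add: complex_eq_iff)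
  qed
qed


section \<open>The operator in the weighted space\<close>

lemma Linf_bounded_version:
  assumes \<Omega>: "open \<Omega>" and f: "f \<in> borel_measurable (lebesgue_on \<Omega>)" "AE x in lebesgue_on \<Omega>. \<bar>f x\<bar> \<le> C" and C: "0 \<le> C"
  shows "\<exists>g :: 'a::euclidean_space \<Rightarrow> real. g \<in> borel_measurable lebesgue \<and> (\<forall>x. \<bar>g x\<bar> \<le> C) \<and>
    (\<forall>x. x \<notin> \<Omega> \<longrightarrow> g x = 0) \<and> (AE x in lebesgue_on \<Omega>. g x = f x)"
proof -
  define h where "h x = (if x \<in> \<Omega> then f x else 0)" for x
  define g where "g x = (if \<bar>h x\<bar> \<le> C then h x else 0)" for x
  have L: "\<Omega> \<in> sets lebesgue" using \<Omega> by auto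
  have hm [measurable]: "h \<in> borel_measurable lebesgue"
    unfolding h_def using f L by (intro borel_measurable_if_I) auto
  have "g \<in> borel_measurable lebesgue" unfolding g_def by measurable
  moreover have "AE x in lebesgue. x \<in> \<Omega> \<longrightarrow> g x = f x"
    using f(2) \<Omega> by (subst (asm) AE_restrict_space_iff) (auto simp: g_def h_def elim: eventually_mono)
  then have "AE x in lebesgue_on \<Omega>. g x = f x"
    using \<Omega> by (subst AE_restrict_space_iff) auto
  ultimately show ?thesis
    using C by (intro exI[of _ g]) (auto simp: g_def h_def)
qed

lemma rep_L2_sum:
  fixes f :: "'i \<Rightarrow> 'a::euclidean_space L2"
  assumes "finite I"
  shows "AE x in lebesgue. rep_L2 (\<Sum>i\<in>I. f i) x = (\<Sum>i\<in>I. rep_L2 (f i) x)"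
  using assms
proof (induction I)
  case empty
  have "AE x in lebesgue. rep_L2 (0::'a L2) x = 0"
    using rep_L2_scaleR[of 0 "0::'a L2"] by simp
  then show ?case by simp
next
  case (insert i I)
  have "AE x in lebesgue. rep_L2 (f i + (\<Sum>i\<in>I. f i)) x = rep_L2 (f i) x + rep_L2 (\<Sum>i\<in>I. f i) x"
    by (rule rep_L2_plus)
  with insert.IH show ?case
    using insert.hyps by (simp add: eventually_conj_iff) (auto elim!: eventually_elim2)
qed

text \<open>The elliptic operator together with representatives \<open>w\<close>, \<open>a\<close>, \<open>\<beta>\<close>, \<open>q\<close> of \<open>e\<^sup>b\<^sup>/\<^sup>2\<close>, \<open>A\<close>,
  \<open>\<nabla>b\<close>, \<open>p\<close> that are bounded everywhere and defined on the whole space, as needed for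
  multiplication operators.\<close>

locale weighted_elliptic =
  fixes \<Omega> :: "(real^'n) set" and A :: "real^'n \<Rightarrow> real^'n^'n" and B :: "real^'n \<Rightarrow> real^'n" and p b :: "real^'n \<Rightarrow> real"
    and Db :: "'n \<Rightarrow> real^'n \<Rightarrow> real"
    and w :: "real^'n \<Rightarrow> real" and a :: "'n \<Rightarrow> 'n \<Rightarrow> real^'n \<Rightarrow> real" and \<beta> :: "'n \<Rightarrow> real^'n \<Rightarrow> real" and q :: "real^'n \<Rightarrow> real"
    and Cw Ca C\<beta> M :: real
  assumes \<Omega>: "open \<Omega>" "bounded \<Omega>"
    and b: "Linf \<Omega> b" "\<And>i. Linf \<Omega> (Db i)" "\<And>i. weak_partial \<Omega> i b (Db i)"
    and w: "w \<in> borel_measurable lebesgue" "\<And>x. \<bar>w x\<bar> \<le> Cw" "\<And>x. x \<notin> \<Omega> \<Longrightarrow> w x = 0"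
      "AE x in lebesgue_on \<Omega>. (w x)\<^sup>2 = exp (b x)"
    and a: "\<And>i j. a i j \<in> borel_measurable lebesgue" "\<And>i j x. \<bar>a i j x\<bar> \<le> Ca" "\<And>i j x. a i j x = a j i x"
      "\<And>i j x. x \<in> \<Omega> \<Longrightarrow> a i j x = A x $ i $ j"
      "\<And>x (\<xi> :: 'n \<Rightarrow> real). 0 \<le> (\<Sum>i\<in>UNIV. \<Sum>j\<in>UNIV. a i j x * \<xi> i * \<xi> j)"
    and \<beta>: "\<And>i. \<beta> i \<in> borel_measurable lebesgue" "\<And>i x. \<bar>\<beta> i x\<bar> \<le> C\<beta>" "\<And>i x. x \<notin> \<Omega> \<Longrightarrow> \<beta> i x = 0"
      "\<And>i. AE x in lebesgue_on \<Omega>. \<beta> i x = Db i x"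
    and q: "q \<in> borel_measurable lebesgue" "\<And>x. \<bar>q x\<bar> \<le> M" "\<And>x. x \<notin> \<Omega> \<Longrightarrow> q x = 0"
      "AE x in lebesgue_on \<Omega>. q x = p x"
    and B: "AE x in lebesgue_on \<Omega>. \<forall>j. B x $ j = (\<Sum>i\<in>UNIV. a j i x * \<beta> i x)"
begin

abbreviation E where "E \<equiv> mult_L2 w"

definition flux :: "('n \<Rightarrow> (real^'n) L2) \<Rightarrow> 'n \<Rightarrow> (real^'n) L2" where
  "flux g i = (\<Sum>j\<in>UNIV. mult_L2 (a i j) (g j))"

lemma E_linear: "bounded_linear E" by (rule bounded_linear_mult_L2[OF w(1,2)])

lemma rep_flux: "AE x in lebesgue. rep_L2 (flux g i) x = (\<Sum>j\<in>UNIV. a i j x *\<^sub>R rep_L2 (g j) x)"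
proof -
  have "AE x in lebesgue. \<forall>j\<in>UNIV. rep_L2 (mult_L2 (a i j) (g j)) x = a i j x *\<^sub>R rep_L2 (g j) x"
    by (intro AE_finite_allI) (auto intro: rep_mult_L2[OF a(1,2)])
  with rep_L2_sum[of UNIV "\<lambda>j. mult_L2 (a i j) (g j)"] show ?thesis
    unfolding flux_def by (auto elim!: eventually_elim2)
qed

lemma AE_on: "(AE x in lebesgue_on \<Omega>. P x) \<longleftrightarrow> (AE x in lebesgue. x \<in> \<Omega> \<longrightarrow> P x)"
  using \<Omega> by (subst AE_restrict_space_iff) auto

text \<open>The first order term \<open>B \<cdot> \<nabla>u = \<nabla>b \<cdot> A \<nabla>u\<close> is the term that the derivative of the weight
  produces in the integration by parts, so that it cancels. This is the role of the assumption
  \<open>B = A \<nabla>b\<close>.\<close>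

lemma graph_weak_form:
  assumes "(u, u') \<in> elliptic_op_graph \<Omega> A B p"
  obtains g where "\<And>j. g j \<in> L2_space \<Omega>" "\<And>j. weak_partial \<Omega> j (rep_L2 u) (rep_L2 (g j))"
    "\<And>\<phi>. test_function \<Omega> \<phi> \<Longrightarrow> inner (E u') (E (abs_L2 \<phi>)) =
        - (\<Sum>i\<in>UNIV. inner (E (flux g i)) (E (abs_L2 (partial_deriv i \<phi>)))) + inner (E (mult_L2 q u)) (E (abs_L2 \<phi>))"
proof -
  obtain g h where u': "u' \<in> L2_space \<Omega>"
    and g: "\<And>j. g j \<in> L2_space \<Omega>" "\<And>j. weak_partial \<Omega> j (rep_L2 u) (rep_L2 (g j))"
    and h: "\<And>i. h i \<in> L2_space \<Omega>"
      "\<And>i. weak_partial \<Omega> i (\<lambda>x. \<Sum>j\<in>UNIV. A x $ i $ j *\<^sub>R rep_L2 (g j) x) (rep_L2 (h i))"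
    and eq: "AE x in lebesgue_on \<Omega>. rep_L2 u' x = (\<Sum>i\<in>UNIV. rep_L2 (h i) x) + (\<Sum>j\<in>UNIV. B x $ j *\<^sub>R rep_L2 (g j) x) + p x *\<^sub>R rep_L2 u x"
    using assms unfolding elliptic_op_graph_def by blast
  have wF: "weak_partial \<Omega> i (rep_L2 (flux g i)) (rep_L2 (h i))" for i
  proof (rule weak_partial_cong_AE[OF \<Omega>(1) h(2)])
    show "AE x in lebesgue_on \<Omega>. (\<Sum>j\<in>UNIV. A x $ i $ j *\<^sub>R rep_L2 (g j) x) = rep_L2 (flux g i) x"
      unfolding AE_on using rep_flux[of g i] by eventually_elim (simp add: a(4) del: scaleR_conv_of_real)
  qed (rule measurable_rep_L2)
  \<comment> \<open>The definition of the operator as an equation in \<open>L\<^sup>2\<close>, with \<open>B \<cdot> \<nabla>u\<close> rewritten as \<open>\<nabla>b\<close>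
    times the flux\<close>
  have dec: "u' = (\<Sum>i\<in>UNIV. h i) + (\<Sum>i\<in>UNIV. mult_L2 (\<beta> i) (flux g i)) + mult_L2 q u" (is "_ = ?s1 + ?s2 + ?s3")
  proof (rule L2_eqI)
    have e1: "AE x in lebesgue. rep_L2 (?s1 + ?s2 + ?s3) x = rep_L2 (?s1 + ?s2) x + rep_L2 ?s3 x" by (rule rep_L2_plus)
    have e2: "AE x in lebesgue. rep_L2 (?s1 + ?s2) x = rep_L2 ?s1 x + rep_L2 ?s2 x" by (rule rep_L2_plus)
    have e3: "AE x in lebesgue. rep_L2 ?s1 x = (\<Sum>i\<in>UNIV. rep_L2 (h i) x)" by (rule rep_L2_sum) simp
    have e4: "AE x in lebesgue. rep_L2 ?s2 x = (\<Sum>i\<in>UNIV. rep_L2 (mult_L2 (\<beta> i) (flux g i)) x)" by (rule rep_L2_sum) simp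
    have e5: "AE x in lebesgue. \<forall>i\<in>UNIV. rep_L2 (mult_L2 (\<beta> i) (flux g i)) x = \<beta> i x *\<^sub>R rep_L2 (flux g i) x"
      by (intro AE_finite_allI) (auto intro: rep_mult_L2[OF \<beta>(1,2)])
    have e6: "AE x in lebesgue. \<forall>i\<in>UNIV. rep_L2 (flux g i) x = (\<Sum>j\<in>UNIV. a i j x *\<^sub>R rep_L2 (g j) x)"
      by (intro AE_finite_allI rep_flux) simp
    have e7: "AE x in lebesgue. rep_L2 ?s3 x = q x *\<^sub>R rep_L2 u x" by (rule rep_mult_L2[OF q(1,2)])
    have e8: "AE x in lebesgue. \<forall>i\<in>UNIV. x \<notin> \<Omega> \<longrightarrow> rep_L2 (h i) x = 0"
      using h(1) by (intro AE_finite_allI) (auto simp: L2_space_def)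
    have e9: "AE x in lebesgue. x \<notin> \<Omega> \<longrightarrow> rep_L2 u' x = 0" using u' by (simp add: L2_space_def)
    note ons = eq[unfolded AE_on] q(4)[unfolded AE_on] B[unfolded AE_on]
    show "AE x in lebesgue. rep_L2 u' x = rep_L2 (?s1 + ?s2 + ?s3) x"
      using e1 e2 e3 e4 e5 e6 e7 e8 e9 ons
    proof eventually_elim
      case (elim x)
      have s: "rep_L2 (?s1 + ?s2 + ?s3) x = (\<Sum>i\<in>UNIV. rep_L2 (h i) x) +
          (\<Sum>i\<in>UNIV. \<beta> i x *\<^sub>R (\<Sum>j\<in>UNIV. a i j x *\<^sub>R rep_L2 (g j) x)) + q x *\<^sub>R rep_L2 u x"
        using elim by (simp del: scaleR_conv_of_real)
      show ?case
      proof (cases "x \<in> \<Omega>")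
        case True
        have "(\<Sum>i\<in>UNIV. \<beta> i x *\<^sub>R (\<Sum>j\<in>UNIV. a i j x *\<^sub>R rep_L2 (g j) x)) =
            (\<Sum>i\<in>UNIV. \<Sum>j\<in>UNIV. (a j i x * \<beta> i x) *\<^sub>R rep_L2 (g j) x)"
          by (simp add: scaleR_sum_right a(3)[of _ _ x, symmetric] mult.commute del: scaleR_conv_of_real)
        also have "\<dots> = (\<Sum>j\<in>UNIV. \<Sum>i\<in>UNIV. (a j i x * \<beta> i x) *\<^sub>R rep_L2 (g j) x)"
          by (rule sum.swap)
        also have "\<dots> = (\<Sum>j\<in>UNIV. B x $ j *\<^sub>R rep_L2 (g j) x)"
          using elim True by (simp add: scaleR_sum_left del: scaleR_conv_of_real)
        finally show ?thesis using elim True s by (simp del: scaleR_conv_of_real)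
      next
        case False
        then show ?thesis using elim s by (simp add: \<beta>(3) q(3) del: scaleR_conv_of_real)
      qed
    qed
  qed
  interpret E: bounded_linear E by (rule E_linear)
  show ?thesis
  proof (rule that[OF g])
    fix \<phi> :: "real^'n \<Rightarrow> complex" assume \<phi>: "test_function \<Omega> \<phi>"
    have parts: "inner (E (flux g i)) (E (abs_L2 (partial_deriv i \<phi>))) =
        - inner (E (mult_L2 (\<beta> i) (flux g i))) (E (abs_L2 \<phi>)) - inner (E (h i)) (E (abs_L2 \<phi>))" for i
      by (rule weighted_parts[OF \<Omega> b(1) b(2) b(3) w \<beta>(1) \<beta>(2) \<beta>(4) wF \<phi>])
    have "inner (E u') (E (abs_L2 \<phi>)) = (\<Sum>i\<in>UNIV. inner (E (h i)) (E (abs_L2 \<phi>))) +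
        (\<Sum>i\<in>UNIV. inner (E (mult_L2 (\<beta> i) (flux g i))) (E (abs_L2 \<phi>))) + inner (E (mult_L2 q u)) (E (abs_L2 \<phi>))"
      by (subst dec) (simp only: E.add E.sum inner_add_left inner_sum_left)
    also have "\<dots> = - (\<Sum>i\<in>UNIV. inner (E (flux g i)) (E (abs_L2 (partial_deriv i \<phi>)))) + inner (E (mult_L2 q u)) (E (abs_L2 \<phi>))"
      by (simp add: parts sum_subtractf sum_negf sum.distrib)
    finally show "inner (E u') (E (abs_L2 \<phi>)) =
        - (\<Sum>i\<in>UNIV. inner (E (flux g i)) (E (abs_L2 (partial_deriv i \<phi>)))) + inner (E (mult_L2 q u)) (E (abs_L2 \<phi>))" .
  qed
qed

text \<open>Both sides are continuous in \<open>v\<close> for the norm of \<open>H\<^sup>1\<close>, in which test functions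
  approximate elements of \<open>H\<^sub>0\<^sup>1\<close>.\<close>

lemma graph_form:
  assumes u: "(u, u') \<in> elliptic_op_graph \<Omega> A B p"
  obtains g where "\<And>j. g j \<in> L2_space \<Omega>" "\<And>j. weak_partial \<Omega> j (rep_L2 u) (rep_L2 (g j))"
    "\<And>v k. v \<in> H10_space \<Omega> \<Longrightarrow> (\<And>j. k j \<in> L2_space \<Omega>) \<Longrightarrow> (\<And>j. weak_partial \<Omega> j (rep_L2 v) (rep_L2 (k j))) \<Longrightarrow>
      inner (E u') (E v) = - (\<Sum>i\<in>UNIV. inner (E (flux g i)) (E (k i))) + inner (E (mult_L2 q u)) (E v)"
proof -
  obtain g where g: "\<And>j. g j \<in> L2_space \<Omega>" "\<And>j. weak_partial \<Omega> j (rep_L2 u) (rep_L2 (g j))"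
    and weak: "\<And>\<phi>. test_function \<Omega> \<phi> \<Longrightarrow> inner (E u') (E (abs_L2 \<phi>)) =
        - (\<Sum>i\<in>UNIV. inner (E (flux g i)) (E (abs_L2 (partial_deriv i \<phi>)))) + inner (E (mult_L2 q u)) (E (abs_L2 \<phi>))"
    by (rule graph_weak_form[OF u]) blast
  show ?thesis
  proof (rule that[OF g])
    fix v k assume v: "v \<in> H10_space \<Omega>" and k: "\<And>j. k j \<in> L2_space \<Omega>" "\<And>j. weak_partial \<Omega> j (rep_L2 v) (rep_L2 (k j))"
    obtain \<phi> :: "nat \<Rightarrow> real^'n \<Rightarrow> complex" where \<phi>: "\<And>n. test_function \<Omega> (\<phi> n)" "(\<lambda>n. abs_L2 (\<phi> n)) \<longlonglongrightarrow> v"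
      and d: "\<And>i. \<exists>g\<in>L2_space \<Omega>. weak_partial \<Omega> i (rep_L2 v) (rep_L2 g) \<and> (\<lambda>n. abs_L2 (partial_deriv i (\<phi> n))) \<longlonglongrightarrow> g"
      using v unfolding H10_space_def by blast
    have dk: "(\<lambda>n. abs_L2 (partial_deriv i (\<phi> n))) \<longlonglongrightarrow> k i" for i
      using d[of i] weak_partial_unique_L2[OF \<Omega>(1) _ k(2) _ k(1)] by blast
    have "(\<lambda>n. inner (E u') (E (abs_L2 (\<phi> n)))) \<longlonglongrightarrow> inner (E u') (E v)"
      by (intro tendsto_inner tendsto_const bounded_linear.tendsto[OF E_linear] \<phi>(2))
    moreover have "(\<lambda>n. - (\<Sum>i\<in>UNIV. inner (E (flux g i)) (E (abs_L2 (partial_deriv i (\<phi> n))))) + inner (E (mult_L2 q u)) (E (abs_L2 (\<phi> n))))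
        \<longlonglongrightarrow> - (\<Sum>i\<in>UNIV. inner (E (flux g i)) (E (k i))) + inner (E (mult_L2 q u)) (E v)"
      by (intro tendsto_add tendsto_minus tendsto_sum tendsto_inner tendsto_const bounded_linear.tendsto[OF E_linear] \<phi>(2) dk)
    ultimately show "inner (E u') (E v) = - (\<Sum>i\<in>UNIV. inner (E (flux g i)) (E (k i))) + inner (E (mult_L2 q u)) (E v)"
      unfolding weak[OF \<phi>(1)] by (rule LIMSEQ_unique)
  qed
qed

lemma inner_E: "inner (E x) (E y) = (\<integral>t. (w t)\<^sup>2 * inner (rep_L2 x t) (rep_L2 y t) \<partial>lebesgue)"
  by (rule inner_mult_L2[OF w(1,2)])

lemma E_mult_symmetric:
  assumes c: "c \<in> borel_measurable lebesgue" "\<And>x. \<bar>c x\<bar> \<le> C"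
  shows "inner (E (mult_L2 c x)) (E y) = inner (E x) (E (mult_L2 c y))"
  unfolding inner_E
proof (rule integral_cong_AE)
  show "AE t in lebesgue. (w t)\<^sup>2 * inner (rep_L2 (mult_L2 c x) t) (rep_L2 y t) = (w t)\<^sup>2 * inner (rep_L2 x t) (rep_L2 (mult_L2 c y) t)"
    using rep_mult_L2[OF c, of x] rep_mult_L2[OF c, of y] by eventually_elim (simp del: scaleR_conv_of_real)
qed (intro borel_measurable_times borel_measurable_power w(1) borel_measurable_inner measurable_rep_L2)+

lemma flux_symmetric:
  "(\<Sum>i\<in>UNIV. inner (E (flux g i)) (E (k i))) = (\<Sum>i\<in>UNIV. inner (E (flux k i)) (E (g i)))"
proof -
  interpret E: bounded_linear E by (rule E_linear)
  have eq: "a i j = a j i" for i j by (rule ext) (rule a(3))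
  have "(\<Sum>i\<in>UNIV. inner (E (flux g i)) (E (k i))) = (\<Sum>i\<in>UNIV. \<Sum>j\<in>UNIV. inner (E (mult_L2 (a i j) (g j))) (E (k i)))"
    by (simp only: flux_def E.sum inner_sum_left)
  also have "\<dots> = (\<Sum>j\<in>UNIV. \<Sum>i\<in>UNIV. inner (E (mult_L2 (a i j) (g j))) (E (k i)))" by (rule sum.swap)
  also have "\<dots> = (\<Sum>j\<in>UNIV. \<Sum>i\<in>UNIV. inner (E (mult_L2 (a j i) (k i))) (E (g j)))"
  proof (intro sum.cong refl)
    fix i j
    show "inner (E (mult_L2 (a i j) (g j))) (E (k i)) = inner (E (mult_L2 (a j i) (k i))) (E (g j))"
      using E_mult_symmetric[OF a(1,2), of i j "g j" "k i"] by (simp only: eq[of i j] inner_commute)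
  qed
  also have "\<dots> = (\<Sum>i\<in>UNIV. inner (E (flux k i)) (E (g i)))"
    by (simp only: flux_def E.sum inner_sum_left)
  finally show ?thesis .
qed

text \<open>Real and imaginary part of the gradient contribute separately, each with the nonnegative
  quadratic form of the coefficients.\<close>

lemma flux_nonneg: "0 \<le> (\<Sum>i\<in>UNIV. inner (E (flux g i)) (E (g i)))"
proof -
  have i: "integrable lebesgue (\<lambda>t. (w t)\<^sup>2 * inner (rep_L2 x t) (rep_L2 y t))" for x y
  proof -
    have "integrable lebesgue (\<lambda>t. inner (w t *\<^sub>R rep_L2 x t) (w t *\<^sub>R rep_L2 y t))"
      by (intro square_integrable_inner square_integrable_mult[OF w(1,2)] square_integrable_rep)
    then show ?thesis by (simp add: power2_eq_square mult.assoc del: scaleR_conv_of_real)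
  qed
  have "(\<Sum>i\<in>UNIV. inner (E (flux g i)) (E (g i))) = (\<integral>t. (\<Sum>i\<in>UNIV. (w t)\<^sup>2 * inner (rep_L2 (flux g i) t) (rep_L2 (g i) t)) \<partial>lebesgue)"
    unfolding inner_E by (rule Bochner_Integration.integral_sum[symmetric]) (rule i)
  also have "0 \<le> \<dots>"
  proof (rule integral_nonneg_AE)
    have "AE x in lebesgue. \<forall>i\<in>UNIV. rep_L2 (flux g i) x = (\<Sum>j\<in>UNIV. a i j x *\<^sub>R rep_L2 (g j) x)"
      by (intro AE_finite_allI rep_flux) simp
    then show "AE t in lebesgue. 0 \<le> (\<Sum>i\<in>UNIV. (w t)\<^sup>2 * inner (rep_L2 (flux g i) t) (rep_L2 (g i) t))"
    proof eventually_elim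
      case (elim t)
      let ?R = "\<lambda>i. Re (rep_L2 (g i) t)" and ?I = "\<lambda>i. Im (rep_L2 (g i) t)"
      have "(\<Sum>i\<in>UNIV. inner (rep_L2 (flux g i) t) (rep_L2 (g i) t)) =
          (\<Sum>i\<in>UNIV. \<Sum>j\<in>UNIV. a i j t * inner (rep_L2 (g j) t) (rep_L2 (g i) t))"
        using elim by (simp add: inner_sum_left del: scaleR_conv_of_real)
      also have "\<dots> = (\<Sum>i\<in>UNIV. \<Sum>j\<in>UNIV. a i j t * ?R i * ?R j) + (\<Sum>i\<in>UNIV. \<Sum>j\<in>UNIV. a i j t * ?I i * ?I j)"
        by (simp add: sum.distrib[symmetric] inner_complex_def algebra_simps)
      also have "0 \<le> \<dots>" by (intro add_nonneg_nonneg a(5))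
      finally show ?case by (simp add: sum_distrib_left[symmetric])
    qed
  qed
  finally show ?thesis .
qed

theorem graph_symmetric:
  assumes u: "(u, u') \<in> elliptic_op_graph \<Omega> A B p" and v: "(v, v') \<in> elliptic_op_graph \<Omega> A B p"
  shows "inner (E u') (E v) = inner (E u) (E v')"
proof -
  obtain g where g: "\<And>j. g j \<in> L2_space \<Omega>" "\<And>j. weak_partial \<Omega> j (rep_L2 u) (rep_L2 (g j))"
    and gf: "\<And>v k. v \<in> H10_space \<Omega> \<Longrightarrow> (\<And>j. k j \<in> L2_space \<Omega>) \<Longrightarrow> (\<And>j. weak_partial \<Omega> j (rep_L2 v) (rep_L2 (k j))) \<Longrightarrow>
      inner (E u') (E v) = - (\<Sum>i\<in>UNIV. inner (E (flux g i)) (E (k i))) + inner (E (mult_L2 q u)) (E v)"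
    by (rule graph_form[OF u]) blast
  obtain k where k: "\<And>j. k j \<in> L2_space \<Omega>" "\<And>j. weak_partial \<Omega> j (rep_L2 v) (rep_L2 (k j))"
    and kf: "\<And>u g. u \<in> H10_space \<Omega> \<Longrightarrow> (\<And>j. g j \<in> L2_space \<Omega>) \<Longrightarrow> (\<And>j. weak_partial \<Omega> j (rep_L2 u) (rep_L2 (g j))) \<Longrightarrow>
      inner (E v') (E u) = - (\<Sum>i\<in>UNIV. inner (E (flux k i)) (E (g i))) + inner (E (mult_L2 q v)) (E u)"
    by (rule graph_form[OF v]) blast
  have H: "u \<in> H10_space \<Omega>" "v \<in> H10_space \<Omega>" using u v by (auto simp: elliptic_op_graph_def)
  have "inner (E u') (E v) = - (\<Sum>i\<in>UNIV. inner (E (flux g i)) (E (k i))) + inner (E (mult_L2 q u)) (E v)"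
    by (rule gf[OF H(2) k])
  also have "\<dots> = - (\<Sum>i\<in>UNIV. inner (E (flux k i)) (E (g i))) + inner (E (mult_L2 q v)) (E u)"
    unfolding flux_symmetric[of g k] E_mult_symmetric[OF q(1,2), of u] by (simp add: inner_commute)
  also have "\<dots> = inner (E v') (E u)"
    by (rule kf[OF H(1) g, symmetric])
  finally show ?thesis by (simp add: inner_commute)
qed

theorem graph_dissipative:
  assumes u: "(u, u') \<in> elliptic_op_graph \<Omega> A B p"
  shows "inner (E u') (E u) \<le> M * (norm (E u))\<^sup>2"
proof -
  obtain g where g: "\<And>j. g j \<in> L2_space \<Omega>" "\<And>j. weak_partial \<Omega> j (rep_L2 u) (rep_L2 (g j))"
    and gf: "\<And>v k. v \<in> H10_space \<Omega> \<Longrightarrow> (\<And>j. k j \<in> L2_space \<Omega>) \<Longrightarrow> (\<And>j. weak_partial \<Omega> j (rep_L2 v) (rep_L2 (k j))) \<Longrightarrow>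
      inner (E u') (E v) = - (\<Sum>i\<in>UNIV. inner (E (flux g i)) (E (k i))) + inner (E (mult_L2 q u)) (E v)"
    by (rule graph_form[OF u]) blast
  have H: "u \<in> H10_space \<Omega>" using u by (auto simp: elliptic_op_graph_def)
  have i: "integrable lebesgue (\<lambda>t. (w t)\<^sup>2 * inner (rep_L2 x t) (rep_L2 y t))" for x y
  proof -
    have "integrable lebesgue (\<lambda>t. inner (w t *\<^sub>R rep_L2 x t) (w t *\<^sub>R rep_L2 y t))"
      by (intro square_integrable_inner square_integrable_mult[OF w(1,2)] square_integrable_rep)
    then show ?thesis by (simp add: power2_eq_square mult.assoc del: scaleR_conv_of_real)
  qed
  have "inner (E (mult_L2 q u)) (E u) \<le> (\<integral>t. M * ((w t)\<^sup>2 * inner (rep_L2 u t) (rep_L2 u t)) \<partial>lebesgue)"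
    unfolding inner_E
  proof (rule integral_mono_AE)
    show "AE t in lebesgue. (w t)\<^sup>2 * inner (rep_L2 (mult_L2 q u) t) (rep_L2 u t) \<le> M * ((w t)\<^sup>2 * inner (rep_L2 u t) (rep_L2 u t))"
      using rep_mult_L2[OF q(1,2), of u]
    proof eventually_elim
      case (elim t)
      have "q t * ((w t)\<^sup>2 * inner (rep_L2 u t) (rep_L2 u t)) \<le> M * ((w t)\<^sup>2 * inner (rep_L2 u t) (rep_L2 u t))"
        using q(2)[of t] by (intro mult_right_mono) auto
      then show ?case using elim by (simp add: mult_ac del: scaleR_conv_of_real)
    qed
  qed (use i in auto)
  also have "\<dots> = M * (norm (E u))\<^sup>2"
    by (simp add: power2_norm_eq_inner inner_E)
  finally have "inner (E (mult_L2 q u)) (E u) \<le> M * (norm (E u))\<^sup>2" .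
  then show ?thesis
    using gf[OF H g] flux_nonneg[of g] by linarith
qed

end


section \<open>Strongly continuous semigroups\<close>

lemma closed_cover_interior:
  fixes F :: "nat \<Rightarrow> 'a::complete_space set"
  assumes "\<And>n. closed (F n)" "(\<Union>n. F n) = UNIV"
  obtains n where "interior (F n) \<noteq> {}"
proof -
  have "\<exists>n. interior (F n) \<noteq> {}"
  proof (rule ccontr)
    assume "\<not> ?thesis"
    then have F: "closedin Met_TC.mtopology T \<and> Met_TC.mtopology interior_of T = {}" if "T \<in> range F" for T
      using that assms(1) by auto
    have "Met_TC.mtopology interior_of \<Union> (range F) = {}"
      by (rule Met_TC.metric_Baire_category_alt[OF _ _ F]) (simp_all add: complete_UNIV)
    then show False using assms(2) by simp
  qed
  then show ?thesis using that by blast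
qed

text \<open>The semigroup acts on the range \<open>X\<close> of a projection. Composing it with the projection
  gives operators on the whole space, to which the notions for bounded linear operators apply
  directly.\<close>

locale projected_semigroup =
  fixes \<pi> :: "'v::banach \<Rightarrow> 'v" and X S
  assumes proj: "bounded_linear \<pi>" "range \<pi> = X" "\<And>v. v \<in> X \<Longrightarrow> \<pi> v = v"
    and sg: "C0_semigroup_on X S"
begin

definition Q :: "real \<Rightarrow> 'v \<Rightarrow> 'v" where "Q t v = S t (\<pi> v)"

lemma proj_in: "\<pi> v \<in> X" using proj(2) by auto

lemma S_facts:
  shows "0 \<le> t \<Longrightarrow> v \<in> X \<Longrightarrow> S t v \<in> X"
    and "0 \<le> t \<Longrightarrow> v \<in> X \<Longrightarrow> w \<in> X \<Longrightarrow> S t (v + w) = S t v + S t w"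
    and "0 \<le> t \<Longrightarrow> v \<in> X \<Longrightarrow> S t (c *\<^sub>R v) = c *\<^sub>R S t v"
    and "v \<in> X \<Longrightarrow> S 0 v = v"
    and "0 \<le> s \<Longrightarrow> 0 \<le> t \<Longrightarrow> v \<in> X \<Longrightarrow> S (s + t) v = S s (S t v)"
    and "v \<in> X \<Longrightarrow> ((\<lambda>t. S t v) \<longlongrightarrow> v) (at_right 0)"
    and "0 \<le> t \<Longrightarrow> \<exists>C. \<forall>v\<in>X. norm (S t v) \<le> C * norm v"
  using sg unfolding C0_semigroup_on_def by blast+

lemma Q_in: "0 \<le> t \<Longrightarrow> Q t v \<in> X"
  unfolding Q_def by (intro S_facts proj_in)

lemma Q_0: "Q 0 v = \<pi> v"
  unfolding Q_def by (intro S_facts proj_in)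

lemma Q_eq: "v \<in> X \<Longrightarrow> Q t v = S t v"
  by (simp add: Q_def proj)

lemma Q_bounded_linear: "0 \<le> t \<Longrightarrow> bounded_linear (Q t)"
proof -
  assume t: "0 \<le> t"
  interpret \<pi>: bounded_linear \<pi> by (rule proj)
  obtain C where C: "\<And>v. v \<in> X \<Longrightarrow> norm (S t v) \<le> C * norm v"
    using S_facts(7)[OF t] by blast
  obtain K where K: "0 \<le> K" "\<And>v. norm (\<pi> v) \<le> norm v * K"
    using \<pi>.nonneg_bounded by auto
  show ?thesis
  proof (rule bounded_linear_intro)
    show "Q t (x + y) = Q t x + Q t y" for x y
      unfolding Q_def \<pi>.add by (intro S_facts proj_in t)
    show "Q t (r *\<^sub>R x) = r *\<^sub>R Q t x" for r x
      unfolding Q_def \<pi>.scaleR by (intro S_facts proj_in t)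
    show "norm (Q t x) \<le> norm x * (K * \<bar>C\<bar>)" for x
    proof -
      have "norm (Q t x) \<le> C * norm (\<pi> x)" unfolding Q_def by (rule C[OF proj_in])
      also have "\<dots> \<le> \<bar>C\<bar> * (norm x * K)" using K by (intro mult_mono) auto
      finally show ?thesis by (simp add: mult_ac)
    qed
  qed
qed

lemma Q_add: "0 \<le> s \<Longrightarrow> 0 \<le> t \<Longrightarrow> Q (s + t) v = Q s (Q t v)"
  using S_facts(5)[of s t "\<pi> v"] proj_in Q_in[of t v] by (simp add: Q_def proj(3))

lemma Q_tendsto_0: "((\<lambda>t. Q t v) \<longlongrightarrow> \<pi> v) (at_right 0)"
  unfolding Q_def by (intro S_facts proj_in)

text \<open>This is the uniform boundedness principle, obtained from the Baire category theorem: by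
  strong continuity at \<open>0\<close> the closed sets \<open>F n\<close> cover the space, and one of them contains a
  ball. The argument is carried out for the index set \<open>{0..1 / Suc n}\<close> shrinking with \<open>n\<close>, as
  no bound on a fixed interval is known beforehand.\<close>

lemma Q_locally_bounded: obtains d M where "0 < d" "0 \<le> M" "\<And>t v. 0 \<le> t \<Longrightarrow> t \<le> d \<Longrightarrow> norm (Q t v) \<le> M * norm v"
proof -
  define F where "F n = {v. \<forall>t\<in>{0..1 / real (Suc n)}. norm (Q t v) \<le> real n}" for n
  have "closed (F n)" for n
  proof -
    have "F n = (\<Inter>t\<in>{0..1 / real (Suc n)}. {v. norm (Q t v) \<le> real n})"
      by (auto simp: F_def)
    then show ?thesis
      using Q_bounded_linear
      by (simp, intro closed_INT ballI closed_Collect_le continuous_on_norm continuous_on_const linear_continuous_on) auto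
  qed
  moreover have "(\<Union>n. F n) = UNIV"
  proof -
    have "\<exists>n. v \<in> F n" for v
    proof -
      have "\<forall>\<^sub>F t in at_right 0. dist (Q t v) (\<pi> v) < 1"
        using Q_tendsto_0 by (rule tendstoD) simp
      then obtain d where d: "0 < d" "\<And>t. 0 < t \<Longrightarrow> t < d \<Longrightarrow> dist (Q t v) (\<pi> v) < 1"
        unfolding eventually_at_right[OF zero_less_one] by auto
      obtain n1 where n1: "1 / real (Suc n1) < d"
        using reals_Archimedean[OF d(1)] by (auto simp: divide_inverse)
      obtain n2 where n2: "norm (\<pi> v) + 1 \<le> real n2" using real_arch_simple by blast
      have "norm (Q t v) \<le> real (max n1 n2)" if t: "t \<in> {0..1 / real (Suc (max n1 n2))}" for t
      proof (cases "t = 0")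
        case True
        then show ?thesis using n2 by (simp add: Q_0)
      next
        case False
        have "1 / real (Suc (max n1 n2)) \<le> 1 / real (Suc n1)"
          by (intro divide_left_mono) auto
        then have "dist (Q t v) (\<pi> v) < 1"
          using t False n1 by (intro d) auto
        then have "norm (Q t v) \<le> norm (\<pi> v) + 1"
          using norm_triangle_sub[of "Q t v" "\<pi> v"] by (simp add: dist_norm)
        then show ?thesis using n2 by simp
      qed
      then show ?thesis unfolding F_def by blast
    qed
    then show ?thesis by blast
  qed
  ultimately obtain n where "interior (F n) \<noteq> {}" by (rule closed_cover_interior)
  then obtain x e where e: "0 < e" "cball x e \<subseteq> F n"
    by (auto simp: mem_interior_cball)
  show ?thesis
  proof (rule that[of "1 / real (Suc n)" "2 * real n / e"])
    show "0 < 1 / real (Suc n)" "0 \<le> 2 * real n / e" using e by auto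
    fix t v assume t: "0 \<le> t" "t \<le> 1 / real (Suc n)"
    interpret Qt: bounded_linear "Q t" by (rule Q_bounded_linear) fact
    show "norm (Q t v) \<le> 2 * real n / e * norm v"
    proof (cases "v = 0")
      case True
      then show ?thesis by (simp add: Qt.zero)
    next
      case False
      \<comment> \<open>\<open>v\<close> is rescaled so that it joins two points of the ball, where \<open>Q t\<close> is bounded by
        \<open>n\<close>.\<close>
      let ?c = "e / norm v"
      have "x \<in> cball x e" "x + ?c *\<^sub>R v \<in> cball x e"
        using False e by (auto simp: dist_norm)
      then have "x \<in> F n" "x + ?c *\<^sub>R v \<in> F n" using e(2) by blast+
      then have "norm (Q t x) \<le> real n" "norm (Q t (x + ?c *\<^sub>R v)) \<le> real n"
        using t unfolding F_def by simp_all
      moreover have "?c * norm (Q t v) = norm (Q t (x + ?c *\<^sub>R v) - Q t x)"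
        using e by (simp add: Qt.add Qt.scaleR)
      ultimately have "?c * norm (Q t v) \<le> 2 * real n"
        using norm_triangle_ineq4[of "Q t (x + ?c *\<^sub>R v)" "Q t x"] by linarith
      then have "(norm v / e) * (?c * norm (Q t v)) \<le> (norm v / e) * (2 * real n)"
        using e by (intro mult_left_mono) auto
      moreover have "(norm v / e) * (?c * norm (Q t v)) = norm (Q t v)"
        using e False by simp
      ultimately show ?thesis by (simp add: mult.commute)
    qed
  qed
qed

lemma Q_bounded_on: "\<exists>M\<ge>0. \<forall>t\<in>{0..T}. \<forall>v. norm (Q t v) \<le> M * norm v"
proof -
  obtain d M where d: "0 < d" "0 \<le> M" "\<And>t v. 0 \<le> t \<Longrightarrow> t \<le> d \<Longrightarrow> norm (Q t v) \<le> M * norm v"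
    by (rule Q_locally_bounded) blast
  define M' where "M' = max M 1"
  have M': "1 \<le> M'" "\<And>t v. 0 \<le> t \<Longrightarrow> t \<le> d \<Longrightarrow> norm (Q t v) \<le> M' * norm v"
    using d(3) by (auto simp: M'_def intro: order_trans[OF _ mult_right_mono[of M "max M 1"]])
  have *: "0 \<le> t \<Longrightarrow> t \<le> real (Suc n) * d \<Longrightarrow> norm (Q t v) \<le> M' ^ Suc n * norm v" for n t v
  proof (induction n arbitrary: t v)
    case 0
    then show ?case using M' by simp
  next
    case (Suc n)
    show ?case
    proof (cases "t \<le> d")
      case True
      have "norm (Q t v) \<le> M' * norm v" using M' True Suc by simp
      also have "\<dots> \<le> M' ^ Suc (Suc n) * norm v"
        using M' self_le_power[of M' "Suc (Suc n)"] by (intro mult_right_mono) auto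
      finally show ?thesis .
    next
      case False
      have "Q t v = Q (t - d) (Q d v)" using Q_add[of "t - d" d v] False d by simp
      also have "norm \<dots> \<le> M' ^ Suc n * norm (Q d v)"
        using Suc False by (intro Suc.IH) (auto simp: algebra_simps)
      also have "\<dots> \<le> M' ^ Suc n * (M' * norm v)"
        using M' d by (intro mult_left_mono) auto
      finally show ?thesis by (simp add: mult_ac)
    qed
  qed
  obtain n where n: "T / d \<le> real n" using real_arch_simple by blast
  then have n': "T \<le> real (Suc n) * d" using d by (simp add: field_simps)
  have "norm (Q t v) \<le> M' ^ Suc n * norm v" if "t \<in> {0..T}" for t v
    using that n' by (intro *) auto
  then show ?thesis using M' by (intro exI[of _ "M' ^ Suc n"]) auto
qed


lemma Q_proj: "Q t (\<pi> v) = Q t v"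
  by (simp add: Q_def proj proj_in)

text \<open>Factor out the semigroup at the smaller of the two times.\<close>

lemma Q_diff_le:
  assumes M: "\<And>s v. 0 \<le> s \<Longrightarrow> s \<le> T \<Longrightarrow> norm (Q s v) \<le> M * norm v"
    and st: "0 \<le> s" "0 \<le> t" "s \<le> T" "t \<le> T"
  shows "norm (Q s v - Q t v) \<le> M * norm (Q \<bar>s - t\<bar> v - \<pi> v)"
proof -
  have *: "norm (Q t v - Q s v) \<le> M * norm (Q (t - s) v - \<pi> v)" if "0 \<le> s" "s \<le> t" "t \<le> T" for s t
  proof -
    interpret Qs: bounded_linear "Q s" using that(1) by (rule Q_bounded_linear)
    have "Q t v = Q s (Q (t - s) v)" using Q_add[of s "t - s" v] that by simp
    then have "Q t v - Q s v = Q s (Q (t - s) v - \<pi> v)"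
      by (simp only: Qs.diff Q_proj)
    then show ?thesis using M[of s "Q (t - s) v - \<pi> v"] that by simp
  qed
  show ?thesis
  proof (cases "s \<le> t")
    case True
    then have "\<bar>s - t\<bar> = t - s" by simp
    then show ?thesis using *[of s t] True st by (simp only: norm_minus_commute[of "Q s v"])
  next
    case False
    then have "\<bar>s - t\<bar> = s - t" by simp
    then show ?thesis using *[of t s] False st by simp
  qed
qed

lemma abs_diff_tendsto_at_right:
  fixes t :: real
  shows "filterlim (\<lambda>y. \<bar>y - t\<bar>) (at_right 0) (at t within A)"
proof -
  have "((\<lambda>y. \<bar>y - t\<bar>) \<longlongrightarrow> \<bar>t - t\<bar>) (at t within A)" by (intro tendsto_intros)
  then show ?thesis
    by (auto simp: filterlim_at eventually_at_filter)
qed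

lemma Q_tendsto_within: "((\<lambda>y. Q y v) \<longlongrightarrow> Q t v) (at t within {0..})" if t: "0 \<le> t"
proof -
  obtain M where M: "0 \<le> M" "\<And>s v. 0 \<le> s \<Longrightarrow> s \<le> t + 1 \<Longrightarrow> norm (Q s v) \<le> M * norm v"
    using Q_bounded_on[of "t + 1"] by auto
  have "((\<lambda>y. M * norm (Q \<bar>y - t\<bar> v - \<pi> v)) \<longlongrightarrow> M * norm (\<pi> v - \<pi> v)) (at t within {0..})"
    by (intro tendsto_intros filterlim_compose[OF Q_tendsto_0 abs_diff_tendsto_at_right])
  then have lim: "((\<lambda>y. M * norm (Q \<bar>y - t\<bar> v - \<pi> v)) \<longlongrightarrow> 0) (at t within {0..})" by simp
  have "\<forall>\<^sub>F y in at t within {0..}. y \<in> {0..} \<and> y < t + 1"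
    unfolding eventually_at by (intro exI[of _ 1]) (auto simp: dist_real_def)
  then have "\<forall>\<^sub>F y in at t within {0..}. norm (Q y v - Q t v) \<le> M * norm (Q \<bar>y - t\<bar> v - \<pi> v)"
    by eventually_elim (rule Q_diff_le[OF M(2)], use t in auto)
  from Lim_null_comparison[OF this lim] show ?thesis
    by (simp add: Lim_null[symmetric])
qed

lemma Q_continuous: "continuous_on {0..} (\<lambda>t. Q t v)"
  unfolding continuous_on_def using Q_tendsto_within by simp

lemma generator_graph_iff:
  "(v, w) \<in> generator_graph X S \<longleftrightarrow> v \<in> X \<and> w \<in> X \<and> ((\<lambda>h. (Q h v - v) /\<^sub>R h) \<longlongrightarrow> w) (at_right 0)"
  by (auto simp: generator_graph_def Q_eq)

lemma generator_graph_invariant: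
  assumes g: "(v, w) \<in> generator_graph X S" and t: "0 \<le> t"
  shows "(Q t v, Q t w) \<in> generator_graph X S"
proof -
  interpret Qt: bounded_linear "Q t" using t by (rule Q_bounded_linear)
  have "((\<lambda>h. Q t ((Q h v - v) /\<^sub>R h)) \<longlongrightarrow> Q t w) (at_right 0)"
    using g by (intro Qt.tendsto) (simp add: generator_graph_iff)
  moreover have "\<forall>\<^sub>F h in at_right 0. Q t ((Q h v - v) /\<^sub>R h) = (Q h (Q t v) - Q t v) /\<^sub>R h"
    using eventually_at_right_less[of 0]
  proof eventually_elim
    case (elim h)
    then show ?case
      using Q_add[of t h v] Q_add[of h t v] t by (simp add: Qt.scaleR Qt.diff add.commute)
  qed
  ultimately have "((\<lambda>h. (Q h (Q t v) - Q t v) /\<^sub>R h) \<longlongrightarrow> Q t w) (at_right 0)"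
    by (rule Lim_transform_eventually)
  then show ?thesis using Q_in t by (simp add: generator_graph_iff)
qed

text \<open>The generator only provides the right derivative at \<open>0\<close>. For both one-sided derivatives
  at \<open>t\<close>, factor out \<open>Q (min y t)\<close> from the difference quotient and use local boundedness.\<close>

lemma Q_has_vector_derivative:
  assumes g: "(v, w) \<in> generator_graph X S" and t: "0 \<le> t"
  shows "((\<lambda>s. Q s v) has_vector_derivative Q t w) (at t within {0..})"
proof -
  obtain M where M: "0 \<le> M" "\<And>s v. 0 \<le> s \<Longrightarrow> s \<le> t + 1 \<Longrightarrow> norm (Q s v) \<le> M * norm v"
    using Q_bounded_on[of "t + 1"] by auto
  have v: "v \<in> X" "w \<in> X" and lim: "((\<lambda>h. (Q h v - v) /\<^sub>R h) \<longlongrightarrow> w) (at_right 0)"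
    using g by (simp_all add: generator_graph_iff)
  define q where "q h = (Q h v - v) /\<^sub>R h" for h
  define B where "B y = M * norm (q \<bar>y - t\<bar> - w) + norm (Q (min y t) w - Q t w)" for y
  have min: "filterlim (\<lambda>y. min y t) (nhds t) (at t within {0..})"
  proof -
    have "((\<lambda>y. min y t) \<longlongrightarrow> min t t) (at t within {0..})" by (intro tendsto_intros)
    then show ?thesis by simp
  qed
  have "((\<lambda>y. Q (min y t) w) \<longlongrightarrow> Q t w) (at t within {0..})"
  proof (rule continuous_on_tendsto_compose[OF Q_continuous min])
    show "\<forall>\<^sub>F y in at t within {0..}. min y t \<in> {0..}"
      unfolding eventually_at_filter using t by auto
  qed (use t in simp)
  moreover have "((\<lambda>y. q \<bar>y - t\<bar>) \<longlongrightarrow> w) (at t within {0..})"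
    using lim unfolding q_def by (rule filterlim_compose[OF _ abs_diff_tendsto_at_right])
  ultimately have "(B \<longlongrightarrow> M * norm (w - w) + norm (Q t w - Q t w)) (at t within {0..})"
    unfolding B_def by (intro tendsto_intros)
  then have B0: "(B \<longlongrightarrow> 0) (at t within {0..})" by simp
  have "\<forall>\<^sub>F y in at t within {0..}. y \<in> {0..} \<and> y \<noteq> t \<and> y < t + 1"
    unfolding eventually_at by (intro exI[of _ 1]) (auto simp: dist_real_def)
  then have "\<forall>\<^sub>F y in at t within {0..}.
      norm ((1 / norm (y - t)) *\<^sub>R (Q y v - (Q t v + (y - t) *\<^sub>R Q t w))) \<le> B y"
  proof eventually_elim
    case (elim y)
    define a where "a = min y t"
    define h where "h = \<bar>y - t\<bar>"
    have a: "0 \<le> a" "a \<le> t + 1" and h: "0 < h" "a + h = max y t"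
      using elim t by (auto simp: a_def h_def)
    interpret Qa: bounded_linear "Q a" using a(1) by (rule Q_bounded_linear)
    have "Q (max y t) v - Q (min y t) v = h *\<^sub>R Q a (q h)"
      using Q_add[of a h v] a h
      by (simp add: a_def[symmetric] q_def Qa.scaleR Qa.diff)
    then have "Q y v - Q t v = (y - t) *\<^sub>R Q a (q h)"
      by (cases "y \<le> t") (auto simp: h_def max_def min_def algebra_simps)
    then have "Q y v - (Q t v + (y - t) *\<^sub>R Q t w) = (y - t) *\<^sub>R (Q a (q h) - Q t w)"
      by (simp add: algebra_simps)
    also have "Q a (q h) - Q t w = Q a (q h - w) + (Q a w - Q t w)"
      by (simp add: Qa.diff)
    finally have "norm ((1 / norm (y - t)) *\<^sub>R (Q y v - (Q t v + (y - t) *\<^sub>R Q t w))) =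
        norm (Q a (q h - w) + (Q a w - Q t w))"
      using elim by simp
    also have "\<dots> \<le> norm (Q a (q h - w)) + norm (Q a w - Q t w)"
      by (rule norm_triangle_ineq)
    also have "\<dots> \<le> B y"
      unfolding B_def a_def[symmetric] h_def[symmetric] using M(2)[OF a] by simp
    finally show ?case .
  qed
  from Lim_null_comparison[OF this B0] show ?thesis
    unfolding has_vector_derivative_def has_derivative_within
    by (simp add: bounded_linear_scaleR_left)
qed

lemma has_vector_derivative_right_quotient:
  fixes F :: "real \<Rightarrow> 'a::real_normed_vector"
  assumes d: "(F has_vector_derivative D) (at a within {a..b})" and "a < b"
  shows "((\<lambda>r. (F (a + r) - F a) /\<^sub>R r) \<longlongrightarrow> D) (at_right 0)"
proof -
  have "((\<lambda>y. (1 / norm (y - a)) *\<^sub>R (F y - (F a + (y - a) *\<^sub>R D))) \<longlongrightarrow> 0) (at a within {a..b})"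
    using d unfolding has_vector_derivative_def has_derivative_within by simp
  moreover have "filterlim (\<lambda>r. a + r) (at a within {a..b}) (at_right 0)"
  proof -
    have "((\<lambda>r. a + r) \<longlongrightarrow> a + 0) (at_right 0)" by (intro tendsto_intros)
    moreover have "\<forall>\<^sub>F r in at_right 0. a + r \<in> {a..b} \<and> a + r \<noteq> a"
      using \<open>a < b\<close> eventually_at_right_real[of 0 "b - a"] by (auto elim!: eventually_mono)
    ultimately show ?thesis by (simp add: filterlim_at)
  qed
  ultimately have "((\<lambda>r. (1 / norm (a + r - a)) *\<^sub>R (F (a + r) - (F a + (a + r - a) *\<^sub>R D))) \<longlongrightarrow> 0) (at_right 0)"
    by (rule filterlim_compose)
  then have 0: "((\<lambda>r. (1 / \<bar>r\<bar>) *\<^sub>R (F (a + r) - (F a + r *\<^sub>R D)) + D) \<longlongrightarrow> 0 + D) (at_right 0)"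
    by (intro tendsto_add tendsto_const) simp
  moreover have "\<forall>\<^sub>F r in at_right 0. (1 / \<bar>r\<bar>) *\<^sub>R (F (a + r) - (F a + r *\<^sub>R D)) + D = (F (a + r) - F a) /\<^sub>R r"
    using eventually_at_right_less[of 0]
    by eventually_elim (simp add: algebra_simps inverse_eq_divide)
  ultimately show ?thesis
    by (auto intro: Lim_transform_eventually)
qed

text \<open>The averages \<open>(1 / h) \<integral>\<^sub>0\<^sup>h Q s v ds\<close> belong to the domain of the generator and tend to
  \<open>v\<close>.\<close>

lemma generator_dense:
  assumes v: "v \<in> X"
  shows "\<exists>V W. (\<forall>n. (V n, W n) \<in> generator_graph X S) \<and> V \<longlonglongrightarrow> v"
proof -
  interpret \<pi>: bounded_linear \<pi> by (rule proj)
  define I where "I a = integral {0..a} (\<lambda>s. Q s v)" for a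
  have cont: "continuous_on {a..b} (\<lambda>s. Q s v)" if "0 \<le> a" for a b
    using that by (intro continuous_on_subset[OF Q_continuous]) auto
  have int: "(\<lambda>s. Q s v) integrable_on {a..b}" if "0 \<le> a" for a b
    by (intro integrable_continuous_real cont that)
  have der: "((\<lambda>r. (I (a + r) - I a) /\<^sub>R r) \<longlongrightarrow> Q a v) (at_right 0)" if a: "0 \<le> a" for a
  proof -
    have "(I has_vector_derivative Q a v) (at a within {0..a + 1})"
      unfolding I_def using a by (intro integral_has_vector_derivative cont) auto
    then have "(I has_vector_derivative Q a v) (at a within {a..a + 1})"
      by (rule has_vector_derivative_within_subset) (use a in auto)
    then show ?thesis by (rule has_vector_derivative_right_quotient) simp
  qed
  have IX: "I a \<in> X" for a
  proof -
    have "\<pi> (I a) = integral {0..a} (\<pi> \<circ> (\<lambda>s. Q s v))"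
      unfolding I_def by (rule integral_linear[symmetric]) (auto intro: int proj)
    also have "\<dots> = I a"
      unfolding I_def by (intro Henstock_Kurzweil_Integration.integral_cong) (auto simp: proj Q_in)
    finally show ?thesis by (metis proj_in)
  qed
  have graph: "(I h, Q h v - v) \<in> generator_graph X S" if h: "0 < h" for h
  proof -
    \<comment> \<open>Shifting the integral turns the difference quotient of \<open>Q\<close> at \<open>I h\<close> into difference
      quotients of \<open>I\<close>.\<close>
    have QI: "Q r (I h) - I h = (I (h + r) - I h) - (I (0 + r) - I 0)" if r: "0 < r" for r
    proof -
      have "Q r (I h) = integral {0..h} (Q r \<circ> (\<lambda>s. Q s v))"
        unfolding I_def using r by (intro integral_linear[symmetric] int Q_bounded_linear) auto
      also have "\<dots> = integral {0..h} (\<lambda>s. Q (s + r) v)"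
        using r by (intro Henstock_Kurzweil_Integration.integral_cong) (simp add: Q_add[symmetric] add.commute)
      also have "\<dots> = integral {r..h + r} (\<lambda>s. Q s v)"
        using integral_shift_Icc_real[of 0 h "\<lambda>s. Q s v" r] by (simp add: comp_def add.commute)
      also have "\<dots> = I (h + r) - I r"
        unfolding I_def using h r
        by (subst Henstock_Kurzweil_Integration.integral_combine[of 0 r "h + r", symmetric]) (auto intro: int)
      finally show ?thesis by (simp add: I_def)
    qed
    have "((\<lambda>r. (I (h + r) - I h) /\<^sub>R r - (I (0 + r) - I 0) /\<^sub>R r) \<longlongrightarrow> Q h v - Q 0 v) (at_right 0)"
      using h by (intro tendsto_diff der) auto
    moreover have "\<forall>\<^sub>F r in at_right 0. (I (h + r) - I h) /\<^sub>R r - (I (0 + r) - I 0) /\<^sub>R r = (Q r (I h) - I h) /\<^sub>R r"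
      using eventually_at_right_less[of 0]
      by eventually_elim (simp only: QI scaleR_diff_right)
    ultimately have "((\<lambda>r. (Q r (I h) - I h) /\<^sub>R r) \<longlongrightarrow> Q h v - v) (at_right 0)"
      using v by (auto simp: Q_0 proj intro: Lim_transform_eventually)
    moreover have "Q h v - v \<in> X"
    proof -
      have "\<pi> (Q h v - v) = Q h v - v" using v h by (simp add: \<pi>.diff proj Q_in)
      then show ?thesis by (metis proj_in)
    qed
    ultimately show ?thesis using IX by (simp add: generator_graph_iff)
  qed
  define V where "V n = I (1 / real (Suc n)) /\<^sub>R (1 / real (Suc n))" for n
  define W where "W n = (Q (1 / real (Suc n)) v - v) /\<^sub>R (1 / real (Suc n))" for n
  have "(V n, W n) \<in> generator_graph X S" for n
  proof -
    let ?h = "1 / real (Suc n)"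
    have "(I ?h /\<^sub>R ?h, (Q ?h v - v) /\<^sub>R ?h) \<in> generator_graph X S"
    proof -
      have g: "(I ?h, Q ?h v - v) \<in> generator_graph X S" by (rule graph) simp
      have sX: "c *\<^sub>R x \<in> X" if "x \<in> X" for c x
      proof -
        have "\<pi> (c *\<^sub>R x) = c *\<^sub>R x" using that by (simp add: \<pi>.scaleR proj)
        then show ?thesis by (metis proj_in)
      qed
      have "((\<lambda>r. inverse ?h *\<^sub>R ((Q r (I ?h) - I ?h) /\<^sub>R r)) \<longlongrightarrow> (Q ?h v - v) /\<^sub>R ?h) (at_right 0)"
        using g by (intro tendsto_intros) (simp add: generator_graph_iff)
      moreover have "\<forall>\<^sub>F r in at_right 0. inverse ?h *\<^sub>R ((Q r (I ?h) - I ?h) /\<^sub>R r) =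
          (Q r (I ?h /\<^sub>R ?h) - I ?h /\<^sub>R ?h) /\<^sub>R r"
        using eventually_at_right_less[of 0]
      proof eventually_elim
        case (elim r)
        interpret Qr: bounded_linear "Q r" by (rule Q_bounded_linear) (use elim in simp)
        show ?case by (simp only: Qr.scaleR scaleR_diff_right[symmetric] scaleR_scaleR mult.commute)
      qed
      ultimately have "((\<lambda>r. (Q r (I ?h /\<^sub>R ?h) - I ?h /\<^sub>R ?h) /\<^sub>R r) \<longlongrightarrow> (Q ?h v - v) /\<^sub>R ?h) (at_right 0)"
        by (rule Lim_transform_eventually)
      then show ?thesis using g sX by (simp only: generator_graph_iff)
    qed
    then show ?thesis unfolding V_def W_def .
  qed
  moreover have "V \<longlonglongrightarrow> v"
  proof -
    have "filterlim (\<lambda>n. 1 / real (Suc n)) (at_right 0) sequentially"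
      using LIMSEQ_inverse_real_of_nat by (auto simp: filterlim_at inverse_eq_divide)
    from filterlim_compose[OF der[of 0] this]
    show ?thesis using v unfolding V_def by (simp add: I_def Q_0 proj)
  qed
  ultimately show ?thesis by blast
qed

end

text \<open>Symmetry and an upper bound are required of the generator, for the form \<open>\<langle>E u, E v\<rangle>\<close>,
  and passed on to the semigroup below. The map \<open>E\<close> stands for the multiplication by the
  square root of a weight.\<close>

locale symmetric_semigroup = projected_semigroup \<pi> X S for \<pi> :: "'v::{banach,real_inner} \<Rightarrow> 'v" and X S +
  fixes E :: "'v \<Rightarrow> 'w::real_inner" and M :: real
  assumes E: "bounded_linear E"
    and sym: "\<And>u u' v v'. (u, u') \<in> generator_graph X S \<Longrightarrow> (v, v') \<in> generator_graph X S \<Longrightarrow>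
      inner (E u') (E v) = inner (E u) (E v')"
    and diss: "\<And>u u'. (u, u') \<in> generator_graph X S \<Longrightarrow> inner (E u') (E u) \<le> M * (norm (E u))\<^sup>2"
begin

lemma E_Q_derivative:
  assumes "(v, w) \<in> generator_graph X S" and "0 \<le> t"
  shows "((\<lambda>s. E (Q s v)) has_vector_derivative E (Q t w)) (at t within {0..})"
  using bounded_linear.has_vector_derivative[OF E Q_has_vector_derivative[OF assms]] .

lemma E_Q_tendsto: "0 \<le> t \<Longrightarrow> V \<longlonglongrightarrow> v \<Longrightarrow> (\<lambda>n. E (Q t (V n))) \<longlonglongrightarrow> E (Q t v)"
  by (intro bounded_linear.tendsto[OF E] bounded_linear.tendsto[OF Q_bounded_linear])

text \<open>The function \<open>s \<mapsto> \<langle>E Q(s) u, E Q(t - s) v\<rangle>\<close> has derivative \<open>0\<close>, and its values at \<open>t\<close>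
  and \<open>0\<close> are the two sides.\<close>

lemma Q_symmetric_aux:
  assumes u: "(u, u') \<in> generator_graph X S" and v: "(v, v') \<in> generator_graph X S" and t: "0 \<le> t"
  shows "inner (E (Q t u)) (E v) = inner (E u) (E (Q t v))"
proof -
  let ?f = "\<lambda>s. inner (E (Q s u)) (E (Q (t - s) v))"
  have "(?f has_vector_derivative 0) (at s within {0..t})" if s: "s \<in> {0..t}" for s
  proof -
    have 1: "((\<lambda>s. E (Q s u)) has_vector_derivative E (Q s u')) (at s within {0..t})"
      by (rule has_vector_derivative_within_subset[OF E_Q_derivative[OF u]]) (use s in auto)
    have "((\<lambda>s. E (Q s v)) \<circ> (\<lambda>s. t - s) has_vector_derivative (-1) *\<^sub>R E (Q (t - s) v')) (at s within {0..t})"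
    proof (rule vector_diff_chain_within)
      show "((\<lambda>s. t - s) has_vector_derivative -1) (at s within {0..t})"
        by (auto intro!: derivative_eq_intros simp: has_real_derivative_iff_has_vector_derivative[symmetric])
      show "((\<lambda>s. E (Q s v)) has_vector_derivative E (Q (t - s) v')) (at (t - s) within (\<lambda>s. t - s) ` {0..t})"
        by (rule has_vector_derivative_within_subset[OF E_Q_derivative[OF v]]) (use s in auto)
    qed
    then have 2: "((\<lambda>s. E (Q (t - s) v)) has_vector_derivative - E (Q (t - s) v')) (at s within {0..t})"
      by (simp add: o_def)
    have "inner (E (Q s u')) (E (Q (t - s) v)) = inner (E (Q s u)) (E (Q (t - s) v'))"
      by (rule sym[OF generator_graph_invariant[OF u] generator_graph_invariant[OF v]]) (use s in auto)
    then show ?thesis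
      using bounded_bilinear.has_vector_derivative[OF bounded_bilinear_inner 1 2] by simp
  qed
  then obtain c where c: "\<And>s. s \<in> {0..t} \<Longrightarrow> ?f s = c"
    using has_vector_derivative_zero_constant[of "{0..t}" ?f] by auto
  have uX: "u \<in> X" "v \<in> X" using u v by (auto simp: generator_graph_iff)
  have "?f t = ?f 0" using c[of t] c[of 0] t by (simp only: atLeastAtMost_iff order_refl)
  then show ?thesis using uX by (simp add: Q_0 proj)
qed

theorem Q_symmetric:
  assumes u: "u \<in> X" and v: "v \<in> X" and t: "0 \<le> t"
  shows "inner (E (Q t u)) (E v) = inner (E u) (E (Q t v))"
proof -
  obtain U U' where U: "\<And>n. (U n, U' n) \<in> generator_graph X S" "U \<longlonglongrightarrow> u"
    using generator_dense[OF u] by blast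
  obtain V V' where V: "\<And>n. (V n, V' n) \<in> generator_graph X S" "V \<longlonglongrightarrow> v"
    using generator_dense[OF v] by blast
  have "inner (E (Q t (U n))) (E (V n)) = inner (E (U n)) (E (Q t (V n)))" for n
    by (rule Q_symmetric_aux[OF U(1) V(1) t])
  moreover have "(\<lambda>n. inner (E (Q t (U n))) (E (V n))) \<longlonglongrightarrow> inner (E (Q t u)) (E v)"
    by (rule tendsto_inner[OF E_Q_tendsto[OF t U(2)] bounded_linear.tendsto[OF E V(2)]])
  moreover have "(\<lambda>n. inner (E (U n)) (E (Q t (V n)))) \<longlonglongrightarrow> inner (E u) (E (Q t v))"
    by (rule tendsto_inner[OF bounded_linear.tendsto[OF E U(2)] E_Q_tendsto[OF t V(2)]])
  ultimately show ?thesis by (simp add: LIMSEQ_unique)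
qed

text \<open>The derivative of the left-hand side in \<open>t\<close> is nonpositive by the upper bound for the
  generator.\<close>

lemma Q_contractive_aux:
  assumes u: "(u, u') \<in> generator_graph X S" and t: "0 \<le> t"
  shows "exp (- 2 * M * t) * (norm (E (Q t u)))\<^sup>2 \<le> (norm (E u))\<^sup>2"
proof -
  let ?y = "\<lambda>s. exp (- 2 * M * s) * inner (E (Q s u)) (E (Q s u))"
  have "?y t \<le> ?y 0"
  proof (rule DERIV_nonpos_imp_decreasing_open[OF t])
    fix s assume s: "0 < s" "s < t"
    have at: "at s within {0..} = at s"
      using s by (intro at_within_interior) (simp add: interior_Ici[of "-1"])
    have "((\<lambda>s. E (Q s u)) has_vector_derivative E (Q s u')) (at s)"
      using E_Q_derivative[OF u, of s] s by (simp add: at)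
    from bounded_bilinear.has_vector_derivative[OF bounded_bilinear_inner this this]
    have 1: "((\<lambda>s. inner (E (Q s u)) (E (Q s u))) has_real_derivative 2 * inner (E (Q s u')) (E (Q s u))) (at s)"
      by (simp add: has_real_derivative_iff_has_vector_derivative inner_commute)
    have "(?y has_real_derivative - 2 * M * exp (- 2 * M * s) * inner (E (Q s u)) (E (Q s u)) +
        exp (- 2 * M * s) * (2 * inner (E (Q s u')) (E (Q s u)))) (at s)"
      by (auto intro!: derivative_eq_intros 1)
    moreover have "- 2 * M * exp (- 2 * M * s) * inner (E (Q s u)) (E (Q s u)) +
        exp (- 2 * M * s) * (2 * inner (E (Q s u')) (E (Q s u))) \<le> 0"
    proof -
      have "inner (E (Q s u')) (E (Q s u)) \<le> M * inner (E (Q s u)) (E (Q s u))"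
        using diss[OF generator_graph_invariant[OF u, of s]] s by (simp add: power2_norm_eq_inner)
      then have "exp (- 2 * M * s) * (2 * inner (E (Q s u')) (E (Q s u))) \<le>
         exp (- 2 * M * s) * (2 * (M * inner (E (Q s u)) (E (Q s u))))"
        by (intro mult_left_mono) auto
      then show ?thesis by (simp add: algebra_simps)
    qed
    ultimately show "\<exists>d. (?y has_real_derivative d) (at s) \<and> d \<le> 0" by blast
  next
    have "continuous_on {0..t} (\<lambda>s. E (Q s u))"
      by (intro bounded_linear.continuous_on[OF E] continuous_on_subset[OF Q_continuous]) auto
    then show "continuous_on {0..t} ?y" by (intro continuous_intros)
  qed
  moreover have "u \<in> X" using u by (auto simp: generator_graph_iff)
  ultimately show ?thesis by (simp add: Q_0 proj power2_norm_eq_inner)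
qed

theorem Q_contractive:
  assumes u: "u \<in> X" and t: "0 \<le> t"
  shows "exp (- 2 * M * t) * (norm (E (Q t u)))\<^sup>2 \<le> (norm (E u))\<^sup>2"
proof -
  obtain U U' where U: "\<And>n. (U n, U' n) \<in> generator_graph X S" "U \<longlonglongrightarrow> u"
    using generator_dense[OF u] by blast
  have a: "exp (- 2 * M * t) * (norm (E (Q t (U n))))\<^sup>2 \<le> (norm (E (U n)))\<^sup>2" for n
    by (rule Q_contractive_aux[OF U(1) t])
  have b: "(\<lambda>n. exp (- 2 * M * t) * (norm (E (Q t (U n))))\<^sup>2) \<longlonglongrightarrow> exp (- 2 * M * t) * (norm (E (Q t u)))\<^sup>2"
    by (intro tendsto_mult tendsto_const tendsto_power tendsto_norm E_Q_tendsto[OF t U(2)])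
  have c: "(\<lambda>n. (norm (E (U n)))\<^sup>2) \<longlonglongrightarrow> (norm (E u))\<^sup>2"
    by (intro tendsto_power tendsto_norm bounded_linear.tendsto[OF E U(2)])
  show ?thesis by (rule LIMSEQ_le[OF b c]) (rule exI[of _ 0], intro allI impI a)
qed

end


section \<open>The moment representation of completely monotone functions\<close>

text \<open>The alternating differences \<open>(-1)\<^sup>l \<Delta>\<^sub>h\<^sup>l m\<close>, which are nonnegative for completely monotone
  \<open>m\<close>.\<close>

primrec alt_diff :: "real \<Rightarrow> (real \<Rightarrow> real) \<Rightarrow> nat \<Rightarrow> real \<Rightarrow> real" where
  "alt_diff h m 0 r = m r"
| "alt_diff h m (Suc l) r = alt_diff h m l r - alt_diff h m l (r + h)"

lemma sum_pascal:
  fixes f :: "nat \<Rightarrow> real"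
  shows "(\<Sum>j\<le>Suc n. real (Suc n choose j) * f j) = (\<Sum>j\<le>n. real (n choose j) * (f j + f (Suc j)))"
proof -
  have "(\<Sum>j\<le>n. real (n choose j) * f j) = (\<Sum>j\<le>Suc n. real (n choose j) * f j)"
    by simp
  also have "\<dots> = f 0 + (\<Sum>j\<le>n. real (n choose Suc j) * f (Suc j))"
    by (subst sum.atMost_Suc_shift) simp
  finally show ?thesis
    by (subst sum.atMost_Suc_shift) (simp add: sum.distrib distrib_right distrib_left)
qed

text \<open>With \<open>D\<close> for the difference and \<open>\<tau>\<close> for the shift by \<open>h\<close> one has \<open>D + \<tau> = 1\<close>. This is
  the binomial expansion of \<open>(D + \<tau>)\<^sup>L = 1\<close>.\<close>

lemma alt_diff_sum:
  "(\<Sum>j\<le>L. real (L choose j) * alt_diff h m (L - j + l) (r + real j * h)) = alt_diff h m l r"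
proof (induction L arbitrary: r l)
  case 0
  then show ?case by simp
next
  case (Suc L)
  have "(\<Sum>j\<le>Suc L. real (Suc L choose j) * alt_diff h m (Suc L - j + l) (r + real j * h)) =
      (\<Sum>j\<le>L. real (L choose j) * (alt_diff h m (Suc L - j + l) (r + real j * h)
         + alt_diff h m (Suc L - Suc j + l) (r + real (Suc j) * h)))"
    by (rule sum_pascal)
  also have "\<dots> = (\<Sum>j\<le>L. real (L choose j) * alt_diff h m (L - j + Suc l) (r + real j * h)) +
      (\<Sum>j\<le>L. real (L choose j) * alt_diff h m (L - j + l) ((r + h) + real j * h))"
    unfolding sum.distrib[symmetric] distrib_left
    by (intro sum.cong refl) (simp add: Suc_diff_le algebra_simps)
  also have "\<dots> = alt_diff h m (Suc l) r + alt_diff h m l (r + h)"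
    by (simp only: Suc)
  finally show ?case by simp
qed

text \<open>Hausdorff's weights for the moment problem: the mass placed at \<open>k / N\<close> if the values
  \<open>m (i h)\<close> are to be moments of order \<open>i\<close>. They are nonnegative and add up to \<open>m 0\<close>.\<close>

definition bernstein_weight :: "real \<Rightarrow> (real \<Rightarrow> real) \<Rightarrow> nat \<Rightarrow> nat \<Rightarrow> real" where
  "bernstein_weight h m N k = real (N choose k) * alt_diff h m (N - k) (real k * h)"

text \<open>The weights reproduce the values of \<open>m\<close> exactly as factorial moments; only the
  comparison of \<open>(k choose i) / (N choose i)\<close> with \<open>(k / N)\<^sup>i\<close> is approximate.\<close>

lemma bernstein_weight_factorial_moment:
  assumes i: "i \<le> N"
  shows "(\<Sum>k\<le>N. bernstein_weight h m N k * (real (k choose i) / real (N choose i))) = m (real i * h)"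
proof -
  have pos: "0 < real (N choose i)" using i by simp
  have "(\<Sum>k\<le>N. bernstein_weight h m N k * (real (k choose i) / real (N choose i))) =
      (\<Sum>k\<in>{i..N}. bernstein_weight h m N k * (real (k choose i) / real (N choose i)))"
    by (rule sum.mono_neutral_right) auto
  also have "\<dots> = (\<Sum>k\<in>{i..N}. real ((N - i) choose (k - i)) * alt_diff h m (N - k) (real k * h))"
  proof (rule sum.cong[OF refl])
    fix k assume k: "k \<in> {i..N}"
    have "real (N choose k) * real (k choose i) = real (N choose i) * real ((N - i) choose (k - i))"
      using choose_mult[of i k N] k by (simp flip: of_nat_mult)
    then show "bernstein_weight h m N k * (real (k choose i) / real (N choose i)) =
        real ((N - i) choose (k - i)) * alt_diff h m (N - k) (real k * h)"
      using pos by (simp add: bernstein_weight_def field_simps)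
  qed
  also have "\<dots> = (\<Sum>j\<le>N - i. real ((N - i) choose j) * alt_diff h m (N - i - j + 0) (real i * h + real j * h))"
    using i by (intro sum.reindex_bij_witness[where i = "\<lambda>j. j + i" and j = "\<lambda>k. k - i"])
      (auto simp: algebra_simps of_nat_diff)
  also have "\<dots> = m (real i * h)"
    by (simp only: alt_diff_sum alt_diff.simps)
  finally show ?thesis .
qed

text \<open>Both quantities are products of \<open>i\<close> factors in \<open>[0, 1]\<close>, and corresponding factors
  differ by at most \<open>i / N\<close>.\<close>

lemma binomial_ratio_power_bound:
  assumes "k \<le> N" "i \<le> N" "0 < N"
  shows "\<bar>(real k / real N) ^ i - real (k choose i) / real (N choose i)\<bar> \<le> (real i)\<^sup>2 / real N"
proof -
  have choose: "real (n choose i) = (\<Prod>l<i. real (n - l)) / fact i" for n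
  proof (cases "i \<le> n")
    case True
    have "real (n choose i) = (\<Prod>l<i. real n - real l) / fact i"
      by (simp add: binomial_gbinomial gbinomial_prod_rev atLeast0LessThan)
    also have "(\<Prod>l<i. real n - real l) = (\<Prod>l<i. real (n - l))"
      using True by (intro prod.cong) auto
    finally show ?thesis .
  next
    case False
    then have "(\<Prod>l<i. real (n - l)) = 0"
      by (intro prod_zero) (auto intro!: bexI[of _ n])
    moreover have "n choose i = 0" using False by simp
    ultimately show ?thesis by (metis divide_eq_0_iff of_nat_0)
  qed
  have "real (k choose i) / real (N choose i) = (\<Prod>l<i. real (k - l) / real (N - l))"
    by (simp add: choose prod_dividef)
  moreover have "(real k / real N) ^ i = (\<Prod>l<i. real k / real N)"
    by simp
  ultimately have "\<bar>(real k / real N) ^ i - real (k choose i) / real (N choose i)\<bar> =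
      norm ((\<Prod>l<i. real k / real N) - (\<Prod>l<i. real (k - l) / real (N - l)))"
    by simp
  also have "\<dots> \<le> (\<Sum>l<i. norm (real k / real N - real (k - l) / real (N - l)))"
    using assms by (intro norm_prod_diff) (auto simp: divide_le_eq)
  also have "\<dots> \<le> (\<Sum>l<i. real i / real N)"
  proof (rule sum_mono)
    fix l assume l: "l \<in> {..<i}"
    show "norm (real k / real N - real (k - l) / real (N - l)) \<le> real i / real N"
    proof (cases "l \<le> k")
      case True
      have N: "0 < real N" "0 < real N - real l" using l assms by auto
      have "real k / real N - real (k - l) / real (N - l) =
          (real l / real N) * ((real N - real k) / (real N - real l))"
        using N True l assms by (simp add: of_nat_diff field_simps)
      also have "norm \<dots> \<le> (real l / real N) * 1"
        unfolding norm_mult using N True assms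
        by (intro mult_mono) (auto simp: abs_of_nonneg divide_le_eq)
      also have "\<dots> \<le> real i / real N"
        using l N by (simp add: divide_right_mono)
      finally show ?thesis .
    next
      case False
      then show ?thesis using l by (simp add: divide_right_mono)
    qed
  qed
  also have "\<dots> = (real i)\<^sup>2 / real N"
    by (simp add: power2_eq_square)
  finally show ?thesis .
qed

text \<open>Up to the factor \<open>y\<^sup>a\<close> the difference is at most \<open>1 - y \<le> - ln y\<close>, and \<open>s \<le> e\<^sup>s\<close> for
  \<open>s = - a ln y\<close>.\<close>

lemma power_powr_diff_bound:
  fixes y a :: real
  assumes y: "0 \<le> y" "y \<le> 1" and a: "0 < a" and i: "a \<le> real i" "real i \<le> a + 1"
  shows "\<bar>y powr a - y ^ i\<bar> \<le> 1 / a"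
proof (cases "y = 0")
  case True
  then show ?thesis using a i by (auto simp: power_0_left)
next
  case False
  then have y0: "0 < y" using y by simp
  have 1: "y ^ i \<le> y powr a"
    using y0 y i by (simp add: powr_realpow[symmetric] powr_mono')
  have "y powr (a + 1) \<le> y ^ i"
    using y0 y i by (simp add: powr_realpow[symmetric] powr_mono')
  then have 2: "y powr a - y ^ i \<le> y powr a * (1 - y)"
    using y0 by (simp add: powr_add algebra_simps)
  have "1 - y \<le> - ln y"
    using ln_le_minus_one[OF y0] by simp
  then have "a * (1 - y) \<le> - (a * ln y)"
    using a mult_left_mono[of "1 - y" "- ln y" a] by simp
  also have "\<dots> \<le> exp (- (a * ln y))"
    using exp_ge_add_one_self[of "- (a * ln y)"] by simp
  also have "\<dots> = 1 / y powr a"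
    using y0 by (simp add: powr_def exp_minus divide_inverse)
  finally have "y powr a * (1 - y) \<le> 1 / a"
    using y0 a by (simp add: field_simps)
  then show ?thesis using 1 2 by simp
qed

text \<open>A solution of the moment problem for the values \<open>m (i / (n + 1))\<close> is approximated by
  Hausdorff's weights. The \<open>n\<close>-th measure lives on \<open>[0, 1]\<close>, with the atoms \<open>k / N\<close> raised to
  the power \<open>n + 1\<close>, so that its moment of order \<open>r\<close> approximates \<open>m\<close> near \<open>r\<close>. By Helly's
  theorem a subsequence converges weakly. The clipping of \<open>x\<close> to \<open>[0, 1]\<close> stands for the
  statement that \<open>\<mu>\<close> is carried by this interval.\<close>

lemma bernstein_widder_representation:
  fixes m :: "real \<Rightarrow> real"
  assumes cm: "\<And>h r l. 0 < h \<Longrightarrow> 0 \<le> r \<Longrightarrow> 0 \<le> alt_diff h m l r"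
    and cont: "continuous_on {0..} m" and m0: "m 0 = 1"
  obtains \<mu> where "prob_space \<mu>" "sets \<mu> = sets borel"
    "\<And>r. 0 < r \<Longrightarrow> m r = (\<integral>x. (max 0 (min 1 x)) powr r \<partial>\<mu>)"
proof -
  \<comment> \<open>The moment of order \<open>i \<approx> n r\<close> of the \<open>n\<close>-th weights is used, with the error \<open>i\<^sup>2 / N\<close>; the
    cube makes it vanish in the limit.\<close>
  define N where "N n = Suc n ^ 3" for n :: nat
  define h where "h n = 1 / real (Suc n)" for n :: nat
  define w where "w n k = bernstein_weight (h n) m (N n) k" for n k
  define X where "X n k = (real k / real (N n)) ^ Suc n" for n k :: nat
  define P where "P n = point_measure {..N n} (\<lambda>k. ennreal (w n k))" for n
  define M where "M n = distr (P n) borel (X n)" for n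
  have Npos: "0 < N n" for n by (simp add: N_def)
  have w0: "0 \<le> w n k" for n k
    unfolding w_def bernstein_weight_def by (intro mult_nonneg_nonneg cm) (auto simp: h_def)
  have wsum: "(\<Sum>k\<le>N n. w n k) = 1" for n
    using bernstein_weight_factorial_moment[of 0 "N n" "h n" m] by (simp add: w_def m0)
  have meas: "X n \<in> measurable (P n) borel" for n
    by (simp add: P_def measurable_def sets_point_measure space_point_measure)
  interpret P: prob_space "P n" for n
    by standard (simp add: P_def emeasure_point_measure_finite space_point_measure w0 wsum)
  have rd: "real_distribution (M n)" for n
    unfolding M_def real_distribution_def real_distribution_axioms_def
    by (auto intro: P.prob_space_distr meas)
  have int: "(\<integral>x. g x \<partial>M n) = (\<Sum>k\<le>N n. w n k * g (X n k))"
    if "g \<in> borel_measurable borel" for g :: "real \<Rightarrow> real" and n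
    unfolding M_def using that
    by (subst integral_distr[OF meas]) (simp_all add: P_def lebesgue_integral_point_measure_finite w0)
  have X01: "0 \<le> X n k" "X n k \<le> 1" if "k \<le> N n" for n k
    using that Npos[of n] unfolding X_def by (simp, intro power_le_one) (auto simp: divide_le_eq)
  have "tight M"
    unfolding tight_def
  proof (intro conjI allI impI rd)
    fix \<epsilon> :: real assume "0 < \<epsilon>"
    have "1 - \<epsilon> < measure (M n) {-1<..1}" for n
    proof -
      have "measure (M n) {-1<..1} = (\<integral>x. indicator {-1<..1} x \<partial>M n)"
        by (simp add: M_def)
      also have "\<dots> = (\<Sum>k\<le>N n. w n k * indicator {-1<..1} (X n k))"
        by (rule int) simp
      also have "\<dots> = (\<Sum>k\<le>N n. w n k)"
      proof (rule sum.cong[OF refl])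
        fix k assume "k \<in> {..N n}"
        then have "0 \<le> X n k" "X n k \<le> 1" using X01 by auto
        then show "w n k * indicator {-1<..1} (X n k) = w n k" by (simp add: indicator_def)
      qed
      finally show ?thesis using wsum \<open>0 < \<epsilon>\<close> by simp
    qed
    then show "\<exists>a b. a < b \<and> (\<forall>n. 1 - \<epsilon> < measure (M n) {a<..b})"
      by (intro exI[of _ "-1"] exI[of _ 1]) auto
  qed
  from tight_imp_convergent_subsubsequence[OF this strict_mono_id]
  obtain s \<mu> where s: "strict_mono (s :: nat \<Rightarrow> nat)" and \<mu>: "real_distribution \<mu>"
    and conv: "weak_conv_m (M \<circ> s) \<mu>" by (auto simp: o_def)
  interpret \<mu>: real_distribution \<mu> by fact
  show ?thesis
  proof (rule that[of \<mu>])
    show "prob_space \<mu>" by unfold_locales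
    show "sets \<mu> = sets borel" by simp
    fix r :: real assume r: "0 < r"
    define g where "g x = (max 0 (min 1 x)) powr r" for x :: real
    have gcont: "isCont g x" for x
      unfolding g_def isCont_def using r
      by (intro tendsto_powr2 tendsto_intros) auto
    have gmeas: "g \<in> borel_measurable borel"
      by (intro borel_measurable_continuous_onI continuous_at_imp_continuous_on) (auto intro: gcont)
    have gb: "norm (g x) \<le> 1" for x
      unfolding g_def using r by (auto intro: powr_le1)
    have lim1: "(\<lambda>n. \<integral>x. g x \<partial>M (s n)) \<longlonglongrightarrow> (\<integral>x. g x \<partial>\<mu>)"
      using weak_conv_imp_integral_bdd_continuous_conv[of "M \<circ> s", OF _ \<mu> conv gcont gb] rd by simp
    \<comment> \<open>the moment order whose node \<open>i h\<close> approximates \<open>r\<close>; rounding up keeps it positive and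
      within reach of \<open>power_powr_diff_bound\<close>\<close>
    define i where "i n = nat \<lceil>real (Suc n) * r\<rceil>" for n
    have i: "real (Suc n) * r \<le> real (i n)" "real (i n) \<le> real (Suc n) * r + 1" for n
      using r mult_nonneg_nonneg[of "real (Suc n)" r] unfolding i_def by linarith+
    define e where "e n = 1 / (real (Suc n) * r) + (real (Suc n) * r + 1)\<^sup>2 / real (Suc n) ^ 3" for n
    have elim: "e \<longlonglongrightarrow> 0"
      unfolding e_def using r by real_asymp
    have "\<forall>\<^sub>F n in sequentially. real (Suc n) * r + 1 \<le> real (Suc n) ^ 3"
      using r by real_asymp
    then have close: "\<forall>\<^sub>F n in sequentially. norm ((\<integral>x. g x \<partial>M n) - m (real (i n) * h n)) \<le> e n"
    proof eventually_elim
      case (elim n)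
      have iN: "i n \<le> N n"
        using elim i(2)[of n] unfolding N_def by (metis of_nat_le_iff of_nat_power order_trans)
      have "(\<integral>x. g x \<partial>M n) - m (real (i n) * h n) =
          (\<Sum>k\<le>N n. w n k * (g (X n k) - real (k choose i n) / real (N n choose i n)))"
        using bernstein_weight_factorial_moment[OF iN, of "h n" m] int[OF gmeas]
        by (simp add: w_def right_diff_distrib sum_subtractf)
      also have "norm \<dots> \<le> (\<Sum>k\<le>N n. w n k * e n)"
      proof (rule sum_norm_le)
        fix k assume "k \<in> {..N n}"
        then have k: "k \<le> N n" by simp
        let ?y = "real k / real (N n)"
        have y: "0 \<le> ?y" "?y \<le> 1" using k Npos[of n] by (auto simp: divide_le_eq)
        have "g (X n k) = ?y powr (real (Suc n) * r)"
        proof (cases "?y = 0")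
          case True
          have "X n k = 0" unfolding X_def by (subst True) simp
          then have "g (X n k) = 0" by (simp add: g_def)
          then show ?thesis by (subst True) simp
        next
          case False
          then have "0 < ?y" using y by simp
          then show ?thesis
            using X01[OF k] unfolding g_def X_def
            by (simp add: powr_realpow[symmetric] powr_powr del: power_Suc of_nat_Suc)
        qed
        then have "\<bar>g (X n k) - ?y ^ i n\<bar> \<le> 1 / (real (Suc n) * r)"
          using power_powr_diff_bound[OF y _ i] r by simp
        moreover have "\<bar>?y ^ i n - real (k choose i n) / real (N n choose i n)\<bar> \<le> (real (Suc n) * r + 1)\<^sup>2 / real (Suc n) ^ 3"
        proof -
          have "\<bar>?y ^ i n - real (k choose i n) / real (N n choose i n)\<bar> \<le> (real (i n))\<^sup>2 / real (N n)"
            by (rule binomial_ratio_power_bound[OF k iN Npos])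
          also have "\<dots> \<le> (real (Suc n) * r + 1)\<^sup>2 / real (N n)"
            using i(2)[of n] by (intro divide_right_mono power_mono) auto
          finally show ?thesis by (simp only: N_def of_nat_power)
        qed
        ultimately have "\<bar>g (X n k) - real (k choose i n) / real (N n choose i n)\<bar> \<le> e n"
          unfolding e_def by linarith
        then show "norm (w n k * (g (X n k) - real (k choose i n) / real (N n choose i n))) \<le> w n k * e n"
          using w0 by (simp add: abs_mult mult_left_mono)
      qed
      also have "\<dots> = e n"
        using wsum by (simp flip: sum_distrib_right)
      finally show ?case .
    qed
    have "(\<lambda>n. real (i n) * h n) \<longlonglongrightarrow> r"
    proof (rule tendsto_sandwich)
      show "\<forall>\<^sub>F n in sequentially. r \<le> real (i n) * h n"
        using i by (intro always_eventually allI) (simp add: h_def field_simps)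
      show "\<forall>\<^sub>F n in sequentially. real (i n) * h n \<le> (real (Suc n) * r + 1) / real (Suc n)"
        using i by (intro always_eventually allI) (simp add: h_def divide_right_mono)
      show "(\<lambda>n. (real (Suc n) * r + 1) / real (Suc n)) \<longlonglongrightarrow> r"
        by real_asymp
    qed simp
    then have "(\<lambda>n. m (real (i n) * h n)) \<longlonglongrightarrow> m r"
      using r by (intro continuous_on_tendsto_compose[OF cont]) (auto simp: h_def)
    moreover have "(\<lambda>n. (\<integral>x. g x \<partial>M n) - m (real (i n) * h n)) \<longlonglongrightarrow> 0"
      by (rule tendsto_0_le[OF elim, of _ 1]) (use close in \<open>auto elim: eventually_mono\<close>)
    ultimately have "(\<lambda>n. m (real (i n) * h n) + ((\<integral>x. g x \<partial>M n) - m (real (i n) * h n))) \<longlonglongrightarrow> m r + 0"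
      by (rule tendsto_add)
    then have "(\<lambda>n. \<integral>x. g x \<partial>M n) \<longlonglongrightarrow> m r" by simp
    then have "(\<lambda>n. \<integral>x. g x \<partial>M (s n)) \<longlonglongrightarrow> m r"
      using LIMSEQ_subseq_LIMSEQ[OF _ s] by (simp add: o_def)
    with lim1 show "m r = (\<integral>x. (max 0 (min 1 x)) powr r \<partial>\<mu>)"
      unfolding g_def by (rule LIMSEQ_unique[rotated])
  qed
qed


section \<open>The Wright function as a limit of renewal probabilities\<close>

text \<open>The power series \<open>(1 - x)\<^sup>w\<close>\<close>

definition binser :: "real \<Rightarrow> real fps" where
  "binser w = fps_compose (fps_binomial w) (- fps_X)"

lemma binser_nth: "fps_nth (binser w) j = pochhammer (- w) j / fact j"
proof -
  have "fps_nth (binser w) j = (-1) ^ j * (w gchoose j)"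
    by (simp add: binser_def fps_compose_uminus')
  also have "\<dots> = pochhammer (- w) j / fact j"
    by (simp add: gbinomial_pochhammer flip: power_add mult.assoc power_mult_distrib)
  finally show ?thesis .
qed

lemma binser_add: "binser (v + w) = binser v * binser w"
  by (simp add: binser_def fps_binomial_add_mult fps_compose_mult_distrib)

lemma binser_0: "binser 0 = 1"
  by (simp add: binser_def)

lemma binser_power: "binser w ^ n = binser (real n * w)"
  by (induction n) (simp_all add: binser_0 binser_add[symmetric] distrib_right)

lemma fps_mult_nonneg:
  fixes f g :: "real fps"
  assumes "\<And>j. 0 \<le> fps_nth f j" "\<And>j. 0 \<le> fps_nth g j"
  shows "0 \<le> fps_nth (f * g) j"
  by (simp add: fps_mult_nth assms sum_nonneg)

lemma fps_power_nonneg: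
  fixes f :: "real fps"
  assumes "\<And>j. 0 \<le> fps_nth f j"
  shows "0 \<le> fps_nth (f ^ m) j"
proof (induction m arbitrary: j)
  case 0
  then show ?case by (simp add: fps_one_nth)
next
  case (Suc m)
  then show ?case using fps_mult_nonneg[OF assms Suc] by simp
qed

text \<open>The generating function of Sibuya's distribution of parameter \<open>\<alpha>\<close>, the law of the
  waiting times of the renewal process below\<close>

definition sibuya :: "real \<Rightarrow> real fps" where
  "sibuya \<alpha> = 1 - binser \<alpha>"

lemma sibuya_nth_0: "fps_nth (sibuya \<alpha>) 0 = 0"
  by (simp add: sibuya_def binser_nth)

lemma sibuya_nonneg:
  assumes "0 < \<alpha>" "\<alpha> < 1"
  shows "0 \<le> fps_nth (sibuya \<alpha>) j"
proof (cases j)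
  case 0
  then show ?thesis by (simp add: sibuya_nth_0)
next
  case (Suc n)
  have "fps_nth (sibuya \<alpha>) j = \<alpha> * pochhammer (1 - \<alpha>) n / fact (Suc n)"
    using Suc by (simp add: sibuya_def binser_nth pochhammer_rec)
  moreover have "0 < pochhammer (1 - \<alpha>) n"
    using assms by (intro pochhammer_pos) simp
  ultimately show ?thesis using assms by simp
qed

text \<open>The probability of exactly \<open>m\<close> renewals up to time \<open>j\<close>: the factor \<open>(1 - x)\<^sup>\<alpha>\<^sup>-\<^sup>1\<close> is the
  generating function of the tails of a waiting time, \<open>(1 - sibuya \<alpha>) / (1 - x)\<close>.\<close>

definition renewal_prob :: "real \<Rightarrow> nat \<Rightarrow> nat \<Rightarrow> real" where
  "renewal_prob \<alpha> m j = fps_nth (binser (\<alpha> - 1) * sibuya \<alpha> ^ m) j"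

lemma renewal_prob_nonneg:
  assumes "0 < \<alpha>" "\<alpha> < 1"
  shows "0 \<le> renewal_prob \<alpha> m j"
  unfolding renewal_prob_def
proof (intro fps_mult_nonneg fps_power_nonneg sibuya_nonneg assms)
  fix j
  show "0 \<le> fps_nth (binser (\<alpha> - 1)) j"
    using assms pochhammer_pos[of "1 - \<alpha>" j] by (simp add: binser_nth)
qed

text \<open>Expand the power of \<open>1 - (1 - x)\<^sup>\<alpha>\<close>. Each summand is a single coefficient of a binomial
  series, whose asymptotics in \<open>j\<close> is the definition of the Gamma function as a limit
  (\<open>binser_nth_asymp\<close>).\<close>

lemma renewal_prob_eq_sum:
  "renewal_prob \<alpha> m j =
     (\<Sum>i\<le>m. real (m choose i) * (-1) ^ i * fps_nth (binser (\<alpha> * (real i + 1) - 1)) j)"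
proof -
  have "sibuya \<alpha> ^ m = (- binser \<alpha> + 1) ^ m"
    by (simp add: sibuya_def)
  also have "\<dots> = (\<Sum>i\<le>m. of_nat (m choose i) * (- binser \<alpha>) ^ i)"
    by (subst binomial_ring) simp
  also have "\<dots> = (\<Sum>i\<le>m. fps_const (real (m choose i) * (-1) ^ i) * binser (real i * \<alpha>))"
  proof (intro sum.cong refl)
    fix i
    have "(- binser \<alpha>) ^ i = fps_const ((-1) ^ i) * binser (real i * \<alpha>)"
      by (subst power_minus) (simp add: binser_power fps_const_power[symmetric] 
         fps_const_neg[symmetric] del: fps_const_power fps_const_neg)
    then show "of_nat (m choose i) * (- binser \<alpha>) ^ i =
        fps_const (real (m choose i) * (-1) ^ i) * binser (real i * \<alpha>)"
      by (simp add: fps_of_nat[symmetric] mult.assoc[symmetric])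
  qed
  finally have "binser (\<alpha> - 1) * sibuya \<alpha> ^ m =
      (\<Sum>i\<le>m. fps_const (real (m choose i) * (-1) ^ i) * (binser (\<alpha> - 1) * binser (real i * \<alpha>)))"
    by (simp add: sum_distrib_left mult_ac)
  also have "\<dots> = (\<Sum>i\<le>m. fps_const (real (m choose i) * (-1) ^ i) * binser (\<alpha> * (real i + 1) - 1))"
    by (simp add: binser_add[symmetric] algebra_simps)
  finally show ?thesis
    by (simp add: renewal_prob_def fps_sum_nth)
qed

lemma binser_nth_asymp:
  "(\<lambda>j. real j powr w * fps_nth (binser (w - 1)) j) \<longlonglongrightarrow> rGamma (1 - w)"
proof -
  have "(\<lambda>n. rGamma_series (1 - w) n * (real n / (real n + 1 - w))) \<longlonglongrightarrow> rGamma (1 - w) * 1"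
  proof (intro tendsto_mult rGamma_series_LIMSEQ)
    show "(\<lambda>n. real n / (real n + 1 - w)) \<longlonglongrightarrow> 1"
      by real_asymp
  qed
  moreover have "\<forall>\<^sub>F n in sequentially. rGamma_series (1 - w) n * (real n / (real n + 1 - w)) =
      real n powr w * fps_nth (binser (w - 1)) n"
  proof -
    have "\<forall>\<^sub>F n in sequentially. n > nat \<lceil>\<bar>w\<bar>\<rceil> + 1"
      by (rule eventually_gt_at_top)
    then show ?thesis
    proof eventually_elim
      case (elim n)
      then have n: "real n > 0" "real n + 1 - w > 0" by linarith+
      have e: "exp ((1 - w) * ln (real n)) = real n powr (1 - w)"
        using n by (simp add: powr_def)
      have "real n powr (1 - w) * real n powr w = real n"
        using n by (simp add: powr_add[symmetric])
      then have e2: "real n / real n powr (1 - w) = real n powr w"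
        using n by (simp add: field_simps)
      have "rGamma_series (1 - w) n * (real n / (real n + 1 - w)) =
         pochhammer (1 - w) n / fact n * (real n / real n powr (1 - w))"
      proof -
        define P where "P = pochhammer (1 - w) n"
        define R where "R = real n powr (1 - w)"
        have R: "exp ((1 - w) * of_real (ln (real n))) = R" "R > 0"
          using n e by (simp_all add: R_def)
        have y: "1 - w + real n = real n + 1 - w" by simp
        show ?thesis
          unfolding rGamma_series_def R Suc_eq_plus1[symmetric] pochhammer_Suc
            P_def[symmetric] R_def[symmetric] y
          using n R(2) by simp
      qed
      also have "\<dots> = real n powr w * fps_nth (binser (w - 1)) n"
        by (simp add: e2 binser_nth)
      finally show ?case .
    qed
  qed
  ultimately show ?thesis
    by (auto elim: Lim_transform_eventually)
qed

lemma exp_ge_power_div_fact: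
  fixes w :: real
  assumes "0 \<le> w"
  shows "w ^ n / fact n \<le> exp w"
proof -
  have "(\<Sum>k\<in>{n}. w ^ k /\<^sub>R fact k) \<le> exp w"
    unfolding exp_def using assms
    by (intro sum_le_suminf summable_exp_generic) auto
  then show ?thesis by (simp add: divide_inverse mult.commute)
qed

text \<open>Passing from \<open>j\<close> to \<open>j + 1\<close> multiplies the coefficient by \<open>1 - w / (j + 1)\<close>. Once
  \<open>j + 1 \<ge> w\<close>, the left-hand side no longer increases; before that, the coefficients are
  dominated by the terms of the exponential series of \<open>w\<close>. The bound is explicit in \<open>w\<close>,
  because it is summed over \<open>w = \<alpha> (i + 1)\<close>.\<close>

lemma binser_nth_bound:
  assumes "0 \<le> w"
  shows "\<bar>fps_nth (binser (w - 1)) j\<bar> * (real j + 1) powr w \<le> exp w * (w + 1) powr w"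
proof -
  let ?c = "\<lambda>j. \<bar>fps_nth (binser (w - 1)) j\<bar>"
  have step: "?c (Suc j) = ?c j * \<bar>1 - w / (real j + 1)\<bar>" for j
  proof -
    have "fps_nth (binser (w - 1)) (Suc j) =
        fps_nth (binser (w - 1)) j * (1 - w / (real j + 1))"
      by (simp add: binser_nth pochhammer_Suc field_simps)
    then show ?thesis by (simp add: abs_mult)
  qed
  have small: "?c j \<le> w ^ j / fact j" if "real j \<le> w" for j
    using that
  proof (induction j)
    case 0
    then show ?case by (simp add: binser_nth)
  next
    case (Suc j)
    have "\<bar>1 - w / (real j + 1)\<bar> \<le> w / (real j + 1)"
    proof -
      have "1 \<le> w / (real j + 1)"
        using Suc.prems by (simp add: le_divide_eq)
      then show ?thesis by linarith
    qed
    then have "?c (Suc j) \<le> w ^ j / fact j * (w / (real j + 1))"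
      unfolding step using Suc assms by (intro mult_mono) auto
    then show ?case by (simp add: field_simps)
  qed
  show ?thesis
  proof (induction j)
    case 0
    have "1 \<le> exp w * (w + 1) powr w"
      using assms by (intro mult_ge1_I) (auto intro: ge_one_powr_ge_zero)
    then show ?case by (simp add: binser_nth)
  next
    case (Suc j)
    show ?case
    proof (cases "real (Suc j) \<le> w")
      case True
      have "w ^ Suc j / fact (Suc j) \<le> exp w"
        by (rule exp_ge_power_div_fact[OF assms])
      then have "?c (Suc j) \<le> exp w"
        using small[OF True] by linarith
      moreover have "(real (Suc j) + 1) powr w \<le> (w + 1) powr w"
        using True assms by (intro powr_mono2) auto
      ultimately show ?thesis by (intro mult_mono) auto
    next
      case False
      let ?x = "real j + 1"
      have le: "\<bar>1 - w / ?x\<bar> \<le> exp (- w / ?x)"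
        using False exp_ge_add_one_self[of "- w / ?x"] by (auto simp: field_simps abs_if)
      have "1 + 1 / ?x \<le> exp (1 / ?x)"
        by (rule exp_ge_add_one_self)
      then have "(?x + 1) \<le> exp (1 / ?x) * ?x"
        by (simp add: field_simps)
      then have "(?x + 1) powr w \<le> (exp (1 / ?x) * ?x) powr w"
        using assms by (intro powr_mono2) auto
      also have "\<dots> = exp (w / ?x) * ?x powr w"
        by (simp add: powr_mult exp_powr_real)
      finally have "?c (Suc j) * (?x + 1) powr w \<le> (?c j * exp (- w / ?x)) * (exp (w / ?x) * ?x powr w)"
        unfolding step using le by (intro mult_mono) auto
      also have "\<dots> = ?c j * ?x powr w"
        by (simp add: mult.assoc exp_minus field_simps)
      finally show ?thesis using Suc by (simp add: add_ac)
    qed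
  qed
qed

text \<open>The ratio of successive terms is of order \<open>i\<^sup>\<alpha>\<^sup>-\<^sup>1\<close>; this is where \<open>\<alpha> < 1\<close> enters.\<close>

lemma summable_dominating_series:
  fixes \<alpha> z :: real
  assumes "0 < \<alpha>" "\<alpha> < 1"
  shows "summable (\<lambda>i. z ^ i / fact i *
    (exp (\<alpha> * (real i + 1)) * (\<alpha> * (real i + 1) + 1) powr (\<alpha> * (real i + 1))))"
    (is "summable ?f")
proof -
  define r where "r i = \<bar>z\<bar> / (real i + 1) * exp \<alpha> *
    ((\<alpha> * (real i + 2) + 1) powr (\<alpha> * (real i + 2)) / (\<alpha> * (real i + 1) + 1) powr (\<alpha> * (real i + 1)))"
    for i :: nat
  have "r \<longlonglongrightarrow> 0"
    unfolding r_def using assms by real_asymp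
  then have "\<forall>\<^sub>F i in sequentially. r i < 1 / 2"
    by (rule order_tendstoD) simp
  then obtain N where N: "\<And>i. i \<ge> N \<Longrightarrow> r i < 1 / 2"
    by (auto simp: eventually_at_top_linorder)
  show ?thesis
  proof (rule summable_ratio_test)
    show "(1 / 2 :: real) < 1" by simp
    fix i assume i: "N \<le> i"
    have "0 < \<alpha> * (real i + 1) + 1"
      using mult_nonneg_nonneg[of \<alpha> "real i + 1"] assms by linarith
    then have p: "0 < (\<alpha> * (real i + 1) + 1) powr (\<alpha> * (real i + 1))"
      by simp
    define A A' where "A = (\<alpha> * (real i + 1) + 1) powr (\<alpha> * (real i + 1))"
      and "A' = (\<alpha> * (real i + 2) + 1) powr (\<alpha> * (real i + 2))"
    have A: "0 < A" "0 \<le> A'"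
      using p by (simp_all add: A_def A'_def)
    have e: "exp (\<alpha> * (real i + 2)) = exp (\<alpha> * (real i + 1)) * exp \<alpha>"
      by (simp add: exp_add[symmetric] algebra_simps)
    have s: "real (Suc i) + 1 = real i + 2" "real i + 1 \<noteq> 0" by simp_all
    have "norm (?f (Suc i)) = \<bar>z\<bar> * \<bar>z\<bar> ^ i / ((real i + 1) * fact i) *
        (exp (\<alpha> * (real i + 1)) * exp \<alpha> * A')"
      unfolding s A'_def[symmetric] e using A by (simp add: abs_mult power_abs add.commute)
    also have "\<dots> = (\<bar>z\<bar> / (real i + 1) * exp \<alpha> * (A' / A)) *
        (\<bar>z\<bar> ^ i / fact i * (exp (\<alpha> * (real i + 1)) * A))"
      using A s by (simp only: times_divide_eq_left times_divide_eq_right) (simp add: ac_simps)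
    also have "\<dots> = r i * norm (?f i)"
      using A by (simp add: r_def A_def[symmetric] A'_def[symmetric] abs_mult power_abs)
    finally have "norm (?f (Suc i)) = r i * norm (?f i)" .
    moreover have "\<dots> \<le> 1 / 2 * norm (?f i)"
      using N[OF i] by (intro mult_right_mono) auto
    ultimately show "norm (?f (Suc i)) \<le> 1 / 2 * norm (?f i)" by (simp only:)
  qed
qed

lemma binomial_scaled_tendsto:
  assumes "0 < \<alpha>" "0 \<le> z"
  shows "(\<lambda>j. real (nat \<lfloor>z * real j powr \<alpha>\<rfloor> choose i) / (real j powr \<alpha>) ^ i) \<longlonglongrightarrow> z ^ i / fact i"
proof -
  let ?m = "\<lambda>j. nat \<lfloor>z * real j powr \<alpha>\<rfloor>"
  have big: "filterlim (\<lambda>j::nat. real j powr \<alpha>) at_top sequentially"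
    using assms by real_asymp
  have 1: "(\<lambda>j. real (?m j) / real j powr \<alpha>) \<longlonglongrightarrow> z"
  proof (rule tendsto_sandwich)
    show "\<forall>\<^sub>F j in sequentially. z - 1 / real j powr \<alpha> \<le> real (?m j) / real j powr \<alpha>"
      using eventually_gt_at_top[of 0]
    proof eventually_elim
      case (elim j)
      have "z * real j powr \<alpha> - 1 \<le> real (?m j)" by linarith
      then have "(z * real j powr \<alpha> - 1) / real j powr \<alpha> \<le> real (?m j) / real j powr \<alpha>"
        by (intro divide_right_mono) auto
      then show ?case using elim by (simp add: diff_divide_distrib)
    qed
    show "\<forall>\<^sub>F j in sequentially. real (?m j) / real j powr \<alpha> \<le> z"
      using eventually_gt_at_top[of 0]
    proof eventually_elim
      case (elim j)
      have "0 \<le> z * real j powr \<alpha>" using assms by simp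
      then have "real (?m j) \<le> z * real j powr \<alpha>" by linarith
      then show ?case using elim by (simp add: field_simps)
    qed
    show "(\<lambda>j. z - 1 / real j powr \<alpha>) \<longlonglongrightarrow> z"
      using assms by real_asymp
  qed auto
  have "(\<lambda>j. (\<Prod>l<i. real (?m j) / real j powr \<alpha> - real l / real j powr \<alpha>) / fact i) \<longlonglongrightarrow>
      (\<Prod>l<i. z - 0) / fact i"
    by (intro tendsto_intros 1 tendsto_divide_0[OF tendsto_const] filterlim_at_top_imp_at_infinity big) auto
  moreover have "(\<Prod>l<i. real (?m j) / real j powr \<alpha> - real l / real j powr \<alpha>) / fact i =
      real (?m j choose i) / (real j powr \<alpha>) ^ i" for j
    by (simp add: binomial_gbinomial gbinomial_prod_rev diff_divide_distrib[symmetric]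
          prod_dividef atLeast0LessThan)
  ultimately show ?thesis by simp
qed

text \<open>Scaled by \<open>j\<^sup>\<alpha>\<close>, the summands of \<open>renewal_prob_eq_sum\<close> tend to the summands of the Wright
  series, and \<open>binser_nth_bound\<close> provides a summable majorant, so that Tannery's theorem
  applies.\<close>

lemma Wright_limit:
  assumes \<alpha>: "0 < \<alpha>" "\<alpha> < 1" and z: "0 \<le> z"
  shows "summable (\<lambda>m. norm ((- z) ^ m * rGamma (- \<alpha> * real m + 1 - \<alpha>) / fact m))"
    and "(\<lambda>j. real j powr \<alpha> * renewal_prob \<alpha> (nat \<lfloor>z * real j powr \<alpha>\<rfloor>) j) \<longlonglongrightarrow> Wright \<alpha> z"
proof -
  let ?m = "\<lambda>j. nat \<lfloor>z * real j powr \<alpha>\<rfloor>"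
  let ?w = "\<lambda>i. \<alpha> * (real i + 1)"
  define a where "a i j = real (?m j choose i) * (-1) ^ i * fps_nth (binser (?w i - 1)) j * real j powr \<alpha>" for i j :: nat
  define b where "b i = (- z) ^ i * rGamma (- \<alpha> * real i + 1 - \<alpha>) / fact i" for i
  define M where "M i = z ^ i / fact i * (exp (?w i) * (?w i + 1) powr ?w i)" for i
  \<comment> \<open>Separates the summand into its two convergent factors.\<close>
  have split: "a i j = (-1) ^ i * (real (?m j choose i) / (real j powr \<alpha>) ^ i) *
      (real j powr ?w i * fps_nth (binser (?w i - 1)) j)" if "j > 0" for i j
  proof -
    have "real j powr ?w i = (real j powr \<alpha>) ^ i * real j powr \<alpha>"
      using that by (simp add: powr_powr[symmetric] powr_add powr_realpow distrib_left)
    then show ?thesis using that by (simp add: a_def)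
  qed
  have lim: "a i \<longlonglongrightarrow> b i" for i
  proof -
    have "(\<lambda>j. (-1) ^ i * (real (?m j choose i) / (real j powr \<alpha>) ^ i) *
      (real j powr ?w i * fps_nth (binser (?w i - 1)) j)) \<longlonglongrightarrow>
        (-1) ^ i * (z ^ i / fact i) * rGamma (1 - ?w i)"
      by (intro tendsto_intros binomial_scaled_tendsto binser_nth_asymp \<alpha> z)
    moreover have "(-1) ^ i * (z ^ i / fact i) * rGamma (1 - ?w i) = b i"
      by (simp add: b_def power_minus[of z] algebra_simps)
    moreover have "\<forall>\<^sub>F j in sequentially. (-1) ^ i * (real (?m j choose i) / (real j powr \<alpha>) ^ i) *
      (real j powr ?w i * fps_nth (binser (?w i - 1)) j) = a i j"
      using eventually_gt_at_top[of 0] by eventually_elim (simp add: split)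
    ultimately show ?thesis by (auto elim: Lim_transform_eventually)
  qed
  have bound: "norm (a i j) \<le> M i" if j: "j > 0" for i j
  proof -
    have m: "real (?m j) \<le> z * real j powr \<alpha>"
      using z by (simp add: of_nat_floor)
    have "real (?m j choose i) \<le> real (?m j) ^ i / fact i"
    proof -
      have "real (fact i * (?m j choose i)) \<le> real (?m j ^ i)"
        by (intro of_nat_mono binomial_fact_pow[unfolded mult.commute[of "(_ choose _)"]])
      then show ?thesis by (simp add: field_simps)
    qed
    also have "\<dots> \<le> (z * real j powr \<alpha>) ^ i / fact i"
      using m by (intro divide_right_mono power_mono) auto
    finally have 1: "real (?m j choose i) / (real j powr \<alpha>) ^ i \<le> z ^ i / fact i"
      using j by (simp add: field_simps power_mult_distrib)
    have "real j powr ?w i \<le> (real j + 1) powr ?w i"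
      using \<alpha> by (intro powr_mono2) auto
    then have "\<bar>fps_nth (binser (?w i - 1)) j\<bar> * real j powr ?w i \<le>
        \<bar>fps_nth (binser (?w i - 1)) j\<bar> * (real j + 1) powr ?w i"
      by (rule mult_left_mono) simp
    then have "\<bar>real j powr ?w i * fps_nth (binser (?w i - 1)) j\<bar> \<le>
        \<bar>fps_nth (binser (?w i - 1)) j\<bar> * (real j + 1) powr ?w i"
      by (subst mult.commute) (simp add: abs_mult)
    also have "\<dots> \<le> exp (?w i) * (?w i + 1) powr ?w i"
      using \<alpha> by (intro binser_nth_bound) simp
    finally have 2: "\<bar>real j powr ?w i * fps_nth (binser (?w i - 1)) j\<bar> \<le> exp (?w i) * (?w i + 1) powr ?w i" .
    have "norm (a i j) = (real (?m j choose i) / (real j powr \<alpha>) ^ i) *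
        \<bar>real j powr ?w i * fps_nth (binser (?w i - 1)) j\<bar>"
      using j by (simp add: split abs_mult power_abs)
    also have "\<dots> \<le> M i"
      unfolding M_def using 1 2 z by (intro mult_mono) auto
    finally show ?thesis .
  qed
  have tann: "(\<forall>\<^sub>F n in sequentially. summable (\<lambda>k. norm (a k n))) \<and>
      summable (\<lambda>n. norm (b n)) \<and> (\<lambda>n. \<Sum>k. a k n) \<longlonglongrightarrow> suminf b"
  proof (rule tannerys_theorem[OF lim])
    show "\<forall>\<^sub>F (k, n) in sequentially \<times>\<^sub>F sequentially. norm (a k n) \<le> M k"
      unfolding eventually_prod_sequentially using bound by (intro exI[of _ 1]) auto
    show "summable M"
      unfolding M_def by (rule summable_dominating_series[OF \<alpha>])
  qed simp
  then show "summable (\<lambda>m. norm ((- z) ^ m * rGamma (- \<alpha> * real m + 1 - \<alpha>) / fact m))"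
    by (simp add: b_def)
  have "(\<Sum>k. a k j) = real j powr \<alpha> * renewal_prob \<alpha> (?m j) j" for j
  proof -
    have "(\<Sum>k. a k j) = (\<Sum>k\<le>?m j. a k j)"
      by (rule suminf_finite) (auto simp: a_def)
    then show ?thesis
      by (simp add: a_def renewal_prob_eq_sum sum_distrib_left mult_ac)
  qed
  then show "(\<lambda>j. real j powr \<alpha> * renewal_prob \<alpha> (?m j) j) \<longlonglongrightarrow> Wright \<alpha> z"
    using tann unfolding Wright_def b_def[symmetric] by simp
qed

lemma Wright_nonneg:
  assumes "0 < \<alpha>" "\<alpha> < 1" "0 \<le> z"
  shows "0 \<le> Wright \<alpha> z"
  using assms by (intro LIMSEQ_le_const[OF Wright_limit(2)]) (auto simp: renewal_prob_nonneg)

lemma Wright_0: "Wright \<alpha> 0 = rGamma (1 - \<alpha>)"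
  unfolding Wright_def by (subst suminf_finite[of "{0}"]) auto

lemma continuous_on_Wright:
  assumes "0 < \<alpha>" "\<alpha> < 1"
  shows "continuous_on UNIV (Wright \<alpha>)"
proof -
  define c where "c m = (-1) ^ m * rGamma (- \<alpha> * real m + 1 - \<alpha>) / fact m" for m :: nat
  have eq: "(- z) ^ m * rGamma (- \<alpha> * real m + 1 - \<alpha>) / fact m = c m * z ^ m" for z m
    by (simp add: c_def power_minus[of z])
  have s: "summable (\<lambda>m. c m * z ^ m)" for z
  proof -
    have "summable (\<lambda>m. norm (c m * \<bar>z\<bar> ^ m))"
      using Wright_limit(1)[OF assms, of "\<bar>z\<bar>"] by (simp only: eq abs_ge_zero)
    then have "summable (\<lambda>m. norm (c m * z ^ m))"
      by (simp add: abs_mult power_abs)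
    then show ?thesis by (rule summable_norm_cancel)
  qed
  have "isCont (\<lambda>z. \<Sum>m. c m * z ^ m) z" for z
    by (rule isCont_powser_converges_everywhere[OF s])
  then show ?thesis
    unfolding Wright_def eq by (simp add: continuous_on_eq_continuous_at)
qed


section \<open>Moments and Laplace transform of the Wright function\<close>

lemma rising_binomial_series:
  fixes k :: nat
  shows "Abs_fps (\<lambda>m. real (m + k choose k)) * (1 - fps_X) ^ Suc k = 1"
proof (induction k)
  case 0
  have "Abs_fps (\<lambda>m. real (m + 0 choose 0)) = Abs_fps (\<lambda>_. 1)" by simp
  then show ?case
    using fps_inverse_gp'[where ?'a = real] inverse_mult_eq_1'[of "Abs_fps (\<lambda>n. 1 :: real)"] by simp
next
  case (Suc k)
  have "Abs_fps (\<lambda>m. real (m + Suc k choose Suc k)) * (1 - fps_X) = Abs_fps (\<lambda>m. real (m + k choose k))"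
    (is "?A * _ = ?B")
  proof (rule fps_ext)
    fix n
    have "fps_nth (?A * (1 - fps_X)) n = fps_nth ?A n - (if n = 0 then 0 else fps_nth ?A (n - 1))"
      by (simp add: right_diff_distrib)
    then show "fps_nth (?A * (1 - fps_X)) n = fps_nth ?B n"
      by (cases n) simp_all
  qed
  then have "?A * (1 - fps_X) ^ Suc (Suc k) = ?B * (1 - fps_X) ^ Suc k"
    by (simp add: mult.assoc[symmetric])
  from trans[OF this Suc] show ?case .
qed

text \<open>Substituting \<open>1 - (1 - x)\<^sup>\<alpha>\<close> into \<open>(1 - X)\<^sup>-\<^sup>(\<^sup>k\<^sup>+\<^sup>1\<^sup>)\<close> gives \<open>(1 - x)\<^sup>-\<^sup>\<alpha>\<^sup>(\<^sup>k\<^sup>+\<^sup>1\<^sup>)\<close>.\<close>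

lemma renewal_prob_moment:
  "(\<Sum>m\<le>j. real (m + k choose k) * renewal_prob \<alpha> m j) = fps_nth (binser (- \<alpha> * real k - 1)) j"
proof -
  let ?A = "Abs_fps (\<lambda>m. real (m + k choose k))"
  let ?P = "sibuya \<alpha>"
  have "fps_compose (?A * (1 - fps_X) ^ Suc k) ?P = 1"
    by (simp only: rising_binomial_series fps_compose_1)
  then have 1: "fps_compose ?A ?P * binser \<alpha> ^ Suc k = 1"
  proof -
    have "fps_compose ((1 - fps_X) ^ Suc k) ?P = (fps_compose (1 - fps_X) ?P) ^ Suc k"
      by (rule fps_compose_power[OF sibuya_nth_0, symmetric])
    also have "fps_compose (1 - fps_X) ?P = binser \<alpha>"
      by (simp add: fps_compose_sub_distrib sibuya_nth_0) (simp add: sibuya_def)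
    finally show ?thesis
      using \<open>fps_compose (?A * (1 - fps_X) ^ Suc k) ?P = 1\<close>
      by (simp only: fps_compose_mult_distrib[OF sibuya_nth_0])
  qed
  have 2: "binser \<alpha> ^ Suc k * binser (- \<alpha> * (real k + 1)) = 1"
    by (simp only: binser_power binser_add[symmetric]) (simp add: binser_0 algebra_simps)
  have 3: "fps_compose ?A ?P = binser (- \<alpha> * (real k + 1))"
  proof -
    have "fps_compose ?A ?P = fps_compose ?A ?P * (binser \<alpha> ^ Suc k * binser (- \<alpha> * (real k + 1)))"
      by (simp only: 2 mult_1_right)
    also have "\<dots> = (fps_compose ?A ?P * binser \<alpha> ^ Suc k) * binser (- \<alpha> * (real k + 1))"
      by (simp only: mult.assoc)
    finally show ?thesis by (simp only: 1 mult_1_left)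
  qed
  have "(\<Sum>m\<le>j. real (m + k choose k) * renewal_prob \<alpha> m j) =
      fps_nth (binser (\<alpha> - 1) * fps_compose ?A ?P) j"
  proof -
    have z: "fps_nth (?P ^ m) l = 0" if "l < m" for l m
      using that by (intro startsby_zero_power_prefix[rule_format] sibuya_nth_0)
    have "fps_nth (binser (\<alpha> - 1) * fps_compose ?A ?P) j =
       (\<Sum>i=0..j. fps_nth (binser (\<alpha> - 1)) i * (\<Sum>m=0..j-i. real (m + k choose k) * fps_nth (?P ^ m) (j - i)))"
      by (simp add: fps_mult_nth fps_compose_nth)
    also have "\<dots> = (\<Sum>i=0..j. fps_nth (binser (\<alpha> - 1)) i * (\<Sum>m\<le>j. real (m + k choose k) * fps_nth (?P ^ m) (j - i)))"
      by (intro sum.cong refl arg_cong2[where f = "(*)"] sum.mono_neutral_left) (auto simp: z)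
    also have "\<dots> = (\<Sum>m\<le>j. real (m + k choose k) * renewal_prob \<alpha> m j)"
      unfolding renewal_prob_def fps_mult_nth sum_distrib_left
      by (subst sum.swap) (simp add: mult_ac)
    finally show ?thesis ..
  qed
  also have "\<dots> = fps_nth (binser (- \<alpha> * real k - 1)) j"
  proof -
    have "\<alpha> - 1 + - \<alpha> * (real k + 1) = - \<alpha> * real k - 1"
      by (simp add: algebra_simps)
    then show ?thesis by (simp only: 3 binser_add[symmetric])
  qed
  finally show ?thesis .
qed

lemma renewal_prob_eq_0: "j < m \<Longrightarrow> renewal_prob \<alpha> m j = 0"
  unfolding renewal_prob_def fps_mult_nth
  by (intro sum.neutral ballI)
    (use startsby_zero_power_prefix[OF sibuya_nth_0] in auto)

text \<open>The integrand is constant on the intervals \<open>[m / c, (m + 1) / c)\<close>.\<close>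

lemma nn_integral_floor:
  fixes F :: "nat \<Rightarrow> ennreal" and c :: real
  assumes c: "0 < c"
  shows "(\<integral>\<^sup>+z\<in>{0<..}. F (nat \<lfloor>z * c\<rfloor>) \<partial>lborel) = (\<Sum>m. F m) * ennreal (1 / c)"
proof -
  have "(\<integral>\<^sup>+z\<in>{0<..}. F (nat \<lfloor>z * c\<rfloor>) \<partial>lborel) = (\<integral>\<^sup>+z. (\<Sum>m. F m * indicator {real m / c..<(real m + 1) / c} z) \<partial>lborel)"
  proof (rule nn_integral_cong_AE, rule AE_mp[OF AE_lborel_singleton[of 0]], rule AE_I2, rule impI)
    fix z :: real assume "z \<noteq> 0"
    show "F (nat \<lfloor>z * c\<rfloor>) * indicator {0<..} z = (\<Sum>m. F m * indicator {real m / c..<(real m + 1) / c} z)"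
    proof (cases "0 < z")
      case True
      let ?k = "nat \<lfloor>z * c\<rfloor>"
      have *: "z \<in> {real m / c..<(real m + 1) / c} \<longleftrightarrow> m = ?k" for m
      proof -
        have "0 \<le> z * c" using True c by simp
        then have "(real m \<le> z * c \<and> z * c < real m + 1) \<longleftrightarrow> m = ?k"
          by linarith
        then show ?thesis using c by (simp add: field_simps)
      qed
      have "(\<Sum>m. F m * indicator {real m / c..<(real m + 1) / c} z) = (\<Sum>m\<in>{?k}. F m * indicator {real m / c..<(real m + 1) / c} z)"
        using * by (intro suminf_finite) (auto simp: indicator_def)
      also have "\<dots> = F ?k"
        using *[of ?k] by (simp add: indicator_def)
      finally show ?thesis using True by simp
    next
      case False
      have "z \<notin> {real m / c..<(real m + 1) / c}" for m
      proof -
        have "0 \<le> real m / c" using c by simp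
        then show ?thesis using False \<open>z \<noteq> 0\<close> by (simp add: not_le del: divide_nonneg_pos)
      qed
      then have "F m * indicator {real m / c..<(real m + 1) / c} z = 0" for m
        by (metis indicator_simps(2) mult_zero_right)
      then show ?thesis using False by (simp del: mult_eq_0_iff)
    qed
  qed
  also have "\<dots> = (\<Sum>m. \<integral>\<^sup>+z. F m * indicator {real m / c..<(real m + 1) / c} z \<partial>lborel)"
    by (rule nn_integral_suminf) measurable
  also have "\<dots> = (\<Sum>m. F m * ennreal (1 / c))"
    using c by (intro arg_cong[where f = suminf] ext)
      (simp add: nn_integral_cmult_indicator divide_right_mono diff_divide_distrib[symmetric])
  finally show ?thesis by simp
qed

text \<open>Equality holds, but Fatou's lemma for the limit in \<open>Wright_limit\<close> gives the inequality
  at once. The integral over \<open>z\<close> of the step functions is a sum over the number of renewals.\<close>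

lemma Wright_moment_le:
  assumes \<alpha>: "0 < \<alpha>" "\<alpha> < 1"
  shows "(\<integral>\<^sup>+z\<in>{0<..}. ennreal (z ^ k / fact k * Wright \<alpha> z) \<partial>lborel) \<le> ennreal (rGamma (1 + \<alpha> * real k))"
proof -
  define F where "F j m = real (m + k choose k) / (real j powr \<alpha>) ^ k * (real j powr \<alpha> * renewal_prob \<alpha> m j)" for j m :: nat
  let ?m = "\<lambda>z j. nat \<lfloor>z * real j powr \<alpha>\<rfloor>"
  have Fnn: "0 \<le> F j m" for j m
    unfolding F_def using \<alpha> by (intro mult_nonneg_nonneg divide_nonneg_nonneg renewal_prob_nonneg) auto
  have lim: "(\<lambda>j. real (?m z j choose k) / (real j powr \<alpha>) ^ k * (real j powr \<alpha> * renewal_prob \<alpha> (?m z j) j))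
      \<longlonglongrightarrow> z ^ k / fact k * Wright \<alpha> z" if "0 < z" for z
    using that \<alpha> by (intro tendsto_mult binomial_scaled_tendsto Wright_limit) auto
  have le: "ennreal (z ^ k / fact k * Wright \<alpha> z) \<le> liminf (\<lambda>j. ennreal (F j (?m z j)))" if "0 < z" for z
  proof -
    have "ennreal (z ^ k / fact k * Wright \<alpha> z) =
        liminf (\<lambda>j. ennreal (real (?m z j choose k) / (real j powr \<alpha>) ^ k * (real j powr \<alpha> * renewal_prob \<alpha> (?m z j) j)))"
      by (rule lim_imp_Liminf[symmetric]) (rule sequentially_bot, rule tendsto_ennrealI, rule lim[OF that])
    also have "\<dots> \<le> liminf (\<lambda>j. ennreal (F j (?m z j)))"
      unfolding F_def using \<alpha>
      by (intro Liminf_mono always_eventually allI ennreal_leI mult_right_mono divide_right_mono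
          mult_nonneg_nonneg renewal_prob_nonneg) (auto intro: binomial_right_mono)
    finally show ?thesis .
  qed
  have "(\<integral>\<^sup>+z\<in>{0<..}. ennreal (z ^ k / fact k * Wright \<alpha> z) \<partial>lborel) \<le>
      (\<integral>\<^sup>+z. liminf (\<lambda>j. ennreal (F j (?m z j)) * indicator {0<..} z) \<partial>lborel)"
    using le by (intro nn_integral_mono) (auto simp: indicator_def)
  also have "\<dots> \<le> liminf (\<lambda>j. \<integral>\<^sup>+z\<in>{0<..}. ennreal (F j (?m z j)) \<partial>lborel)"
    by (rule nn_integral_liminf) measurable
  also have "\<dots> = liminf (\<lambda>j. ennreal (real j powr (- \<alpha> * real k) * fps_nth (binser (- \<alpha> * real k - 1)) j))"
  proof (rule Liminf_eq)
    show "\<forall>\<^sub>F j in sequentially. (\<integral>\<^sup>+z\<in>{0<..}. ennreal (F j (?m z j)) \<partial>lborel) =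
        ennreal (real j powr (- \<alpha> * real k) * fps_nth (binser (- \<alpha> * real k - 1)) j)"
      using eventually_gt_at_top[of 0]
    proof eventually_elim
      case (elim j)
      let ?s = "real j powr \<alpha>"
      have s: "0 < ?s" using elim by simp
      have "(\<integral>\<^sup>+z\<in>{0<..}. ennreal (F j (?m z j)) \<partial>lborel) = (\<Sum>m. ennreal (F j m)) * ennreal (1 / ?s)"
        by (rule nn_integral_floor[OF s, of "\<lambda>m. ennreal (F j m)"])
      also have "(\<Sum>m. ennreal (F j m)) = (\<Sum>m\<le>j. ennreal (F j m))"
        by (intro suminf_finite) (auto simp: F_def renewal_prob_eq_0)
      also have "\<dots> = ennreal (\<Sum>m\<le>j. F j m)"
        using Fnn by simp
      also have "(\<Sum>m\<le>j. F j m) = ?s / ?s ^ k * fps_nth (binser (- \<alpha> * real k - 1)) j"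
        unfolding renewal_prob_moment[symmetric] F_def sum_distrib_left
        by (intro sum.cong) auto
      also have "ennreal (?s / ?s ^ k * fps_nth (binser (- \<alpha> * real k - 1)) j) * ennreal (1 / ?s) =
          ennreal (?s / ?s ^ k * fps_nth (binser (- \<alpha> * real k - 1)) j * (1 / ?s))"
        using s by (intro ennreal_mult''[symmetric]) simp
      also have "?s / ?s ^ k * fps_nth (binser (- \<alpha> * real k - 1)) j * (1 / ?s) =
          real j powr (- \<alpha> * real k) * fps_nth (binser (- \<alpha> * real k - 1)) j"
        using s elim by (simp add: powr_minus powr_powr[symmetric] powr_realpow field_simps)
      finally show ?case .
    qed
  qed
  also have "\<dots> = ennreal (rGamma (1 + \<alpha> * real k))"
    using binser_nth_asymp[of "- \<alpha> * real k"]
    by (intro lim_imp_Liminf tendsto_ennrealI) auto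
  finally show ?thesis .
qed

text \<open>Bound the Gamma integral from below by its part over \<open>[y, \<infinity>)\<close>. The free parameter \<open>y\<close>
  makes the bound geometric in \<open>x\<close> with a rate of choice.\<close>

lemma rGamma_le_exp_powr:
  fixes x y :: real
  assumes "0 < y" "0 \<le> x"
  shows "rGamma (1 + x) \<le> exp y * y powr (- x)"
proof -
  have G: "((\<lambda>t. t powr x / exp t) has_integral Gamma (1 + x)) {0..}"
    using Gamma_integral_real[of "1 + x"] assms by simp
  have E: "((\<lambda>t. y powr x * exp (- 1 * t)) has_integral y powr x * (exp (- 1 * y) / 1)) {y..}"
    by (intro has_integral_mult_right has_integral_exp_minus_to_infinity) simp
  have "y powr x * (exp (- 1 * y) / 1) \<le> Gamma (1 + x)"
  proof (rule has_integral_le[OF _ G])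
    show "((\<lambda>t. if t \<in> {y..} then y powr x * exp (- 1 * t) else 0) has_integral
        y powr x * (exp (- 1 * y) / 1)) {0..}"
      using assms E by (subst has_integral_restrict) auto
    fix t :: real assume "t \<in> {0..}"
    show "(if t \<in> {y..} then y powr x * exp (- 1 * t) else 0) \<le> t powr x / exp t"
      using assms by (auto simp: exp_minus field_simps intro!: powr_mono2)
  qed
  then have "y powr x / exp y \<le> Gamma (1 + x)"
    by (simp add: exp_minus divide_inverse)
  moreover have "0 < y powr x / exp y"
    using assms by simp
  ultimately have "inverse (Gamma (1 + x)) \<le> inverse (y powr x / exp y)"
    by (rule le_imp_inverse_le)
  then show ?thesis
    by (simp add: rGamma_inverse_Gamma powr_minus divide_inverse mult.commute)
qed

text \<open>Sum the moments. The parameter \<open>y\<close> of the bound for the Gamma function is chosen such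
  that the resulting series is geometric with ratio less than \<open>1 / 2\<close>.\<close>

lemma Wright_exp_moment:
  assumes \<alpha>: "0 < \<alpha>" "\<alpha> < 1" and K: "0 \<le> K"
  shows "(\<integral>\<^sup>+z\<in>{0<..}. ennreal (Wright \<alpha> z * exp (K * z)) \<partial>lborel) < \<infinity>"
proof -
  have [measurable]: "Wright \<alpha> \<in> borel_measurable borel"
    by (intro borel_measurable_continuous_onI continuous_on_Wright \<alpha>)
  \<comment> \<open>such that \<open>K / y\<^sup>\<alpha> < 1 / 2\<close>\<close>
  define y where "y = (2 * K + 1) powr (1 / \<alpha>)"
  have y: "0 < y" "y powr \<alpha> = 2 * K + 1"
    using \<alpha> K by (auto simp: y_def powr_powr)
  have exp_sum: "ennreal (Wright \<alpha> z * exp (K * z)) = (\<Sum>k. ennreal (K ^ k) * ennreal (z ^ k / fact k * Wright \<alpha> z))"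
    if z: "0 < z" for z
  proof -
    have nn: "0 \<le> Wright \<alpha> z" using \<alpha> z by (simp add: Wright_nonneg)
    have "(\<lambda>k. (K * z) ^ k /\<^sub>R fact k) sums exp (K * z)"
      unfolding exp_def by (intro summable_sums summable_exp_generic)
    then have "(\<lambda>k. (K * z) ^ k /\<^sub>R fact k * Wright \<alpha> z) sums (exp (K * z) * Wright \<alpha> z)"
      by (rule sums_mult2)
    then have "ennreal (exp (K * z) * Wright \<alpha> z) = (\<Sum>k. ennreal ((K * z) ^ k /\<^sub>R fact k * Wright \<alpha> z))"
      using nn K z by (intro suminf_ennreal_eq[symmetric]) auto
    also have "\<dots> = (\<Sum>k. ennreal (K ^ k) * ennreal (z ^ k / fact k * Wright \<alpha> z))"
      using nn K z by (intro arg_cong[where f = suminf] ext)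
        (simp add: ennreal_mult[symmetric] power_mult_distrib divide_inverse mult_ac)
    finally show ?thesis by (simp add: mult.commute)
  qed
  have "(\<integral>\<^sup>+z\<in>{0<..}. ennreal (Wright \<alpha> z * exp (K * z)) \<partial>lborel) =
      (\<integral>\<^sup>+z. (\<Sum>k. ennreal (K ^ k) * (ennreal (z ^ k / fact k * Wright \<alpha> z) * indicator {0<..} z)) \<partial>lborel)"
    using exp_sum by (intro nn_integral_cong) (auto simp: indicator_def)
  also have "\<dots> = (\<Sum>k. ennreal (K ^ k) * (\<integral>\<^sup>+z\<in>{0<..}. ennreal (z ^ k / fact k * Wright \<alpha> z) \<partial>lborel))"
    by (subst nn_integral_suminf, measurable) (simp add: nn_integral_cmult)
  also have "\<dots> \<le> (\<Sum>k. ennreal (exp y * (1 / 2) ^ k))"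
  proof (intro suminf_le allI summableI)
    fix k
    have "ennreal (K ^ k) * (\<integral>\<^sup>+z\<in>{0<..}. ennreal (z ^ k / fact k * Wright \<alpha> z) \<partial>lborel) \<le>
        ennreal (K ^ k) * ennreal (exp y * y powr (- (\<alpha> * real k)))"
      using \<alpha> y by (intro mult_left_mono order_trans[OF Wright_moment_le] ennreal_leI rGamma_le_exp_powr) auto
    also have "\<dots> = ennreal (exp y * (K / (2 * K + 1)) ^ k)"
    proof -
      have "y powr (\<alpha> * real k) = (2 * K + 1) ^ k"
        using y K by (simp add: powr_powr[symmetric] powr_realpow)
      then show ?thesis
        using K by (simp add: ennreal_mult[symmetric] powr_minus power_divide field_simps)
    qed
    also have "\<dots> \<le> ennreal (exp y * (1 / 2) ^ k)"
      using K by (intro ennreal_leI mult_left_mono power_mono) (auto simp: field_simps)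
    finally show "ennreal (K ^ k) * (\<integral>\<^sup>+z\<in>{0<..}. ennreal (z ^ k / fact k * Wright \<alpha> z) \<partial>lborel) \<le>
        ennreal (exp y * (1 / 2) ^ k)" .
  qed
  also have "\<dots> = ennreal (exp y * 2)"
    using sums_mult[OF geometric_sums[of "1 / 2 :: real"], of "exp y"]
    by (intro suminf_ennreal_eq) auto
  also have "\<dots> < \<infinity>" by simp
  finally show ?thesis .
qed

definition Wright_laplace :: "real \<Rightarrow> real \<Rightarrow> ennreal" where
  "Wright_laplace \<alpha> l = (\<integral>\<^sup>+s\<in>{0<..}. ennreal (Wright \<alpha> s * exp (- l * s)) \<partial>lborel)"

lemma nn_integral_exp_Icc:
  assumes "0 \<le> l" "0 \<le> d"
  shows "(\<integral>\<^sup>+s\<in>{0..d}. ennreal (l * exp (- l * s)) \<partial>lborel) = ennreal (1 - exp (- l * d))"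
proof -
  have "(\<integral>\<^sup>+s\<in>{0..d}. ennreal (l * exp (- l * s)) \<partial>lborel) = ennreal (- exp (- l * d) - (- exp (- l * 0)))"
    using assms by (intro nn_integral_FTC_Icc) (auto intro!: derivative_eq_intros)
  then show ?thesis by simp
qed

text \<open>Near \<open>0\<close> the Wright function lies between two positive constants, which gives the decay
  \<open>1 / l\<close> for large \<open>l\<close>; exponential moments control the tail, and the bounded range of
  negative \<open>l\<close>.\<close>

lemma Wright_laplace_bounds:
  assumes \<alpha>: "0 < \<alpha>" "\<alpha> < 1" and K: "0 \<le> K"
  obtains c C where "0 < c" "c \<le> 1" "c \<le> C"
    "\<And>l. - K \<le> l \<Longrightarrow> ennreal (c / (1 + max l 0)) \<le> Wright_laplace \<alpha> l"
    "\<And>l. - K \<le> l \<Longrightarrow> Wright_laplace \<alpha> l \<le> ennreal (C / (1 + max l 0))"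
proof -
  have cont: "continuous_on S (Wright \<alpha>)" for S
    using continuous_on_Wright[OF \<alpha>] continuous_on_subset by blast
  have [measurable]: "Wright \<alpha> \<in> borel_measurable borel"
    by (intro borel_measurable_continuous_onI cont)
  have W0: "0 < Wright \<alpha> 0"
    using \<alpha> by (simp add: Wright_0 rGamma_inverse_Gamma Gamma_real_pos)
  \<comment> \<open>The lower bound comes from an interval \<open>[0, d]\<close> on which the Wright function is at least
    half its value at \<open>0\<close>.\<close>
  obtain d where d: "0 < d" "\<And>s. 0 \<le> s \<Longrightarrow> s \<le> d \<Longrightarrow> Wright \<alpha> 0 / 2 \<le> Wright \<alpha> s"
  proof -
    have "(Wright \<alpha> \<longlongrightarrow> Wright \<alpha> 0) (at 0)"
      using cont[of UNIV] by (simp add: continuous_on_eq_continuous_at isCont_def)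
    then have "\<forall>\<^sub>F s in at 0. Wright \<alpha> 0 / 2 < Wright \<alpha> s"
      using W0 by (intro order_tendstoD) auto
    then obtain d where "0 < d" "\<And>s. s \<noteq> 0 \<Longrightarrow> dist s 0 < d \<Longrightarrow> Wright \<alpha> 0 / 2 < Wright \<alpha> s"
      by (auto simp: eventually_at)
    then have "Wright \<alpha> 0 / 2 \<le> Wright \<alpha> s" if "0 \<le> s" "s \<le> d / 2" for s
      using that W0 by (cases "s = 0") (auto simp: dist_real_def intro!: less_imp_le)
    then show ?thesis
      using \<open>0 < d\<close> by (intro that[of "d / 2"]) auto
  qed
  obtain B where B: "\<And>s. s \<in> {0..1} \<Longrightarrow> Wright \<alpha> s \<le> B"
    using continuous_attains_sup[OF compact_Icc _ cont, of 0 1] by force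
  have B0: "0 \<le> B" using B[of 0] W0 by simp
  have nn: "0 \<le> s \<Longrightarrow> 0 \<le> Wright \<alpha> s" for s
    using \<alpha> by (simp add: Wright_nonneg)
  obtain CK where CK: "0 \<le> CK" "(\<integral>\<^sup>+z\<in>{0<..}. ennreal (Wright \<alpha> z * exp (K * z)) \<partial>lborel) = ennreal CK"
    using Wright_exp_moment[OF \<alpha> K] by (auto simp: less_top_ennreal)
  define c where "c = min 1 (Wright \<alpha> 0 / 2 * (1 - exp (- d)))"
  define C where "C = 2 * B + CK + 1"
  \<comment> \<open>\<open>e\<^sup>-\<^sup>(\<^sup>1\<^sup>+\<^sup>l\<^sup>)\<^sup>s \<le> e\<^sup>-\<^sup>l\<^sup>s\<close> replaces \<open>l\<close> by \<open>1 + l\<close>, so that small \<open>l\<close> need no separate case.\<close>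
  have lower: "ennreal (c / (1 + l)) \<le> Wright_laplace \<alpha> l" if l: "0 \<le> l" for l
  proof -
    let ?a = "Wright \<alpha> 0 / 2"
    have "ennreal (c / (1 + l)) \<le> ennreal (?a / (1 + l) * (1 - exp (- (1 + l) * d)))"
    proof (rule ennreal_leI)
      have "c \<le> ?a * (1 - exp (- d))" by (simp add: c_def)
      also have "\<dots> \<le> ?a * (1 - exp (- (1 + l) * d))"
      proof (rule mult_left_mono)
        have "0 \<le> l * d" using l d by simp
        then show "1 - exp (- d) \<le> 1 - exp (- (1 + l) * d)" by (simp add: algebra_simps)
      qed (use W0 in simp)
      finally show "c / (1 + l) \<le> ?a / (1 + l) * (1 - exp (- (1 + l) * d))"
        using l by (simp only: times_divide_eq_left) (rule divide_right_mono, auto)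
    qed
    also have "\<dots> = ennreal (?a / (1 + l)) * (\<integral>\<^sup>+s\<in>{0..d}. ennreal ((1 + l) * exp (- (1 + l) * s)) \<partial>lborel)"
      using l d W0 by (subst nn_integral_exp_Icc)
        (auto intro!: ennreal_mult mult_nonpos_nonneg simp del: times_divide_eq_left)
    also have "\<dots> = (\<integral>\<^sup>+s\<in>{0..d}. ennreal (?a * exp (- (1 + l) * s)) \<partial>lborel)"
    proof -
      have "ennreal (?a / (1 + l)) * (ennreal ((1 + l) * exp (- (1 + l) * s)) * indicator {0..d} s) =
          ennreal (?a * exp (- (1 + l) * s)) * indicator {0..d} s" for s
      proof -
        have "ennreal (?a / (1 + l)) * ennreal ((1 + l) * exp (- (1 + l) * s)) =
            ennreal (?a / (1 + l) * ((1 + l) * exp (- (1 + l) * s)))"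
          using l W0 by (intro ennreal_mult[symmetric]) auto
        also have "?a / (1 + l) * ((1 + l) * exp (- (1 + l) * s)) = ?a * exp (- (1 + l) * s)"
        proof -
          have "a / L * (L * e) = a * e" if "L \<noteq> 0" for a L e :: real
            using that by simp
          from this[of "1 + l" ?a] show ?thesis using l by (metis add_nonneg_eq_0_iff zero_le_one zero_neq_one)
        qed
        finally show ?thesis by (simp only: mult.assoc[symmetric])
      qed
      note * = this
      have "(\<lambda>s. ennreal ((1 + l) * exp (- (1 + l) * s)) * indicator {0..d} s) \<in> borel_measurable lborel"
        by measurable
      from nn_integral_cmult[OF this, of "ennreal (?a / (1 + l))", symmetric] show ?thesis
        by (simp only: *)
    qed
    also have "\<dots> \<le> Wright_laplace \<alpha> l"
      unfolding Wright_laplace_def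
    proof (rule nn_integral_mono_AE, rule AE_mp[OF AE_lborel_singleton[of 0]], rule AE_I2, rule impI)
      fix s :: real assume "s \<noteq> 0"
      show "ennreal (?a * exp (- (1 + l) * s)) * indicator {0..d} s \<le>
          ennreal (Wright \<alpha> s * exp (- l * s)) * indicator {0<..} s"
      proof (cases "s \<in> {0..d}")
        case True
        have "?a * exp (- (1 + l) * s) \<le> Wright \<alpha> s * exp (- l * s)"
        proof (rule mult_mono)
          show "?a \<le> Wright \<alpha> s" using True d by simp
          show "exp (- (1 + l) * s) \<le> exp (- l * s)" using True by (simp add: algebra_simps)
          show "0 \<le> Wright \<alpha> s" using True nn by simp
        qed simp
        then show ?thesis using True \<open>s \<noteq> 0\<close> by (simp add: ennreal_leI)
      qed simp
    qed
    finally show ?thesis .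
  qed
  have anti: "Wright_laplace \<alpha> l \<le> Wright_laplace \<alpha> l'" if "l' \<le> l" for l l'
    unfolding Wright_laplace_def
  proof (rule nn_integral_mono)
    fix s :: real
    show "ennreal (Wright \<alpha> s * exp (- l * s)) * indicator {0<..} s \<le>
        ennreal (Wright \<alpha> s * exp (- l' * s)) * indicator {0<..} s"
      using that nn[of s] by (cases "0 < s") (auto intro!: ennreal_leI mult_left_mono)
  qed
  have upper: "Wright_laplace \<alpha> l \<le> ennreal (C / (1 + l))" if l: "0 \<le> l" for l
  proof -
    have "ennreal (1 + l) * Wright_laplace \<alpha> l =
       (\<integral>\<^sup>+s\<in>{0<..}. ennreal ((1 + l) * (Wright \<alpha> s * exp (- l * s))) \<partial>lborel)"
    proof -
      have "ennreal (1 + l) * (ennreal (Wright \<alpha> s * exp (- l * s)) * indicator {0<..} s) =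
          ennreal ((1 + l) * (Wright \<alpha> s * exp (- l * s))) * indicator {0<..} s" for s
        using l by (subst ennreal_mult'[of "1 + l"]) (simp_all only: mult.assoc add_nonneg_nonneg zero_le_one)
      note * = this
      have "(\<lambda>s. ennreal (Wright \<alpha> s * exp (- l * s)) * indicator {0<..} s) \<in> borel_measurable lborel"
        by measurable
      from nn_integral_cmult[OF this, of "ennreal (1 + l)", symmetric] show ?thesis
        unfolding Wright_laplace_def by (simp only: *)
    qed
    \<comment> \<open>On \<open>[0, 1]\<close> the Wright function is bounded by \<open>B\<close>; for \<open>s \<ge> 1\<close> the factor \<open>1 + l \<le> e\<^sup>l\<close>
      is absorbed by \<open>e\<^sup>-\<^sup>l\<^sup>s\<close>.\<close>
    also have "\<dots> \<le> (\<integral>\<^sup>+s. (ennreal B * (ennreal (l * exp (- l * s)) * indicator {0..1} s)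
       + (ennreal B * indicator {0..1} s
       + ennreal (Wright \<alpha> s * exp (K * s)) * indicator {0<..} s)) \<partial>lborel)"
    proof (rule nn_integral_mono)
      fix s :: real
      consider "s \<le> 0" | "0 < s" "s \<le> 1" | "1 < s" by linarith
      then show "ennreal ((1 + l) * (Wright \<alpha> s * exp (- l * s))) * indicator {0<..} s \<le>
          ennreal B * (ennreal (l * exp (- l * s)) * indicator {0..1} s)
          + (ennreal B * indicator {0..1} s
          + ennreal (Wright \<alpha> s * exp (K * s)) * indicator {0<..} s)"
      proof cases
        case 2
        have "(1 + l) * (Wright \<alpha> s * exp (- l * s)) \<le> (1 + l) * (B * exp (- l * s))"
          using 2 l B by (intro mult_left_mono mult_right_mono) auto
        also have "\<dots> \<le> B * (l * exp (- l * s)) + B"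
        proof -
          have "B * exp (- l * s) \<le> B * 1"
            using B0 l 2 by (intro mult_left_mono) auto
          then show ?thesis by (simp add: algebra_simps)
        qed
        finally have "ennreal ((1 + l) * (Wright \<alpha> s * exp (- l * s))) \<le> ennreal (B * (l * exp (- l * s)) + B)"
          by (rule ennreal_leI)
        also have "\<dots> = ennreal B * ennreal (l * exp (- l * s)) + ennreal B"
          using B0 l by (simp add: ennreal_plus ennreal_mult)
        finally show ?thesis
          using 2 by (simp add: add.assoc[symmetric] add_increasing2)
      next
        case 3
        have "(1 + l) * exp (- l * s) \<le> exp l * exp (- l * s)"
          by (intro mult_right_mono exp_ge_add_one_self) auto
        also have "\<dots> \<le> 1"
          using 3 l mult_left_mono[of 1 s l] by (simp flip: exp_add)
        also have "1 \<le> exp (K * s)"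
          using K 3 by simp
        finally have "Wright \<alpha> s * ((1 + l) * exp (- l * s)) \<le> Wright \<alpha> s * exp (K * s)"
          using 3 nn by (intro mult_left_mono) auto
        then show ?thesis
          using 3 by (simp add: ennreal_leI mult_ac)
      qed simp
    qed
    also have "\<dots> = ennreal B * ennreal (1 - exp (- l)) + (ennreal B + ennreal CK)"
      using nn_integral_exp_Icc[OF l, of 1] CK
      by (subst nn_integral_add, simp, simp, subst nn_integral_add, simp, simp)
         (simp add: nn_integral_cmult)
    also have "\<dots> = ennreal (B * (1 - exp (- l)) + (B + CK))"
      using B0 CK l by (simp add: ennreal_plus ennreal_mult)
    also have "\<dots> \<le> ennreal C"
      unfolding C_def using B0 l by (intro ennreal_leI) (simp add: algebra_simps)
    finally have *: "ennreal (1 + l) * Wright_laplace \<alpha> l \<le> ennreal C" .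
    have "Wright_laplace \<alpha> l = ennreal (1 / (1 + l)) * (ennreal (1 + l) * Wright_laplace \<alpha> l)"
    proof -
      have "ennreal (1 / (1 + l)) * ennreal (1 + l) = ennreal (1 / (1 + l) * (1 + l))"
        using l by (intro ennreal_mult[symmetric]) auto
      also have "1 / (1 + l) * (1 + l) = 1" using l by simp
      finally show ?thesis by (simp only: mult.assoc[symmetric] ennreal_1 mult_1_left)
    qed
    also have "\<dots> \<le> ennreal (1 / (1 + l)) * ennreal C"
      by (intro mult_left_mono *) simp
    also have "\<dots> = ennreal (C / (1 + l))"
      using l by (simp add: ennreal_mult'[symmetric])
    finally show ?thesis .
  qed
  show ?thesis
  proof (rule that[of c C])
    show c0: "0 < c" "c \<le> 1" using W0 d by (auto simp: c_def)
    show "c \<le> C" using c0 B0 CK by (simp add: C_def)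
    fix l assume l: "- K \<le> l"
    show "ennreal (c / (1 + max l 0)) \<le> Wright_laplace \<alpha> l"
      using lower[of "max l 0"] anti[of l "max l 0"] by auto
    show "Wright_laplace \<alpha> l \<le> ennreal (C / (1 + max l 0))"
    proof (cases "0 \<le> l")
      case True
      then show ?thesis using upper by simp
    next
      case False
      have "Wright_laplace \<alpha> l \<le> Wright_laplace \<alpha> (- K)" by (rule anti[OF l])
      also have "\<dots> = ennreal CK" using CK(2) by (simp add: Wright_laplace_def)
      also have "\<dots> \<le> ennreal C" using B0 by (intro ennreal_leI) (simp add: C_def)
      finally show ?thesis using False by simp
    qed
  qed
qed


section \<open>The spectral measure of an orbit\<close>

text \<open>Hoelder's inequality \<open>\<integral>g\<^sup>2\<^sup>\<tau> \<le> (\<integral>g\<^sup>2)\<^sup>\<tau>\<close>, from Young's inequality for \<open>g\<^sup>2\<close> and its mean \<open>J\<close>\<close>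

lemma holder_powr_prob:
  fixes f g :: "'a \<Rightarrow> real"
  assumes "prob_space \<mu>" and m: "g \<in> borel_measurable \<mu>" "f \<in> borel_measurable \<mu>"
    and le: "\<And>x. 0 \<le> f x" "\<And>x. 0 \<le> g x" "\<And>x. f x \<le> \<kappa> * g x powr \<tau>"
    and I: "(\<integral>\<^sup>+x. ennreal ((f x)\<^sup>2) \<partial>\<mu>) = ennreal I" "(\<integral>\<^sup>+x. ennreal ((g x)\<^sup>2) \<partial>\<mu>) = ennreal J" "0 \<le> I" "0 \<le> J"
    and t: "0 < \<tau>" "\<tau> < 1" "0 \<le> \<kappa>"
  shows "I \<le> \<kappa>\<^sup>2 * J powr \<tau>"
proof (cases "J = 0")
  case True
  then have "AE x in \<mu>. ennreal ((g x)\<^sup>2) = 0"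
    using I(2) m nn_integral_0_iff_AE[of "\<lambda>x. ennreal ((g x)\<^sup>2)" \<mu>] by simp
  then have "AE x in \<mu>. ennreal ((f x)\<^sup>2) = 0"
  proof eventually_elim
    case (elim x)
    then have "g x = 0" by (simp add: ennreal_eq_0_iff)
    then have "f x = 0" using le(1,3)[of x] t by simp
    then show ?case by simp
  qed
  then have "(\<integral>\<^sup>+x. ennreal ((f x)\<^sup>2) \<partial>\<mu>) = 0"
    using m nn_integral_0_iff_AE[of "\<lambda>x. ennreal ((f x)\<^sup>2)" \<mu>] by simp
  then have "I = 0" using I by simp
  then show ?thesis by simp
next
  case False
  then have J: "0 < J" using I(4) by simp
  \<comment> \<open>Young's inequality for \<open>g\<^sup>2\<close> and \<open>J\<close>, multiplied by \<open>J\<^sup>1\<^sup>-\<^sup>\<tau>\<close> so that it integrates to a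
    multiple of \<open>J\<close>\<close>
  have pt: "J powr (1 - \<tau>) * (f x)\<^sup>2 \<le> \<kappa>\<^sup>2 * (\<tau> * (g x)\<^sup>2) + \<kappa>\<^sup>2 * ((1 - \<tau>) * J)" for x
  proof (cases "g x = 0")
    case True
    then have "f x = 0" using le(1,3)[of x] t by simp
    then show ?thesis using t J by simp
  next
    case False
    then have g: "0 < g x" using le(2)[of x] by simp
    have "(f x)\<^sup>2 \<le> (\<kappa> * g x powr \<tau>)\<^sup>2" using le by (intro power_mono) auto
    also have "\<dots> = \<kappa>\<^sup>2 * ((g x)\<^sup>2) powr \<tau>"
    proof -
      have "((g x)\<^sup>2) powr \<tau> = g x powr (\<tau> + \<tau>)"
        using g powr_mult[of "g x" "g x" \<tau>] by (simp only: power2_eq_square powr_add)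
      then show ?thesis by (simp only: power_mult_distrib power2_eq_square[of "g x powr \<tau>"] powr_add)
    qed
    finally have "J powr (1 - \<tau>) * (f x)\<^sup>2 \<le> J powr (1 - \<tau>) * (\<kappa>\<^sup>2 * ((g x)\<^sup>2) powr \<tau>)"
      by (intro mult_left_mono) auto
    also have "\<dots> = \<kappa>\<^sup>2 * (((g x)\<^sup>2) powr \<tau> * J powr (1 - \<tau>))" by (simp add: mult_ac)
    also have "\<dots> \<le> \<kappa>\<^sup>2 * (\<tau> * (g x)\<^sup>2 + (1 - \<tau>) * J)"
      using t J g by (intro mult_left_mono Youngs_inequality_0) auto
    finally show ?thesis by (simp add: algebra_simps)
  qed
  interpret prob_space \<mu> by fact
  have "ennreal (J powr (1 - \<tau>) * I) = (\<integral>\<^sup>+x. ennreal (J powr (1 - \<tau>)) * ennreal ((f x)\<^sup>2) \<partial>\<mu>)"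
    using m by (subst nn_integral_cmult) (simp_all add: I ennreal_mult)
  also have "\<dots> \<le> (\<integral>\<^sup>+x. ennreal (\<kappa>\<^sup>2 * \<tau>) * ennreal ((g x)\<^sup>2) + ennreal (\<kappa>\<^sup>2 * ((1 - \<tau>) * J)) \<partial>\<mu>)"
  proof (rule nn_integral_mono)
    fix x
    show "ennreal (J powr (1 - \<tau>)) * ennreal ((f x)\<^sup>2) \<le> ennreal (\<kappa>\<^sup>2 * \<tau>) * ennreal ((g x)\<^sup>2) + ennreal (\<kappa>\<^sup>2 * ((1 - \<tau>) * J))"
      using pt[of x] t J
      by (simp add: ennreal_mult[symmetric] ennreal_plus[symmetric] mult.assoc del: ennreal_plus)
  qed
  also have "\<dots> = ennreal (\<kappa>\<^sup>2 * \<tau>) * ennreal J + ennreal (\<kappa>\<^sup>2 * ((1 - \<tau>) * J))"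
    using m by (subst nn_integral_add) (simp_all add: nn_integral_cmult emeasure_space_1 I(2))
  also have "\<dots> = ennreal (\<kappa>\<^sup>2 * \<tau> * J + \<kappa>\<^sup>2 * ((1 - \<tau>) * J))"
    using t J by (simp add: ennreal_mult[symmetric] ennreal_plus[symmetric] del: ennreal_plus)
  also have "\<kappa>\<^sup>2 * \<tau> * J + \<kappa>\<^sup>2 * ((1 - \<tau>) * J) = \<kappa>\<^sup>2 * J" by (simp add: algebra_simps)
  also have "\<kappa>\<^sup>2 * J = J powr (1 - \<tau>) * (\<kappa>\<^sup>2 * J powr \<tau>)"
  proof -
    have "J powr (1 - \<tau>) * J powr \<tau> = J" using J by (simp add: powr_add[symmetric])
    then show ?thesis by (simp add: mult.left_commute)
  qed
  finally have "J powr (1 - \<tau>) * I \<le> J powr (1 - \<tau>) * (\<kappa>\<^sup>2 * J powr \<tau>)"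
    using J t by (simp add: ennreal_le_iff)
  then show ?thesis using J by simp
qed

definition clip :: "real \<Rightarrow> real" where "clip x = max 0 (min 1 x)"

lemma clip_bounds: "0 \<le> clip x" "clip x \<le> 1" by (auto simp: clip_def)

lemma measurable_clip [measurable]: "clip \<in> borel_measurable borel"
  unfolding clip_def by measurable

context symmetric_semigroup begin

text \<open>The semigroup damped by the upper bound of its generator, which makes it a contraction
  for the form defined by \<open>E\<close>\<close>

definition damped :: "real \<Rightarrow> 'v \<Rightarrow> 'v" where "damped t v = exp (- M * t) *\<^sub>R Q t v"

text \<open>Alternating differences of the orbit itself; the pairing of two of them is an
  alternating difference of the autocorrelation.\<close>

primrec orbit_diff :: "real \<Rightarrow> 'v \<Rightarrow> nat \<Rightarrow> real \<Rightarrow> 'v" where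
  "orbit_diff h u 0 r = damped r u"
| "orbit_diff h u (Suc l) r = orbit_diff h u l r - orbit_diff h u l (r + h)"

lemma damped_bounded_linear: "0 \<le> t \<Longrightarrow> bounded_linear (damped t)"
  unfolding damped_def by (intro bounded_linear_const_scaleR Q_bounded_linear)

lemma damped_add: "0 \<le> s \<Longrightarrow> 0 \<le> t \<Longrightarrow> damped s (damped t v) = damped (s + t) v"
  by (simp add: damped_def Q_add linear_cmul[OF bounded_linear.linear[OF Q_bounded_linear]] exp_add[symmetric] algebra_simps)

lemma X_subspace: "subspace X"
proof -
  have "X = \<pi> ` UNIV" by (simp add: proj)
  then show ?thesis
    using linear_subspace_image[OF bounded_linear.linear[OF proj(1)] subspace_UNIV] by simp
qed

lemma damped_in: "0 \<le> t \<Longrightarrow> damped t v \<in> X"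
  unfolding damped_def by (intro subspace_scale X_subspace Q_in)

lemma orbit_diff_in: "0 \<le> r \<Longrightarrow> 0 \<le> h \<Longrightarrow> orbit_diff h u l r \<in> X"
  by (induction l arbitrary: r) (simp_all add: damped_in subspace_diff[OF X_subspace])

lemma damped_orbit_diff: "0 \<le> s \<Longrightarrow> 0 \<le> h \<Longrightarrow> 0 \<le> r \<Longrightarrow> damped s (orbit_diff h u l r) = orbit_diff h u l (s + r)"
  by (induction l arbitrary: r)
    (simp_all add: damped_add linear_diff[OF bounded_linear.linear[OF damped_bounded_linear]] add_ac)

definition autocorr :: "'v \<Rightarrow> real \<Rightarrow> real" where "autocorr u r = inner (E (damped r u)) (E u)"

lemma E_damped: "E (damped t v) = exp (- M * t) *\<^sub>R E (Q t v)"
  by (simp add: damped_def linear_cmul[OF bounded_linear.linear[OF E]])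

lemma inner_damped: 
  assumes "u \<in> X" "0 \<le> r" "0 \<le> s"
  shows "inner (E (damped r u)) (E (damped s u)) = autocorr u (r + s)"
proof -
  have "inner (E (Q (r + s) u)) (E u) = inner (E (Q s (Q r u))) (E u)"
    using assms by (simp add: Q_add[symmetric] add.commute)
  also have "\<dots> = inner (E (Q r u)) (E (Q s u))"
    using assms by (intro Q_symmetric Q_in) auto
  finally show ?thesis
    by (simp add: autocorr_def E_damped exp_add[symmetric] algebra_simps)
qed

lemma inner_orbit_diff:
  assumes "u \<in> X" "0 \<le> h" "0 \<le> r" "0 \<le> s"
  shows "inner (E (orbit_diff h u l r)) (E (orbit_diff h u k s)) = alt_diff h (autocorr u) (l + k) (r + s)"
  using assms(3,4)
proof (induction l arbitrary: r)
  case 0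
  then show ?case
  proof (induction k arbitrary: s)
    case 0
    then show ?case using inner_damped assms by simp
  next
    case (Suc k)
    then show ?case using assms
      by (simp add: linear_diff[OF bounded_linear.linear[OF E]] inner_diff_right add.assoc)
  qed
next
  case (Suc l)
  then show ?case using assms
    by (simp add: linear_diff[OF bounded_linear.linear[OF E]] inner_diff_left add_ac)
qed

lemma damped_contractive:
  assumes "u \<in> X" "0 \<le> t"
  shows "(norm (E (damped t u)))\<^sup>2 \<le> (norm (E u))\<^sup>2"
proof -
  have "(exp (- M * t))\<^sup>2 = exp (- 2 * M * t)" by (simp add: power2_eq_square exp_add[symmetric])
  then show ?thesis
    using Q_contractive[OF assms] by (simp add: E_damped power_mult_distrib)
qed

text \<open>Split an order \<open>l = 2 k\<close> evenly: the difference is the squared norm of the \<open>k\<close>-th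
  difference of the orbit at time \<open>r / 2\<close>. An odd order is the loss of such a squared norm
  after a further time \<open>h / 2\<close>.\<close>

lemma alt_diff_autocorr_nonneg:
  assumes u: "u \<in> X" and h: "0 < h" and r: "0 \<le> r"
  shows "0 \<le> alt_diff h (autocorr u) l r"
proof -
  have sq: "(norm (E (orbit_diff h u k s)))\<^sup>2 = alt_diff h (autocorr u) (k + k) (s + s)" if "0 \<le> s" for k s
    unfolding power2_norm_eq_inner using inner_orbit_diff[OF u _ that that, of h k k] h by simp
  show ?thesis
  proof (cases "even l")
    case True
    then obtain k where k: "l = k + k" by (auto simp: mult_2 elim!: evenE)
    have "0 \<le> (norm (E (orbit_diff h u k (r / 2))))\<^sup>2" by simp
    also have "\<dots> = alt_diff h (autocorr u) (k + k) (r / 2 + r / 2)" using r by (intro sq) simp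
    finally show ?thesis by (simp only: k field_sum_of_halves)
  next
    case False
    then obtain k where k: "l = Suc (k + k)" by (auto simp: mult_2 elim!: oddE)
    have "(norm (E (damped (h / 2) (orbit_diff h u k (r / 2)))))\<^sup>2 \<le> (norm (E (orbit_diff h u k (r / 2))))\<^sup>2"
      using h r by (intro damped_contractive orbit_diff_in) auto
    moreover have "damped (h / 2) (orbit_diff h u k (r / 2)) = orbit_diff h u k (h / 2 + r / 2)"
      using h r by (intro damped_orbit_diff) auto
    ultimately have "(norm (E (orbit_diff h u k (h / 2 + r / 2))))\<^sup>2 \<le> (norm (E (orbit_diff h u k (r / 2))))\<^sup>2"
      by simp
    moreover have "(norm (E (orbit_diff h u k (r / 2))))\<^sup>2 = alt_diff h (autocorr u) (k + k) (r / 2 + r / 2)"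
      "(norm (E (orbit_diff h u k (h / 2 + r / 2))))\<^sup>2 = alt_diff h (autocorr u) (k + k) (h / 2 + r / 2 + (h / 2 + r / 2))"
      using h r by (intro sq; simp)+
    moreover have "r / 2 + r / 2 = r" "h / 2 + r / 2 + (h / 2 + r / 2) = r + h" by simp_all
    ultimately show ?thesis unfolding k by simp
  qed
qed

lemma autocorr_continuous: "continuous_on {0..} (autocorr u)"
  unfolding autocorr_def E_damped
  by (intro continuous_on_inner continuous_on_scaleR bounded_linear.continuous_on[OF E] Q_continuous continuous_intros)

theorem spectral_representation:
  assumes u: "u \<in> X" and nz: "E u \<noteq> 0"
  obtains \<mu> where "prob_space \<mu>" "sets \<mu> = sets borel"
    "\<And>r. 0 < r \<Longrightarrow> inner (E (Q r u)) (E u) = (norm (E u))\<^sup>2 * (\<integral>x. exp (M * r) * clip x powr r \<partial>\<mu>)"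
proof -
  let ?n = "(norm (E u))\<^sup>2"
  have n: "0 < ?n" using nz by simp
  have alt: "alt_diff h (\<lambda>r. autocorr u r / ?n) l r = alt_diff h (autocorr u) l r / ?n" for h l r
    by (induction l arbitrary: r) (simp_all add: diff_divide_distrib)
  have A0: "autocorr u 0 = ?n"
    using u by (simp add: autocorr_def damped_def Q_0 proj power2_norm_eq_inner)
  obtain \<mu> where \<mu>: "prob_space \<mu>" "sets \<mu> = sets borel"
    and m: "\<And>r. 0 < r \<Longrightarrow> autocorr u r / ?n = (\<integral>x. (max 0 (min 1 x)) powr r \<partial>\<mu>)"
  proof (rule bernstein_widder_representation[of "\<lambda>r. autocorr u r / ?n"])
    fix h r :: real and l assume "0 < h" "0 \<le> r"
    then show "0 \<le> alt_diff h (\<lambda>r. autocorr u r / ?n) l r"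
      unfolding alt using n by (intro divide_nonneg_pos alt_diff_autocorr_nonneg u) auto
  next
    show "continuous_on {0..} (\<lambda>r. autocorr u r / ?n)"
      using n by (intro continuous_on_divide autocorr_continuous continuous_on_const) auto
    show "autocorr u 0 / ?n = 1" using n A0 by simp
  qed blast
  show ?thesis
  proof (rule that[OF \<mu>])
    fix r :: real assume r: "0 < r"
    have "inner (E (Q r u)) (E u) = exp (M * r) * autocorr u r"
      by (simp add: autocorr_def E_damped mult.assoc[symmetric] exp_add[symmetric])
    also have "autocorr u r = ?n * (\<integral>x. (max 0 (min 1 x)) powr r \<partial>\<mu>)"
      using m[OF r] n by (simp add: field_simps)
    finally show "inner (E (Q r u)) (E u) = ?n * (\<integral>x. exp (M * r) * clip x powr r \<partial>\<mu>)"
      by (simp add: clip_def mult_ac)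
  qed
qed

end


section \<open>The energy of the solution\<close>

text \<open>The value at time \<open>t\<close> of the solution of the scalar equation with initial value \<open>1\<close> and
  eigenvalue \<open>M + ln x\<close>, the Mittag-Leffler function at \<open>(M + ln x) t\<^sup>\<alpha>\<close>. The point \<open>x = 0\<close>
  stands for the eigenvalue \<open>- \<infinity>\<close>, where the solution vanishes for \<open>t > 0\<close>.\<close>

definition profile :: "real \<Rightarrow> real \<Rightarrow> real \<Rightarrow> real \<Rightarrow> real" where
  "profile \<alpha> M t x =
     (if x \<le> 0 then 0
      else if \<alpha> = 1 then exp (M * t) * x powr t
      else enn2real (Wright_laplace \<alpha> (t powr \<alpha> * (- ln x - M))))"

lemma measurable_profile:
  assumes "0 < \<alpha>" "\<alpha> \<le> 1"
  shows "profile \<alpha> M t \<in> borel_measurable borel"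
proof (cases "\<alpha> = 1")
  case True
  have "profile \<alpha> M t = (\<lambda>x. if x \<le> 0 then 0 else exp (M * t) * x powr t)"
    using True by (intro ext) (simp add: profile_def)
  then show ?thesis by simp
next
  case False
  have [measurable]: "Wright \<alpha> \<in> borel_measurable borel"
    by (rule borel_measurable_continuous_onI[OF continuous_on_Wright]) (use assms False in auto)
  have [measurable]: "Wright_laplace \<alpha> \<in> borel_measurable borel"
    unfolding Wright_laplace_def by measurable
  show ?thesis unfolding profile_def by measurable
qed

text \<open>For \<open>\<alpha> < 1\<close> this combines the two-sided bound for the Laplace transform with
  \<open>(1 + a)\<^sup>\<tau> \<le> 1 + \<tau> a \<le> 1 + \<tau>\<^sup>\<alpha> a\<close>, where \<open>\<tau> = t / T\<close>.\<close>

lemma profile_ratio: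
  assumes \<alpha>: "0 < \<alpha>" "\<alpha> \<le> 1" and T: "0 < T" and M: "0 \<le> M"
  shows "\<exists>\<kappa>\<ge>1. \<forall>t x. 0 < t \<and> t < T \<and> 0 \<le> x \<and> x \<le> 1 \<longrightarrow>
    profile \<alpha> M t x \<le> \<kappa> * profile \<alpha> M T x powr (t / T)"
proof (cases "\<alpha> = 1")
  case True
  have "profile \<alpha> M t x = profile \<alpha> M T x powr (t / T)" if "0 < t" "0 \<le> x" for t x
  proof (cases "x = 0")
    case False
    have "(exp (M * T) * x powr T) powr (t / T) = exp (M * T) powr (t / T) * x powr (T * (t / T))"
      using False that by (simp add: powr_mult powr_powr)
    also have "\<dots> = exp (M * t) * x powr t" using T by (simp add: powr_def)
    finally show ?thesis using False that True by (simp add: profile_def)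
  qed (simp add: profile_def)
  note eq = this
  show ?thesis
  proof (intro exI[of _ 1] conjI allI impI)
    fix t x :: real assume "0 < t \<and> t < T \<and> 0 \<le> x \<and> x \<le> 1"
    then show "profile \<alpha> M t x \<le> 1 * profile \<alpha> M T x powr (t / T)"
      using eq[of t x] by linarith
  qed simp
next
  case False
  define K where "K = M * T powr \<alpha>"
  obtain c C where c: "0 < c" "c \<le> 1" "c \<le> C"
    and lo: "\<And>l. - K \<le> l \<Longrightarrow> ennreal (c / (1 + max l 0)) \<le> Wright_laplace \<alpha> l"
    and hi: "\<And>l. - K \<le> l \<Longrightarrow> Wright_laplace \<alpha> l \<le> ennreal (C / (1 + max l 0))"
    by (rule Wright_laplace_bounds[of \<alpha> K]) (use \<alpha> False M in \<open>simp, simp, simp add: K_def, blast\<close>)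
  have C: "0 < C" using c by simp
  show ?thesis
  proof (intro exI[of _ "C / c"] conjI allI impI)
    show "1 \<le> C / c" using c by simp
    fix t x :: real assume "0 < t \<and> t < T \<and> 0 \<le> x \<and> x \<le> 1"
    then have t: "0 < t" "t < T" and x: "0 \<le> x" "x \<le> 1" by auto
    show "profile \<alpha> M t x \<le> C / c * profile \<alpha> M T x powr (t / T)"
    proof (cases "x = 0")
      case True
      then show ?thesis using c C by (simp add: profile_def)
    next
      case x0: False
      define \<nu> where "\<nu> = - ln x - M"
      define \<tau> where "\<tau> = t / T"
      define a where "a = max (T powr \<alpha> * \<nu>) 0"
      have \<tau>: "0 < \<tau>" "\<tau> < 1" using t T by (auto simp: \<tau>_def)
      have a: "0 \<le> a" by (simp add: a_def)
      have \<nu>: "- M \<le> \<nu>" using x x0 by (simp add: \<nu>_def)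
      have l: "- K \<le> r powr \<alpha> * \<nu>" if "0 < r" "r \<le> T" for r
      proof -
        have "r powr \<alpha> * \<nu> \<ge> r powr \<alpha> * (- M)" using \<nu> by (intro mult_left_mono) auto
        moreover have "r powr \<alpha> * M \<le> T powr \<alpha> * M" using that M \<alpha> by (intro mult_right_mono powr_mono2) auto
        ultimately show ?thesis by (simp add: K_def mult.commute)
      qed
      have maxt: "max (t powr \<alpha> * \<nu>) 0 = \<tau> powr \<alpha> * a"
      proof -
        have "t powr \<alpha> = \<tau> powr \<alpha> * T powr \<alpha>" using t T by (simp add: \<tau>_def powr_divide)
        then show ?thesis by (simp add: a_def max_mult_distrib_left mult.assoc)
      qed
      have p: "profile \<alpha> M r x = enn2real (Wright_laplace \<alpha> (r powr \<alpha> * \<nu>))" for r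
        using False x x0 by (simp add: profile_def \<nu>_def)
      have up: "profile \<alpha> M t x \<le> C / (1 + \<tau> powr \<alpha> * a)"
      proof -
        have "Wright_laplace \<alpha> (t powr \<alpha> * \<nu>) \<le> ennreal (C / (1 + \<tau> powr \<alpha> * a))"
          using hi[OF l[of t]] t maxt by simp
        then show ?thesis using C a unfolding p by (intro enn2real_leI) auto
      qed
      have low: "c / (1 + a) \<le> profile \<alpha> M T x"
      proof -
        have 1: "ennreal (c / (1 + a)) \<le> Wright_laplace \<alpha> (T powr \<alpha> * \<nu>)"
          using lo[OF l[of T]] T by (simp add: a_def)
        have 2: "Wright_laplace \<alpha> (T powr \<alpha> * \<nu>) < \<infinity>"
          using hi[OF l[of T]] T by (auto intro: le_less_trans)
        show ?thesis using enn2real_mono[OF 1] 2 c a unfolding p by simp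
      qed
      \<comment> \<open>Bernoulli's inequality, and \<open>\<tau> \<le> \<tau>\<^sup>\<alpha>\<close> because \<open>\<tau> < 1\<close>\<close>
      have bern: "(1 + a) powr \<tau> \<le> 1 + \<tau> powr \<alpha> * a"
      proof -
        have "(1 + a) powr \<tau> * 1 powr (1 - \<tau>) \<le> \<tau> * (1 + a) + (1 - \<tau>) * 1"
          using \<tau> a by (intro Youngs_inequality_0) auto
        also have "\<dots> = 1 + \<tau> powr 1 * a" using \<tau> by (simp add: algebra_simps)
        also have "\<dots> \<le> 1 + \<tau> powr \<alpha> * a"
          using \<tau> a \<alpha> by (intro add_left_mono mult_right_mono powr_mono') auto
        finally show ?thesis by simp
      qed
      have "C / (1 + \<tau> powr \<alpha> * a) \<le> C / (1 + a) powr \<tau>"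
        using bern a C by (intro divide_left_mono) (auto intro!: mult_pos_pos add_pos_nonneg)
      also have "\<dots> = C / c * (c * (1 / (1 + a) powr \<tau>))" using c by simp
      also have "\<dots> \<le> C / c * (c powr \<tau> * (1 / (1 + a) powr \<tau>))"
      proof -
        \<comment> \<open>here \<open>c \<le> 1\<close> is needed\<close>
        have "c powr 1 \<le> c powr \<tau>" using c \<tau> by (intro powr_mono') auto
        then show ?thesis using c C by (intro mult_left_mono mult_right_mono) auto
      qed
      also have "\<dots> = C / c * (c / (1 + a)) powr \<tau>" using c a by (simp add: powr_divide)
      also have "\<dots> \<le> C / c * profile \<alpha> M T x powr \<tau>"
        using c C a \<tau> low by (intro mult_left_mono powr_mono2) auto
      finally show ?thesis using up by (simp add: \<tau>_def)
    qed
  qed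
qed

lemma profile_Wright:
  assumes \<alpha>: "0 < \<alpha>" "\<alpha> < 1" and t: "0 < t" and M: "0 \<le> M" and x: "0 \<le> x" "x \<le> 1"
  shows "(\<integral>\<^sup>+s. ennreal (indicator {0<..} s * (Wright \<alpha> s * (exp (M * (s * t powr \<alpha>)) * x powr (s * t powr \<alpha>)))) \<partial>lborel)
     = ennreal (profile \<alpha> M t x)"
proof (cases "x = 0")
  case True
  then show ?thesis by (simp add: profile_def)
next
  case False
  let ?l = "t powr \<alpha> * (- ln x - M)"
  have x0: "0 < x" using False x by simp
  have "ln x \<le> 0" using x x0 by simp
  then have l: "- (M * t powr \<alpha>) \<le> ?l"
    using mult_left_mono[of "- M" "- ln x - M" "t powr \<alpha>"] by (simp add: mult.commute)
  obtain c C where hi: "\<And>l. - (M * t powr \<alpha>) \<le> l \<Longrightarrow> Wright_laplace \<alpha> l \<le> ennreal (C / (1 + max l 0))"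
    by (rule Wright_laplace_bounds[OF \<alpha>, of "M * t powr \<alpha>"]) (use M in \<open>simp, blast\<close>)
  have fin: "Wright_laplace \<alpha> ?l < \<infinity>" using hi[OF l] by (rule le_less_trans) simp
  have "(\<integral>\<^sup>+s. ennreal (indicator {0<..} s * (Wright \<alpha> s * (exp (M * (s * t powr \<alpha>)) * x powr (s * t powr \<alpha>)))) \<partial>lborel)
     = Wright_laplace \<alpha> ?l"
    unfolding Wright_laplace_def
  proof (rule nn_integral_cong)
    fix s :: real
    have "exp (M * (s * t powr \<alpha>)) * x powr (s * t powr \<alpha>) = exp (- ?l * s)"
      using x0 by (simp add: powr_def[of x] exp_add[symmetric] algebra_simps)
    then show "ennreal (indicator {0<..} s * (Wright \<alpha> s * (exp (M * (s * t powr \<alpha>)) * x powr (s * t powr \<alpha>)))) =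
        ennreal (Wright \<alpha> s * exp (- ?l * s)) * indicator {0<..} s"
      by (simp add: indicator_def)
  qed
  also have "\<dots> = ennreal (enn2real (Wright_laplace \<alpha> ?l))" using fin by simp
  also have "enn2real (Wright_laplace \<alpha> ?l) = profile \<alpha> M t x" using x0 \<alpha> by (simp add: profile_def)
  finally show ?thesis .
qed

context symmetric_semigroup begin

lemma Q_energy:
  assumes u: "u \<in> X" and \<mu>: "prob_space \<mu>" "sets \<mu> = sets borel"
    and rep: "\<And>r. 0 < r \<Longrightarrow> inner (E (Q r u)) (E u) = (norm (E u))\<^sup>2 * (\<integral>x. exp (M * r) * clip x powr r \<partial>\<mu>)"
    and r: "0 < r"
  shows "ennreal (inner (E (Q r u)) (E u)) = (\<integral>\<^sup>+x. ennreal ((norm (E u))\<^sup>2) * ennreal (exp (M * r) * clip x powr r) \<partial>\<mu>)"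
proof -
  interpret prob_space \<mu> by fact
  have [measurable]: "(\<lambda>x. exp (M * r) * clip x powr r) \<in> borel_measurable \<mu>"
    unfolding measurable_cong_sets[OF \<mu>(2) refl] by measurable
  have "clip x powr r \<le> 1" for x
    using powr_mono2[of r "clip x" 1] clip_bounds[of x] r by simp
  then have "integrable \<mu> (\<lambda>x. exp (M * r) * clip x powr r)"
    by (intro integrable_const_bound[where B = "exp (M * r)"]) auto
  then have "ennreal (\<integral>x. exp (M * r) * clip x powr r \<partial>\<mu>) = (\<integral>\<^sup>+x. ennreal (exp (M * r) * clip x powr r) \<partial>\<mu>)"
    by (intro nn_integral_eq_integral[symmetric]) auto
  then show ?thesis
    unfolding rep[OF r] by (subst nn_integral_cmult, measurable) (simp only: ennreal_mult' zero_le_power2)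
qed

text \<open>For \<open>\<alpha> < 1\<close> insert the subordination formula into both arguments of \<open>\<langle>E v, E v\<rangle>\<close>. By
  symmetry and the semigroup law the integrand depends on \<open>s + s'\<close> only, and it is a mixture
  of powers \<open>x\<^sup>s x\<^sup>s\<^sup>'\<close>, so that Tonelli's theorem makes it a mixture of squares.\<close>

theorem solution_energy:
  assumes \<alpha>: "0 < \<alpha>" "\<alpha> \<le> 1" and t: "0 < t" and M: "0 \<le> M" and u: "u \<in> X" and sol: "solution_op \<alpha> S t u v"
    and \<mu>: "prob_space \<mu>" "sets \<mu> = sets borel"
    and rep: "\<And>r. 0 < r \<Longrightarrow> inner (E (Q r u)) (E u) = (norm (E u))\<^sup>2 * (\<integral>x. exp (M * r) * clip x powr r \<partial>\<mu>)"
  shows "ennreal ((norm (E v))\<^sup>2) = ennreal ((norm (E u))\<^sup>2) * (\<integral>\<^sup>+x. ennreal ((profile \<alpha> M t (clip x))\<^sup>2) \<partial>\<mu>)"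
proof -
  interpret P: prob_space \<mu> by fact
  interpret LP: pair_sigma_finite \<mu> lborel
    by (intro pair_sigma_finite.intro P.sigma_finite_measure_axioms lborel.sigma_finite_measure_axioms)
  define n where "n = (norm (E u))\<^sup>2"
  define F where "F r = inner (E (Q r u)) (E u)" for r
  have F: "ennreal (F r) = (\<integral>\<^sup>+x. ennreal n * ennreal (exp (M * r) * clip x powr r) \<partial>\<mu>)" if "0 < r" for r
    unfolding F_def n_def by (rule Q_energy[OF u \<mu> rep that])
  have F0: "0 \<le> F r" if "0 < r" for r
    unfolding F_def rep[OF that] by (intro mult_nonneg_nonneg Bochner_Integration.integral_nonneg) auto
  have Fs: "inner (E (Q r u)) (E (Q s u)) = F (r + s)" if "0 < r" "0 < s" for r s
    using Q_symmetric[of "Q r u" u s] Q_in[of r u] that u unfolding F_def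
    by (simp add: Q_add[symmetric] add.commute)
  have clip_m [measurable]: "clip \<in> borel_measurable \<mu>"
    unfolding measurable_cong_sets[OF \<mu>(2) refl] by measurable
  show ?thesis
  proof (cases "\<alpha> = 1")
    case True
    have v: "v = Q t u" using sol True u by (simp add: solution_op_def Q_eq)
    have "ennreal ((norm (E v))\<^sup>2) = ennreal (F (t + t))"
      unfolding v power2_norm_eq_inner using Fs[OF t t] by simp
    also have "\<dots> = (\<integral>\<^sup>+x. ennreal n * ennreal (exp (M * (t + t)) * clip x powr (t + t)) \<partial>\<mu>)"
      using t by (intro F) simp
    also have "\<dots> = ennreal n * (\<integral>\<^sup>+x. ennreal (exp (M * (t + t)) * clip x powr (t + t)) \<partial>\<mu>)"
      by (rule nn_integral_cmult) measurable
    also have "(\<integral>\<^sup>+x. ennreal (exp (M * (t + t)) * clip x powr (t + t)) \<partial>\<mu>) = (\<integral>\<^sup>+x. ennreal ((profile \<alpha> M t (clip x))\<^sup>2) \<partial>\<mu>)"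
    proof (rule nn_integral_cong)
      fix x
      show "ennreal (exp (M * (t + t)) * clip x powr (t + t)) = ennreal ((profile \<alpha> M t (clip x))\<^sup>2)"
      proof -
        have "exp (M * (t + t)) * clip x powr (t + t) = (exp (M * t) * clip x powr t)\<^sup>2"
          by (simp only: power2_eq_square powr_add exp_add distrib_left mult_ac)
        then show ?thesis using clip_bounds[of x] True by (auto simp: profile_def)
      qed
    qed
    finally show ?thesis by (simp add: n_def)
  next
    case False
    then have \<alpha>1: "\<alpha> < 1" using \<alpha> by simp
    define \<tau> where "\<tau> = t powr \<alpha>"
    have \<tau>: "0 < \<tau>" using t by (simp add: \<tau>_def)
    have W: "0 \<le> Wright \<alpha> s" if "0 < s" for s using Wright_nonneg \<alpha> \<alpha>1 that by simp
    have Wm [measurable]: "Wright \<alpha> \<in> borel_measurable borel"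
      by (rule borel_measurable_continuous_onI[OF continuous_on_Wright[OF \<alpha>(1) \<alpha>1]])
    define k where "k s x = ennreal (indicator {0<..} s * (Wright \<alpha> s * (exp (M * (s * \<tau>)) * clip x powr (s * \<tau>))))" for s x :: real
    define g where "g x = ennreal (profile \<alpha> M t (clip x))" for x
    have kg: "(\<integral>\<^sup>+s. k s x \<partial>lborel) = g x" for x
      unfolding k_def g_def \<tau>_def by (rule profile_Wright[OF \<alpha>(1) \<alpha>1 t M clip_bounds])
    have km: "(\<lambda>p. k (fst p) (snd p)) \<in> borel_measurable (lborel \<Otimes>\<^sub>M \<mu>)"
      unfolding k_def by measurable
    have kx [measurable]: "(\<lambda>x. k s x) \<in> borel_measurable \<mu>" for s unfolding k_def by measurable
    have ks [measurable]: "(\<lambda>s. k s x) \<in> borel_measurable lborel" for x unfolding k_def by measurable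
    have gm [measurable]: "g \<in> borel_measurable \<mu>"
      unfolding kg[symmetric, abs_def]
      by (rule lborel.borel_measurable_nn_integral) (unfold k_def, measurable)
    have h: "((\<lambda>s. Wright \<alpha> s *\<^sub>R Q (s * \<tau>) u) has_integral v) {0<..}"
      using sol False u by (simp add: solution_op_def Q_eq \<tau>_def)
    have hz: "((\<lambda>s. Wright \<alpha> s * inner (E (Q (s * \<tau>) u)) z) has_integral inner (E v) z) {0<..}" for z
    proof -
      have "bounded_linear (\<lambda>y. inner (E y) z)"
        by (rule bounded_linear_compose[OF bounded_linear_inner_left E])
      from has_integral_linear[OF h this] show ?thesis
        by (simp add: o_def linear_cmul[OF bounded_linear.linear[OF E]])
    qed
    \<comment> \<open>the form with the subordination formula inserted in the first argument only\<close>
    define J where "J s = inner (E v) (E (Q (s * \<tau>) u))" for s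
    have hJ: "((\<lambda>s'. Wright \<alpha> s' * F ((s' + s) * \<tau>)) has_integral J s) {0<..}" if s: "0 < s" for s
    proof (rule has_integral_eq[OF _ hz[of "E (Q (s * \<tau>) u)", folded J_def]])
      fix s' :: real assume "s' \<in> {0<..}"
      then show "Wright \<alpha> s' * inner (E (Q (s' * \<tau>) u)) (E (Q (s * \<tau>) u)) = Wright \<alpha> s' * F ((s' + s) * \<tau>)"
        using Fs[of "s' * \<tau>" "s * \<tau>"] s \<tau> by (simp add: distrib_right)
    qed
    have J0: "0 \<le> J s" if s: "0 < s" for s
      by (rule has_integral_nonneg[OF hJ[OF s]]) (use s \<tau> in \<open>auto intro!: mult_nonneg_nonneg W F0\<close>)
    have eJ: "ennreal (indicator {0<..} s * (Wright \<alpha> s * J s)) = (\<integral>\<^sup>+x. ennreal n * k s x * g x \<partial>\<mu>)" for s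
    proof (cases "0 < s")
      case s: True
      have inner: "ennreal (Wright \<alpha> s) * ennreal (indicator {0<..} s' * (Wright \<alpha> s' * F ((s' + s) * \<tau>))) =
          (\<integral>\<^sup>+x. ennreal n * k s x * k s' x \<partial>\<mu>)" for s'
      proof (cases "0 < s'")
        case s': True
        have "ennreal (Wright \<alpha> s) * ennreal (Wright \<alpha> s' * F ((s' + s) * \<tau>)) = ennreal (Wright \<alpha> s * Wright \<alpha> s') * ennreal (F ((s' + s) * \<tau>))"
          using W[OF s] W[OF s'] F0[of "(s' + s) * \<tau>"] s s' \<tau> by (simp add: ennreal_mult' mult.assoc)
        also have "\<dots> = (\<integral>\<^sup>+x. ennreal (Wright \<alpha> s * Wright \<alpha> s') * (ennreal n * ennreal (exp (M * ((s' + s) * \<tau>)) * clip x powr ((s' + s) * \<tau>))) \<partial>\<mu>)"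
          using s s' \<tau> by (subst F) (auto intro!: nn_integral_cmult[symmetric])
        also have "\<dots> = (\<integral>\<^sup>+x. ennreal n * k s x * k s' x \<partial>\<mu>)"
        proof (rule nn_integral_cong)
          fix x
          have "exp (M * ((s' + s) * \<tau>)) * clip x powr ((s' + s) * \<tau>) =
            (exp (M * (s * \<tau>)) * clip x powr (s * \<tau>)) * (exp (M * (s' * \<tau>)) * clip x powr (s' * \<tau>))"
            by (simp add: distrib_right distrib_left exp_add powr_add mult_ac)
          then show "ennreal (Wright \<alpha> s * Wright \<alpha> s') * (ennreal n * ennreal (exp (M * ((s' + s) * \<tau>)) * clip x powr ((s' + s) * \<tau>))) = ennreal n * k s x * k s' x"
            using W[OF s] W[OF s'] s s' by (simp add: k_def ennreal_mult' mult_ac)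
        qed
        finally show ?thesis using s' by simp
      qed (simp add: k_def)
      have "ennreal (indicator {0<..} s * (Wright \<alpha> s * J s)) = ennreal (Wright \<alpha> s) * ennreal (J s)"
        using s W[OF s] by (simp add: ennreal_mult')
      also have "ennreal (J s) = (\<integral>\<^sup>+s'. ennreal (indicator {0<..} s' * (Wright \<alpha> s' * F ((s' + s) * \<tau>))) \<partial>lborel)"
        by (rule nn_integral_has_integral_lebesgue[OF _ hJ[OF s], symmetric])
          (use s \<tau> in \<open>auto intro!: mult_nonneg_nonneg W F0\<close>)
      also have "ennreal (Wright \<alpha> s) * \<dots> = (\<integral>\<^sup>+s'. (\<integral>\<^sup>+x. ennreal n * k s x * k s' x \<partial>\<mu>) \<partial>lborel)"
        unfolding inner[symmetric]
      proof (rule nn_integral_cmult[symmetric])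
        have "continuous_on {0<..} (\<lambda>s'. Q ((s' + s) * \<tau>) u)"
          by (rule continuous_on_compose2[OF Q_continuous]) (use s \<tau> in \<open>auto intro!: continuous_intros\<close>)
        then have "continuous_on {0<..} (\<lambda>s'. Wright \<alpha> s' * F ((s' + s) * \<tau>))"
          unfolding F_def
          by (intro continuous_on_mult continuous_on_inner continuous_on_const bounded_linear.continuous_on[OF E]
              continuous_on_subset[OF continuous_on_Wright[OF \<alpha>(1) \<alpha>1]]) auto
        then have "(\<lambda>s'. indicator {0<..} s' *\<^sub>R (Wright \<alpha> s' * F ((s' + s) * \<tau>))) \<in> borel_measurable borel"
          by (intro borel_measurable_continuous_on_indicator) auto
        then have "(\<lambda>s'. indicator {0<..} s' * (Wright \<alpha> s' * F ((s' + s) * \<tau>))) \<in> borel_measurable borel"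
          by simp
        from measurable_compose[OF this measurable_ennreal]
        show "(\<lambda>s'. ennreal (indicator {0<..} s' * (Wright \<alpha> s' * F ((s' + s) * \<tau>)))) \<in> borel_measurable lborel"
          by simp
      qed
      also have "\<dots> = (\<integral>\<^sup>+x. (\<integral>\<^sup>+s'. ennreal n * k s x * k s' x \<partial>lborel) \<partial>\<mu>)"
        by (rule LP.Fubini') (unfold k_def, measurable)
      also have "\<dots> = (\<integral>\<^sup>+x. ennreal n * k s x * g x \<partial>\<mu>)"
        by (simp add: nn_integral_cmult kg)
      finally show ?thesis .
    qed (simp add: k_def)
    have "ennreal ((norm (E v))\<^sup>2) = (\<integral>\<^sup>+s. ennreal (indicator {0<..} s * (Wright \<alpha> s * J s)) \<partial>lborel)"
    proof (rule nn_integral_has_integral_lebesgue[symmetric])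
      show "((\<lambda>s. Wright \<alpha> s * J s) has_integral (norm (E v))\<^sup>2) {0<..}"
        using hz[of "E v"] by (simp add: J_def power2_norm_eq_inner inner_commute)
    qed (auto intro!: mult_nonneg_nonneg W J0)
    also have "\<dots> = (\<integral>\<^sup>+s. (\<integral>\<^sup>+x. ennreal n * k s x * g x \<partial>\<mu>) \<partial>lborel)"
      by (simp only: eJ)
    also have "\<dots> = (\<integral>\<^sup>+x. (\<integral>\<^sup>+s. ennreal n * k s x * g x \<partial>lborel) \<partial>\<mu>)"
      by (rule LP.Fubini') (unfold g_def[symmetric] k_def, measurable)
    also have "\<dots> = (\<integral>\<^sup>+x. ennreal n * (g x * g x) \<partial>\<mu>)"
      by (simp add: nn_integral_cmult nn_integral_multc kg mult.assoc)
    also have "\<dots> = ennreal n * (\<integral>\<^sup>+x. g x * g x \<partial>\<mu>)"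
      by (rule nn_integral_cmult) measurable
    also have "(\<integral>\<^sup>+x. g x * g x \<partial>\<mu>) = (\<integral>\<^sup>+x. ennreal ((profile \<alpha> M t (clip x))\<^sup>2) \<partial>\<mu>)"
    proof (rule nn_integral_cong)
      have "0 \<le> profile \<alpha> M t (clip x)" for x using False by (simp add: profile_def)
      then show "g x * g x = ennreal ((profile \<alpha> M t (clip x))\<^sup>2)" for x
        by (simp add: g_def power2_eq_square ennreal_mult)
    qed
    finally show ?thesis by (simp add: n_def)
  qed
qed

lemma solution_vanishes:
  assumes \<alpha>: "0 < \<alpha>" "\<alpha> \<le> 1" and t: "0 \<le> t" and u: "u \<in> X" "E u = 0" and sol: "solution_op \<alpha> S t u v"
  shows "E v = 0"
proof -
  have Q: "E (Q r u) = 0" if "0 \<le> r" for r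
    using Q_contractive[OF u(1) that] u(2) by (simp add: mult_le_0_iff)
  show ?thesis
  proof (cases "\<alpha> = 1")
    case True
    then show ?thesis using sol Q[OF t] u by (simp add: solution_op_def Q_eq)
  next
    case False
    have "((\<lambda>s. E (Wright \<alpha> s *\<^sub>R S (s * t powr \<alpha>) u)) has_integral E v) {0<..}"
      using has_integral_linear[OF _ E, of _ v "{0<..}"] sol False by (simp add: solution_op_def o_def)
    then have "((\<lambda>s::real. 0) has_integral E v) {0<..}"
      by (rule has_integral_eq[rotated])
        (use Q u in \<open>simp add: linear_cmul[OF bounded_linear.linear[OF E]] flip: Q_eq[OF u(1)]\<close>)
    then show ?thesis using has_integral_0_eq by blast
  qed
qed

text \<open>Apply \<open>holder_powr_prob\<close> to the energies at the times \<open>t\<close> and \<open>T\<close>, divided by the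
  initial energy.\<close>

theorem solution_interpolation:
  assumes \<alpha>: "0 < \<alpha>" "\<alpha> \<le> 1" and t: "0 < t" "t < T" and M: "0 \<le> M" and u: "u \<in> X"
    and sol: "solution_op \<alpha> S t u v" "solution_op \<alpha> S T u w"
    and \<kappa>: "0 \<le> \<kappa>" "\<And>x. 0 \<le> x \<Longrightarrow> x \<le> 1 \<Longrightarrow> profile \<alpha> M t x \<le> \<kappa> * profile \<alpha> M T x powr (t / T)"
  shows "norm (E v) \<le> \<kappa> * norm (E u) powr (1 - t / T) * norm (E w) powr (t / T)"
proof (cases "E u = 0")
  case True
  then show ?thesis using solution_vanishes[OF \<alpha> _ u True sol(1)] t by simp
next
  case False
  define n where "n = (norm (E u))\<^sup>2"
  define \<tau> where "\<tau> = t / T"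
  have \<tau>: "0 < \<tau>" "\<tau> < 1" using t by (auto simp: \<tau>_def)
  have n: "0 < n" using False by (simp add: n_def)
  obtain \<mu> where \<mu>: "prob_space \<mu>" "sets \<mu> = sets borel"
    and rep: "\<And>r. 0 < r \<Longrightarrow> inner (E (Q r u)) (E u) = (norm (E u))\<^sup>2 * (\<integral>x. exp (M * r) * clip x powr r \<partial>\<mu>)"
    by (rule spectral_representation[OF u False]) blast
  have "0 < T" using t by simp
  have energy: "(\<integral>\<^sup>+x. ennreal ((profile \<alpha> M r (clip x))\<^sup>2) \<partial>\<mu>) = ennreal ((norm (E z))\<^sup>2 / n)"
    if "0 < r" "solution_op \<alpha> S r u z" for r z
  proof -
    have "ennreal ((norm (E z))\<^sup>2) = ennreal n * (\<integral>\<^sup>+x. ennreal ((profile \<alpha> M r (clip x))\<^sup>2) \<partial>\<mu>)"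
      unfolding n_def by (rule solution_energy[OF \<alpha> that(1) M u that(2) \<mu> rep])
    then have "ennreal (1 / n) * ennreal ((norm (E z))\<^sup>2) = ennreal (1 / n) * ennreal n * (\<integral>\<^sup>+x. ennreal ((profile \<alpha> M r (clip x))\<^sup>2) \<partial>\<mu>)"
      by (simp add: mult.assoc)
    then show ?thesis using n by (simp add: ennreal_mult[symmetric])
  qed
  have pm: "(\<lambda>x. profile \<alpha> M r (clip x)) \<in> borel_measurable \<mu>" for r
    unfolding measurable_cong_sets[OF \<mu>(2) refl]
    by (rule measurable_compose[OF measurable_clip measurable_profile[OF \<alpha>]])
  have p0: "0 \<le> profile \<alpha> M r x" for r x by (simp add: profile_def)
  have "(norm (E v))\<^sup>2 / n \<le> \<kappa>\<^sup>2 * ((norm (E w))\<^sup>2 / n) powr \<tau>"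
    using n \<tau> by (intro holder_powr_prob[OF \<mu>(1) pm pm p0 p0 _ energy[OF t(1) sol(1)] energy[OF \<open>0 < T\<close> sol(2)]])
      (auto simp: \<tau>_def intro: \<kappa> clip_bounds)
  then have "(norm (E v))\<^sup>2 \<le> \<kappa>\<^sup>2 * (n powr (1 - \<tau>) * ((norm (E w))\<^sup>2) powr \<tau>)"
    using n by (simp add: powr_divide powr_diff field_simps)
  also have "\<dots> = (\<kappa> * norm (E u) powr (1 - \<tau>) * norm (E w) powr \<tau>)\<^sup>2"
  proof -
    have "(z\<^sup>2) powr s = (z powr s)\<^sup>2" if "0 \<le> z" for z s :: real
      using that by (simp only: power2_eq_square powr_mult)
    then show ?thesis by (simp only: n_def power_mult_distrib norm_ge_zero mult.assoc)
  qed
  finally show ?thesis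
    unfolding \<tau>_def[symmetric] by (rule power2_le_imp_le) (intro mult_nonneg_nonneg \<kappa> powr_ge_zero)
qed

end


section \<open>The weight for the given coefficients\<close>

lemma locally_integrable_measurable:
  fixes f :: "real^'n \<Rightarrow> 'b::euclidean_space"
  assumes \<Omega>: "open \<Omega>" and f: "locally_integrable_on \<Omega> f"
  shows "f \<in> borel_measurable (lebesgue_on \<Omega>)"
proof -
  obtain C :: "nat \<Rightarrow> (real^'n) set" where C: "\<And>n. compact (C n)" "\<And>n. C n \<subseteq> \<Omega>" "\<And>K. compact K \<Longrightarrow> K \<subseteq> \<Omega> \<Longrightarrow> \<exists>N. \<forall>n\<ge>N. K \<subseteq> C n"
  proof (rule open_Union_compact_subsets[OF \<Omega>])
    fix C :: "nat \<Rightarrow> (real^'n) set"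
    assume "\<And>n. compact (C n)" "\<And>n. C n \<subseteq> \<Omega>" "\<And>K. compact K \<Longrightarrow> K \<subseteq> \<Omega> \<Longrightarrow> \<exists>N. \<forall>n\<ge>N. K \<subseteq> C n"
    then show thesis by (rule that)
  qed
  have "(\<lambda>x. indicator \<Omega> x *\<^sub>R f x) \<in> borel_measurable lebesgue"
  proof (rule borel_measurable_LIMSEQ_metric)
    show "(\<lambda>x. indicator (C n) x *\<^sub>R f x) \<in> borel_measurable lebesgue" for n
      using f C(1,2)[of n] unfolding locally_integrable_on_def set_integrable_def
      by (intro borel_measurable_integrable) simp
    fix x
    have "eventually (\<lambda>n. indicator (C n) x *\<^sub>R f x = indicator \<Omega> x *\<^sub>R f x) sequentially"
    proof (cases "x \<in> \<Omega>")
      case True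
      then obtain m where "\<forall>n\<ge>m. {x} \<subseteq> C n" using C(3)[of "{x}"] by auto
      then have "x \<in> C n" if "m \<le> n" for n using that by simp
      then show ?thesis using True by (intro eventually_sequentiallyI[of m]) simp
    next
      case False
      then have "x \<notin> C n" for n using C(2) by blast
      then show ?thesis using False by simp
    qed
    then show "(\<lambda>n. indicator (C n) x *\<^sub>R f x) \<longlonglongrightarrow> indicator \<Omega> x *\<^sub>R f x"
      by (rule tendsto_eventually)
  qed
  then show ?thesis
    using \<Omega> by (subst borel_measurable_restrict_space_iff) auto
qed

text \<open>The gradient of \<open>b\<close> is determined by \<open>B\<close> through ellipticity:
  \<open>\<kappa>\<^sub>0 \<bar>\<nabla>b\<bar>\<^sup>2 \<le> \<nabla>b \<cdot> A \<nabla>b = \<nabla>b \<cdot> B\<close>.\<close>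

lemma A_gradient_bounded:
  fixes A :: "real^'n \<Rightarrow> real^'n^'n"
  assumes \<Omega>: "open \<Omega>" and ell: "uniformly_elliptic \<Omega> A"
    and B: "\<And>j. Linf \<Omega> (\<lambda>x. B x $ j)"
    and Db: "\<And>j. weak_partial \<Omega> j b (\<lambda>x. Db x $ j)" "AE x in lebesgue_on \<Omega>. B x = A x *v Db x"
  shows "\<exists>C\<ge>0. \<forall>j. AE x in lebesgue_on \<Omega>. \<bar>Db x $ j\<bar> \<le> C"
proof -
  obtain \<kappa> where \<kappa>: "0 < \<kappa>" "\<And>x (\<xi>::real^'n). x \<in> closure \<Omega> \<Longrightarrow>
      \<kappa> * (\<Sum>j\<in>UNIV. (\<xi> $ j)\<^sup>2) \<le> (\<Sum>i\<in>UNIV. \<Sum>j\<in>UNIV. A x $ i $ j * \<xi> $ i * \<xi> $ j)"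
    using ell unfolding uniformly_elliptic_def by blast
  have "\<exists>C. \<forall>j. 0 \<le> C j \<and> (AE x in lebesgue_on \<Omega>. \<bar>B x $ j\<bar> \<le> C j)"
  proof (rule choice, rule allI)
    fix j
    show "\<exists>c. 0 \<le> c \<and> (AE x in lebesgue_on \<Omega>. \<bar>B x $ j\<bar> \<le> c)"
      by (rule LinfE[OF B[of j]]) blast
  qed
  then obtain C where C: "\<And>j. 0 \<le> C j" "\<And>j. AE x in lebesgue_on \<Omega>. \<bar>B x $ j\<bar> \<le> C j" by blast
  show ?thesis
  proof (intro exI[of _ "(\<Sum>j\<in>UNIV. C j) / \<kappa>"] conjI allI)
    show "0 \<le> (\<Sum>j\<in>UNIV. C j) / \<kappa>" using C(1) \<kappa>(1) by (intro divide_nonneg_pos sum_nonneg) auto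
    fix j
    have "AE x in lebesgue_on \<Omega>. \<forall>j\<in>UNIV. \<bar>B x $ j\<bar> \<le> C j"
      by (intro AE_finite_allI C) simp
    moreover have "AE x in lebesgue_on \<Omega>. x \<in> \<Omega>"
      using \<Omega> by (subst AE_restrict_space_iff) auto
    ultimately show "AE x in lebesgue_on \<Omega>. \<bar>Db x $ j\<bar> \<le> (\<Sum>j\<in>UNIV. C j) / \<kappa>"
      using Db(2)
    proof eventually_elim
      case (elim x)
      have sq: "(\<Sum>j\<in>UNIV. (Db x $ j)\<^sup>2) = norm (Db x) * norm (Db x)"
      proof -
        have "(\<Sum>j\<in>UNIV. (Db x $ j)\<^sup>2) = inner (Db x) (Db x)"
          by (simp only: inner_vec_def power2_eq_square inner_real_def)
        then show ?thesis by (simp only: dot_square_norm power2_eq_square)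
      qed
      have "\<kappa> * (norm (Db x) * norm (Db x)) \<le> (\<Sum>i\<in>UNIV. \<Sum>j\<in>UNIV. A x $ i $ j * Db x $ i * Db x $ j)"
        using \<kappa>(2)[of x "Db x"] elim closure_subset[of \<Omega>] unfolding sq by auto
      also have "\<dots> = inner (Db x) (B x)"
        using elim by (simp add: inner_vec_def matrix_vector_mult_def sum_distrib_left mult_ac)
      also have "\<dots> \<le> norm (Db x) * norm (B x)" by (rule norm_cauchy_schwarz)
      also have "\<dots> \<le> norm (Db x) * (\<Sum>j\<in>UNIV. C j)"
      proof (rule mult_left_mono)
        have "(\<Sum>j\<in>UNIV. \<bar>B x $ j\<bar>) \<le> (\<Sum>j\<in>UNIV. C j)"
          using elim by (intro sum_mono) blast
        then show "norm (B x) \<le> (\<Sum>j\<in>UNIV. C j)"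
          using norm_le_l1_cart[of "B x"] by linarith
      qed simp
      finally have *: "norm (Db x) * (\<kappa> * norm (Db x)) \<le> norm (Db x) * (\<Sum>j\<in>UNIV. C j)"
        by (simp only: mult_ac)
      have "norm (Db x) \<le> (\<Sum>j\<in>UNIV. C j) / \<kappa>"
      proof (cases "norm (Db x) = 0")
        case True
        show ?thesis unfolding True using C(1) \<kappa>(1) by (intro divide_nonneg_pos sum_nonneg) auto
      next
        case False
        then have "\<kappa> * norm (Db x) \<le> (\<Sum>j\<in>UNIV. C j)"
          using mult_left_le_imp_le[OF *] norm_ge_zero[of "Db x"] by linarith
        then show ?thesis using \<kappa>(1) by (simp add: pos_le_divide_eq mult.commute)
      qed
      then show ?case using component_le_norm_cart[of "Db x" j] by linarith
    qed
  qed
qed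

lemma norm_mult_L2_mono:
  assumes a: "a \<in> borel_measurable lebesgue" "\<And>x. \<bar>a x\<bar> \<le> C"
    and c: "c \<in> borel_measurable lebesgue" "\<And>x. \<bar>c x\<bar> \<le> D"
    and le: "\<And>x. x \<in> \<Omega> \<Longrightarrow> \<bar>a x\<bar> \<le> \<bar>c x\<bar>" and v: "v \<in> L2_space \<Omega>"
  shows "norm (mult_L2 a v) \<le> norm (mult_L2 c v)"
proof (rule power2_le_imp_le)
  have "ennreal ((norm (mult_L2 a v))\<^sup>2) \<le> ennreal ((norm (mult_L2 c v))\<^sup>2)"
    unfolding nn_integral_norm_L2[symmetric]
  proof (rule nn_integral_mono_AE)
    show "AE x in lebesgue. ennreal ((norm (rep_L2 (mult_L2 a v) x))\<^sup>2) \<le> ennreal ((norm (rep_L2 (mult_L2 c v) x))\<^sup>2)"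
      using rep_mult_L2[OF a, of v] rep_mult_L2[OF c, of v] v[unfolded L2_space_def, simplified]
    proof eventually_elim
      case (elim x)
      have "norm (rep_L2 (mult_L2 a v) x) \<le> norm (rep_L2 (mult_L2 c v) x)"
        using elim le[of x] by (cases "x \<in> \<Omega>") (simp_all add: mult_right_mono del: scaleR_conv_of_real)
      then show ?case by (intro ennreal_leI power_mono) auto
    qed
  qed
  then show "(norm (mult_L2 a v))\<^sup>2 \<le> (norm (mult_L2 c v))\<^sup>2" by simp
qed simp

lemma mult_L2_const: "mult_L2 (\<lambda>x. r) v = r *\<^sub>R v"
proof (rule L2_eqI)
  show "AE x in lebesgue. rep_L2 (mult_L2 (\<lambda>x. r) v) x = rep_L2 (r *\<^sub>R v) x"
    using rep_mult_L2[of "\<lambda>x. r" "\<bar>r\<bar>" v] rep_L2_scaleR[of r v] by (auto elim: eventually_elim2)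
qed

lemma AE_le_Linf_norm:
  assumes "Linf \<Omega> b"
  shows "AE x in lebesgue_on \<Omega>. \<bar>b x\<bar> \<le> Linf_norm \<Omega> b"
proof -
  obtain C where C: "0 \<le> C" "b \<in> borel_measurable (lebesgue_on \<Omega>)" "AE x in lebesgue_on \<Omega>. \<bar>b x\<bar> \<le> C"
    by (rule LinfE[OF assms])
  let ?e = "esssup (lebesgue_on \<Omega>) (\<lambda>x. ereal \<bar>b x\<bar>)"
  have le: "?e \<le> ereal C"
    by (rule esssup_I) (use C in auto)
  have "AE x in lebesgue_on \<Omega>. ereal \<bar>b x\<bar> \<le> ?e" by (rule esssup_AE)
  then show ?thesis
  proof eventually_elim
    case (elim x)
    with le show ?case unfolding Linf_norm_def by (cases ?e) auto
  qed
qed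

text \<open>The function \<open>b\<close> is truncated at its norm, such that \<open>e\<^sup>b\<^sup>/\<^sup>2\<close> stays, at every point of
  \<open>\<Omega>\<close>, between \<open>exp (- \<parallel>b\<parallel>\<^sub>\<infinity> / 2)\<close> and \<open>exp (\<parallel>b\<parallel>\<^sub>\<infinity> / 2)\<close>. This gives the comparison of the
  norms.\<close>

lemma weighted_elliptic_exists:
  fixes \<Omega> :: "(real^'n) set" and A :: "real^'n \<Rightarrow> real^'n^'n"
  assumes \<Omega>: "open \<Omega>" "bounded \<Omega>"
    and A: "\<And>i j. C1_closure \<Omega> (\<lambda>x. A x $ i $ j)" "\<forall>x\<in>closure \<Omega>. \<forall>i j. A x $ i $ j = A x $ j $ i"
    and ell: "uniformly_elliptic \<Omega> A"
    and B: "\<And>j. W_inf 1 \<Omega> (\<lambda>x. B x $ j)" and p: "Linf \<Omega> p" and b: "Linf \<Omega> b" and grad: "is_A_gradient \<Omega> A b B"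
  shows "\<exists>Db w a \<beta> q Cw Ca C\<beta> M. weighted_elliptic \<Omega> A B p b Db w a \<beta> q Cw Ca C\<beta> M \<and> 0 \<le> M \<and>
    (\<forall>v\<in>L2_space \<Omega>. norm (mult_L2 w v) \<le> exp (Linf_norm \<Omega> b / 2) * norm v \<and>
      norm v \<le> exp (Linf_norm \<Omega> b / 2) * norm (mult_L2 w v))"
proof -
  have in\<Omega>: "AE x in lebesgue_on \<Omega>. x \<in> \<Omega>"
    using \<Omega> by (subst AE_restrict_space_iff) auto
  obtain D where D: "\<And>j. weak_partial \<Omega> j b (\<lambda>x. D x $ j)" "AE x in lebesgue_on \<Omega>. B x = A x *v D x"
    using grad unfolding is_A_gradient_def by blast
  have BL: "Linf \<Omega> (\<lambda>x. B x $ j)" for j using B[of j] by simp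
  obtain C\<beta> where C\<beta>: "0 \<le> C\<beta>" "\<And>j. AE x in lebesgue_on \<Omega>. \<bar>D x $ j\<bar> \<le> C\<beta>"
    using A_gradient_bounded[OF \<Omega>(1) ell BL D] by blast
  have Dm: "(\<lambda>x. D x $ j) \<in> borel_measurable (lebesgue_on \<Omega>)" for j
    using D(1)[of j] unfolding weak_partial_def by (intro locally_integrable_measurable \<Omega>) simp
  have "\<exists>\<beta>. \<forall>j. \<beta> j \<in> borel_measurable lebesgue \<and> (\<forall>x. \<bar>\<beta> j x\<bar> \<le> C\<beta>) \<and> (\<forall>x. x \<notin> \<Omega> \<longrightarrow> \<beta> j x = 0) \<and>
      (AE x in lebesgue_on \<Omega>. \<beta> j x = D x $ j)"
    by (rule choice, rule allI, rule Linf_bounded_version[OF \<Omega>(1) Dm C\<beta>(2) C\<beta>(1)])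
  then obtain \<beta> where "\<forall>j. \<beta> j \<in> borel_measurable lebesgue \<and> (\<forall>x. \<bar>\<beta> j x\<bar> \<le> C\<beta>) \<and> (\<forall>x. x \<notin> \<Omega> \<longrightarrow> \<beta> j x = 0) \<and>
      (AE x in lebesgue_on \<Omega>. \<beta> j x = D x $ j)" ..
  then have \<beta>: "\<And>j. \<beta> j \<in> borel_measurable lebesgue" "\<And>j x. \<bar>\<beta> j x\<bar> \<le> C\<beta>" "\<And>j x. x \<notin> \<Omega> \<Longrightarrow> \<beta> j x = 0"
    "\<And>j. AE x in lebesgue_on \<Omega>. \<beta> j x = D x $ j" by auto
  obtain M where M: "0 \<le> M" "p \<in> borel_measurable (lebesgue_on \<Omega>)" "AE x in lebesgue_on \<Omega>. \<bar>p x\<bar> \<le> M"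
    by (rule LinfE[OF p])
  obtain q where "q \<in> borel_measurable lebesgue \<and> (\<forall>x. \<bar>q x\<bar> \<le> M) \<and> (\<forall>x. x \<notin> \<Omega> \<longrightarrow> q x = 0) \<and>
      (AE x in lebesgue_on \<Omega>. q x = p x)"
    using Linf_bounded_version[OF \<Omega>(1) M(2,3,1)] ..
  then have q: "q \<in> borel_measurable lebesgue" "\<And>x. \<bar>q x\<bar> \<le> M" "\<And>x. x \<notin> \<Omega> \<Longrightarrow> q x = 0"
    "AE x in lebesgue_on \<Omega>. q x = p x"
    by auto
  define N where "N = Linf_norm \<Omega> b"
  have bN: "AE x in lebesgue_on \<Omega>. \<bar>b x\<bar> \<le> N" unfolding N_def by (rule AE_le_Linf_norm[OF b])
  have bm: "b \<in> borel_measurable (lebesgue_on \<Omega>)" using b by (simp add: Linf_def)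
  define g where "g x = (if x \<in> \<Omega> then max (- N) (min N (b x)) else 0)" for x
  have gm [measurable]: "g \<in> borel_measurable lebesgue"
    unfolding g_def by (intro borel_measurable_if_I borel_measurable_max borel_measurable_min borel_measurable_const bm) (use \<Omega> in auto)
  define w where "w x = indicator \<Omega> x * exp (g x / 2)" for x
  have wm [measurable]: "w \<in> borel_measurable lebesgue"
    unfolding w_def
  proof (intro borel_measurable_times borel_measurable_indicator)
    show "\<Omega> \<in> sets lebesgue" using \<Omega> by auto
    show "(\<lambda>x. exp (g x / 2)) \<in> borel_measurable lebesgue"
      by (rule measurable_compose[OF gm]) (auto intro!: borel_measurable_continuous_onI continuous_intros)
  qed
  \<comment> \<open>A nonempty open set has positive measure, so that \<open>\<bar>b\<bar> \<le> N\<close> almost everywhere forces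
    \<open>N \<ge> 0\<close>.\<close>
  have Nnn: "0 \<le> N" if "x \<in> \<Omega>" for x
  proof (rule ccontr)
    assume "\<not> 0 \<le> N"
    with bN have "AE x in lebesgue_on \<Omega>. False" by (auto elim: eventually_mono)
    then have "AE x in lebesgue. x \<notin> \<Omega>" using \<Omega> by (subst (asm) AE_restrict_space_iff) auto
    then have "emeasure lebesgue \<Omega> = 0" using \<Omega> by (subst (asm) AE_iff_measurable[of \<Omega>]) auto
    then have "\<Omega> \<in> null_sets lebesgue" using \<Omega> by auto
    then have "negligible \<Omega>" by (simp add: negligible_iff_null_sets)
    then show False using open_not_negligible[OF \<Omega>(1)] that by blast
  qed
  have gN: "\<bar>g x\<bar> \<le> N" if "x \<in> \<Omega>" for x using Nnn[OF that] that by (auto simp: g_def)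
  have w_le: "\<bar>w x\<bar> \<le> exp (N / 2)" for x
    using gN[of x] by (auto simp: w_def indicator_def)
  have w_ge: "exp (- (N / 2)) \<le> \<bar>w x\<bar>" if "x \<in> \<Omega>" for x
    using gN[OF that] that by (simp add: w_def)
  have wsq: "AE x in lebesgue_on \<Omega>. (w x)\<^sup>2 = exp (b x)"
    using bN in\<Omega>
  proof eventually_elim
    case (elim x)
    then have "g x = b x" by (auto simp: g_def)
    then show ?case using elim by (simp add: w_def power2_eq_square exp_add[symmetric])
  qed
  define a where "a i j x = indicator \<Omega> x * A x $ i $ j" for i j x
  have Ac: "continuous_on (closure \<Omega>) (\<lambda>x. A x $ i $ j)" for i j
    using A(1)[of i j] by (simp add: C1_closure_def)
  have "\<exists>c. \<forall>x\<in>closure \<Omega>. \<bar>A x $ i $ j\<bar> \<le> c" for i j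
  proof -
    have "compact (closure \<Omega>)" using \<Omega> by simp
    then have "bounded ((\<lambda>x. A x $ i $ j) ` closure \<Omega>)"
      by (intro compact_imp_bounded compact_continuous_image Ac)
    then show ?thesis by (auto simp: bounded_iff)
  qed
  then have "\<exists>c. \<forall>i j. \<forall>x\<in>closure \<Omega>. \<bar>A x $ i $ j\<bar> \<le> c i j" by (intro choice allI) simp
  then obtain c where c: "\<And>i j x. x \<in> closure \<Omega> \<Longrightarrow> \<bar>A x $ i $ j\<bar> \<le> c i j" by blast
  define Ca where "Ca = (\<Sum>i\<in>UNIV. \<Sum>j\<in>UNIV. \<bar>c i j\<bar>)"
  have Ca: "\<bar>a i j x\<bar> \<le> Ca" for i j x
  proof -
    have "\<bar>a i j x\<bar> \<le> \<bar>c i j\<bar>"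
      using c[of x i j] closure_subset[of \<Omega>] by (auto simp: a_def indicator_def)
    also have "\<dots> \<le> (\<Sum>j\<in>UNIV. \<bar>c i j\<bar>)" by (rule member_le_sum) auto
    also have "\<dots> \<le> Ca" unfolding Ca_def by (rule member_le_sum) (auto intro: sum_nonneg)
    finally show ?thesis .
  qed
  have am: "a i j \<in> borel_measurable lebesgue" for i j
  proof -
    have "(\<lambda>x. indicator \<Omega> x *\<^sub>R (A x $ i $ j)) \<in> borel_measurable borel"
      using \<Omega> by (intro borel_measurable_continuous_on_indicator continuous_on_subset[OF Ac closure_subset]) auto
    then have "(\<lambda>x. a i j x) \<in> borel_measurable lborel" by (simp add: a_def)
    then show ?thesis by (rule measurable_completion)
  qed
  have apos: "0 \<le> (\<Sum>i\<in>UNIV. \<Sum>j\<in>UNIV. a i j x * \<xi> i * \<xi> j)" for x and \<xi> :: "'n \<Rightarrow> real"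
  proof (cases "x \<in> \<Omega>")
    case True
    obtain \<kappa> where \<kappa>: "0 < \<kappa>" "\<And>x (\<xi>::real^'n). x \<in> closure \<Omega> \<Longrightarrow>
        \<kappa> * (\<Sum>j\<in>UNIV. (\<xi> $ j)\<^sup>2) \<le> (\<Sum>i\<in>UNIV. \<Sum>j\<in>UNIV. A x $ i $ j * \<xi> $ i * \<xi> $ j)"
      using ell unfolding uniformly_elliptic_def by blast
    have "0 \<le> \<kappa> * (\<Sum>j\<in>UNIV. ((\<chi> i. \<xi> i) $ j)\<^sup>2)" using \<kappa>(1) by (intro mult_nonneg_nonneg sum_nonneg) auto
    also have "\<dots> \<le> (\<Sum>i\<in>UNIV. \<Sum>j\<in>UNIV. A x $ i $ j * (\<chi> i. \<xi> i) $ i * (\<chi> i. \<xi> i) $ j)"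
      using True closure_subset by (intro \<kappa>(2)) blast
    finally show ?thesis using True by (simp add: a_def)
  qed (simp add: a_def)
  have asym: "a i j x = a j i x" for i j x
    using A(2) closure_subset[of \<Omega>] by (auto simp: a_def indicator_def)
  have Bj: "AE x in lebesgue_on \<Omega>. \<forall>j. B x $ j = (\<Sum>i\<in>UNIV. a j i x * \<beta> i x)"
  proof -
    have "AE x in lebesgue_on \<Omega>. \<forall>i\<in>UNIV. \<beta> i x = D x $ i" by (intro AE_finite_allI \<beta>(4)) simp
    with D(2) in\<Omega> show ?thesis
    proof eventually_elim
      case (elim x)
      then show ?case by (simp add: a_def matrix_vector_mult_def)
    qed
  qed
  have W: "weighted_elliptic \<Omega> A B p b (\<lambda>j x. D x $ j) w a \<beta> q (exp (N / 2)) Ca C\<beta> M"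
  proof
    show "\<And>i. Linf \<Omega> (\<lambda>x. D x $ i)" by (rule LinfI[OF Dm C\<beta>(2)])
    show "\<And>x. x \<notin> \<Omega> \<Longrightarrow> w x = 0" by (simp add: w_def)
    show "\<And>i j x. x \<in> \<Omega> \<Longrightarrow> a i j x = A x $ i $ j" by (simp add: a_def)
  qed (fact \<Omega> b D wm w_le wsq am Ca asym apos \<beta> q Bj)+
  show ?thesis
  proof (intro exI conjI ballI, fact W, fact M, fold N_def)
    fix v :: "(real^'n) L2" assume v: "v \<in> L2_space \<Omega>"
    have "norm (mult_L2 w v) \<le> norm (mult_L2 (\<lambda>x. exp (N / 2)) v)"
      using w_le by (intro norm_mult_L2_mono[OF _ w_le _ _ _ v]) auto
    then show "norm (mult_L2 w v) \<le> exp (N / 2) * norm v" by (simp add: mult_L2_const)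
    have "norm (mult_L2 (\<lambda>x. exp (- (N / 2))) v) \<le> norm (mult_L2 w v)"
      using w_ge by (intro norm_mult_L2_mono[OF _ _ _ w_le _ v]) auto
    then have "exp (- (N / 2)) * norm v \<le> norm (mult_L2 w v)" by (simp add: mult_L2_const)
    then have "exp (N / 2) * (exp (- (N / 2)) * norm v) \<le> exp (N / 2) * norm (mult_L2 w v)" by simp
    then show "norm v \<le> exp (N / 2) * norm (mult_L2 w v)" by (simp add: mult.assoc[symmetric] exp_add[symmetric])
  qed
qed


section \<open>The stability estimate\<close>

theorem theorem1p1:
  fixes \<Omega> :: "(real^'n) set"
    and A :: "real^'n \<Rightarrow> real^'n^'n"
    and B :: "real^'n \<Rightarrow> real^'n"
    and b p :: "real^'n \<Rightarrow> real"
    and \<alpha> T :: real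
  assumes "open \<Omega>" and "connected \<Omega>" and "\<Omega> \<noteq> {}" and "bounded \<Omega>" and "C2_boundary \<Omega>"
    and "0 < \<alpha>" and "\<alpha> \<le> 1" and "0 < T"
    and "\<And>i j. C1_closure \<Omega> (\<lambda>x. A x $ i $ j)"
    and "\<And>x i j. x \<in> closure \<Omega> \<Longrightarrow> A x $ i $ j = A x $ j $ i"
    and "uniformly_elliptic \<Omega> A"
    and "\<And>j. W_inf 1 \<Omega> (\<lambda>x. B x $ j)"
    and "Linf \<Omega> p"
    and "W_inf 2 \<Omega> b"
    and "is_A_gradient \<Omega> A b B"
  shows "\<exists>\<kappa>\<ge>1. \<forall>uT\<in>L2_space \<Omega>. \<forall>u. continuous_on {0..T} u \<and> u ` {0..T} \<subseteq> L2_space \<Omega> \<and>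
           backward_solution \<Omega> A B p \<alpha> T uT u \<longrightarrow>
           (\<forall>t\<in>{0..T}. norm (u t) \<le> \<kappa> * exp (Linf_norm \<Omega> b) *
              rpow (norm (u 0)) (1 - t / T) * rpow (norm (u T)) (t / T))"
proof -
  let ?N = "Linf_norm \<Omega> b"
  have "Linf \<Omega> b" using \<open>W_inf 2 \<Omega> b\<close> by (simp add: numeral_2_eq_2)
  moreover have "\<forall>x\<in>closure \<Omega>. \<forall>i j. A x $ i $ j = A x $ j $ i" using assms(10) by blast
  ultimately have "\<exists>Db w a \<beta> q Cw Ca C\<beta> M. weighted_elliptic \<Omega> A B p b Db w a \<beta> q Cw Ca C\<beta> M \<and> 0 \<le> M \<and>
    (\<forall>v\<in>L2_space \<Omega>. norm (mult_L2 w v) \<le> exp (?N / 2) * norm v \<and> norm v \<le> exp (?N / 2) * norm (mult_L2 w v))"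
    by (intro weighted_elliptic_exists assms(1,4,9,11,12,13,15))
  then
  obtain Db w a \<beta> q Cw Ca C\<beta> M where we: "weighted_elliptic \<Omega> A B p b Db w a \<beta> q Cw Ca C\<beta> M" and M: "0 \<le> M"
    and eqv: "\<forall>v\<in>L2_space \<Omega>. norm (mult_L2 w v) \<le> exp (?N / 2) * norm v \<and> norm v \<le> exp (?N / 2) * norm (mult_L2 w v)"
    by (elim exE conjE)
  have upper: "norm (mult_L2 w v) \<le> exp (?N / 2) * norm v"
    and lower: "norm v \<le> exp (?N / 2) * norm (mult_L2 w v)" if "v \<in> L2_space \<Omega>" for v
    using eqv that by simp_all
  interpret W: weighted_elliptic \<Omega> A B p b Db w a \<beta> q Cw Ca C\<beta> M by (rule we)
  let ?E = "mult_L2 w"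
  obtain \<kappa> where \<kappa>: "1 \<le> \<kappa>" "\<And>t x. 0 < t \<Longrightarrow> t < T \<Longrightarrow> 0 \<le> x \<Longrightarrow> x \<le> 1 \<Longrightarrow>
      profile \<alpha> M t x \<le> \<kappa> * profile \<alpha> M T x powr (t / T)"
    using profile_ratio[OF assms(6,7,8) M] by blast
  have "norm (u t) \<le> \<kappa> * exp ?N * rpow (norm (u 0)) (1 - t / T) * rpow (norm (u T)) (t / T)"
    if uL: "u ` {0..T} \<subseteq> L2_space \<Omega>" and S: "C0_semigroup_on (L2_space \<Omega>) S"
      "generator_graph (L2_space \<Omega>) S = elliptic_op_graph \<Omega> A B p"
      and sol: "\<And>t. t \<in> {0..T} \<Longrightarrow> solution_op \<alpha> S t (u 0) (u t)" and t: "t \<in> {0..T}" for u S t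
  proof -
    have uX: "u s \<in> L2_space \<Omega>" if "s \<in> {0..T}" for s using uL that by blast
    have L: "\<Omega> \<in> sets lebesgue" using assms(1) by auto
    interpret symmetric_semigroup "mult_L2 (indicator \<Omega>)" "L2_space \<Omega>" S ?E M
    proof (intro symmetric_semigroup.intro projected_semigroup.intro symmetric_semigroup_axioms.intro)
      show "bounded_linear (mult_L2 (indicator \<Omega>))" "range (mult_L2 (indicator \<Omega>)) = L2_space \<Omega>"
        "\<And>v. v \<in> L2_space \<Omega> \<Longrightarrow> mult_L2 (indicator \<Omega>) v = v"
        by (rule indicator_projection[OF L], assumption?)+
      show "C0_semigroup_on (L2_space \<Omega>) S" by fact
      show "bounded_linear ?E" by (rule W.E_linear)
    qed (unfold S(2), (rule W.graph_symmetric W.graph_dissipative; assumption)+)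
    \<comment> \<open>The estimate at the times \<open>0\<close> and \<open>T\<close>. The sign of \<open>?N\<close> enters through the comparison
      of norms.\<close>
    have triv: "norm v \<le> \<kappa> * exp ?N * norm v" if v: "v \<in> L2_space \<Omega>" for v
    proof -
      have "norm v \<le> exp (?N / 2) * (exp (?N / 2) * norm v)"
        using lower[OF v] upper[OF v] by (meson mult_left_mono exp_ge_zero order_trans)
      also have "\<dots> = exp ?N * norm v" by (simp add: mult.assoc[symmetric] exp_add[symmetric])
      also have "\<dots> \<le> \<kappa> * (exp ?N * norm v)" using mult_right_mono[OF \<kappa>(1), of "exp ?N * norm v"] by simp
      finally show ?thesis by (simp add: mult.assoc)
    qed
    consider "t = 0" | "t = T" | "0 < t" "t < T" using t by fastforce
    then show ?thesis
    proof cases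
      case 1
      then show ?thesis using triv[OF uX[of 0]] assms(8) by (simp add: rpow_def)
    next
      case 2
      then show ?thesis using triv[OF uX[of T]] assms(8) by (simp add: rpow_def)
    next
      case 3
      let ?e = "exp (?N / 2)" and ?\<tau> = "t / T"
      have \<tau>: "0 < ?\<tau>" "?\<tau> < 1" using 3 by auto
      have "norm (u t) \<le> ?e * norm (?E (u t))" by (rule lower[OF uX[OF t]])
      also have "norm (?E (u t)) \<le> \<kappa> * norm (?E (u 0)) powr (1 - ?\<tau>) * norm (?E (u T)) powr ?\<tau>"
        using assms(8) \<kappa>(1) by (intro solution_interpolation[OF assms(6,7) 3 M uX sol[OF t] sol _ \<kappa>(2)[OF 3]]) auto
      also have "\<dots> \<le> \<kappa> * (?e * norm (u 0)) powr (1 - ?\<tau>) * (?e * norm (u T)) powr ?\<tau>"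
        using \<kappa>(1) \<tau> assms(8) by (intro mult_mono powr_mono2 upper uX) auto
      also have "\<dots> = \<kappa> * (?e powr (1 - ?\<tau>) * ?e powr ?\<tau>) * norm (u 0) powr (1 - ?\<tau>) * norm (u T) powr ?\<tau>"
        by (simp add: powr_mult mult_ac)
      also have "?e powr (1 - ?\<tau>) * ?e powr ?\<tau> = ?e" by (simp add: powr_add[symmetric])
      finally have "norm (u t) \<le> ?e * (\<kappa> * ?e * norm (u 0) powr (1 - ?\<tau>) * norm (u T) powr ?\<tau>)" by simp
      also have "\<dots> = \<kappa> * (?e * ?e) * norm (u 0) powr (1 - ?\<tau>) * norm (u T) powr ?\<tau>" by (simp add: mult_ac)
      also have "?e * ?e = exp ?N" by (simp add: exp_add[symmetric])
      finally show ?thesis unfolding rpow_def using 3 by simp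
    qed
  qed
  then show ?thesis
    using \<kappa>(1) unfolding backward_solution_def by (intro exI[of _ \<kappa>] conjI ballI allI impI) blast+
qed

end
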